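(* Let $S$ be a spray on a manifold $M$ of dimension $n\ge2$. (1) Let $I$ be an open interval containing $0$, let $V\colon I\times(-\varepsilon,\varepsilon)^{n-1}\to M$ be an $(n-1)$-parameter geodesic variation, let $(t,s^1,\ldots,s^{n-1})$ be the coordinates of its domain, and let $c(t)=V(t,0,\ldots,0)$. Let $W$ be an $(n-1)$-dimensional subspace of $T_{c(0)}M$ with $c'(0)\notin W$, let $\{e_a\}_{a=1}^{n-1}$ be a basis of $W$, and let $e_1(t),\ldots,e_{n-1}(t)$ be its extension to parallel vector fields along $c$. Then the conditions $$J\circ c'(t)=0,\qquad J\circ e_a(t)=(\partial_{s^a}V)(t,0,\ldots,0),\quad a\in\{1,\ldots,n-1\},\ t\in I,$$ define a Jacobi tensor $J$ along $c$. (2) Let $c\colon I\to M$ be a geodesic of $S$, where $I$ is a compact interval containing $0$. Let $J$ be a Jacobi tensor along $c$ that is transversal with respect to $W_t=\operatorname{span}\{e_1(t),\ldots,e_{n-1}(t)\}$, where $\{e_a(t)\}_{a=1}^{n-1}$ are the parallel vector fields along $c$ extending a basis of some $(n-1)$-dimensional subspace $W\subset T_{c(0)}M$ with $c'(0)\notin W$. Then there exist an open interval $I^\ast\supset I$, an $\varepsilon>0$ and an $(n-1)$-parameter geodesic variation $V\colon I^\ast\times(-\varepsilon,\varepsilon)^{n-1}\to M$ such that $$J\circ c'(t)=0,\qquad J\circ e_a(t)=(\partial_{s^a}V)(t,0,\ldots,0),\quad a\in\{1,\ldots,n-1\},\ t\in I,$$ where $c(t)=V(t,0,\ldots,0)$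 for $t\in I$.
   Context: $M$ is a smooth manifold (Hausdorff, countable base, without boundary); all objects are $C^\infty$-smooth. $TM\setminus\{0\}$ is the set of nonzero tangent vectors. A semispray on $M$ is a vector field $S$ on $TM\setminus\{0\}$ with $D\pi\circ S=\mathrm{id}$, where $\pi\colon TM\to M$ is the projection; locally $S=y^i\frac{\partial}{\partial x^i}-2G^i(x,y)\frac{\partial}{\partial y^i}$ in induced coordinates $(x^i,y^i)$ of $TM$. $S$ is a spray if moreover $[\mathbb{C},S]=S$, where $\mathbb{C}=y^i\frac{\partial}{\partial y^i}$ is the Liouville vector field (so each $G^i$ is positively $2$-homogeneous in $y$). A curve $c\colon I\to M$ with $c'(t)\ne0$ for all $t$ is a geodesic of $S$ if $c''=S\circ c'$, i.e. locally $\ddot x^i+2G^i(c')=0$. A curve on a closed interval is a geodesic if it extends to a geodesic on an open interval. A $k$-parameter geodesic variation of a geodesic $c\colon I\to M$ is a map $V\colon I\times(-\varepsilon,\varepsilon)^k\to M$ with $V(t,0,\ldots,0)=c(t)$ for all $t\in I$ and such that $t\mapsto V(t,s^1,\ldots,s^k)$ is a geodesic for all $(s^1,\ldots,s^k)$; when $c$ is not mentioned, $c$ is the curve $t\mapsto V(t,0,\ldots,0)$. $\partial_{s^a}V(t,s)\in T_{V(t,s)}M$ is the partial derivative. Put $N^i_j=\partial G^i/\partial y^j$. Along a geodesic $c$ the dynamical covariant derivative $\nabla$ is defined by: $\nabla X=\left(\frac{dX^i}{dt}+N^i_j(c')X^j\right)\frac{\partial}{\partial x^i}$ for a vector field ($(1,0)$-tensor)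 $X=X^i(t)\frac{\partial}{\partial x^i}|_{c(t)}$ along $c$; $\nabla\alpha=\left(\frac{d\alpha_i}{dt}-N^j_i(c')\alpha_j\right)dx^i$ for a $(0,1)$-tensor $\alpha$ along $c$; $\nabla f=df/dt$ for functions; and it extends to all tensors along $c$ by the Leibniz rule, so that for a $(1,1)$-tensor $J$ along $c$, $\nabla(J\circ v)=(\nabla J)\circ v+J\circ\nabla v$. A tensor $T$ along $c$ is parallel if $\nabla T=0$. The Jacobi endomorphism is the $(1,1)$-tensor along $c$ given by $\Phi=\Phi^i_j(c')\frac{\partial}{\partial x^i}\otimes dx^j|_{c(t)}$ with $\Phi^i_j=2\frac{\partial G^i}{\partial x^j}-S\left(\frac{\partial G^i}{\partial y^j}\right)-\frac{\partial G^i}{\partial y^r}\frac{\partial G^r}{\partial y^j}$. A Jacobi tensor along $c$ is a $(1,1)$-tensor $J$ along $c$ with $\nabla^2J+\Phi\circ J=0$. Given an $(n-1)$-dimensional subspace $W\subset T_{c(0)}M$ with $c'(0)\notin W$, a basis of $W$ extends uniquely to parallel vector fields $e_1(t),\ldots,e_{n-1}(t)$ along $c$; $W_t=\operatorname{span}\{e_1(t),\ldots,e_{n-1}(t)\}$ is independent of the basis and $T_{c(t)}M=\operatorname{span}\{c'(t)\}\oplus W_t$. A $(1,1)$-tensor $J$ along $c$ is transversal with respect to $W_t$ if $J\circ c'(t)=0$ and $\operatorname{Im}J(t)\subset W_t$ for all $t\in I$. *)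

theory Defs
  imports "HOL-Analysis.Analysis" "HOL-Library.Function_Algebras"
begin

section \<open>Smooth maps between Euclidean spaces\<close>

text \<open>Derivatives are taken within \<open>S\<close>. The notion is meant for sets on which such derivatives are
  unique; it is used below for open sets, and for relatively open subsets of nondegenerate real
  intervals, where it amounts to one-sided derivatives at the endpoints.\<close>

primrec Ck_on :: "nat \<Rightarrow> 'a::euclidean_space set \<Rightarrow> ('a \<Rightarrow> 'b::euclidean_space) \<Rightarrow> bool" where
  "Ck_on 0 S f \<longleftrightarrow> continuous_on S f"
| "Ck_on (Suc k) S f \<longleftrightarrow>
     (\<forall>x\<in>S. f differentiable (at x within S)) \<and>
     (\<forall>v. Ck_on k S (\<lambda>x. frechet_derivative f (at x within S) v))"

definition smooth_on :: "'a::euclidean_space set \<Rightarrow> ('a \<Rightarrow> 'b::euclidean_space) \<Rightarrow> bool" where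
  "smooth_on S f \<longleftrightarrow> (\<forall>k. Ck_on k S f)"

section \<open>Manifolds and tangent vectors\<close>

text \<open>A chart is a domain together with a coordinate map; only the values of the coordinate map on
  the domain matter.\<close>

type_synonym ('p, 'e) chart = "'p set \<times> ('p \<Rightarrow> 'e)"

abbreviation chart_inv :: "('p, 'e) chart \<Rightarrow> 'e \<Rightarrow> 'p" where
  "chart_inv \<kappa> \<equiv> inv_into (fst \<kappa>) (snd \<kappa>)"

text \<open>The smooth structure is given by an atlas, which need not be maximal.\<close>

definition smooth_manifold :: "'p topology \<Rightarrow> ('p, 'e::euclidean_space) chart set \<Rightarrow> bool" where
  "smooth_manifold M A \<longleftrightarrow>
     Hausdorff_space M \<and> second_countable M \<and>
     (\<forall>\<kappa>\<in>A. openin M (fst \<kappa>) \<and> open (snd \<kappa> ` fst \<kappa>) \<and>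
        homeomorphic_map (subtopology M (fst \<kappa>)) (top_of_set (snd \<kappa> ` fst \<kappa>)) (snd \<kappa>)) \<and>
     topspace M = (\<Union>\<kappa>\<in>A. fst \<kappa>) \<and>
     (\<forall>\<kappa>\<in>A. \<forall>\<mu>\<in>A. smooth_on (snd \<kappa> ` (fst \<kappa> \<inter> fst \<mu>)) (snd \<mu> \<circ> chart_inv \<kappa>))"

definition smooth_map_into ::
  "'p topology \<Rightarrow> ('p, 'e::euclidean_space) chart set \<Rightarrow> 'a::euclidean_space set \<Rightarrow> ('a \<Rightarrow> 'p) \<Rightarrow> bool"
where
  "smooth_map_into M A D f \<longleftrightarrow>
     continuous_map (top_of_set D) M f \<and>
     (\<forall>\<kappa>\<in>A. smooth_on (D \<inter> f -` fst \<kappa>) (snd \<kappa> \<circ> f))"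

instantiation "fun" :: (type, real_vector) real_vector
begin

definition scaleR_fun :: "real \<Rightarrow> ('a \<Rightarrow> 'b) \<Rightarrow> 'a \<Rightarrow> 'b" where
  "scaleR_fun r f = (\<lambda>x. r *\<^sub>R f x)"

instance
  by standard (simp_all add: scaleR_fun_def plus_fun_def fun_eq_iff algebra_simps)

end

text \<open>A tangent vector at \<open>p\<close> is the family of its coordinate vectors in the charts around \<open>p\<close> (with
  value \<open>0\<close> at all other charts), which transform by the derivatives of the chart transitions.
  Addition and scaling are pointwise, so that the library's \<^const>\<open>subspace\<close>, \<^const>\<open>span\<close>,
  \<^const>\<open>independent\<close> and \<^const>\<open>dim\<close> apply.\<close>

type_synonym ('p, 'e) tvec = "('p, 'e) chart \<Rightarrow> 'e"

definition tangent_space :: "('p, 'e::euclidean_space) chart set \<Rightarrow> 'p \<Rightarrow> ('p, 'e) tvec set" where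
  "tangent_space A p =
     {v. (\<forall>\<kappa>. \<not> (\<kappa> \<in> A \<and> p \<in> fst \<kappa>) \<longrightarrow> v \<kappa> = 0) \<and>
         (\<forall>\<kappa>\<in>A. \<forall>\<mu>\<in>A. p \<in> fst \<kappa> \<and> p \<in> fst \<mu> \<longrightarrow>
            v \<mu> = frechet_derivative (snd \<mu> \<circ> chart_inv \<kappa>) (at (snd \<kappa> p)) (v \<kappa>))}"

text \<open>The tangent vector at \<open>p\<close> with coordinate vector \<open>w\<close> in the chart \<open>\<kappa>\<close>.\<close>

definition coord_vec ::
  "('p, 'e::euclidean_space) chart set \<Rightarrow> ('p, 'e) chart \<Rightarrow> 'p \<Rightarrow> 'e \<Rightarrow> ('p, 'e) tvec"
where
  "coord_vec A \<kappa> p w = (\<lambda>\<mu>. if \<mu> \<in> A \<and> p \<in> fst \<mu>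
     then frechet_derivative (snd \<mu> \<circ> chart_inv \<kappa>) (at (snd \<kappa> p)) w else 0)"

definition pushforward ::
  "('p, 'e::euclidean_space) chart set \<Rightarrow> ('q, 'f::euclidean_space) chart set \<Rightarrow> ('p \<Rightarrow> 'q) \<Rightarrow>
   'p \<Rightarrow> ('p, 'e) tvec \<Rightarrow> ('q, 'f) tvec"
where
  "pushforward A B F p v = (\<lambda>\<mu>. if \<mu> \<in> B \<and> F p \<in> fst \<mu>
     then let \<kappa> = (SOME \<kappa>. \<kappa> \<in> A \<and> p \<in> fst \<kappa>)
          in frechet_derivative (snd \<mu> \<circ> F \<circ> chart_inv \<kappa>) (at (snd \<kappa> p)) (v \<kappa>)
     else 0)"

text \<open>The velocity at \<open>t\<close> of a curve on the interval \<open>I\<close> (one-sided at an endpoint contained in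
  \<open>I\<close>).\<close>

definition velocity ::
  "('p, 'e::euclidean_space) chart set \<Rightarrow> real set \<Rightarrow> (real \<Rightarrow> 'p) \<Rightarrow> real \<Rightarrow> ('p, 'e) tvec"
where
  "velocity A I c t = (\<lambda>\<kappa>. if \<kappa> \<in> A \<and> c t \<in> fst \<kappa>
     then vector_derivative (snd \<kappa> \<circ> c) (at t within I) else 0)"

text \<open>Vector fields on a manifold with atlas \<open>B\<close>; \<open>local_rep X \<kappa>\<close> is the coordinate expression of \<open>X\<close>
  in the chart \<open>\<kappa>\<close>.\<close>

definition local_rep :: "('p \<Rightarrow> ('p, 'e) tvec) \<Rightarrow> ('p, 'e) chart \<Rightarrow> 'e \<Rightarrow> 'e" where
  "local_rep X \<kappa> z = X (chart_inv \<kappa> z) \<kappa>"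

definition smooth_vector_field ::
  "('p, 'e::euclidean_space) chart set \<Rightarrow> ('p \<Rightarrow> ('p, 'e) tvec) \<Rightarrow> bool"
where
  "smooth_vector_field B X \<longleftrightarrow>
     (\<forall>p \<in> (\<Union>\<kappa>\<in>B. fst \<kappa>). X p \<in> tangent_space B p) \<and>
     (\<forall>\<kappa>\<in>B. smooth_on (snd \<kappa> ` fst \<kappa>) (local_rep X \<kappa>))"

definition lie_bracket ::
  "('p, 'e::euclidean_space) chart set \<Rightarrow> ('p \<Rightarrow> ('p, 'e) tvec) \<Rightarrow> ('p \<Rightarrow> ('p, 'e) tvec) \<Rightarrow>
   'p \<Rightarrow> ('p, 'e) tvec"
where
  "lie_bracket B X Y p = (\<lambda>\<kappa>. if \<kappa> \<in> B \<and> p \<in> fst \<kappa>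
     then frechet_derivative (local_rep Y \<kappa>) (at (snd \<kappa> p)) (X p \<kappa>)
        - frechet_derivative (local_rep X \<kappa>) (at (snd \<kappa> p)) (Y p \<kappa>)
     else 0)"

section \<open>The slit tangent bundle, sprays and geodesics\<close>

text \<open>Points of \<open>TM\<close> are pairs of a base point and a tangent vector there. A chart \<open>\<kappa>\<close> of \<open>M\<close> induces the
  chart \<open>(x, y)\<close> of \<open>TM\<close> minus the zero section.\<close>

type_synonym ('p, 'e) tpoint = "'p \<times> ('p, 'e) tvec"

definition slit_chart ::
  "('p, 'e::euclidean_space) chart set \<Rightarrow> ('p, 'e) chart \<Rightarrow> (('p, 'e) tpoint, 'e \<times> 'e) chart"
where
  "slit_chart A \<kappa> =
     ({(p, v). p \<in> fst \<kappa> \<and> v \<in> tangent_space A p \<and> v \<noteq> 0}, \<lambda>(p, v). (snd \<kappa> p, v \<kappa>))"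

definition slit_atlas ::
  "('p, 'e::euclidean_space) chart set \<Rightarrow> (('p, 'e) tpoint, 'e \<times> 'e) chart set"
where
  "slit_atlas A = slit_chart A ` A"

text \<open>A vector field on the slit tangent bundle.\<close>

type_synonym ('p, 'e) tfield =
  "('p, 'e) tpoint \<Rightarrow> (('p, 'e) tpoint, 'e \<times> 'e) tvec"

text \<open>The Liouville vector field, with coordinates \<open>(0, y)\<close> at \<open>(x, y)\<close>.\<close>

definition liouville :: "('p, 'e::euclidean_space) chart set \<Rightarrow> ('p, 'e) tfield" where
  "liouville A P = (\<lambda>\<kappa>. if \<kappa> \<in> slit_atlas A \<and> P \<in> fst \<kappa> then (0, snd (snd \<kappa> P)) else 0)"

definition semispray :: "('p, 'e::euclidean_space) chart set \<Rightarrow> ('p, 'e) tfield \<Rightarrow> bool" where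
  "semispray A S \<longleftrightarrow>
     smooth_vector_field (slit_atlas A) S \<and>
     (\<forall>P \<in> (\<Union>\<kappa>\<in>slit_atlas A. fst \<kappa>). pushforward (slit_atlas A) A fst P (S P) = snd P)"

definition spray :: "('p, 'e::euclidean_space) chart set \<Rightarrow> ('p, 'e) tfield \<Rightarrow> bool" where
  "spray A S \<longleftrightarrow>
     semispray A S \<and>
     (\<forall>P \<in> (\<Union>\<kappa>\<in>slit_atlas A. fst \<kappa>). lie_bracket (slit_atlas A) (liouville A) S P = S P)"

text \<open>The canonical lift of a curve to \<open>TM\<close>.\<close>

definition tlift ::
  "('p, 'e::euclidean_space) chart set \<Rightarrow> real set \<Rightarrow> (real \<Rightarrow> 'p) \<Rightarrow> real \<Rightarrow> ('p, 'e) tpoint"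
where
  "tlift A I c t = (c t, velocity A I c t)"

text \<open>Geodesics on open intervals, and on closed intervals by extension.\<close>

definition geodesic ::
  "'p topology \<Rightarrow> ('p, 'e::euclidean_space) chart set \<Rightarrow> ('p, 'e) tfield \<Rightarrow> real set \<Rightarrow>
   (real \<Rightarrow> 'p) \<Rightarrow> bool"
where
  "geodesic M A S I c \<longleftrightarrow>
     open I \<and> is_interval I \<and> smooth_map_into M A I c \<and>
     (\<forall>t\<in>I. velocity A I c t \<noteq> 0 \<and>
        velocity (slit_atlas A) I (tlift A I c) t = S (tlift A I c t))"

definition geodesic_closed ::
  "'p topology \<Rightarrow> ('p, 'e::euclidean_space) chart set \<Rightarrow> ('p, 'e) tfield \<Rightarrow> real set \<Rightarrow>
   (real \<Rightarrow> 'p) \<Rightarrow> bool"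
where
  "geodesic_closed M A S I c \<longleftrightarrow>
     (\<exists>I' c'. I \<subseteq> I' \<and> geodesic M A S I' c' \<and> (\<forall>t\<in>I. c' t = c t))"

definition cube :: "real \<Rightarrow> (real^'k) set" where
  "cube \<epsilon> = {s. \<forall>a. - \<epsilon> < s $ a \<and> s $ a < \<epsilon>}"

text \<open>A \<open>CARD('k)\<close>-parameter geodesic variation of the geodesic \<open>t \<mapsto> V (t, 0)\<close>, on an open interval.\<close>

definition geodesic_variation ::
  "'p topology \<Rightarrow> ('p, 'e::euclidean_space) chart set \<Rightarrow> ('p, 'e) tfield \<Rightarrow> real set \<Rightarrow> real \<Rightarrow>
   (real \<times> (real^'k) \<Rightarrow> 'p) \<Rightarrow> bool"
where
  "geodesic_variation M A S I \<epsilon> V \<longleftrightarrow>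
     \<epsilon> > 0 \<and> open I \<and> is_interval I \<and> smooth_map_into M A (I \<times> cube \<epsilon>) V \<and>
     (\<forall>s\<in>cube \<epsilon>. geodesic M A S I (\<lambda>t. V (t, s)))"

definition variation_partial ::
  "('p, 'e::euclidean_space) chart set \<Rightarrow> (real \<times> (real^'k) \<Rightarrow> 'p) \<Rightarrow> 'k \<Rightarrow> real \<Rightarrow> real^'k \<Rightarrow>
   ('p, 'e) tvec"
where
  "variation_partial A V a t s = velocity A UNIV (\<lambda>r. V (t, s + axis a r)) 0"

section \<open>Dynamical covariant derivative and Jacobi tensors\<close>

text \<open>The functions \<open>G\<^sup>i\<close>, \<open>N\<^sup>i\<^sub>j = \<partial>G\<^sup>i/\<partial>y\<^sup>j\<close> and \<open>\<Phi>\<^sup>i\<^sub>j\<close> in the chart of \<open>TM\<close> induced by \<open>\<kappa>\<close>, as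
  functions of \<open>z = (x, y)\<close>. For a function \<open>f\<close> on \<open>TM\<close>, \<open>S(f)\<close> is the derivative of the
  coordinate expression of \<open>f\<close> along that of \<open>S\<close>.\<close>

definition spray_G ::
  "('p, real^'n) chart set \<Rightarrow> ('p, real^'n) tfield \<Rightarrow> ('p, real^'n) chart \<Rightarrow>
   (real^'n) \<times> (real^'n) \<Rightarrow> real^'n"
where
  "spray_G A S \<kappa> z = - (1/2) *\<^sub>R snd (local_rep S (slit_chart A \<kappa>) z)"

definition spray_N ::
  "('p, real^'n) chart set \<Rightarrow> ('p, real^'n) tfield \<Rightarrow> ('p, real^'n) chart \<Rightarrow>
   (real^'n) \<times> (real^'n) \<Rightarrow> real^'n^'n"
where
  "spray_N A S \<kappa> z =
     (\<chi> i j. frechet_derivative (\<lambda>u. spray_G A S \<kappa> u $ i) (at z) (0, axis j 1))"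

definition spray_Phi ::
  "('p, real^'n) chart set \<Rightarrow> ('p, real^'n) tfield \<Rightarrow> ('p, real^'n) chart \<Rightarrow>
   (real^'n) \<times> (real^'n) \<Rightarrow> real^'n^'n"
where
  "spray_Phi A S \<kappa> z =
     (\<chi> i j. 2 * frechet_derivative (\<lambda>u. spray_G A S \<kappa> u $ i) (at z) (axis j 1, 0)
           - frechet_derivative (\<lambda>u. spray_N A S \<kappa> u $ i $ j) (at z)
               (local_rep S (slit_chart A \<kappa>) z)
           - (\<Sum>r\<in>UNIV. spray_N A S \<kappa> z $ i $ r * spray_N A S \<kappa> z $ r $ j))"

text \<open>\<open>N\<^sup>i\<^sub>j(c'(t))\<close> and \<open>\<Phi>\<^sup>i\<^sub>j(c'(t))\<close>.\<close>

definition N_along ::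
  "('p, real^'n) chart set \<Rightarrow> ('p, real^'n) tfield \<Rightarrow> real set \<Rightarrow> (real \<Rightarrow> 'p) \<Rightarrow>
   ('p, real^'n) chart \<Rightarrow> real \<Rightarrow> real^'n^'n"
where
  "N_along A S I c \<kappa> t = spray_N A S \<kappa> (snd (slit_chart A \<kappa>) (tlift A I c t))"

definition Phi_along ::
  "('p, real^'n) chart set \<Rightarrow> ('p, real^'n) tfield \<Rightarrow> real set \<Rightarrow> (real \<Rightarrow> 'p) \<Rightarrow>
   ('p, real^'n) chart \<Rightarrow> real \<Rightarrow> real^'n^'n"
where
  "Phi_along A S I c \<kappa> t = spray_Phi A S \<kappa> (snd (slit_chart A \<kappa>) (tlift A I c t))"

definition vector_field_along ::
  "('p, 'e::euclidean_space) chart set \<Rightarrow> real set \<Rightarrow> (real \<Rightarrow> 'p) \<Rightarrow> (real \<Rightarrow> ('p, 'e) tvec) \<Rightarrow> bool"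
where
  "vector_field_along A I c X \<longleftrightarrow>
     (\<forall>t\<in>I. X t \<in> tangent_space A (c t)) \<and>
     (\<forall>\<kappa>\<in>A. smooth_on (I \<inter> c -` fst \<kappa>) (\<lambda>t. X t \<kappa>))"

definition nabla_vec ::
  "('p, real^'n) chart set \<Rightarrow> ('p, real^'n) tfield \<Rightarrow> real set \<Rightarrow> (real \<Rightarrow> 'p) \<Rightarrow>
   (real \<Rightarrow> ('p, real^'n) tvec) \<Rightarrow> real \<Rightarrow> ('p, real^'n) tvec"
where
  "nabla_vec A S I c X t = (\<lambda>\<kappa>. if \<kappa> \<in> A \<and> c t \<in> fst \<kappa>
     then vector_derivative (\<lambda>\<tau>. X \<tau> \<kappa>) (at t within I) + N_along A S I c \<kappa> t *v X t \<kappa>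
     else 0)"

definition parallel_vec ::
  "('p, real^'n) chart set \<Rightarrow> ('p, real^'n) tfield \<Rightarrow> real set \<Rightarrow> (real \<Rightarrow> 'p) \<Rightarrow>
   (real \<Rightarrow> ('p, real^'n) tvec) \<Rightarrow> bool"
where
  "parallel_vec A S I c X \<longleftrightarrow>
     vector_field_along A I c X \<and> (\<forall>t\<in>I. nabla_vec A S I c X t = 0)"

text \<open>A (1,1)-tensor along \<open>c\<close> is a family of endomorphisms \<open>J t\<close> of the tangent spaces at \<open>c t\<close>; the
  values of \<open>J t\<close> outside the tangent space are irrelevant. \<open>endo_field_along\<close> is the pointwise
  notion, \<open>tensor11_along\<close> adds smoothness of the components \<open>J\<^sup>i\<^sub>j(t)\<close>.\<close>

definition endo_field_along ::
  "('p, 'e::euclidean_space) chart set \<Rightarrow> real set \<Rightarrow> (real \<Rightarrow> 'p) \<Rightarrow>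
   (real \<Rightarrow> ('p, 'e) tvec \<Rightarrow> ('p, 'e) tvec) \<Rightarrow> bool"
where
  "endo_field_along A I c J \<longleftrightarrow>
     (\<forall>t\<in>I. (\<forall>u\<in>tangent_space A (c t). J t u \<in> tangent_space A (c t)) \<and>
        (\<forall>u\<in>tangent_space A (c t). \<forall>v\<in>tangent_space A (c t). J t (u + v) = J t u + J t v) \<and>
        (\<forall>r. \<forall>u\<in>tangent_space A (c t). J t (r *\<^sub>R u) = r *\<^sub>R J t u))"

definition tensor_matrix ::
  "('p, real^'n) chart set \<Rightarrow> (real \<Rightarrow> 'p) \<Rightarrow> (real \<Rightarrow> ('p, real^'n) tvec \<Rightarrow> ('p, real^'n) tvec) \<Rightarrow>
   ('p, real^'n) chart \<Rightarrow> real \<Rightarrow> real^'n^'n"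
where
  "tensor_matrix A c J \<kappa> t = (\<chi> i j. J t (coord_vec A \<kappa> (c t) (axis j 1)) \<kappa> $ i)"

definition tensor11_along ::
  "('p, real^'n) chart set \<Rightarrow> real set \<Rightarrow> (real \<Rightarrow> 'p) \<Rightarrow>
   (real \<Rightarrow> ('p, real^'n) tvec \<Rightarrow> ('p, real^'n) tvec) \<Rightarrow> bool"
where
  "tensor11_along A I c J \<longleftrightarrow>
     endo_field_along A I c J \<and>
     (\<forall>\<kappa>\<in>A. smooth_on (I \<inter> c -` fst \<kappa>) (tensor_matrix A c J \<kappa>))"

text \<open>The endomorphism at \<open>p\<close> with matrix \<open>B \<kappa>\<close> in each chart \<open>\<kappa>\<close> around \<open>p\<close>.\<close>

definition matrix_endo ::
  "('p, real^'n) chart set \<Rightarrow> 'p \<Rightarrow> (('p, real^'n) chart \<Rightarrow> real^'n^'n) \<Rightarrow>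
   ('p, real^'n) tvec \<Rightarrow> ('p, real^'n) tvec"
where
  "matrix_endo A p B v = (\<lambda>\<kappa>. if \<kappa> \<in> A \<and> p \<in> fst \<kappa> then B \<kappa> *v v \<kappa> else 0)"

text \<open>By the coordinate formulas for vectors and covectors, the coordinate fields satisfy
  \<open>\<nabla>\<partial>\<^sub>j = N\<^sup>i\<^sub>j \<partial>\<^sub>i\<close> and \<open>\<nabla>dx\<^sup>j = - N\<^sup>j\<^sub>i dx\<^sup>i\<close> along \<open>c\<close>, so the Leibniz rule applied to
  \<open>J = J\<^sup>i\<^sub>j \<partial>\<^sub>i \<otimes> dx\<^sup>j\<close> gives
  \<open>\<nabla>J = (dJ\<^sup>i\<^sub>j/dt + N\<^sup>i\<^sub>k J\<^sup>k\<^sub>j - J\<^sup>i\<^sub>k N\<^sup>k\<^sub>j) \<partial>\<^sub>i \<otimes> dx\<^sup>j\<close>.\<close>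

definition nabla_tensor ::
  "('p, real^'n) chart set \<Rightarrow> ('p, real^'n) tfield \<Rightarrow> real set \<Rightarrow> (real \<Rightarrow> 'p) \<Rightarrow>
   (real \<Rightarrow> ('p, real^'n) tvec \<Rightarrow> ('p, real^'n) tvec) \<Rightarrow>
   (real \<Rightarrow> ('p, real^'n) tvec \<Rightarrow> ('p, real^'n) tvec)"
where
  "nabla_tensor A S I c J t = matrix_endo A (c t) (\<lambda>\<kappa>.
     vector_derivative (tensor_matrix A c J \<kappa>) (at t within I)
     + N_along A S I c \<kappa> t ** tensor_matrix A c J \<kappa> t
     - tensor_matrix A c J \<kappa> t ** N_along A S I c \<kappa> t)"

definition jacobi_endo ::
  "('p, real^'n) chart set \<Rightarrow> ('p, real^'n) tfield \<Rightarrow> real set \<Rightarrow> (real \<Rightarrow> 'p) \<Rightarrow>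
   (real \<Rightarrow> ('p, real^'n) tvec \<Rightarrow> ('p, real^'n) tvec)"
where
  "jacobi_endo A S I c t = matrix_endo A (c t) (\<lambda>\<kappa>. Phi_along A S I c \<kappa> t)"

definition jacobi_tensor ::
  "('p, real^'n) chart set \<Rightarrow> ('p, real^'n) tfield \<Rightarrow> real set \<Rightarrow> (real \<Rightarrow> 'p) \<Rightarrow>
   (real \<Rightarrow> ('p, real^'n) tvec \<Rightarrow> ('p, real^'n) tvec) \<Rightarrow> bool"
where
  "jacobi_tensor A S I c J \<longleftrightarrow>
     tensor11_along A I c J \<and>
     (\<forall>t\<in>I. \<forall>v\<in>tangent_space A (c t).
        nabla_tensor A S I c (nabla_tensor A S I c J) t v + jacobi_endo A S I c t (J t v) = 0)"

text \<open>\<open>W\<close> is an \<open>(n-1)\<close>-dimensional subspace of the tangent space at \<open>c 0\<close> not containing \<open>c'(0)\<close>, and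
  \<open>e\<close> is the extension of a basis of \<open>W\<close> to parallel vector fields along \<open>c\<close>.\<close>

definition parallel_transversal_frame ::
  "('p, real^'n) chart set \<Rightarrow> ('p, real^'n) tfield \<Rightarrow> real set \<Rightarrow> (real \<Rightarrow> 'p) \<Rightarrow>
   ('p, real^'n) tvec set \<Rightarrow> ('k::finite \<Rightarrow> real \<Rightarrow> ('p, real^'n) tvec) \<Rightarrow> bool"
where
  "parallel_transversal_frame A S I c W e \<longleftrightarrow>
     subspace W \<and> W \<subseteq> tangent_space A (c 0) \<and> dim W = CARD('n) - 1 \<and>
     velocity A I c 0 \<notin> W \<and>
     inj (\<lambda>a. e a 0) \<and> independent (range (\<lambda>a. e a 0)) \<and> span (range (\<lambda>a. e a 0)) = W \<and>
     (\<forall>a. parallel_vec A S I c (e a))"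

definition transversal ::
  "('p, 'e::euclidean_space) chart set \<Rightarrow> real set \<Rightarrow> (real \<Rightarrow> 'p) \<Rightarrow>
   (real \<Rightarrow> ('p, 'e) tvec \<Rightarrow> ('p, 'e) tvec) \<Rightarrow> (real \<Rightarrow> ('p, 'e) tvec set) \<Rightarrow> bool"
where
  "transversal A I c J Wt \<longleftrightarrow>
     (\<forall>t\<in>I. J t (velocity A I c t) = 0 \<and> J t ` tangent_space A (c t) \<subseteq> Wt t)"

end

theory Submission
  imports Defs
begin

text \<open>In a chart the geodesic equation is the ordinary differential equation \<open>z' = F z\<close> for
  \<open>z = (x, x')\<close> and \<open>F (x, y) = (y, - 2 G (x, y))\<close>. The coordinates \<open>(\<xi>, \<eta>)\<close> of a variation of a
  geodesic and of its velocity solve the linearized equation \<open>(\<xi>, \<eta>)' = DF(z) (\<xi>, \<eta>)\<close>; as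
  \<open>\<nabla>\<xi> = \<eta> + N \<xi>\<close>, this is the Jacobi equation \<open>\<nabla>\<^sup>2\<xi> + \<Phi> \<xi> = 0\<close>. By \<open>[C, S] = S\<close> Euler's
  relation \<open>N y = 2 G\<close> holds, so \<open>c'\<close> is parallel and \<open>c', e\<^sub>1, \<dots>, e\<^sub>n\<^sub>-\<^sub>1\<close> are the columns of an
  invertible matrix \<open>E\<close> with \<open>E' = - N E\<close>. The tensor with matrix \<open>(0, \<xi>\<^sub>1, \<dots>, \<xi>\<^sub>n\<^sub>-\<^sub>1) E\<^sup>-\<^sup>1\<close> is then a
  Jacobi tensor.

  Conversely, the variation starts at time \<open>0\<close> with the data
  \<open>z(0) + \<Sum>\<^sub>a s\<^sub>a (\<xi>\<^sub>a(0), \<eta>\<^sub>a(0))\<close>, where \<open>\<xi>\<^sub>a = J e\<^sub>a\<close>, and follows the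
  geodesic flow; a variation of a part of \<open>c\<close> extends across each point of the compact interval after
  shrinking \<open>\<epsilon>\<close>. Uniqueness for the linearized equation identifies \<open>\<partial>V/\<partial>s\<^sub>a\<close> with \<open>J e\<^sub>a\<close>.

  The flow of a \<open>C\<^sup>k\<close> vector field is \<open>C\<^sup>k\<close> because its derivative with respect to a parameter solves
  the linearized equation.\<close>

section \<open>Calculus of \<open>C\<^sup>k\<close> maps\<close>

text \<open>The two halves of the statement live on open intervals and on compact ones with
  one-sided derivatives. Calculus is therefore done relative to a set, and the equations along
  \<open>c\<close> are stated for \<open>geodesic_on\<close>, which covers both.

  Differential equations are solved only over times so short that Lipschitz constant times length is
  at most 1/2. The plain sup norm then suffices for contraction and error bounds, and everything
  global (uniqueness of geodesics, parallel and Jacobi fields, extension of variations) is a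
  connectedness argument: a property spreads over a neighbourhood of each time.

  The obstacle to smooth variations is that differentiating a flow in its parameter gives an
  equation whose coefficients depend on the flow itself. The linearized equation is solved directly,
  its solution is recognized as the derivative by an error estimate, and regularity is gained one
  order at a time. Applied to a given variation, the same differentiation theorem shows that its
  parameter derivatives solve the linearized equation, so no separate interchange of second
  derivatives occurs.\<close>

text \<open>On a thick set Frechet derivatives within the set are unique. Besides open sets this covers
  nondegenerate intervals, with one-sided derivatives at the end points.\<close>

definition thick :: "'a::euclidean_space set \<Rightarrow> bool" where
  "thick S \<longleftrightarrow> (\<forall>x\<in>S. \<forall>i\<in>Basis. \<forall>e>0. \<exists>d. 0 < \<bar>d\<bar> \<and> \<bar>d\<bar> < e \<and> x + d *\<^sub>R i \<in> S)"

lemma thick_Int_open: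
  fixes S :: "'a::euclidean_space set"
  assumes "thick S" "open U"
  shows "thick (S \<inter> U)"
  unfolding thick_def
proof (intro ballI allI impI)
  fix x i :: 'a and e :: real assume x: "x \<in> S \<inter> U" "i \<in> Basis" "e > 0"
  obtain r where r: "r > 0" "ball x r \<subseteq> U" using x \<open>open U\<close> open_contains_ball by blast
  obtain d where d: "0 < \<bar>d\<bar>" "\<bar>d\<bar> < min e r" "x + d *\<^sub>R i \<in> S"
    using assms(1) x r unfolding thick_def by (meson IntE min_less_iff_conj)
  have "x + d *\<^sub>R i \<in> ball x r" using d x by (simp add: dist_norm)
  then show "\<exists>d. 0 < \<bar>d\<bar> \<and> \<bar>d\<bar> < e \<and> x + d *\<^sub>R i \<in> S \<inter> U" using d r by auto
qed

lemma thick_UNIV: "thick (UNIV :: 'a::euclidean_space set)"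
  unfolding thick_def
proof (intro ballI allI impI)
  fix x i :: 'a and e :: real assume "e > 0"
  then show "\<exists>d. 0 < \<bar>d\<bar> \<and> \<bar>d\<bar> < e \<and> x + d *\<^sub>R i \<in> UNIV" by (intro exI[of _ "e/2"]) auto
qed

lemma thick_open: "open S \<Longrightarrow> thick S"
  using thick_Int_open[OF thick_UNIV] by simp

lemma thick_cbox_real:
  fixes a b :: real
  assumes "a < b"
  shows "thick {a..b}"
  unfolding thick_def
proof (intro ballI allI impI)
  fix x i e :: real assume x: "x \<in> {a..b}" "i \<in> Basis" "e > 0"
  \<comment> \<open>The step goes to the right, except at the right end point, where it goes left;
    the minimum keeps it inside the interval and below \<open>e\<close>.\<close>
  define d where "d = (if x < b then min (e/2) (b - x) else - min (e/2) (b-a))"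
  show "\<exists>d. 0 < \<bar>d\<bar> \<and> \<bar>d\<bar> < e \<and> x + d *\<^sub>R i \<in> {a..b}"
    using x assms by (intro exI[of _ d]) (auto simp: d_def)
qed

lemma frechet_derivative_eqI:
  assumes "thick S" "x \<in> S" "(f has_derivative f') (at x within S)"
  shows "frechet_derivative f (at x within S) = f'"
proof (rule frechet_derivative_unique_within)
  show "(f has_derivative frechet_derivative f (at x within S)) (at x within S)"
    using assms(3) frechet_derivative_works differentiableI by blast
qed (use assms in \<open>auto simp: thick_def\<close>)

lemma has_derivative_cong_on:
  assumes "x \<in> S" "\<And>x. x \<in> S \<Longrightarrow> f x = g x"
  shows "(f has_derivative f') (at x within S) \<longleftrightarrow> (g has_derivative f') (at x within S)"
  by (metis assms has_derivative_transform)

lemma Ck_on_cong: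
  assumes "\<And>x. x \<in> S \<Longrightarrow> f x = g x"
  shows "Ck_on k S f \<longleftrightarrow> Ck_on k S g"
  using assms
proof (induction k arbitrary: f g)
  case 0
  then show ?case by (auto intro: continuous_on_cong)
next
  case (Suc k)
  have D: "(f has_derivative f') (at x within S) \<longleftrightarrow> (g has_derivative f') (at x within S)" if "x \<in> S" for x f'
    using has_derivative_cong_on[of x S f g] that Suc.prems by blast
  then have "frechet_derivative f (at x within S) = frechet_derivative g (at x within S)" if "x \<in> S" for x
    unfolding frechet_derivative_def using that by simp
  then have "Ck_on k S (\<lambda>x. frechet_derivative f (at x within S) v) = Ck_on k S (\<lambda>x. frechet_derivative g (at x within S) v)" for v
    by (intro Suc.IH) simp
  then show ?case using D by (simp add: differentiable_def)
qed

lemma Ck_on_SucI: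
  assumes "thick S" "\<And>x. x \<in> S \<Longrightarrow> (f has_derivative f' x) (at x within S)"
    and "\<And>v. Ck_on k S (\<lambda>x. f' x v)"
  shows "Ck_on (Suc k) S f"
proof -
  have "Ck_on k S (\<lambda>x. frechet_derivative f (at x within S) v)" for v
    by (rule Ck_on_cong[THEN iffD1, OF _ assms(3)]) (simp add: frechet_derivative_eqI[OF assms(1) _ assms(2)])
  then show ?thesis using assms(2) by (auto simp: differentiable_def)
qed

lemma Ck_on_SucD:
  assumes "Ck_on (Suc k) S f" "x \<in> S"
  shows "(f has_derivative frechet_derivative f (at x within S)) (at x within S)"
  using assms by (simp add: frechet_derivative_works[symmetric])

lemma Ck_on_SucE:
  assumes "Ck_on (Suc k) S f"
  obtains f' where "\<And>x. x \<in> S \<Longrightarrow> (f has_derivative f' x) (at x within S)"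
    "\<And>v. Ck_on k S (\<lambda>x. f' x v)"
  using that[of "\<lambda>x. frechet_derivative f (at x within S)"] Ck_on_SucD[OF assms] assms by auto

lemma Ck_on_imp_continuous_on: "Ck_on k S f \<Longrightarrow> continuous_on S f"
  by (cases k) (auto intro: differentiable_imp_continuous_on simp: differentiable_on_def)

lemma Ck_on_Suc_imp: "Ck_on (Suc k) S f \<Longrightarrow> Ck_on k S f"
proof (induction k arbitrary: f)
  case 0
  then show ?case using Ck_on_imp_continuous_on by fastforce
next
  case (Suc k)
  then show ?case by (metis Ck_on.simps(2))
qed

lemma Ck_on_const: "thick S \<Longrightarrow> Ck_on k S (\<lambda>x. c)"
proof (induction k arbitrary: c)
  case (Suc k)
  show ?case by (rule Ck_on_SucI[where f'="\<lambda>_ _. 0"]) (use Suc in auto)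
qed auto

lemma Ck_on_bounded_linear:
  assumes "thick S" "bounded_linear L" "Ck_on k S f"
  shows "Ck_on k S (\<lambda>x. L (f x))"
  using assms(3)
proof (induction k arbitrary: f)
  case 0
  then show ?case using assms by (auto intro: bounded_linear.continuous_on)
next
  case (Suc k)
  then obtain f' where f': "\<And>x. x \<in> S \<Longrightarrow> (f has_derivative f' x) (at x within S)"
    "\<And>v. Ck_on k S (\<lambda>x. f' x v)" by (metis Ck_on_SucE)
  show ?case
    by (rule Ck_on_SucI[where f'="\<lambda>x v. L (f' x v)"])
      (use assms f' Suc.IH in \<open>auto intro: bounded_linear.has_derivative\<close>)
qed

lemma Ck_on_ident: "thick S \<Longrightarrow> Ck_on k S (\<lambda>x. x)"
  by (cases k) (auto intro!: Ck_on_SucI[where f'="\<lambda>x v. v"] Ck_on_const derivative_eq_intros simp del: Ck_on.simps(2))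

lemma Ck_on_linear: "thick S \<Longrightarrow> bounded_linear L \<Longrightarrow> Ck_on k S L"
  using Ck_on_bounded_linear[of S L k "\<lambda>x. x"] Ck_on_ident by blast

lemma Ck_on_add:
  assumes "thick S" "Ck_on k S f" "Ck_on k S g"
  shows "Ck_on k S (\<lambda>x. f x + g x)"
  using assms(2,3)
proof (induction k arbitrary: f g)
  case 0
  then show ?case by (auto intro: continuous_intros)
next
  case (Suc k)
  obtain f' where f': "\<And>x. x \<in> S \<Longrightarrow> (f has_derivative f' x) (at x within S)"
    "\<And>v. Ck_on k S (\<lambda>x. f' x v)" using Suc.prems by (metis Ck_on_SucE)
  obtain g' where g': "\<And>x. x \<in> S \<Longrightarrow> (g has_derivative g' x) (at x within S)"
    "\<And>v. Ck_on k S (\<lambda>x. g' x v)" using Suc.prems by (metis Ck_on_SucE)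
  show ?case
    by (rule Ck_on_SucI[where f'="\<lambda>x v. f' x v + g' x v"])
      (use assms f' g' Suc.IH in \<open>auto intro: has_derivative_add\<close>)
qed

lemma Ck_on_sum:
  assumes "thick S" "\<And>i. i \<in> I \<Longrightarrow> Ck_on k S (f i)"
  shows "Ck_on k S (\<lambda>x. \<Sum>i\<in>I. f i x)"
  using assms(2) by (induction I rule: infinite_finite_induct) (auto intro: Ck_on_const Ck_on_add assms(1))

lemma Ck_on_bilinear:
  assumes "thick S" "bounded_bilinear pr" "Ck_on k S f" "Ck_on k S g"
  shows "Ck_on k S (\<lambda>x. pr (f x) (g x))"
  using assms(3,4)
proof (induction k arbitrary: f g)
  case 0
  then show ?case using assms(2) by (auto intro: bounded_bilinear.continuous_on)
next
  case (Suc k)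
  obtain f' where f': "\<And>x. x \<in> S \<Longrightarrow> (f has_derivative f' x) (at x within S)"
    "\<And>v. Ck_on k S (\<lambda>x. f' x v)" using Suc.prems by (metis Ck_on_SucE)
  obtain g' where g': "\<And>x. x \<in> S \<Longrightarrow> (g has_derivative g' x) (at x within S)"
    "\<And>v. Ck_on k S (\<lambda>x. g' x v)" using Suc.prems by (metis Ck_on_SucE)
  have "Ck_on k S f" "Ck_on k S g" using Suc.prems Ck_on_Suc_imp by blast+
  then show ?case
    by (intro Ck_on_SucI[where f'="\<lambda>x v. pr (f x) (g' x v) + pr (f' x v) (g x)"] Ck_on_add assms Suc.IH f' g'
       bounded_bilinear.FDERIV[OF assms(2)])
qed

lemma Ck_on_minus: "thick S \<Longrightarrow> Ck_on k S f \<Longrightarrow> Ck_on k S (\<lambda>x. - f x)"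
  by (rule Ck_on_bounded_linear[OF _ bounded_linear_minus[OF bounded_linear_ident]])

lemma Ck_on_diff: "thick S \<Longrightarrow> Ck_on k S f \<Longrightarrow> Ck_on k S g \<Longrightarrow> Ck_on k S (\<lambda>x. f x - g x)"
  using Ck_on_add[of S k f "\<lambda>x. - g x"] Ck_on_minus by auto

lemmas Ck_on_scaleR = Ck_on_bilinear[OF _ bounded_bilinear_scaleR]
lemmas Ck_on_inner_left = Ck_on_bounded_linear[OF _ bounded_linear_inner_left]
lemmas Ck_on_fst = Ck_on_bounded_linear[OF _ bounded_linear_fst]
lemmas Ck_on_snd = Ck_on_bounded_linear[OF _ bounded_linear_snd]

lemma Ck_on_Pair:
  assumes "thick S" "Ck_on k S f" "Ck_on k S g"
  shows "Ck_on k S (\<lambda>x. (f x, g x))"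
proof -
  have "bounded_linear (\<lambda>a. (a, 0::'c))" "bounded_linear (\<lambda>b. (0::'b, b))"
    by (auto intro!: bounded_linear_Pair bounded_linear_ident bounded_linear_zero)
  then have "Ck_on k S (\<lambda>x. (f x, 0) + (0, g x))"
    using Ck_on_add[OF assms(1) Ck_on_bounded_linear[OF assms(1) _ assms(2), of "\<lambda>a. (a, 0::'c)"]
       Ck_on_bounded_linear[OF assms(1) _ assms(3), of "\<lambda>b. (0::'b, b)"]] by simp
  then show ?thesis by simp
qed

lemma Ck_on_componentwise:
  assumes "thick S" "\<And>i. i \<in> Basis \<Longrightarrow> Ck_on k S (\<lambda>x. f x \<bullet> i)"
  shows "Ck_on k S f"
proof -
  have "Ck_on k S (\<lambda>x. \<Sum>i\<in>Basis. (f x \<bullet> i) *\<^sub>R i)"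
    by (intro Ck_on_sum Ck_on_scaleR Ck_on_const assms)
  then show ?thesis by (simp add: euclidean_representation)
qed

lemma at_within_Int_open':
  assumes "x \<in> U" "open U"
  shows "at x within S \<inter> U = at x within S"
  by (rule at_within_nhd[OF assms]) auto

lemma Ck_on_subset:
  assumes "thick T" "T \<subseteq> S" "Ck_on k S f"
  shows "Ck_on k T f"
  using assms(3)
proof (induction k arbitrary: f)
  case 0
  then show ?case using assms by (auto intro: continuous_on_subset)
next
  case (Suc k)
  then obtain f' where f': "\<And>x. x \<in> S \<Longrightarrow> (f has_derivative f' x) (at x within S)"
    "\<And>v. Ck_on k S (\<lambda>x. f' x v)" by (metis Ck_on_SucE)
  show ?case
    by (rule Ck_on_SucI[where f'=f'])
      (use assms f' Suc.IH in \<open>auto intro: has_derivative_subset\<close>)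
qed

text \<open>At a point of the open set \<open>U\<close> derivatives within \<open>S\<close> and
  within \<open>S \<inter> U\<close> coincide, so the directional derivatives computed on the pieces
  are restrictions of a single function. This is what makes glued maps smooth.\<close>

lemma Ck_on_local:
  assumes "thick S" "\<And>x. x \<in> S \<Longrightarrow> \<exists>U. open U \<and> x \<in> U \<and> Ck_on k (S \<inter> U) f"
  shows "Ck_on k S f"
  using assms(2)
proof (induction k arbitrary: f)
  case 0
  have "continuous (at x within S) f" if x: "x \<in> S" for x
  proof -
    obtain U where U: "open U" "x \<in> U" "continuous_on (S \<inter> U) f" using 0[OF x] by auto
    then have "continuous (at x within S \<inter> U) f" using x by (simp add: continuous_on_eq_continuous_within)
    then show ?thesis using U at_within_Int_open'[of x U S] by simp
  qed
  then show ?case by (simp add: continuous_on_eq_continuous_within)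
next
  case (Suc k)
  let ?f' = "\<lambda>x. frechet_derivative f (at x within S)"
  have D: "(f has_derivative ?f' x) (at x within S)" if x: "x \<in> S" for x
  proof -
    obtain U where U: "open U" "x \<in> U" "Ck_on (Suc k) (S \<inter> U) f" using Suc.prems x by blast
    have "x \<in> S \<inter> U" using x U by blast
    from Ck_on_SucD[OF U(3) this] show ?thesis unfolding at_within_Int_open'[OF U(2,1)] .
  qed
  show ?case
  proof (rule Ck_on_SucI[OF assms(1) D])
    fix v
    show "Ck_on k S (\<lambda>x. ?f' x v)"
    proof (rule Suc.IH)
      fix x assume x: "x \<in> S"
      obtain U where U: "open U" "x \<in> U" "Ck_on (Suc k) (S \<inter> U) f" using Suc.prems x by blast
      have "Ck_on k (S \<inter> U) (\<lambda>x. frechet_derivative f (at x within S \<inter> U) v)" using U by simp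
      moreover have e: "frechet_derivative f (at x within S \<inter> U) v = ?f' x v" if "x \<in> S \<inter> U" for x
        using at_within_Int_open'[OF _ U(1), of x S] that by auto
      ultimately have "Ck_on k (S \<inter> U) (\<lambda>x. ?f' x v)" by (simp only: Ck_on_cong[OF e])
      then show "\<exists>U. open U \<and> x \<in> U \<and> Ck_on k (S \<inter> U) (\<lambda>x. ?f' x v)" using U by blast
    qed
  qed
qed

lemma linear_expand:
  assumes "linear L"
  shows "L v = (\<Sum>i\<in>Basis. (v \<bullet> i) *\<^sub>R L (i::'a::euclidean_space))"
proof -
  have "L v = L (\<Sum>i\<in>Basis. (v \<bullet> i) *\<^sub>R i)" by (simp add: euclidean_representation)
  also have "\<dots> = (\<Sum>i\<in>Basis. (v \<bullet> i) *\<^sub>R L i)" by (simp add: linear_sum[OF assms] linear_cmul[OF assms])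
  finally show ?thesis .
qed

text \<open>\<open>Ck_on\<close> controls a derivative one fixed direction at a time. When the
  direction varies with the point, it is expanded in the basis, which leaves products of
  coefficients with derivatives in fixed directions.\<close>

lemma Ck_on_linear_apply:
  assumes "thick S" "\<And>x. x \<in> S \<Longrightarrow> linear (L x)" "\<And>i. i \<in> Basis \<Longrightarrow> Ck_on k S (\<lambda>x. L x i)" "Ck_on k S w"
  shows "Ck_on k S (\<lambda>x. L x (w x))"
proof -
  have "Ck_on k S (\<lambda>x. \<Sum>i\<in>Basis. (w x \<bullet> i) *\<^sub>R L x i)"
    by (intro Ck_on_sum Ck_on_scaleR Ck_on_inner_left assms)
  then show ?thesis
    by (rule Ck_on_cong[THEN iffD1, rotated]) (rule linear_expand[OF assms(2), symmetric])
qed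

text \<open>By the chain rule a directional derivative of the composite is
  \<open>g' (f x) (f' x v)\<close>: derivatives of \<open>g\<close> in fixed directions are composed
  with \<open>f\<close> by the induction hypothesis, hence the generalization over \<open>g\<close>,
  and the moving direction is handled by \<open>Ck_on_linear_apply\<close>.\<close>

lemma Ck_on_compose:
  assumes S: "thick S" and T: "thick T" and sub: "f ` S \<subseteq> T" and "Ck_on k T g" "Ck_on k S f"
  shows "Ck_on k S (\<lambda>x. g (f x))"
  using assms(4,5)
proof (induction k arbitrary: g)
  case 0
  then show ?case using sub by (auto intro: continuous_on_compose2)
next
  case (Suc k)
  obtain f' where f': "\<And>x. x \<in> S \<Longrightarrow> (f has_derivative f' x) (at x within S)"
    "\<And>v. Ck_on k S (\<lambda>x. f' x v)" using Suc.prems by (metis Ck_on_SucE)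
  obtain g' where g': "\<And>x. x \<in> T \<Longrightarrow> (g has_derivative g' x) (at x within T)"
    "\<And>v. Ck_on k T (\<lambda>x. g' x v)" using Suc.prems by (metis Ck_on_SucE)
  show ?case
  proof (rule Ck_on_SucI[OF S, where f'="\<lambda>x v. g' (f x) (f' x v)"])
    fix x assume "x \<in> S"
    then show "((\<lambda>x. g (f x)) has_derivative (\<lambda>v. g' (f x) (f' x v))) (at x within S)"
      using has_derivative_in_compose[OF f'(1) has_derivative_subset[OF g'(1) sub]] sub by blast
  next
    fix v
    show "Ck_on k S (\<lambda>x. g' (f x) (f' x v))"
    proof (rule Ck_on_linear_apply[OF S, where L="\<lambda>x. g' (f x)" and w="\<lambda>x. f' x v"])
      show "linear (g' (f x))" if "x \<in> S" for x
        using g'(1)[of "f x"] sub that has_derivative_linear by blast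
      show "Ck_on k S (\<lambda>x. g' (f x) i)" for i
        by (rule Suc.IH[OF g'(2) Ck_on_Suc_imp[OF Suc.prems(2)]])
    qed (rule f'(2))
  qed
qed

text \<open>Covers a derivative whose base point and direction both move. The coefficients of
  linearized equations and the velocities of variations have this form.\<close>

lemma Ck_on_frechet_comp:
  assumes "open S" "thick T" "p ` T \<subseteq> S" "Ck_on (Suc k) S f" "Ck_on k T p" "Ck_on k T w"
  shows "Ck_on k T (\<lambda>x. frechet_derivative f (at (p x)) (w x))"
proof (rule Ck_on_linear_apply[OF assms(2) _ _ assms(6), where L="\<lambda>x. frechet_derivative f (at (p x))"])
  fix x assume "x \<in> T"
  then have "p x \<in> S" using assms(3) by blast
  then have "f differentiable (at (p x))"
    using assms(1,4) by (simp add: at_within_open[OF _ assms(1)])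
  then show "linear (frechet_derivative f (at (p x)))"
    by (rule linear_frechet_derivative)
next
  fix i
  have "Ck_on k S (\<lambda>x. frechet_derivative f (at x within S) i)" using assms(4) by simp
  then have "Ck_on k S (\<lambda>x. frechet_derivative f (at x) i)"
    by (rule Ck_on_cong[THEN iffD1, rotated]) (simp add: at_within_open[OF _ assms(1)])
  then show "Ck_on k T (\<lambda>x. frechet_derivative f (at (p x)) i)"
    using Ck_on_compose[OF assms(2) thick_open[OF assms(1)] assms(3), where g="\<lambda>x. frechet_derivative f (at x) i"] assms(5)
    by blast
qed

lemma Ck_on_Suc_open_D:
  assumes "open S" "Ck_on (Suc k) S f" "x \<in> S"
  shows "(f has_derivative frechet_derivative f (at x)) (at x)"
  using Ck_on_SucD[OF assms(2,3)] assms by (simp add: at_within_open[OF _ assms(1)])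

section \<open>Derivatives of curves on thick sets; differentiability from continuous partial
  derivatives\<close>

lemma thick_real_not_bot:
  assumes "thick S" "(x::real) \<in> S"
  shows "at x within S \<noteq> bot"
proof -
  have "x islimpt S"
    unfolding islimpt_approachable
  proof (intro allI impI)
    fix e :: real assume "e > 0"
    then obtain d where "0 < \<bar>d\<bar>" "\<bar>d\<bar> < e" "x + d *\<^sub>R 1 \<in> S"
      using assms unfolding thick_def by (metis Basis_real_def singletonI)
    then show "\<exists>x'\<in>S. x' \<noteq> x \<and> dist x' x < e" by (intro bexI[of _ "x+d"]) (auto simp: dist_real_def)
  qed
  then show ?thesis by (simp add: trivial_limit_within)
qed

lemma vector_derivative_eqI:
  assumes "thick S" "x \<in> S" "(f has_vector_derivative f') (at x within S)"
  shows "vector_derivative f (at x within S) = f'"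
  by (rule vector_derivative_within[OF thick_real_not_bot]) (use assms in auto)

lemma Ck_on_Suc_vectorD:
  assumes "thick S" "Ck_on (Suc k) S (f :: real \<Rightarrow> _)"
  shows "x \<in> S \<Longrightarrow> (f has_vector_derivative vector_derivative f (at x within S)) (at x within S)"
    "Ck_on k S (\<lambda>x. vector_derivative f (at x within S))"
proof -
  obtain f' where f': "\<And>x. x \<in> S \<Longrightarrow> (f has_derivative f' x) (at x within S)"
    "\<And>v. Ck_on k S (\<lambda>x. f' x v)" using assms(2) by (metis Ck_on_SucE)
  have D: "(f has_vector_derivative f' x 1) (at x within S)" if "x \<in> S" for x
  proof -
    have "linear (f' x)" using f'(1)[OF that] has_derivative_linear by blast
    then have "f' x h = h *\<^sub>R f' x 1" for h using linear_cmul[of "f' x" h 1] by simp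
    then have "f' x = (\<lambda>h. h *\<^sub>R f' x 1)" by (rule ext)
    then show ?thesis using f'(1)[OF that] by (simp add: has_vector_derivative_def)
  qed
  then have E: "vector_derivative f (at x within S) = f' x 1" if "x \<in> S" for x
    using vector_derivative_eqI assms(1) that by blast
  then show "x \<in> S \<Longrightarrow> (f has_vector_derivative vector_derivative f (at x within S)) (at x within S)"
    using D by simp
  show "Ck_on k S (\<lambda>x. vector_derivative f (at x within S))"
    by (rule Ck_on_cong[THEN iffD1, OF _ f'(2)[of 1]]) (simp add: E)
qed

lemma onorm_scaleR_le:
  assumes "norm (d :: 'a::real_normed_vector) \<le> e"
  shows "onorm (\<lambda>v::real. v *\<^sub>R d) \<le> e"
proof (rule onorm_bound)
  show "0 \<le> e" using assms norm_ge_zero order_trans by blast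
  show "norm (v *\<^sub>R d) \<le> e * norm v" for v :: real
    using mult_right_mono[OF assms, of "\<bar>v\<bar>"] by (simp add: mult.commute)
qed

lemma has_vector_derivative_line:
  fixes f :: "'a::real_normed_vector \<Rightarrow> 'b::real_normed_vector"
  shows "((\<lambda>h. f (u + \<tau> *\<^sub>R v + h *\<^sub>R v)) has_vector_derivative D) (at 0)
    \<longleftrightarrow> ((\<lambda>h. f (u + h *\<^sub>R v)) has_vector_derivative D) (at \<tau>)"
proof
  assume A: "((\<lambda>h. f (u + \<tau> *\<^sub>R v + h *\<^sub>R v)) has_vector_derivative D) (at 0)"
  have "((\<lambda>h. h - \<tau>) has_vector_derivative 1) (at \<tau>)" by (auto intro!: derivative_eq_intros)
  from vector_diff_chain_at[OF this, of "\<lambda>h. f (u + \<tau> *\<^sub>R v + h *\<^sub>R v)" D] A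
  show "((\<lambda>h. f (u + h *\<^sub>R v)) has_vector_derivative D) (at \<tau>)"
    by (simp add: o_def algebra_simps)
next
  assume A: "((\<lambda>h. f (u + h *\<^sub>R v)) has_vector_derivative D) (at \<tau>)"
  have "((\<lambda>h. h + \<tau>) has_vector_derivative 1) (at 0)" by (auto intro!: derivative_eq_intros)
  from vector_diff_chain_at[OF this, of "\<lambda>h. f (u + h *\<^sub>R v)" D] A
  show "((\<lambda>h. f (u + \<tau> *\<^sub>R v + h *\<^sub>R v)) has_vector_derivative D) (at 0)"
    by (simp add: o_def algebra_simps)
qed

text \<open>The point \<open>x + h\<close> is reached from \<open>x\<close> along segments parallel
  to the axes. On each of them the partial derivative stays close to its value at \<open>x\<close>
  by continuity, so the deviation from the linear part is small compared with the length.\<close>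

lemma partials_imp_has_derivative:
  fixes f :: "'a::euclidean_space \<Rightarrow> 'b::real_normed_vector"
  assumes W: "open W" "x \<in> W"
    and D: "\<And>i y. i \<in> Basis \<Longrightarrow> y \<in> W \<Longrightarrow> ((\<lambda>h. f (y + h *\<^sub>R i)) has_vector_derivative g i y) (at 0)"
    and C: "\<And>i. i \<in> Basis \<Longrightarrow> continuous_on W (g i)"
  shows "(f has_derivative (\<lambda>v. \<Sum>i\<in>Basis. (v \<bullet> i) *\<^sub>R g i x)) (at x)"
  unfolding has_derivative_at_alt
proof (intro conjI allI impI)
  show "bounded_linear (\<lambda>v. \<Sum>i\<in>Basis. (v \<bullet> i) *\<^sub>R g i x)"
    by (intro bounded_linear_sum bounded_linear_scaleR_const bounded_linear_inner_left)
  fix e0 :: real assume "e0 > 0"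
  \<comment> \<open>The error is first bounded by \<open>e\<close> times the sum of the absolute
    values of the coordinates, which is at most \<open>DIM('a)\<close> times the norm.\<close>
  define e where "e = e0 / DIM('a)"
  have e: "e > 0" using \<open>e0 > 0\<close> by (simp add: e_def)
  have "\<forall>i\<in>Basis. \<forall>\<^sub>F y in nhds x. dist (g i y) (g i x) < e"
  proof
    fix i :: 'a assume "i \<in> Basis"
    then have "isCont (g i) x" using C W continuous_on_eq_continuous_at by blast
    then have "\<forall>\<^sub>F y in at x. dist (g i y) (g i x) < e" using e tendstoD[of "g i" "g i x"] by (simp add: isCont_def)
    then show "\<forall>\<^sub>F y in nhds x. dist (g i y) (g i x) < e" using e by (simp add: eventually_nhds_conv_at)
  qed
  then have "\<forall>\<^sub>F y in nhds x. \<forall>i\<in>Basis. dist (g i y) (g i x) < e" by (simp add: eventually_ball_finite)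
  moreover have "\<forall>\<^sub>F y in nhds x. y \<in> W" using W eventually_nhds by blast
  ultimately have "\<forall>\<^sub>F y in nhds x. y \<in> W \<and> (\<forall>i\<in>Basis. dist (g i y) (g i x) < e)" by eventually_elim auto
  then obtain d where d: "d > 0" "\<And>y. dist y x < d \<Longrightarrow> y \<in> W" "\<And>y i. dist y x < d \<Longrightarrow> i \<in> Basis \<Longrightarrow> dist (g i y) (g i x) < e"
    unfolding eventually_nhds_metric by blast
  \<comment> \<open>Here \<open>B\<close> is the set of coordinates already moved. Passing to
    \<open>insert j B\<close> costs one segment parallel to axis \<open>j\<close>, on which the mean
    value inequality is applied to \<open>f\<close> minus its linear part at
    \<open>x\<close>.\<close>
  have claim: "norm (f (x + (\<Sum>i\<in>B. (h \<bullet> i) *\<^sub>R i)) - f x - (\<Sum>i\<in>B. (h \<bullet> i) *\<^sub>R g i x)) \<le> e * (\<Sum>i\<in>B. \<bar>h \<bullet> i\<bar>)"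
    if h: "(\<Sum>i\<in>Basis. \<bar>h \<bullet> i\<bar>) < d" and "B \<subseteq> Basis" for B and h :: 'a
    using finite_subset[OF that(2) finite_Basis] that(2)
  proof (induction B rule: finite_induct)
    case (insert j B)
    define u where "u = x + (\<Sum>i\<in>B. (h \<bullet> i) *\<^sub>R i)"
    have j: "j \<in> Basis" using insert by auto
    have near: "dist (u + \<tau> *\<^sub>R j) x < d" if "\<tau> \<in> closed_segment 0 (h \<bullet> j)" for \<tau>
    proof -
      have "\<bar>\<tau>\<bar> \<le> \<bar>h \<bullet> j\<bar>" using that by (auto simp: closed_segment_eq_real_ivl split: if_splits)
      have "norm (\<Sum>i\<in>B. (h \<bullet> i) *\<^sub>R i) \<le> (\<Sum>i\<in>B. \<bar>h \<bullet> i\<bar>)"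
        by (rule order_trans[OF norm_sum]) (use insert in \<open>auto intro!: sum_mono\<close>)
      then have "norm ((\<Sum>i\<in>B. (h \<bullet> i) *\<^sub>R i) + \<tau> *\<^sub>R j) \<le> (\<Sum>i\<in>B. \<bar>h \<bullet> i\<bar>) + \<bar>h \<bullet> j\<bar>"
        using \<open>\<bar>\<tau>\<bar> \<le> \<bar>h \<bullet> j\<bar>\<close> j norm_triangle_ineq[of "\<Sum>i\<in>B. (h \<bullet> i) *\<^sub>R i" "\<tau> *\<^sub>R j"] by simp
      also have "\<dots> = (\<Sum>i\<in>insert j B. \<bar>h \<bullet> i\<bar>)" using insert by simp
      also have "\<dots> \<le> (\<Sum>i\<in>Basis. \<bar>h \<bullet> i\<bar>)" using insert by (intro sum_mono2) auto
      finally show ?thesis using h by (simp add: u_def dist_norm)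
    qed
    have "norm ((f (u + (h \<bullet> j) *\<^sub>R j) - (h \<bullet> j) *\<^sub>R g j x) - (f (u + 0 *\<^sub>R j) - 0 *\<^sub>R g j x)) \<le> e * norm (h \<bullet> j - 0)"
    proof (rule differentiable_bound[of "closed_segment 0 (h \<bullet> j)" "\<lambda>\<tau>. f (u + \<tau> *\<^sub>R j) - \<tau> *\<^sub>R g j x"
          "\<lambda>\<tau> v. v *\<^sub>R (g j (u + \<tau> *\<^sub>R j) - g j x)"])
      fix \<tau> assume \<tau>: "\<tau> \<in> closed_segment 0 (h \<bullet> j)"
      have "((\<lambda>h. f (u + h *\<^sub>R j)) has_vector_derivative g j (u + \<tau> *\<^sub>R j)) (at \<tau>)"
        using D j near[OF \<tau>] d by (subst has_vector_derivative_line[symmetric]) blast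
      then have "((\<lambda>\<tau>. f (u + \<tau> *\<^sub>R j) - \<tau> *\<^sub>R g j x) has_vector_derivative (g j (u + \<tau> *\<^sub>R j) - g j x)) (at \<tau>)"
        by (auto intro!: derivative_eq_intros)
      then show "((\<lambda>\<tau>. f (u + \<tau> *\<^sub>R j) - \<tau> *\<^sub>R g j x) has_derivative (\<lambda>v. v *\<^sub>R (g j (u + \<tau> *\<^sub>R j) - g j x))) (at \<tau> within closed_segment 0 (h \<bullet> j))"
        unfolding has_vector_derivative_def by (rule has_derivative_at_withinI)
      have "norm (g j (u + \<tau> *\<^sub>R j) - g j x) \<le> e" using d(3)[OF near[OF \<tau>] j] by (simp add: dist_norm)
      then show "onorm (\<lambda>v. v *\<^sub>R (g j (u + \<tau> *\<^sub>R j) - g j x)) \<le> e"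
        by (rule onorm_scaleR_le)
    qed auto
    moreover have "norm (f u - f x - (\<Sum>i\<in>B. (h \<bullet> i) *\<^sub>R g i x)) \<le> e * (\<Sum>i\<in>B. \<bar>h \<bullet> i\<bar>)"
      using insert by (auto simp: u_def)
    ultimately have "norm ((f (u + (h \<bullet> j) *\<^sub>R j) - (h \<bullet> j) *\<^sub>R g j x - f u) + (f u - f x - (\<Sum>i\<in>B. (h \<bullet> i) *\<^sub>R g i x)))
       \<le> e * \<bar>h \<bullet> j\<bar> + e * (\<Sum>i\<in>B. \<bar>h \<bullet> i\<bar>)"
      by (intro norm_triangle_mono) auto
    then show ?case using insert by (simp add: u_def algebra_simps)
  qed simp
  show "\<exists>d>0. \<forall>y. norm (y - x) < d \<longrightarrow> norm (f y - f x - (\<Sum>i\<in>Basis. ((y - x) \<bullet> i) *\<^sub>R g i x)) \<le> e0 * norm (y - x)"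
  proof (intro exI[of _ "d / DIM('a)"] conjI allI impI)
    fix y assume y: "norm (y - x) < d / DIM('a)"
    have s: "(\<Sum>i\<in>Basis. \<bar>(y - x) \<bullet> i\<bar>) \<le> DIM('a) * norm (y - x)"
      using sum_mono[of Basis "\<lambda>i. \<bar>(y - x) \<bullet> i\<bar>" "\<lambda>i. norm (y - x)"] by (simp add: Basis_le_norm)
    also have "\<dots> < d" using y by (simp add: field_simps)
    finally have "norm (f y - f x - (\<Sum>i\<in>Basis. ((y - x) \<bullet> i) *\<^sub>R g i x)) \<le> e * (\<Sum>i\<in>Basis. \<bar>(y - x) \<bullet> i\<bar>)"
      using claim[of "y - x" Basis] by (simp add: euclidean_representation)
    also have "\<dots> \<le> e * (DIM('a) * norm (y - x))" using s e by (intro mult_left_mono) auto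
    also have "\<dots> = e0 * norm (y - x)" by (simp add: e_def)
    finally show "norm (f y - f x - (\<Sum>i\<in>Basis. ((y - x) \<bullet> i) *\<^sub>R g i x)) \<le> e0 * norm (y - x)" .
  qed (use d in auto)
qed

section \<open>Ordinary differential equations with parameters\<close>

text \<open>Substitute for the exponential Gronwall bound on intervals so short that \<open>L (b - a) \<le> 1/2\<close>.\<close>

lemma ode_small_interval_bound:
  fixes e :: "real \<Rightarrow> 'b::real_normed_vector"
  assumes t0: "t0 \<in> {a..b}"
    and D: "\<And>t. t \<in> {a..b} \<Longrightarrow> (e has_vector_derivative e' t) (at t within {a..b})"
    and B: "\<And>t. t \<in> {a..b} \<Longrightarrow> norm (e' t) \<le> L * norm (e t) + m"
    and L: "L * (b - a) \<le> 1/2" "L \<ge> 0" "m \<ge> 0"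
    and t: "t \<in> {a..b}"
  shows "norm (e t) \<le> 2 * (norm (e t0) + (b - a) * m)"
proof -
  have "continuous_on {a..b} e"
    using D by (meson continuous_on_vector_derivative)
  then have "continuous_on {a..b} (\<lambda>t. norm (e t))" by (rule continuous_on_norm)
  \<comment> \<open>At a maximum \<open>t1\<close> of the norm, the mean value inequality bounds
    \<open>norm (e t1)\<close> by the value at \<open>t0\<close>, a term with \<open>m\<close>, and
    \<open>L * (b - a)\<close> times itself, which is at most one half of it. Absorbing that half
    yields the factor 2.\<close>
  then obtain t1 where t1: "t1 \<in> {a..b}" "\<And>t. t \<in> {a..b} \<Longrightarrow> norm (e t) \<le> norm (e t1)"
    using continuous_attains_sup[of "{a..b}" "\<lambda>t. norm (e t)"] t0 by auto
  define N where "N = norm (e t1)"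
  have "norm (e t1 - e t0) \<le> (L * N + m) * norm (t1 - t0)"
  proof (rule differentiable_bound[of "{a..b}" e "\<lambda>t v. v *\<^sub>R e' t"])
    fix x assume x: "x \<in> {a..b}"
    show "(e has_derivative (\<lambda>v. v *\<^sub>R e' x)) (at x within {a..b})"
      using D[OF x] by (simp add: has_vector_derivative_def)
    have "norm (e' x) \<le> L * N + m"
      using B[OF x] t1(2)[OF x] L mult_left_mono[of "norm (e x)" N L] by (auto simp: N_def)
    then show "onorm (\<lambda>v. v *\<^sub>R e' x) \<le> L * N + m"
      by (rule onorm_scaleR_le)
  qed (use t1 t0 in auto)
  also have "\<dots> \<le> (L * N + m) * (b - a)"
    using t1(1) t0 L by (intro mult_left_mono) (auto simp: N_def)
  also have "\<dots> = L * (b - a) * N + m * (b - a)" by (simp add: algebra_simps)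
  also have "\<dots> \<le> 1/2 * N + m * (b - a)"
    using mult_right_mono[OF L(1), of N] by (simp add: N_def)
  finally have "norm (e t1 - e t0) \<le> N / 2 + m * (b - a)" by simp
  moreover have "N \<le> norm (e t1 - e t0) + norm (e t0)"
    unfolding N_def by (metis diff_add_cancel norm_triangle_ineq)
  ultimately have "N \<le> 2 * (norm (e t0) + (b - a) * m)" by (simp add: algebra_simps)
  then show ?thesis using t1(2)[OF t] by (simp add: N_def)
qed

text \<open>Substitution writes the integral of \<open>f\<close> from 0 to t over the fixed domain
  {0..1}. Negative t then needs no orientation, and continuity in t and in parameters concerns an
  integral over a constant set.\<close>

lemma scaled_integral_has_vector_derivative:
  fixes f :: "real \<Rightarrow> 'e::euclidean_space"
  assumes c: "continuous_on {-\<delta>..\<delta>} f" and t: "t \<in> {-\<delta>..\<delta>}"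
  shows "((\<lambda>t. t *\<^sub>R integral {0..1} (\<lambda>\<sigma>. f (\<sigma> * t))) has_vector_derivative f t) (at t within {-\<delta>..\<delta>})"
proof -
  obtain H where H: "\<And>x. x \<in> {-\<delta>..\<delta>} \<Longrightarrow> (H has_vector_derivative f x) (at x within {-\<delta>..\<delta>})"
    using antiderivative_continuous[OF c] by blast
  have E: "s *\<^sub>R integral {0..1} (\<lambda>\<sigma>. f (\<sigma> * s)) = H s - H 0" if s: "s \<in> {-\<delta>..\<delta>}" for s
  proof -
    have sub: "\<sigma> * s \<in> {-\<delta>..\<delta>}" if "\<sigma> \<in> {0..1}" for \<sigma>
    proof -
      have "\<bar>\<sigma> * s\<bar> \<le> 1 * \<bar>s\<bar>" unfolding abs_mult using that by (intro mult_right_mono) auto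
      then show ?thesis using s by auto
    qed
    have "((\<lambda>\<sigma>. s *\<^sub>R f (\<sigma> * s)) has_integral ((H \<circ> (\<lambda>\<sigma>. \<sigma> * s)) 1 - (H \<circ> (\<lambda>\<sigma>. \<sigma> * s)) 0)) {0..1}"
    proof (rule fundamental_theorem_of_calculus)
      fix \<sigma> :: real assume \<sigma>: "\<sigma> \<in> {0..1}"
      have 1: "((\<lambda>\<sigma>. \<sigma> * s) has_vector_derivative s) (at \<sigma> within {0..1})"
        by (auto intro!: derivative_eq_intros)
      have "(H has_vector_derivative f (\<sigma> * s)) (at (\<sigma> * s) within (\<lambda>\<sigma>. \<sigma> * s) ` {0..1})"
        by (rule has_vector_derivative_within_subset[OF H]) (use sub \<sigma> in auto)
      then show "((H \<circ> (\<lambda>\<sigma>. \<sigma> * s)) has_vector_derivative s *\<^sub>R f (\<sigma> * s)) (at \<sigma> within {0..1})"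
        by (rule vector_diff_chain_within[OF 1])
    qed simp
    from integral_unique[OF this] show ?thesis by simp
  qed
  have "((\<lambda>t. H t - H 0) has_vector_derivative f t) (at t within {-\<delta>..\<delta>})"
    using H[OF t] by (auto intro!: derivative_eq_intros)
  then show ?thesis by (rule has_vector_derivative_transform[OF t, rotated]) (simp add: E)
qed

text \<open>The parameter is part of the argument of the unknown, so one fixed point in the complete
  space of bounded continuous functions is jointly continuous in time and parameter. The initial
  value is normalized to 0; other initial values are moved into \<open>g\<close> by translating the
  unknown.\<close>

lemma parametric_picard:
  fixes g :: "real \<times> 'p::euclidean_space \<times> 'e::euclidean_space \<Rightarrow> 'e"
  assumes C: "compact C" "convex C" "C \<noteq> {}" and \<delta>: "\<delta> > 0"
    and g: "continuous_on ({-\<delta>..\<delta>} \<times> C \<times> UNIV) g"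
    and Lip: "\<And>t p x y. t \<in> {-\<delta>..\<delta>} \<Longrightarrow> p \<in> C \<Longrightarrow> norm (g (t, p, x) - g (t, p, y)) \<le> L * norm (x - y)"
    and L: "L \<ge> 0" "L * \<delta> \<le> 1/2"
  obtains u where "continuous_on ({-\<delta>..\<delta>} \<times> C) u" "\<And>p. p \<in> C \<Longrightarrow> u (0, p) = 0"
    "\<And>t p. t \<in> {-\<delta>..\<delta>} \<Longrightarrow> p \<in> C \<Longrightarrow>
       ((\<lambda>t. u (t, p)) has_vector_derivative g (t, p, u (t, p))) (at t within {-\<delta>..\<delta>})"
proof -
  define K where "K = {-\<delta>..\<delta>} \<times> C"
  have K: "compact K" "convex K" "closed K" "K \<noteq> {}"
    using C \<delta> by (auto simp: K_def compact_Times convex_Times compact_imp_closed)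
  \<comment> \<open>Elements of the type of bounded continuous functions are defined on the whole
    space. Composing with the retraction onto the compact convex \<open>K\<close> turns functions on
    \<open>K\<close> into such elements without changing them on \<open>K\<close>.\<close>
  define \<pi> where "\<pi> = closest_point K"
  have \<pi>K: "\<pi> w \<in> K" for w using closest_point_in_set K by (auto simp: \<pi>_def)
  have \<pi>_id: "\<pi> w = w" if "w \<in> K" for w using that closest_point_self by (auto simp: \<pi>_def)
  have \<pi>c: "continuous_on A \<pi>" for A unfolding \<pi>_def by (rule continuous_on_closest_point[OF K(2,3,4)])
  have scale: "(\<sigma> * t, p) \<in> K" if "(t, p) \<in> K" "\<sigma> \<in> {0..1}" for \<sigma> t p
  proof -
    have "\<bar>\<sigma> * t\<bar> \<le> 1 * \<bar>t\<bar>" unfolding abs_mult using that by (intro mult_right_mono) auto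
    then show ?thesis using that by (auto simp: K_def)
  qed
  define G where "G u w = fst w *\<^sub>R integral {0..1} (\<lambda>\<sigma>. g (\<sigma> * fst w, snd w, u (\<sigma> * fst w, snd w)))"
    for u :: "real \<times> 'p \<Rightarrow> 'e" and w
  have integrand: "continuous_on {0..1} (\<lambda>\<sigma>. g (\<sigma> * fst w, snd w, u (\<sigma> * fst w, snd w)))"
    if "continuous_on K u" "w \<in> K" for u w
    by (rule continuous_on_compose2[OF g])
      (use that scale[of "fst w" "snd w"] in \<open>auto intro!: continuous_intros continuous_on_compose2[OF that(1)] simp: K_def\<close>)
  have Gc: "continuous_on K (G u)" if u: "continuous_on K u" for u
  proof -
    have "continuous_on (K \<times> cbox 0 1) (\<lambda>(w, \<sigma>). g (\<sigma> * fst w, snd w, u (\<sigma> * fst w, snd w)))"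
      unfolding split_beta
      by (rule continuous_on_compose2[OF g])
        (use scale in \<open>force intro!: continuous_intros continuous_on_compose2[OF u] simp: K_def\<close>)+
    from integral_continuous_on_param[OF this]
    show ?thesis unfolding G_def by (auto intro!: continuous_intros)
  qed
  define T where "T u = Bcontfun (\<lambda>w. G (apply_bcontfun u) (\<pi> w))" for u :: "(real \<times> 'p) \<Rightarrow>\<^sub>C 'e"
  have T: "apply_bcontfun (T u) w = G (apply_bcontfun u) (\<pi> w)" for u w
  proof -
    have "continuous_on UNIV (\<lambda>w. G (apply_bcontfun u) (\<pi> w))"
      by (rule continuous_on_compose2[OF Gc \<pi>c]) (use \<pi>K in auto)
    moreover have "bounded (G (apply_bcontfun u) ` K)"
      by (intro compact_imp_bounded compact_continuous_image Gc K) auto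
    then have "bounded (range (\<lambda>w. G (apply_bcontfun u) (\<pi> w)))"
      by (rule bounded_subset) (use \<pi>K in auto)
    ultimately show ?thesis unfolding T_def by (subst Bcontfun_inverse) (auto simp: bcontfun_def)
  qed
  \<comment> \<open>Times are at most \<delta> in absolute value, so the contraction factor is
    \<open>L * \<delta>\<close>.\<close>
  have "dist (T u) (T v) \<le> 1/2 * dist u v" for u v
  proof (rule dist_bound)
    fix w
    obtain t p where w: "\<pi> w = (t, p)" by fastforce
    have tp: "(t, p) \<in> K" using \<pi>K[of w] w by simp
    have i: "continuous_on {0..1} (\<lambda>\<sigma>. g (\<sigma> * t, p, apply_bcontfun u (\<sigma> * t, p)))" for u :: "(real \<times> 'p) \<Rightarrow>\<^sub>C 'e"
      using integrand[OF _ tp, of u] by simp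
    have "norm (integral {0..1} (\<lambda>\<sigma>. g (\<sigma> * t, p, u (\<sigma> * t, p)) - g (\<sigma> * t, p, v (\<sigma> * t, p)))) \<le> L * dist u v * (1 - 0)"
    proof (rule integral_bound)
      fix \<sigma> :: real assume "\<sigma> \<in> {0..1}"
      then have "\<sigma> * t \<in> {-\<delta>..\<delta>}" "p \<in> C" using scale[OF tp] by (auto simp: K_def)
      then have "norm (g (\<sigma> * t, p, u (\<sigma> * t, p)) - g (\<sigma> * t, p, v (\<sigma> * t, p))) \<le> L * norm (u (\<sigma> * t, p) - v (\<sigma> * t, p))"
        by (rule Lip)
      also have "\<dots> \<le> L * dist u v"
        using dist_bounded[of u "(\<sigma> * t, p)" v] L by (intro mult_left_mono) (auto simp: dist_norm)
      finally show "norm (g (\<sigma> * t, p, u (\<sigma> * t, p)) - g (\<sigma> * t, p, v (\<sigma> * t, p))) \<le> L * dist u v" .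
    qed (auto intro!: continuous_intros i)
    then have *: "norm (integral {0..1} (\<lambda>\<sigma>. g (\<sigma> * t, p, u (\<sigma> * t, p))) - integral {0..1} (\<lambda>\<sigma>. g (\<sigma> * t, p, v (\<sigma> * t, p)))) \<le> L * dist u v"
      by (subst integral_diff[symmetric]) (auto intro!: integrable_continuous_real i)
    have "dist (T u w) (T v w) = \<bar>t\<bar> * norm (integral {0..1} (\<lambda>\<sigma>. g (\<sigma> * t, p, u (\<sigma> * t, p))) - integral {0..1} (\<lambda>\<sigma>. g (\<sigma> * t, p, v (\<sigma> * t, p))))"
      by (simp add: T w G_def dist_norm flip: scaleR_diff_right)
    also have "\<dots> \<le> \<delta> * (L * dist u v)" using tp * by (intro mult_mono) (auto simp: K_def)
    also have "\<dots> \<le> 1/2 * dist u v" using mult_right_mono[OF L(2), of "dist u v"] by (simp add: algebra_simps)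
    finally show "dist (T u w) (T v w) \<le> 1/2 * dist u v" .
  qed
  then have "\<exists>!u. T u = u" by (intro banach_fix_type[of "1/2"]) auto
  then obtain U where U: "T U = U" by blast
  define u where "u = apply_bcontfun U"
  have u: "u (t, p) = t *\<^sub>R integral {0..1} (\<lambda>\<sigma>. g (\<sigma> * t, p, u (\<sigma> * t, p)))" if "(t, p) \<in> K" for t p
    using T[of U "(t, p)"] \<pi>_id[OF that] by (simp add: U u_def G_def)
  have uc: "continuous_on A u" for A by (simp add: u_def)
  show thesis
  proof
    show "continuous_on ({-\<delta>..\<delta>} \<times> C) u" by (rule uc)
    show "u (0, p) = 0" if "p \<in> C" for p using u[of 0 p] that \<delta> by (simp add: K_def)
    show "((\<lambda>t. u (t, p)) has_vector_derivative g (t, p, u (t, p))) (at t within {-\<delta>..\<delta>})"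
      if t: "t \<in> {-\<delta>..\<delta>}" and p: "p \<in> C" for t p
    proof -
      have "continuous_on {-\<delta>..\<delta>} (\<lambda>t. g (t, p, u (t, p)))"
        by (rule continuous_on_compose2[OF g]) (use p in \<open>auto intro!: continuous_intros continuous_on_compose2[OF uc]\<close>)
      from scaled_integral_has_vector_derivative[OF this t]
      show ?thesis by (rule has_vector_derivative_transform[OF t, rotated]) (use u p in \<open>simp add: K_def\<close>)
    qed
  qed
qed

text \<open>The Taylor remainder is estimated uniformly over a compact set of base points. The
  derivatives in the finitely many basis directions are uniformly continuous on a compact
  neighbourhood of \<Gamma>, and the mean value inequality on short segments does the rest.\<close>

lemma uniform_linearization:
  fixes f :: "'a::euclidean_space \<Rightarrow> 'b::real_normed_vector"
  assumes \<Omega>: "open \<Omega>" and \<Gamma>: "compact \<Gamma>" "\<Gamma> \<subseteq> \<Omega>"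
    and D: "\<And>w. w \<in> \<Omega> \<Longrightarrow> (f has_derivative f' w) (at w)"
    and C: "\<And>v. continuous_on \<Omega> (\<lambda>w. f' w v)" and \<eta>: "\<eta> > 0"
  obtains d where "d > 0" "\<And>w w'. w \<in> \<Gamma> \<Longrightarrow> norm (w' - w) < d \<Longrightarrow> norm (f w' - f w - f' w (w' - w)) \<le> \<eta> * norm (w' - w)"
proof -
  obtain r where r: "r > 0" "(\<Union>w\<in>\<Gamma>. cball w r) \<subseteq> \<Omega>"
    using compact_subset_open_imp_cball_epsilon_subset[OF \<Gamma>(1) \<Omega> \<Gamma>(2)] by blast
  \<comment> \<open>This is the closed \<open>r\<close>-neighbourhood of \<Gamma>, written as a sum
    of compact sets to have its compactness at once.\<close>
  define K where "K = {x + y | x y. x \<in> \<Gamma> \<and> y \<in> cball 0 r}"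
  have K: "compact K" unfolding K_def by (intro compact_sums \<Gamma> compact_cball)
  have inK: "w' \<in> K" if "w \<in> \<Gamma>" "norm (w' - w) \<le> r" for w w'
    unfolding K_def using that by (intro CollectI exI[of _ w] exI[of _ "w' - w"]) auto
  have K\<Omega>: "K \<subseteq> \<Omega>"
  proof
    fix z assume "z \<in> K"
    then obtain x y where "z = x + y" "x \<in> \<Gamma>" "norm y \<le> r" by (auto simp: K_def)
    then have "z \<in> cball x r" by (simp add: dist_norm)
    then show "z \<in> \<Omega>" using r \<open>x \<in> \<Gamma>\<close> by blast
  qed
  define \<eta>' where "\<eta>' = \<eta> / DIM('a)"
  have \<eta>': "\<eta>' > 0" using \<eta> by (simp add: \<eta>'_def)
  have "\<exists>d>0. \<forall>x\<in>K. \<forall>x'\<in>K. dist x' x < d \<longrightarrow> dist (f' x' i) (f' x i) < \<eta>'" for i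
    using compact_uniformly_continuous[OF continuous_on_subset[OF C K\<Omega>] K, of i] \<eta>'
    unfolding uniformly_continuous_on_def by blast
  then obtain dd where dd: "\<And>i. dd i > 0" "\<And>i x x'. x \<in> K \<Longrightarrow> x' \<in> K \<Longrightarrow> dist x' x < dd i \<Longrightarrow> dist (f' x' i) (f' x i) < \<eta>'"
    by metis
  define d where "d = Min (insert r (dd ` Basis))"
  have d: "d > 0" using r dd by (simp add: d_def)
  have "d \<le> x" if "x \<in> insert r (dd ` Basis)" for x
    unfolding d_def by (rule Min.coboundedI[OF _ that]) simp
  then have d: "d > 0" "d \<le> r" "\<And>i. i \<in> Basis \<Longrightarrow> d \<le> dd i" using d by auto
  show thesis
  proof
    show "d > 0" by fact
    fix w w' assume w: "w \<in> \<Gamma>" and w': "norm (w' - w) < d"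
    have "norm (f w' - f w - f' w (w' - w)) \<le> norm (w' - w) * \<eta>"
    proof (rule differentiable_bound_linearization[of w w' "ball w d" f f'])
      show "w + t *\<^sub>R (w' - w) \<in> ball w d" if "t \<in> {0..1}" for t
      proof -
        have "t * norm (w' - w) \<le> 1 * norm (w' - w)" using that by (intro mult_right_mono) auto
        then show ?thesis using w' that by (simp add: dist_norm)
      qed
      fix x assume x: "x \<in> ball w d"
      have xw: "norm (x - w) < d" using x by (simp add: dist_norm norm_minus_commute)
      have xK: "x \<in> K" "w \<in> K" using inK[OF w] xw d r by auto
      then show "(f has_derivative f' x) (at x within ball w d)" using D K\<Omega> has_derivative_at_withinI by blast
      have lin: "linear (f' x)" "linear (f' w)" using D xK K\<Omega> has_derivative_linear by blast+
      show "onorm (f' x - f' w) \<le> \<eta>"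
      proof (rule onorm_bound)
        fix v
        have "norm (f' x i - f' w i) \<le> \<eta>'" if "i \<in> Basis" for i
        proof -
          have "dist x w < dd i" using d(3)[OF that] xw by (simp add: dist_norm)
          from dd(2)[OF xK(2,1) this] show ?thesis by (simp add: dist_norm)
        qed
        then have "norm (\<Sum>i\<in>Basis. (v \<bullet> i) *\<^sub>R (f' x i - f' w i)) \<le> (\<Sum>i\<in>(Basis::'a set). norm v * \<eta>')"
          by (intro sum_norm_le) (auto intro!: mult_mono Basis_le_norm)
        moreover have "(f' x - f' w) v = (\<Sum>i\<in>Basis. (v \<bullet> i) *\<^sub>R (f' x i - f' w i))"
          using linear_expand[OF lin(1), of v] linear_expand[OF lin(2), of v]
          by (simp add: scaleR_diff_right sum_subtractf)
        ultimately show "norm ((f' x - f' w) v) \<le> \<eta> * norm v" by (simp add: \<eta>'_def mult.commute)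
      qed (use \<eta> in simp)
    qed (use d in simp)
    then show "norm (f w' - f w - f' w (w' - w)) \<le> \<eta> * norm (w' - w)" by (simp add: mult.commute)
  qed
qed

text \<open>The candidate \<open>z\<close> is constructed beforehand, as the solution of the
  linearized equation given by Picard iteration. The error e = y(p + h v) - y(p) - h z then
  satisfies |e'| \<le> (L + \<eta>) |e| + \<eta> |h| (|v| + Z) with \<eta> as small as desired, and
  its initial value is o(h); hence so is e, uniformly on a short interval. \<open>Lip\<close>
  concerns the state direction alone, since the parameter direction only contributes an
  inhomogeneity.\<close>

lemma ode_param_derivative_local:
  fixes f :: "real \<times> 'p::euclidean_space \<times> 'e::euclidean_space \<Rightarrow> 'e" and y :: "real \<times> 'p \<Rightarrow> 'e"
  assumes d: "0 < d" "d < \<delta>" and P: "open P" and X: "open X" and p0: "p0 \<in> P"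
    and D: "\<And>w. w \<in> {-\<delta><..<\<delta>} \<times> P \<times> X \<Longrightarrow> (f has_derivative f' w) (at w)"
    and C: "\<And>v. continuous_on ({-\<delta><..<\<delta>} \<times> P \<times> X) (\<lambda>w. f' w v)"
    and Lip: "\<And>w x. w \<in> {-\<delta><..<\<delta>} \<times> P \<times> X \<Longrightarrow> norm (f' w (0, 0, x)) \<le> L * norm x"
    and L: "L \<ge> 0" "L * (4 * \<delta>) \<le> 1/2"
    and y: "continuous_on ({-\<delta><..<\<delta>} \<times> P) y" "\<And>w. w \<in> {-\<delta><..<\<delta>} \<times> P \<Longrightarrow> y w \<in> X"
      "\<And>t p. t \<in> {-\<delta><..<\<delta>} \<Longrightarrow> p \<in> P \<Longrightarrow> ((\<lambda>t. y (t, p)) has_vector_derivative f (t, p, y (t, p))) (at t)"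
    and y0: "\<And>p. p \<in> P \<Longrightarrow> ((\<lambda>p. y (0, p)) has_derivative y0' p) (at p)" "continuous_on P (\<lambda>p. y0' p v)"
  obtains r z where "r > 0" "ball p0 r \<subseteq> P" "continuous_on ({-d..d} \<times> cball p0 r) z"
    "\<And>t p. t \<in> {-d..d} \<Longrightarrow> p \<in> ball p0 r \<Longrightarrow> ((\<lambda>h. y (t, p + h *\<^sub>R v)) has_vector_derivative z (t, p)) (at 0)"
    "\<And>t p. t \<in> {-d..d} \<Longrightarrow> p \<in> ball p0 r \<Longrightarrow>
       ((\<lambda>t. z (t, p)) has_vector_derivative f' (t, p, y (t, p)) (0, v, z (t, p))) (at t within {-d..d})"
    "\<And>p. p \<in> ball p0 r \<Longrightarrow> z (0, p) = y0' p v"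
proof -
  let ?I = "{-d..d}" and ?\<Omega> = "{-\<delta><..<\<delta>} \<times> P \<times> X"
  obtain r where r: "r > 0" "cball p0 r \<subseteq> P" using P p0 open_contains_cball by blast
  define C1 where "C1 = cball p0 r"
  have C1: "compact C1" "convex C1" "C1 \<noteq> {}" "C1 \<subseteq> P" using r by (auto simp: C1_def)
  have Isub: "?I \<subseteq> {-\<delta><..<\<delta>}" using d by auto
  have IC: "?I \<times> C1 \<subseteq> {-\<delta><..<\<delta>} \<times> P" using Isub C1 by blast
  have yc: "continuous_on (?I \<times> C1) y" by (rule continuous_on_subset[OF y(1) IC])
  have in\<Omega>: "(t, p, y (t, p)) \<in> ?\<Omega>" if "t \<in> ?I" "p \<in> C1" for t p
  proof -
    have "(t, p) \<in> {-\<delta><..<\<delta>} \<times> P" using that IC by blast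
    then show ?thesis using y(2)[of "(t, p)"] by auto
  qed
  have lin: "linear (f' w)" if "w \<in> ?\<Omega>" for w using D[OF that] has_derivative_linear by blast
  have lip: "norm (f' w (a, q, x) - f' w (a, q, x')) \<le> L * norm (x - x')" if "w \<in> ?\<Omega>" for w a q x x'
    using Lip[OF that, of "x - x'"] linear_diff[OF lin[OF that], of "(a, q, x)" "(a, q, x')"] by simp
  have d2: "L * d \<le> 1/2"
  proof -
    have "L * d \<le> L * (4 * \<delta>)" using d L by (intro mult_left_mono) auto
    then show ?thesis using L by simp
  qed
  \<comment> \<open>The unknown is \<open>z\<close> minus its initial value \<open>y0' p v\<close>,
    since \<open>parametric_picard\<close> starts at 0.\<close>
  define g where "g = (\<lambda>(t, p, x). f' (t, p, y (t, p)) (0, v, y0' p v + x))"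
  have gcont: "continuous_on (?I \<times> C1 \<times> UNIV) g"
  proof -
    have yc': "continuous_on (?I \<times> C1 \<times> UNIV) (\<lambda>w. y (fst w, fst (snd w)))"
      by (rule continuous_on_compose2[OF yc]) (auto intro!: continuous_intros)
    have b: "continuous_on (?I \<times> C1 \<times> UNIV) (\<lambda>w. f' (fst w, fst (snd w), y (fst w, fst (snd w))) i)" for i
      by (rule continuous_on_compose2[OF C[of i]]) (use in\<Omega> in \<open>auto intro!: continuous_intros yc'\<close>)
    have b0: "continuous_on (?I \<times> C1 \<times> (UNIV :: 'e set)) (\<lambda>w. y0' (fst (snd w)) v)"
      by (rule continuous_on_compose2[OF y0(2)]) (use C1 in \<open>auto intro!: continuous_intros\<close>)
    have "continuous_on (?I \<times> C1 \<times> UNIV) (\<lambda>w. \<Sum>i\<in>Basis. ((0::real, v, y0' (fst (snd w)) v + snd (snd w)) \<bullet> i)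
        *\<^sub>R f' (fst w, fst (snd w), y (fst w, fst (snd w))) i)"
      by (intro continuous_intros b b0)
    then show ?thesis
      by (rule continuous_on_eq) (auto simp: g_def linear_expand[OF lin[OF in\<Omega>], symmetric])
  qed
  have gLip: "norm (g (t, p, x) - g (t, p, x')) \<le> L * norm (x - x')" if "t \<in> ?I" "p \<in> C1" for t p x x'
    using lip[OF in\<Omega>[OF that], of 0 v "y0' p v + x" "y0' p v + x'"] by (simp add: g_def)
  obtain u where u: "continuous_on (?I \<times> C1) u" "\<And>p. p \<in> C1 \<Longrightarrow> u (0, p) = 0"
    "\<And>t p. t \<in> ?I \<Longrightarrow> p \<in> C1 \<Longrightarrow> ((\<lambda>t. u (t, p)) has_vector_derivative g (t, p, u (t, p))) (at t within ?I)"
    using parametric_picard[OF C1(1-3) d(1) gcont gLip L(1) d2] by blast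
  define z where "z w = u w + y0' (snd w) v" for w
  have zc: "continuous_on (?I \<times> C1) z"
    unfolding z_def using C1 by (intro continuous_intros u continuous_on_compose2[OF y0(2)]) auto
  have z': "((\<lambda>t. z (t, p)) has_vector_derivative f' (t, p, y (t, p)) (0, v, z (t, p))) (at t within ?I)"
    if "t \<in> ?I" "p \<in> C1" for t p
    using u(3)[OF that] unfolding z_def by (auto intro!: derivative_eq_intros simp: g_def add.commute)
  have key: "((\<lambda>h. y (t, p + h *\<^sub>R v)) has_vector_derivative z (t, p)) (at 0)"
    if t: "t \<in> ?I" and p: "p \<in> ball p0 r" for t p
    unfolding has_vector_derivative_def has_derivative_at_alt
  proof (intro conjI allI impI)
    fix \<epsilon> :: real assume \<epsilon>: "\<epsilon> > 0"
    have pC: "p \<in> C1" using p by (simp add: C1_def)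
    have "bounded ((\<lambda>t. z (t, p)) ` ?I)"
      by (intro compact_imp_bounded compact_continuous_image continuous_on_compose2[OF zc]) (use pC in \<open>auto intro!: continuous_intros\<close>)
    then obtain Z where Z: "\<And>t. t \<in> ?I \<Longrightarrow> norm (z (t, p)) \<le> Z" unfolding bounded_iff by blast
    have Z0: "Z \<ge> 0" using Z[OF t] norm_ge_zero order_trans by blast
    \<comment> \<open>The first bound makes \<open>(L + \<eta>) * (2 * d)\<close> at most 1/2: the
      factor 4 in \<open>L * (4 * \<delta>) \<le> 1/2\<close> has left half of it for \<eta>. The
      second makes the inhomogeneous term contribute at most \<epsilon>/2; the other \<epsilon>/2 is
      reserved for the initial error.\<close>
    define \<eta> where "\<eta> = min (1 / (8 * d)) (\<epsilon> / (8 * d * (norm v + Z + 1)))"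
    have \<eta>: "\<eta> > 0" using d \<epsilon> Z0 by (auto simp: \<eta>_def intro!: divide_pos_pos mult_pos_pos add_nonneg_pos)
    have \<eta>1: "\<eta> * (2 * d) \<le> 1/4"
    proof -
      have "\<eta> * (2 * d) \<le> 1 / (8 * d) * (2 * d)" using d by (intro mult_right_mono) (auto simp: \<eta>_def)
      then show ?thesis using d by simp
    qed
    have \<eta>2: "\<eta> * (4 * d * (norm v + Z)) \<le> \<epsilon> / 2"
    proof -
      have "\<eta> * (4 * d * (norm v + Z)) \<le> \<epsilon> / (8 * d * (norm v + Z + 1)) * (4 * d * (norm v + Z + 1))"
        using d Z0 \<eta> \<epsilon> by (intro mult_mono mult_left_mono) (auto simp: \<eta>_def)
      also have "\<dots> = \<epsilon> / 2"
      proof -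
        define c where "c = norm v + Z + 1"
        have "c > 0" using Z0 by (simp add: c_def add_nonneg_pos)
        then show ?thesis using d unfolding c_def[symmetric] by simp
      qed
      finally show ?thesis .
    qed
    define \<Gamma> where "\<Gamma> = (\<lambda>t. (t, p, y (t, p))) ` ?I"
    have \<Gamma>: "compact \<Gamma>" "\<Gamma> \<subseteq> ?\<Omega>" unfolding \<Gamma>_def
      by (rule compact_continuous_image)
        (use pC in\<Omega> in \<open>auto intro!: continuous_intros continuous_on_compose2[OF yc]\<close>)
    have "open ?\<Omega>" by (intro open_Times P X open_greaterThanLessThan)
    then obtain d1 where d1: "d1 > 0"
      "\<And>w w'. w \<in> \<Gamma> \<Longrightarrow> norm (w' - w) < d1 \<Longrightarrow> norm (f w' - f w - f' w (w' - w)) \<le> \<eta> * norm (w' - w)"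
      using uniform_linearization[OF _ \<Gamma> D C \<eta>] by blast
    have "uniformly_continuous_on (?I \<times> C1) y"
      using compact_uniformly_continuous[OF yc] compact_Times[OF _ C1(1)] by blast
    then obtain d2 where d2: "d2 > 0"
      "\<And>w w'. w \<in> ?I \<times> C1 \<Longrightarrow> w' \<in> ?I \<times> C1 \<Longrightarrow> dist w' w < d2 \<Longrightarrow> dist (y w') (y w) < d1 / 2"
      unfolding uniformly_continuous_on_def using d1(1) by (meson half_gt_zero)
    have "((\<lambda>p. y (0, p)) has_derivative y0' p) (at p)" using y0(1) pC C1 by blast
    then obtain d3 where d3: "d3 > 0"
      "\<And>q. norm (q - p) < d3 \<Longrightarrow> norm (y (0, q) - y (0, p) - y0' p (q - p)) \<le> \<epsilon> / (4 * (norm v + 1)) * norm (q - p)"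
      unfolding has_derivative_at_alt using \<epsilon> by (metis add_nonneg_pos norm_ge_zero zero_less_divide_iff zero_less_mult_iff zero_less_numeral zero_less_one)
    \<comment> \<open>This makes |h| |v| smaller than \<open>d1 / 2\<close> and \<open>d2\<close>,
      which together put the two arguments of \<open>f\<close> within \<open>d1\<close>; than
      \<open>d3\<close>, for the initial values; and than the distance left inside the closed ball.
      Adding 1 covers v = 0.\<close>
    define h0 where "h0 = min (min (d1 / 2) d2) (min d3 (r - dist p0 p)) / (norm v + 1)"
    have v1: "norm v + 1 > 0" by (simp add: add_nonneg_pos)
    have h0: "h0 > 0" using d1 d2 d3 p v1 by (simp add: h0_def)
    show "\<exists>d>0. \<forall>h. norm (h - 0) < d \<longrightarrow>
       norm (y (t, p + h *\<^sub>R v) - y (t, p + 0 *\<^sub>R v) - (h - 0) *\<^sub>R z (t, p)) \<le> \<epsilon> * norm (h - 0)"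
    proof (intro exI[of _ h0] conjI h0 allI impI)
      fix h :: real assume "norm (h - 0) < h0"
      then have h: "\<bar>h\<bar> < h0" by simp
      have "\<bar>h\<bar> * norm v \<le> \<bar>h\<bar> * (norm v + 1)" by (intro mult_left_mono) auto
      also have "\<dots> < h0 * (norm v + 1)" using h v1 by (intro mult_strict_right_mono)
      also have "h0 * (norm v + 1) = min (min (d1 / 2) d2) (min d3 (r - dist p0 p))"
        using v1 by (simp add: h0_def)
      finally have hv: "norm (h *\<^sub>R v) < d1 / 2" "norm (h *\<^sub>R v) < d2" "norm (h *\<^sub>R v) < d3" "norm (h *\<^sub>R v) < r - dist p0 p"
        by auto
      have qC: "p + h *\<^sub>R v \<in> C1"
      proof -
        have "dist p0 (p + h *\<^sub>R v) \<le> dist p0 p + dist p (p + h *\<^sub>R v)" by (rule dist_triangle)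
        also have "dist p (p + h *\<^sub>R v) = norm (h *\<^sub>R v)" by (simp add: dist_norm)
        finally show ?thesis using hv(4) by (simp add: C1_def)
      qed
      define e where "e s = y (s, p + h *\<^sub>R v) - y (s, p) - h *\<^sub>R z (s, p)" for s
      define e' where "e' s = f (s, p + h *\<^sub>R v, y (s, p + h *\<^sub>R v)) - f (s, p, y (s, p)) - h *\<^sub>R f' (s, p, y (s, p)) (0, v, z (s, p))" for s
      have De: "(e has_vector_derivative e' s) (at s within ?I)" if "s \<in> ?I" for s
        unfolding e_def e'_def
        by (intro derivative_intros bounded_linear.has_vector_derivative[OF bounded_linear_scaleR_right] z' that pC
            has_vector_derivative_at_within[OF y(3)]) (use that qC pC C1 Isub in auto)
      have Be: "norm (e' s) \<le> (L + \<eta>) * norm (e s) + \<eta> * \<bar>h\<bar> * (norm v + Z)" if s: "s \<in> ?I" for s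
      proof -
        let ?w = "(s, p, y (s, p))" and ?w' = "(s, p + h *\<^sub>R v, y (s, p + h *\<^sub>R v))"
        have diff: "?w' - ?w = (0, h *\<^sub>R v, y (s, p + h *\<^sub>R v) - y (s, p))" by simp
        have split: "?w' - ?w = h *\<^sub>R (0, v, z (s, p)) + (0, 0, e s)" by (simp add: e_def)
        have nw: "norm (?w' - ?w) \<le> norm (h *\<^sub>R v) + norm (y (s, p + h *\<^sub>R v) - y (s, p))"
          unfolding diff using norm_Pair_le[of "0::real" "(h *\<^sub>R v, y (s, p + h *\<^sub>R v) - y (s, p))"]
            norm_Pair_le[of "h *\<^sub>R v" "y (s, p + h *\<^sub>R v) - y (s, p)"] by simp
        have "dist (s, p + h *\<^sub>R v) (s, p) < d2" using hv(2) by (simp add: dist_norm)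
        then have "dist (y (s, p + h *\<^sub>R v)) (y (s, p)) < d1 / 2" using d2(2)[of "(s, p)" "(s, p + h *\<^sub>R v)"] s pC qC by auto
        then have "norm (?w' - ?w) < d1" using nw hv(1) by (simp add: dist_norm)
        then have "norm (f ?w' - f ?w - f' ?w (?w' - ?w)) \<le> \<eta> * norm (?w' - ?w)"
          using d1(2)[of ?w ?w'] s by (auto simp: \<Gamma>_def)
        moreover have "f' ?w (?w' - ?w) = h *\<^sub>R f' ?w (0, v, z (s, p)) + f' ?w (0, 0, e s)"
          unfolding split using lin[OF in\<Omega>[OF s pC]] by (simp only: linear_add linear_cmul)
        ultimately have "norm (e' s - f' ?w (0, 0, e s)) \<le> \<eta> * norm (?w' - ?w)"
          by (simp add: e'_def algebra_simps)
        also have "\<dots> \<le> \<eta> * (norm (h *\<^sub>R v) + (norm (e s) + norm (h *\<^sub>R z (s, p))))"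
        proof (intro mult_left_mono order_trans[OF nw] add_left_mono)
          have "y (s, p + h *\<^sub>R v) - y (s, p) = e s + h *\<^sub>R z (s, p)" by (simp add: e_def)
          then show "norm (y (s, p + h *\<^sub>R v) - y (s, p)) \<le> norm (e s) + norm (h *\<^sub>R z (s, p))"
            by (metis norm_triangle_ineq)
        qed (use \<eta> in auto)
        also have "\<dots> \<le> \<eta> * (\<bar>h\<bar> * norm v + (norm (e s) + \<bar>h\<bar> * Z))"
          using Z[OF s] \<eta> by (intro mult_left_mono add_mono) (auto intro!: mult_left_mono)
        finally have "norm (e' s - f' ?w (0, 0, e s)) \<le> \<eta> * (\<bar>h\<bar> * norm v + (norm (e s) + \<bar>h\<bar> * Z))" .
        moreover have "norm (f' ?w (0, 0, e s)) \<le> L * norm (e s)" by (rule Lip[OF in\<Omega>[OF s pC]])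
        moreover have "norm (e' s) \<le> norm (e' s - f' ?w (0, 0, e s)) + norm (f' ?w (0, 0, e s))"
          by (metis diff_add_cancel norm_triangle_ineq)
        ultimately show ?thesis by (simp add: algebra_simps)
      qed
      have e0: "norm (e 0) \<le> \<epsilon> / 4 * \<bar>h\<bar>"
      proof -
        have "linear (y0' p)" using y0(1) pC C1 has_derivative_linear by blast
        then have "e 0 = y (0, p + h *\<^sub>R v) - y (0, p) - y0' p ((p + h *\<^sub>R v) - p)"
          using u(2)[OF pC] by (simp add: e_def z_def linear_cmul)
        then have "norm (e 0) \<le> \<epsilon> / (4 * (norm v + 1)) * norm (h *\<^sub>R v)"
          using d3(2)[of "p + h *\<^sub>R v"] hv(3) by simp
        also have "\<dots> = \<epsilon> / 4 * \<bar>h\<bar> * (norm v / (norm v + 1))" by simp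
        also have "\<dots> \<le> \<epsilon> / 4 * \<bar>h\<bar> * 1"
          using \<epsilon> v1 by (intro mult_left_mono) (auto simp: divide_simps)
        finally show ?thesis by simp
      qed
      have L': "(L + \<eta>) * (d - - d) \<le> 1/2"
      proof -
        have "L * (2 * d) \<le> L * (2 * \<delta>)" using d L by (intro mult_left_mono) auto
        then show ?thesis using L(2) \<eta>1 by (simp add: algebra_simps)
      qed
      have "norm (e t) \<le> 2 * (norm (e 0) + (d - - d) * (\<eta> * \<bar>h\<bar> * (norm v + Z)))"
        by (rule ode_small_interval_bound[where L="L + \<eta>" and e'=e', OF _ De Be L' _ _ t])
          (use d L \<eta> Z0 in \<open>auto intro!: mult_nonneg_nonneg add_nonneg_nonneg\<close>)
      also have "\<dots> = 2 * norm (e 0) + \<eta> * (4 * d * (norm v + Z)) * \<bar>h\<bar>" by (simp add: algebra_simps)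
      also have "\<dots> \<le> 2 * (\<epsilon> / 4 * \<bar>h\<bar>) + \<epsilon> / 2 * \<bar>h\<bar>"
        using e0 \<eta>2 by (intro add_mono mult_left_mono mult_right_mono) auto
      finally show "norm (y (t, p + h *\<^sub>R v) - y (t, p + 0 *\<^sub>R v) - (h - 0) *\<^sub>R z (t, p)) \<le> \<epsilon> * norm (h - 0)"
        by (simp add: e_def)
    qed
  qed (auto intro: bounded_linear_scaleR_left)
  show thesis
  proof
    show "r > 0" by fact
    show "ball p0 r \<subseteq> P" using r by (meson ball_subset_cball order_trans)
    show "continuous_on (?I \<times> cball p0 r) z" using zc by (simp add: C1_def)
    show "z (0, p) = y0' p v" if "p \<in> ball p0 r" for p
      using u(2)[of p] that by (simp add: z_def C1_def)
  qed (use key z' in \<open>auto simp: C1_def\<close>)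
qed

text \<open>The local result covers a closed subinterval and a small ball of parameters. Patching is
  automatic because \<open>z\<close> is defined as the directional derivative itself, with which
  every local solution agrees. The premise \<open>0 < \<delta>\<close> of the last conclusion puts
  time 0 into the interval.\<close>

lemma ode_param_derivative:
  fixes f :: "real \<times> 'p::euclidean_space \<times> 'e::euclidean_space \<Rightarrow> 'e" and y :: "real \<times> 'p \<Rightarrow> 'e"
  assumes P: "open P" and X: "open X"
    and D: "\<And>w. w \<in> {-\<delta><..<\<delta>} \<times> P \<times> X \<Longrightarrow> (f has_derivative f' w) (at w)"
    and C: "\<And>v. continuous_on ({-\<delta><..<\<delta>} \<times> P \<times> X) (\<lambda>w. f' w v)"
    and Lip: "\<And>w x. w \<in> {-\<delta><..<\<delta>} \<times> P \<times> X \<Longrightarrow> norm (f' w (0, 0, x)) \<le> L * norm x"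
    and L: "L \<ge> 0" "L * (4 * \<delta>) \<le> 1/2"
    and y: "continuous_on ({-\<delta><..<\<delta>} \<times> P) y" "\<And>w. w \<in> {-\<delta><..<\<delta>} \<times> P \<Longrightarrow> y w \<in> X"
      "\<And>t p. t \<in> {-\<delta><..<\<delta>} \<Longrightarrow> p \<in> P \<Longrightarrow> ((\<lambda>t. y (t, p)) has_vector_derivative f (t, p, y (t, p))) (at t)"
    and y0: "\<And>p. p \<in> P \<Longrightarrow> ((\<lambda>p. y (0, p)) has_derivative y0' p) (at p)" "continuous_on P (\<lambda>p. y0' p v)"
  obtains z where "continuous_on ({-\<delta><..<\<delta>} \<times> P) z"
    "\<And>t p. t \<in> {-\<delta><..<\<delta>} \<Longrightarrow> p \<in> P \<Longrightarrow> ((\<lambda>h. y (t, p + h *\<^sub>R v)) has_vector_derivative z (t, p)) (at 0)"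
    "\<And>t p. t \<in> {-\<delta><..<\<delta>} \<Longrightarrow> p \<in> P \<Longrightarrow>
       ((\<lambda>t. z (t, p)) has_vector_derivative f' (t, p, y (t, p)) (0, v, z (t, p))) (at t)"
    "\<And>p. 0 < \<delta> \<Longrightarrow> p \<in> P \<Longrightarrow> z (0, p) = y0' p v"
proof -
  define z where "z w = vector_derivative (\<lambda>h. y (fst w, snd w + h *\<^sub>R v)) (at 0)" for w
  let ?W = "{-\<delta><..<\<delta>} \<times> P"
  have W: "open ?W" by (intro open_Times P open_greaterThanLessThan)
  define Q where "Q d t q \<longleftrightarrow> ((\<lambda>h. y (t, q + h *\<^sub>R v)) has_vector_derivative z (t, q)) (at 0) \<and>
       ((\<lambda>t. z (t, q)) has_vector_derivative f' (t, q, y (t, q)) (0, v, z (t, q))) (at t within {-d..d})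
       \<and> z (0, q) = y0' q v" for d t q
  have loc: "\<exists>d r. t \<in> {-d<..<d} \<and> 0 < d \<and> 0 < r \<and> d < \<delta> \<and> continuous_on ({-d..d} \<times> ball p r) z \<and>
       (\<forall>t\<in>{-d..d}. \<forall>q\<in>ball p r. Q d t q)"
    if t: "t \<in> {-\<delta><..<\<delta>}" and p: "p \<in> P" for t p
  proof -
    define d where "d = (\<bar>t\<bar> + \<delta>) / 2"
    have "\<bar>t\<bar> < \<delta>" using t by auto
    then have "0 < d" "d < \<delta>" "\<bar>t\<bar> < d" by (auto simp: d_def)
    then have d: "0 < d" "d < \<delta>" "t \<in> {-d<..<d}" by auto
    obtain r \<zeta> where r: "r > 0" "ball p r \<subseteq> P" "continuous_on ({-d..d} \<times> cball p r) \<zeta>"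
      "\<And>t q. t \<in> {-d..d} \<Longrightarrow> q \<in> ball p r \<Longrightarrow> ((\<lambda>h. y (t, q + h *\<^sub>R v)) has_vector_derivative \<zeta> (t, q)) (at 0)"
      "\<And>t q. t \<in> {-d..d} \<Longrightarrow> q \<in> ball p r \<Longrightarrow>
       ((\<lambda>t. \<zeta> (t, q)) has_vector_derivative f' (t, q, y (t, q)) (0, v, \<zeta> (t, q))) (at t within {-d..d})"
      "\<And>q. q \<in> ball p r \<Longrightarrow> \<zeta> (0, q) = y0' q v"
      using ode_param_derivative_local[where y=y and f=f and f'=f' and v=v and ?y0'.0=y0' and L=L,
          OF d(1,2) P X p D C Lip L y y0] by blast
    have eq: "z (t, q) = \<zeta> (t, q)" if "t \<in> {-d..d}" "q \<in> ball p r" for t q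
      using vector_derivative_at[OF r(4)[OF that]] by (simp add: z_def)
    have "continuous_on ({-d..d} \<times> ball p r) \<zeta>" by (rule continuous_on_subset[OF r(3)]) auto
    then have "continuous_on ({-d..d} \<times> ball p r) z" by (rule continuous_on_eq) (use eq in auto)
    moreover have "((\<lambda>t. z (t, q)) has_vector_derivative f' (t, q, y (t, q)) (0, v, z (t, q))) (at t within {-d..d})"
      if "t \<in> {-d..d}" "q \<in> ball p r" for t q
      unfolding eq[OF that] by (rule has_vector_derivative_transform[OF that(1) _ r(5)[OF that]]) (use eq that in auto)
    moreover have "(0::real) \<in> {-d..d}" using d by auto
    ultimately show ?thesis using r d eq unfolding Q_def by (intro exI[of _ d] exI[of _ r]) auto
  qed
  show thesis
  proof
    show "continuous_on ?W z"
      unfolding continuous_on_eq_continuous_at[OF W]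
    proof safe
      fix t p assume "t \<in> {-\<delta><..<\<delta>}" "p \<in> P"
      from loc[OF this] obtain d r where dr: "t \<in> {-d<..<d}" "0 < r" "continuous_on ({-d..d} \<times> ball p r) z" by blast
      have "continuous_on ({-d<..<d} \<times> ball p r) z" by (rule continuous_on_subset[OF dr(3)]) auto
      moreover have "open ({-d<..<d} \<times> ball p r)" by (intro open_Times) auto
      ultimately show "isCont z (t, p)" using dr by (simp add: continuous_on_eq_continuous_at)
    qed
    fix p assume p: "p \<in> P"
    show "z (0, p) = y0' p v" if "0 < \<delta>"
    proof -
      have "0 \<in> {-\<delta><..<\<delta>}" using that by simp
      from loc[OF this p] obtain d r where "0 < d" "0 < r" "\<forall>t\<in>{-d..d}. \<forall>q\<in>ball p r. Q d t q" by blast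
      then have "Q d 0 p" by simp
      then show ?thesis by (simp add: Q_def)
    qed
    fix t assume t: "t \<in> {-\<delta><..<\<delta>}"
    from loc[OF t p] obtain d r where dr: "t \<in> {-d<..<d}" "0 < r" "\<forall>t\<in>{-d..d}. \<forall>q\<in>ball p r. Q d t q" by blast
    then have "Q d t p" by simp
    then have A: "((\<lambda>h. y (t, p + h *\<^sub>R v)) has_vector_derivative z (t, p)) (at 0)"
       "((\<lambda>t. z (t, p)) has_vector_derivative f' (t, p, y (t, p)) (0, v, z (t, p))) (at t within {-d..d})"
      by (auto simp: Q_def)
    show "((\<lambda>h. y (t, p + h *\<^sub>R v)) has_vector_derivative z (t, p)) (at 0)" by (rule A)
    have "t \<in> interior {-d..d}" using dr by simp
    then show "((\<lambda>t. z (t, p)) has_vector_derivative f' (t, p, y (t, p)) (0, v, z (t, p))) (at t)"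
      using A(2) at_within_interior[of t "{-d..d}"] by simp
  qed
qed

text \<open>For a solution of a differential equation the time derivative is known from the equation
  and the parameter derivatives from the linearized one. This is the step that turns their
  regularity into one more order for the solution.\<close>

lemma Ck_on_Suc_partialsI:
  fixes y :: "real \<times> 'p::euclidean_space \<Rightarrow> 'e::euclidean_space"
  assumes P: "open P"
    and yt: "\<And>t p. t \<in> {-\<delta><..<\<delta>} \<Longrightarrow> p \<in> P \<Longrightarrow> ((\<lambda>t. y (t, p)) has_vector_derivative yt (t, p)) (at t)"
      "Ck_on k ({-\<delta><..<\<delta>} \<times> P) yt"
    and z: "\<And>v t p. v \<in> Basis \<Longrightarrow> t \<in> {-\<delta><..<\<delta>} \<Longrightarrow> p \<in> P \<Longrightarrow>
        ((\<lambda>h. y (t, p + h *\<^sub>R v)) has_vector_derivative z v (t, p)) (at 0)"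
      "\<And>v. v \<in> Basis \<Longrightarrow> Ck_on k ({-\<delta><..<\<delta>} \<times> P) (z v)"
  shows "Ck_on (Suc k) ({-\<delta><..<\<delta>} \<times> P) y"
proof -
  let ?W = "{-\<delta><..<\<delta>} \<times> P"
  have W: "open ?W" by (intro open_Times P open_greaterThanLessThan)
  \<comment> \<open>A basis vector of the product is (1, 0) or (0, v) with v \<noteq> 0, so the
    second component tells the time direction from the parameter directions.\<close>
  define g where "g i = (if snd i = 0 then yt else z (snd i))" for i :: "real \<times> 'p"
  have gC: "Ck_on k ?W (g i)" if "i \<in> Basis" for i
    using that yt(2) z(2) by (auto simp: g_def Basis_prod_def)
  have D: "((\<lambda>h. y (w + h *\<^sub>R i)) has_vector_derivative g i w) (at 0)" if i: "i \<in> Basis" and w: "w \<in> ?W" for i w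
  proof -
    obtain t p where tp: "w = (t, p)" "t \<in> {-\<delta><..<\<delta>}" "p \<in> P" using w by blast
    consider "i = (1, 0)" | v where "v \<in> Basis" "i = (0, v)" using i by (auto simp: Basis_prod_def)
    then show ?thesis
    proof cases
      case 1
      have "((\<lambda>h. y (0 + h *\<^sub>R 1, p)) has_vector_derivative yt (t, p)) (at t)" using yt(1)[OF tp(2,3)] by simp
      from has_vector_derivative_line[of "\<lambda>s. y (s, p)" 0 t 1 "yt (t, p)", THEN iffD2, OF this]
      show ?thesis by (simp add: tp g_def 1)
    next
      case 2
      then have "v \<noteq> 0" by auto
      then show ?thesis using 2 z(1)[OF 2(1) tp(2,3)] by (simp add: tp g_def)
    qed
  qed
  show ?thesis
  proof (rule Ck_on_SucI[OF thick_open[OF W], where f'="\<lambda>x v. \<Sum>i\<in>Basis. (v \<bullet> i) *\<^sub>R g i x"])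
    fix x assume "x \<in> ?W"
    from partials_imp_has_derivative[OF W this D Ck_on_imp_continuous_on[OF gC]]
    show "(y has_derivative (\<lambda>v. \<Sum>i\<in>Basis. (v \<bullet> i) *\<^sub>R g i x)) (at x within ?W)"
      by (rule has_derivative_at_withinI)
  next
    show "Ck_on k ?W (\<lambda>x. \<Sum>i\<in>Basis. (v \<bullet> i) *\<^sub>R g i x)" for v
      by (rule Ck_on_sum[OF thick_open[OF W]], rule Ck_on_scaleR[OF thick_open[OF W] Ck_on_const[OF thick_open[OF W]] gC])
  qed
qed

text \<open>The linear case is treated first because the partial derivatives of a solution solve a linear
  equation with the same \<open>B\<close> on the same space, so that induction on \<open>k\<close> is possible.\<close>

lemma linear_ode_Ck:
  fixes y :: "real \<times> 'p::euclidean_space \<Rightarrow> 'e::euclidean_space"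
  assumes \<delta>: "\<delta> > 0" and P: "open P"
    and B: "\<And>w. w \<in> {-\<delta><..<\<delta>} \<times> P \<Longrightarrow> linear (B w)" "\<And>w x. w \<in> {-\<delta><..<\<delta>} \<times> P \<Longrightarrow> norm (B w x) \<le> L * norm x"
    and L: "L \<ge> 0" "L * (4 * \<delta>) \<le> 1/2"
    and BC: "\<And>x. Ck_on k ({-\<delta><..<\<delta>} \<times> P) (\<lambda>w. B w x)"
    and bC: "Ck_on k ({-\<delta><..<\<delta>} \<times> P) b" and y0: "Ck_on k P (\<lambda>p. y (0, p))"
    and y: "continuous_on ({-\<delta><..<\<delta>} \<times> P) y"
      "\<And>t p. t \<in> {-\<delta><..<\<delta>} \<Longrightarrow> p \<in> P \<Longrightarrow> ((\<lambda>t. y (t, p)) has_vector_derivative B (t, p) (y (t, p)) + b (t, p)) (at t)"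
  shows "Ck_on k ({-\<delta><..<\<delta>} \<times> P) y"
  using BC bC y0 y
proof (induction k arbitrary: b y)
  case 0
  then show ?case by simp
next
  case (Suc k)
  note BC = Suc.prems(1) and bC = Suc.prems(2) and y0 = Suc.prems(3) and y = Suc.prems(4,5)
  let ?W = "{-\<delta><..<\<delta>} \<times> P"
  have W: "open ?W" by (intro open_Times P open_greaterThanLessThan)
  note tW = thick_open[OF W]
  have yk: "Ck_on k ?W y"
    by (rule Suc.IH[OF _ _ _ y]) (use BC bC y0 Ck_on_Suc_imp in blast)+
  define DB where "DB i w = frechet_derivative (\<lambda>w. B w i) (at w)" for i w
  define Db where "Db w = frechet_derivative b (at w)" for w
  have DB: "((\<lambda>w. B w i) has_derivative DB i w) (at w)" if "w \<in> ?W" for i w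
    unfolding DB_def by (rule Ck_on_Suc_open_D[OF W BC that])
  have Db: "(b has_derivative Db w) (at w)" if "w \<in> ?W" for w
    unfolding Db_def by (rule Ck_on_Suc_open_D[OF W bC that])
  have DBk: "Ck_on k ?W (\<lambda>w. DB i w v)" for i v
    unfolding DB_def by (rule Ck_on_frechet_comp[OF W tW _ BC Ck_on_ident[OF tW] Ck_on_const[OF tW]]) auto
  have Dbk: "Ck_on k ?W (\<lambda>w. Db w v)" for v
    unfolding Db_def by (rule Ck_on_frechet_comp[OF W tW _ bC Ck_on_ident[OF tW] Ck_on_const[OF tW]]) auto
  define pr :: "real \<times> 'p \<times> 'e \<Rightarrow> real \<times> 'p" where "pr w = (fst w, fst (snd w))" for w
  have pr: "bounded_linear pr" unfolding pr_def
    by (intro bounded_linear_Pair bounded_linear_fst bounded_linear_compose[OF bounded_linear_fst bounded_linear_snd])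
  \<comment> \<open>The equation is fed into the general differentiation result with f(t, p, x) =
    B(t, p) x + b(t, p). In the direction of x the derivative of f is B, so the same
    \<open>L\<close> serves.\<close>
  define f where "f w = B (pr w) (snd (snd w)) + b (pr w)" for w
  define f' where "f' w d = (\<Sum>i\<in>Basis. (snd (snd w) \<bullet> i) *\<^sub>R DB i (pr w) (pr d)) + B (pr w) (snd (snd d)) + Db (pr w) (pr d)" for w d
  let ?\<Omega> = "{-\<delta><..<\<delta>} \<times> P \<times> (UNIV :: 'e set)"
  have \<Omega>: "open ?\<Omega>" by (intro open_Times P) auto
  have prW: "pr w \<in> ?W" if "w \<in> ?\<Omega>" for w using that by (auto simp: pr_def)
  have fD: "(f has_derivative f' w) (at w)" if w: "w \<in> ?\<Omega>" for w
  proof -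
    have s: "((\<lambda>w. snd (snd w) \<bullet> i) has_derivative (\<lambda>d. snd (snd d) \<bullet> i)) (at w)" for i :: 'e
      by (intro bounded_linear_imp_has_derivative bounded_linear_compose[OF bounded_linear_inner_left]
          bounded_linear_compose[OF bounded_linear_snd] bounded_linear_snd)
    have p: "(pr has_derivative pr) (at w)" by (rule bounded_linear_imp_has_derivative[OF pr])
    have "((\<lambda>w. (\<Sum>i\<in>Basis. (snd (snd w) \<bullet> i) *\<^sub>R B (pr w) i) + b (pr w)) has_derivative
       (\<lambda>d. (\<Sum>i\<in>Basis. (snd (snd w) \<bullet> i) *\<^sub>R DB i (pr w) (pr d) + (snd (snd d) \<bullet> i) *\<^sub>R B (pr w) i) + Db (pr w) (pr d))) (at w)"
      by (intro has_derivative_add has_derivative_sum has_derivative_scaleR s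
         has_derivative_compose[OF p DB[OF prW[OF w]]] has_derivative_compose[OF p Db[OF prW[OF w]]])
    also have "(\<lambda>d. (\<Sum>i\<in>Basis. (snd (snd w) \<bullet> i) *\<^sub>R DB i (pr w) (pr d) + (snd (snd d) \<bullet> i) *\<^sub>R B (pr w) i) + Db (pr w) (pr d)) = f' w"
      unfolding f'_def by (rule ext) (simp add: sum.distrib linear_expand[OF B(1)[OF prW[OF w]], symmetric])
    finally show ?thesis
      by (rule has_derivative_transform_within_open[OF _ \<Omega> w])
        (simp add: f_def linear_expand[OF B(1)[OF prW], symmetric])
  qed
  have prc: "continuous_on S pr" for S using linear_continuous_on[OF pr] by blast
  have f'c: "continuous_on ?\<Omega> (\<lambda>w. f' w v)" for v
  proof -
    have c: "continuous_on ?\<Omega> (\<lambda>w. h (pr w))" if "continuous_on ?W h" for h :: "real \<times> 'p \<Rightarrow> 'e"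
      by (rule continuous_on_compose2[OF that prc]) (use prW in blast)
    show ?thesis unfolding f'_def
      by (intro continuous_intros c Ck_on_imp_continuous_on[OF DBk] Ck_on_imp_continuous_on[OF Dbk] Ck_on_imp_continuous_on[OF BC])
  qed
  have f'L: "norm (f' w (0, 0, x)) \<le> L * norm x" if "w \<in> ?\<Omega>" for w x
  proof -
    have "linear (DB i (pr w))" "linear (Db (pr w))" for i
      using DB[OF prW[OF that]] Db[OF prW[OF that]] has_derivative_linear by blast+
    then have "f' w (0, 0, x) = B (pr w) x"
      by (simp add: f'_def pr_def linear_0 flip: zero_prod_def)
    then show ?thesis using B(2)[OF prW[OF that]] by simp
  qed
  have yf: "((\<lambda>t. y (t, p)) has_vector_derivative f (t, p, y (t, p))) (at t)" if "t \<in> {-\<delta><..<\<delta>}" "p \<in> P" for t p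
    using y(2)[OF that] by (simp add: f_def pr_def)
  have y0D: "((\<lambda>p. y (0, p)) has_derivative frechet_derivative (\<lambda>p. y (0, p)) (at p)) (at p)" if "p \<in> P" for p
    by (rule Ck_on_Suc_open_D[OF P y0 that])
  have y0k: "Ck_on k P (\<lambda>p. frechet_derivative (\<lambda>p. y (0, p)) (at p) v)" for v
    by (rule Ck_on_frechet_comp[OF P thick_open[OF P] _ y0]) (auto intro: Ck_on_ident Ck_on_const thick_open[OF P])
  have "\<exists>z. Ck_on k ?W z \<and> (\<forall>t\<in>{-\<delta><..<\<delta>}. \<forall>p\<in>P. ((\<lambda>h. y (t, p + h *\<^sub>R v)) has_vector_derivative z (t, p)) (at 0))" for v
  proof -
    obtain z where z: "continuous_on ?W z"
      "\<And>t p. t \<in> {-\<delta><..<\<delta>} \<Longrightarrow> p \<in> P \<Longrightarrow> ((\<lambda>h. y (t, p + h *\<^sub>R v)) has_vector_derivative z (t, p)) (at 0)"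
      "\<And>t p. t \<in> {-\<delta><..<\<delta>} \<Longrightarrow> p \<in> P \<Longrightarrow>
         ((\<lambda>t. z (t, p)) has_vector_derivative f' (t, p, y (t, p)) (0, v, z (t, p))) (at t)"
      "\<And>p. 0 < \<delta> \<Longrightarrow> p \<in> P \<Longrightarrow> z (0, p) = frechet_derivative (\<lambda>p. y (0, p)) (at p) v"
      using ode_param_derivative[OF P open_UNIV fD f'c f'L L y(1) _ yf y0D Ck_on_imp_continuous_on[OF y0k], of v] by blast
    \<comment> \<open>Differentiating the equation in direction v gives z' = B z + b'. The
      derivative of B acts on y, so b' is only as regular as y; that y is C^k is \<open>yk\<close>,
      the induction hypothesis applied to y itself.\<close>
    define b' where "b' w = (\<Sum>i\<in>Basis. (y w \<bullet> i) *\<^sub>R DB i w (0, v)) + Db w (0, v)" for w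
    have "Ck_on k ?W z"
    proof (rule Suc.IH[where b=b'])
      show "Ck_on k ?W (\<lambda>w. B w x)" for x using BC Ck_on_Suc_imp by blast
      show "Ck_on k ?W b'" unfolding b'_def
        by (intro Ck_on_add Ck_on_sum Ck_on_scaleR Ck_on_inner_left tW yk DBk Dbk)
      show "Ck_on k P (\<lambda>p. z (0, p))"
        by (rule Ck_on_cong[THEN iffD1, OF _ y0k[of v]]) (simp add: z(4)[OF \<delta>])
      show "((\<lambda>t. z (t, p)) has_vector_derivative B (t, p) (z (t, p)) + b' (t, p)) (at t)"
        if "t \<in> {-\<delta><..<\<delta>}" "p \<in> P" for t p
        using z(3)[OF that] by (simp add: f'_def b'_def pr_def algebra_simps)
    qed (rule z(1))
    then show ?thesis using z(2) by blast
  qed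
  then obtain z where z: "\<And>v. Ck_on k ?W (z v)"
    "\<And>v t p. t \<in> {-\<delta><..<\<delta>} \<Longrightarrow> p \<in> P \<Longrightarrow> ((\<lambda>h. y (t, p + h *\<^sub>R v)) has_vector_derivative z v (t, p)) (at 0)"
    by metis
  show ?case
  proof (rule Ck_on_Suc_partialsI[where yt="\<lambda>w. B w (y w) + b w" and z=z, OF P y(2) _ z(2) z(1)])
    have "Ck_on k ?W (\<lambda>w. B w (y w))"
      by (rule Ck_on_linear_apply[OF tW B(1) _ yk]) (use BC Ck_on_Suc_imp in blast)+
    then show "Ck_on k ?W (\<lambda>w. B w (y w) + b w)" using Ck_on_add[OF tW] Ck_on_Suc_imp[OF bC] by blast
  qed auto
qed

text \<open>Compactness of a closed ball bounds the derivative in each basis direction, and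
  convexity turns this into a Lipschitz bound. Both are recorded with one \<open>L\<close>: the
  derivative bound serves linearized equations, the Lipschitz bound existence and
  uniqueness.\<close>

lemma C1_locally_lipschitz:
  fixes F :: "'a::euclidean_space \<Rightarrow> 'b::euclidean_space"
  assumes U: "open U" and F: "Ck_on (Suc 0) U F" and z0: "z0 \<in> U"
  obtains R L where "R > 0" "L \<ge> 0" "cball z0 R \<subseteq> U"
    "\<And>x w. x \<in> cball z0 R \<Longrightarrow> norm (frechet_derivative F (at x) w) \<le> L * norm w"
    "\<And>x y. x \<in> cball z0 R \<Longrightarrow> y \<in> cball z0 R \<Longrightarrow> norm (F x - F y) \<le> L * norm (x - y)"
proof -
  obtain R where R: "R > 0" "cball z0 R \<subseteq> U" using U z0 open_contains_cball by blast
  let ?D = "\<lambda>x. frechet_derivative F (at x)"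
  have D: "(F has_derivative ?D x) (at x)" if "x \<in> U" for x by (rule Ck_on_Suc_open_D[OF U F that])
  have "continuous_on U (\<lambda>x. ?D x i)" for i
    using Ck_on_frechet_comp[OF U thick_open[OF U] _ F Ck_on_ident[OF thick_open[OF U]] Ck_on_const[OF thick_open[OF U]], of i]
    by simp
  then have "bounded ((\<lambda>x. ?D x i) ` cball z0 R)" for i
    using R by (intro compact_imp_bounded compact_continuous_image) (auto intro: continuous_on_subset)
  then have "\<exists>B. \<forall>x\<in>cball z0 R. norm (?D x i) \<le> B" for i unfolding bounded_iff by blast
  then obtain B where B: "\<And>i x. x \<in> cball z0 R \<Longrightarrow> norm (?D x i) \<le> B i" by metis
  define L where "L = (\<Sum>i\<in>Basis. B i)"
  have z0R: "z0 \<in> cball z0 R" using R by simp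
  have B0: "B i \<ge> 0" for i using B[OF z0R, of i] norm_ge_zero order_trans by blast
  have L0: "L \<ge> 0" unfolding L_def by (intro sum_nonneg B0)
  have b: "norm (?D x w) \<le> L * norm w" if "x \<in> cball z0 R" for x w
  proof -
    have "linear (?D x)" using D that R has_derivative_linear by blast
    then have "norm (?D x w) = norm (\<Sum>i\<in>Basis. (w \<bullet> i) *\<^sub>R ?D x i)" by (subst linear_expand[of "?D x" w]) auto
    also have "\<dots> \<le> (\<Sum>i\<in>Basis. norm w * B i)"
      by (intro sum_norm_le) (auto intro!: mult_mono Basis_le_norm B that B0)
    also have "\<dots> = L * norm w" by (simp add: L_def sum_distrib_left mult.commute)
    finally show ?thesis .
  qed
  show thesis
  proof
    show "norm (F x - F y) \<le> L * norm (x - y)" if "x \<in> cball z0 R" "y \<in> cball z0 R" for x y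
    proof (rule differentiable_bound[of "cball z0 R" F ?D])
      show "(F has_derivative ?D x) (at x within cball z0 R)" if "x \<in> cball z0 R" for x
        using D that R has_derivative_at_withinI by blast
      show "onorm (?D x) \<le> L" if "x \<in> cball z0 R" for x
        by (rule onorm_bound[OF L0 b[OF that]])
    qed (use that in auto)
  qed (use R L0 b in auto)
qed

text \<open>Bootstrapping: if y is C^k, so are the coefficients DF(y) of the linearized equation,
  hence the parameter derivatives by \<open>linear_ode_Ck\<close>, and so is the time derivative
  F(y); thus y is C^{k+1}. The time interval does not shrink with the order, because all orders use
  the same \<open>L\<close>.\<close>

lemma ode_flow_Ck:
  fixes F :: "'e::euclidean_space \<Rightarrow> 'e" and y :: "real \<times> 'p::euclidean_space \<Rightarrow> 'e"
  assumes \<delta>: "\<delta> > 0" and P: "open P" and U: "open U" and F: "\<And>k. Ck_on k U F" and X: "open X" "X \<subseteq> U"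
    and Lip: "\<And>x w. x \<in> X \<Longrightarrow> norm (frechet_derivative F (at x) w) \<le> L * norm w"
    and L: "L \<ge> 0" "L * (4 * \<delta>) \<le> 1/2"
    and y: "continuous_on ({-\<delta><..<\<delta>} \<times> P) y" "\<And>w. w \<in> {-\<delta><..<\<delta>} \<times> P \<Longrightarrow> y w \<in> X"
      "\<And>t p. t \<in> {-\<delta><..<\<delta>} \<Longrightarrow> p \<in> P \<Longrightarrow> ((\<lambda>t. y (t, p)) has_vector_derivative F (y (t, p))) (at t)"
    and y0: "\<And>k. Ck_on k P (\<lambda>p. y (0, p))"
  shows "Ck_on k ({-\<delta><..<\<delta>} \<times> P) y"
proof (induction k)
  case 0
  then show ?case using y(1) by simp
next
  case (Suc k)
  let ?W = "{-\<delta><..<\<delta>} \<times> P"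
  have W: "open ?W" by (intro open_Times P open_greaterThanLessThan)
  note tW = thick_open[OF W] and tP = thick_open[OF P]
  let ?D = "\<lambda>x. frechet_derivative F (at x)"
  have DF: "(F has_derivative ?D x) (at x)" if "x \<in> U" for x by (rule Ck_on_Suc_open_D[OF U F that])
  have DFc: "continuous_on U (\<lambda>x. ?D x i)" for i
    using Ck_on_frechet_comp[OF U thick_open[OF U] _ F Ck_on_ident[OF thick_open[OF U]] Ck_on_const[OF thick_open[OF U]], of 0 i]
    by simp
  define f where "f w = F (snd (snd w))" for w :: "real \<times> 'p \<times> 'e"
  define f' where "f' w d = ?D (snd (snd w)) (snd (snd d))" for w d :: "real \<times> 'p \<times> 'e"
  have lin: "bounded_linear (\<lambda>w :: real \<times> 'p \<times> 'e. snd (snd w))"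
    by (rule bounded_linear_compose[OF bounded_linear_snd bounded_linear_snd])
  have fD: "(f has_derivative f' w) (at w)" if w: "w \<in> {-\<delta><..<\<delta>} \<times> P \<times> X" for w
  proof -
    have "snd (snd w) \<in> U" using w X by auto
    from has_derivative_compose[OF bounded_linear_imp_has_derivative[OF lin] DF[OF this]]
    show ?thesis unfolding f_def[abs_def] f'_def[abs_def] .
  qed
  have fC: "continuous_on ({-\<delta><..<\<delta>} \<times> P \<times> X) (\<lambda>w. f' w v)" for v
    unfolding f'_def by (rule continuous_on_compose2[OF DFc]) (use X in \<open>auto intro!: continuous_intros\<close>)
  have fL: "norm (f' w (0, 0, x)) \<le> L * norm x" if w: "w \<in> {-\<delta><..<\<delta>} \<times> P \<times> X" for w x
    unfolding f'_def using w by (auto intro!: Lip)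
  have yf: "((\<lambda>t. y (t, p)) has_vector_derivative f (t, p, y (t, p))) (at t)" if "t \<in> {-\<delta><..<\<delta>}" "p \<in> P" for t p
    using y(3)[OF that] by (simp add: f_def)
  have y0D: "((\<lambda>p. y (0, p)) has_derivative frechet_derivative (\<lambda>p. y (0, p)) (at p)) (at p)" if "p \<in> P" for p
    by (rule Ck_on_Suc_open_D[OF P y0 that])
  have y0k: "Ck_on k P (\<lambda>p. frechet_derivative (\<lambda>p. y (0, p)) (at p) v)" for k v
    by (rule Ck_on_frechet_comp[OF P tP _ y0 Ck_on_ident[OF tP] Ck_on_const[OF tP]]) auto
  have sub: "y ` ?W \<subseteq> U" using y(2) X by blast
  have "\<exists>z. Ck_on k ?W z \<and> (\<forall>t\<in>{-\<delta><..<\<delta>}. \<forall>p\<in>P. ((\<lambda>h. y (t, p + h *\<^sub>R v)) has_vector_derivative z (t, p)) (at 0))" for v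
  proof -
    obtain z where z: "continuous_on ?W z"
      "\<And>t p. t \<in> {-\<delta><..<\<delta>} \<Longrightarrow> p \<in> P \<Longrightarrow> ((\<lambda>h. y (t, p + h *\<^sub>R v)) has_vector_derivative z (t, p)) (at 0)"
      "\<And>t p. t \<in> {-\<delta><..<\<delta>} \<Longrightarrow> p \<in> P \<Longrightarrow>
         ((\<lambda>t. z (t, p)) has_vector_derivative f' (t, p, y (t, p)) (0, v, z (t, p))) (at t)"
      "\<And>p. 0 < \<delta> \<Longrightarrow> p \<in> P \<Longrightarrow> z (0, p) = frechet_derivative (\<lambda>p. y (0, p)) (at p) v"
      using ode_param_derivative[OF P X(1) fD fC fL L y(1,2) yf y0D Ck_on_imp_continuous_on[OF y0k], of v] by blast
    have "Ck_on k ?W z"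
    proof (rule linear_ode_Ck[where B="\<lambda>w. ?D (y w)" and b="\<lambda>_. 0" and L=L, OF \<delta> P])
      show "linear (?D (y w))" if "w \<in> ?W" for w
        using DF[of "y w"] sub that has_derivative_linear by blast
      show "norm (?D (y w) x) \<le> L * norm x" if "w \<in> ?W" for w x by (rule Lip[OF y(2)[OF that]])
      show "Ck_on k ?W (\<lambda>w. ?D (y w) x)" for x
        by (rule Ck_on_frechet_comp[OF U tW sub F Suc.IH Ck_on_const[OF tW]])
      show "Ck_on k P (\<lambda>p. z (0, p))"
        by (rule Ck_on_cong[THEN iffD1, OF _ y0k[of k v]]) (simp add: z(4)[OF \<delta>])
      show "((\<lambda>t. z (t, p)) has_vector_derivative ?D (y (t, p)) (z (t, p)) + 0) (at t)"
        if "t \<in> {-\<delta><..<\<delta>}" "p \<in> P" for t p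
        using z(3)[OF that] by (simp add: f'_def)
    qed (use L z(1) Ck_on_const[OF tW] in auto)
    then show ?thesis using z(2) by blast
  qed
  then obtain z where z: "\<And>v. Ck_on k ?W (z v)"
    "\<And>v t p. t \<in> {-\<delta><..<\<delta>} \<Longrightarrow> p \<in> P \<Longrightarrow> ((\<lambda>h. y (t, p + h *\<^sub>R v)) has_vector_derivative z v (t, p)) (at 0)"
    by metis
  show ?case
    by (rule Ck_on_Suc_partialsI[where yt="\<lambda>w. F (y w)" and z=z, OF P y(3) Ck_on_compose[OF tW thick_open[OF U] sub F Suc.IH] z(2) z(1)])
qed

text \<open>Picard iteration wants a Lipschitz right hand side on the whole space, so F is
  precomposed with the closest-point projection onto a ball. Start points lie in the half ball and
  \<delta> is so small that solutions move by at most R/2; along them the projection is the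
  identity, and they solve the original equation.\<close>

lemma flow_box:
  fixes F :: "'e::euclidean_space \<Rightarrow> 'e"
  assumes U: "open U" and F: "\<And>k. Ck_on k U F" and z0: "z0 \<in> U"
  obtains \<delta> r Z where "\<delta> > 0" "r > 0" "ball z0 r \<subseteq> U" "\<And>k. Ck_on k ({-\<delta><..<\<delta>} \<times> ball z0 r) Z"
    "\<And>w. w \<in> {-\<delta><..<\<delta>} \<times> ball z0 r \<Longrightarrow> Z w \<in> U" "\<And>p. p \<in> ball z0 r \<Longrightarrow> Z (0, p) = p"
    "\<And>t p. t \<in> {-\<delta><..<\<delta>} \<Longrightarrow> p \<in> ball z0 r \<Longrightarrow> ((\<lambda>t. Z (t, p)) has_vector_derivative F (Z (t, p))) (at t)"
proof -
  obtain R L where R: "R > 0" "L \<ge> 0" "cball z0 R \<subseteq> U"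
    and b: "\<And>x w. x \<in> cball z0 R \<Longrightarrow> norm (frechet_derivative F (at x) w) \<le> L * norm w"
    and lip: "\<And>x y. x \<in> cball z0 R \<Longrightarrow> y \<in> cball z0 R \<Longrightarrow> norm (F x - F y) \<le> L * norm (x - y)"
    using C1_locally_lipschitz[OF U F z0] by blast
  let ?K = "cball z0 R"
  have Fc: "continuous_on ?K F" using Ck_on_imp_continuous_on[OF F] R continuous_on_subset by blast
  then have "bounded (F ` ?K)" by (intro compact_imp_bounded compact_continuous_image) auto
  then obtain M where M: "\<And>x. x \<in> ?K \<Longrightarrow> norm (F x) \<le> M" unfolding bounded_iff by blast
  have M0: "M \<ge> 0" using M[of z0] R norm_ge_zero[of "F z0"] by (meson centre_in_cball less_imp_le order_trans)
  \<comment> \<open>The first term yields \<open>L * (4 * \<delta>) \<le> 1/2\<close>, as the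
    differentiation theorem demands, the second \<open>4 * \<delta> * M \<le> R / 2\<close>, the
    bound on the displacement. Adding 1 avoids division by zero.\<close>
  define \<delta> where "\<delta> = min (1 / (8 * (L + 1))) (R / (8 * (M + 1)))"
  have \<delta>0: "\<delta> > 0" using R M0 by (auto simp: \<delta>_def)
  have L\<delta>: "L * (4 * \<delta>) \<le> 1/2"
  proof -
    have "L * (4 * \<delta>) \<le> (L + 1) * (4 * (1 / (8 * (L + 1))))" using R \<delta>0 by (intro mult_mono) (auto simp: \<delta>_def)
    moreover have "c * (4 * (1 / (8 * c))) = 1 / 2" if "c > 0" for c :: real using that by simp
    ultimately show ?thesis using R by (metis add_nonneg_pos zero_less_one)
  qed
  have L\<delta>': "L * \<delta> \<le> 1/2" using L\<delta> R \<delta>0 mult_nonneg_nonneg[of L \<delta>] by linarith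
  have M\<delta>: "4 * \<delta> * M \<le> R / 2"
  proof -
    have "4 * \<delta> * M \<le> 4 * (R / (8 * (M + 1))) * (M + 1)" using R M0 \<delta>0 by (intro mult_mono) (auto simp: \<delta>_def)
    moreover have "4 * (R / (8 * c)) * c = R / 2" if "c > 0" for c :: real using that by simp
    ultimately show ?thesis using M0 by (metis add_nonneg_pos zero_less_one)
  qed
  define C where "C = cball z0 (R/2)"
  have C: "compact C" "convex C" "C \<noteq> {}" using R by (auto simp: C_def)
  have K: "closed ?K" "?K \<noteq> {}" "convex ?K" using R by auto
  define \<pi> where "\<pi> = closest_point ?K"
  have \<pi>K: "\<pi> x \<in> ?K" for x unfolding \<pi>_def by (rule closest_point_in_set[OF K(1,2)])
  define g where "g = (\<lambda>(t::real, p, x). F (\<pi> (p + x)))"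
  have \<pi>c: "continuous_on S \<pi>" for S unfolding \<pi>_def by (rule continuous_on_closest_point[OF K(3,1,2)])
  have "continuous_on ({-\<delta>..\<delta>} \<times> C \<times> UNIV) g"
    unfolding g_def split_beta
    by (rule continuous_on_compose2[OF Fc]) (use \<pi>K in \<open>auto intro!: continuous_intros continuous_on_compose2[OF \<pi>c[of UNIV]]\<close>)
  moreover have "norm (g (t, p, x) - g (t, p, y)) \<le> L * norm (x - y)" for t p x y
  proof -
    have "norm (g (t, p, x) - g (t, p, y)) \<le> L * norm (\<pi> (p + x) - \<pi> (p + y))"
      unfolding g_def using lip[OF \<pi>K \<pi>K] by simp
    also have "\<dots> \<le> L * norm ((p + x) - (p + y))"
      using closest_point_lipschitz[OF K(3,1,2), of "p + x" "p + y"] R by (intro mult_left_mono) (auto simp: \<pi>_def dist_norm)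
    finally show ?thesis by simp
  qed
  ultimately obtain u where u: "continuous_on ({-\<delta>..\<delta>} \<times> C) u" "\<And>p. p \<in> C \<Longrightarrow> u (0, p) = 0"
    "\<And>t p. t \<in> {-\<delta>..\<delta>} \<Longrightarrow> p \<in> C \<Longrightarrow> ((\<lambda>t. u (t, p)) has_vector_derivative g (t, p, u (t, p))) (at t within {-\<delta>..\<delta>})"
    using parametric_picard[OF C \<delta>0 _ _ R(2) L\<delta>', of g] by blast
  have ub: "norm (u (t, p)) \<le> R / 2" if t: "t \<in> {-\<delta>..\<delta>}" and p: "p \<in> C" for t p
  proof -
    \<comment> \<open>The right hand side is bounded by \<open>M\<close> outright, so the estimate
      is used with Lipschitz constant 0.\<close>
    have "norm (u (t, p)) \<le> 2 * (norm (u (0, p)) + (\<delta> - - \<delta>) * M)"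
    proof (rule ode_small_interval_bound[where L=0, OF _ u(3)[OF _ p] _ _ _ M0 t])
      show "norm (g (s, p, u (s, p))) \<le> 0 * norm (u (s, p)) + M" for s
        using M[OF \<pi>K] by (simp add: g_def)
    qed (use \<delta>0 in auto)
    then show ?thesis using u(2)[OF p] M\<delta> by simp
  qed
  define P where "P = ball z0 (R/2)"
  have PC: "P \<subseteq> C" by (auto simp: P_def C_def)
  define Z where "Z w = snd w + u w" for w
  let ?W = "{-\<delta><..<\<delta>} \<times> P"
  have ZX: "Z w \<in> ball z0 R" if w: "w \<in> ?W" for w
  proof -
    have "norm (u w) \<le> R / 2" using ub[of "fst w" "snd w"] w PC by auto
    moreover have "dist z0 (snd w) < R / 2" using w by (auto simp: P_def)
    moreover have "dist z0 (Z w) \<le> dist z0 (snd w) + dist (snd w) (Z w)" by (rule dist_triangle)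
    moreover have "dist (snd w) (Z w) = norm (u w)" by (simp add: Z_def dist_norm)
    ultimately show ?thesis by simp
  qed
  have Z': "((\<lambda>t. Z (t, p)) has_vector_derivative F (Z (t, p))) (at t)" if t: "t \<in> {-\<delta><..<\<delta>}" and p: "p \<in> P" for t p
  proof -
    have "(t, p) \<in> ?W" using t p by blast
    then have zk: "Z (t, p) \<in> ?K" using ZX by (meson ball_subset_cball subsetD)
    have "\<pi> (Z (t, p)) = Z (t, p)" unfolding \<pi>_def by (rule closest_point_self[OF zk])
    then have "g (t, p, u (t, p)) = F (Z (t, p))" by (simp add: g_def Z_def)
    moreover have "t \<in> {-\<delta>..\<delta>}" "t \<in> interior {-\<delta>..\<delta>}" using t by auto
    ultimately have "((\<lambda>t. u (t, p)) has_vector_derivative F (Z (t, p))) (at t)"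
      using u(3)[of t p] p PC at_within_interior[of t "{-\<delta>..\<delta>}"] by auto
    then show ?thesis unfolding Z_def by (auto intro!: derivative_eq_intros)
  qed
  have Zc: "continuous_on ?W Z" unfolding Z_def
    by (intro continuous_intros continuous_on_subset[OF u(1)]) (use PC in auto)
  have Z0: "Z (0, p) = p" if "p \<in> P" for p using u(2)[of p] that PC by (auto simp: Z_def)
  have P: "open P" by (simp add: P_def)
  have XU: "ball z0 R \<subseteq> U" using R(3) by (meson ball_subset_cball order_trans)
  show thesis
  proof
    show "\<delta> > 0" "R/2 > 0" using \<delta>0 R by auto
    show "ball z0 (R/2) \<subseteq> U" using R(1,3) by auto
    show "Ck_on k ({-\<delta><..<\<delta>} \<times> ball z0 (R/2)) Z" for k
      unfolding P_def[symmetric]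
    proof (rule ode_flow_Ck[OF \<delta>0 P U F open_ball XU _ R(2) L\<delta> Zc ZX Z'])
      show "Ck_on k P (\<lambda>p. Z (0, p))" for k
        by (rule Ck_on_cong[THEN iffD1, OF _ Ck_on_ident[OF thick_open[OF P]]]) (simp add: Z0)
      show "norm (frechet_derivative F (at x) w) \<le> L * norm w" if "x \<in> ball z0 R" for x w
        using b[of x w] that by auto
    qed
    show "Z w \<in> U" if "w \<in> {-\<delta><..<\<delta>} \<times> ball z0 (R/2)" for w
      using ZX[of w] that XU unfolding P_def by blast
  qed (use Z0 Z' in \<open>auto simp: P_def\<close>)
qed

section \<open>Uniqueness of solutions\<close>

lemma ode_unique_lipschitz:
  fixes F :: "'e::real_normed_vector \<Rightarrow> 'e"
  assumes lip: "\<And>x y. x \<in> K \<Longrightarrow> y \<in> K \<Longrightarrow> norm (F x - F y) \<le> L * norm (x - y)"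
    and L: "L \<ge> 0" "L * (b - a) \<le> 1/2" and t0: "t0 \<in> {a..b}" "x1 t0 = x2 t0"
    and x1: "\<And>t. t \<in> {a..b} \<Longrightarrow> x1 t \<in> K" "\<And>t. t \<in> {a..b} \<Longrightarrow> (x1 has_vector_derivative F (x1 t)) (at t within {a..b})"
    and x2: "\<And>t. t \<in> {a..b} \<Longrightarrow> x2 t \<in> K" "\<And>t. t \<in> {a..b} \<Longrightarrow> (x2 has_vector_derivative F (x2 t)) (at t within {a..b})"
    and t: "t \<in> {a..b}"
  shows "x1 t = x2 t"
proof -
  have D: "((\<lambda>t. x1 t - x2 t) has_vector_derivative F (x1 s) - F (x2 s)) (at s within {a..b})" if "s \<in> {a..b}" for s
    by (rule has_vector_derivative_diff[OF x1(2)[OF that] x2(2)[OF that]])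
  have B: "norm (F (x1 s) - F (x2 s)) \<le> L * norm (x1 s - x2 s) + 0" if "s \<in> {a..b}" for s
    using lip[OF x1(1)[OF that] x2(1)[OF that]] by simp
  have "norm (x1 t - x2 t) \<le> 2 * (norm (x1 t0 - x2 t0) + (b - a) * 0)"
    by (rule ode_small_interval_bound[OF t0(1) D B L(2,1) order_refl t])
  then show ?thesis using t0 by simp
qed

text \<open>Only the inequality |X'| \<le> L |X| matters. Vanishing is passed between arbitrary
  times near \<open>t1\<close>, in both directions, which is the form that spreads along an interval
  by connectedness. Such times are less than \<open>2 * e\<close> apart, and \<open>e\<close> is
  chosen with \<open>L * (2 * e) \<le> 1 / 2\<close>.\<close>

lemma linear_ode_unique_local:
  fixes X :: "real \<Rightarrow> 'b::real_normed_vector"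
  assumes I: "is_interval I" and d: "d > 0" and L: "L \<ge> 0"
    and D: "\<And>t. t \<in> I \<Longrightarrow> \<bar>t - t1\<bar> < d \<Longrightarrow> (X has_vector_derivative X' t) (at t within I)"
    and B: "\<And>t. t \<in> I \<Longrightarrow> \<bar>t - t1\<bar> < d \<Longrightarrow> norm (X' t) \<le> L * norm (X t)"
  obtains e where "e > 0" "\<And>t0 t. t0 \<in> I \<Longrightarrow> t \<in> I \<Longrightarrow> \<bar>t0 - t1\<bar> < e \<Longrightarrow> \<bar>t - t1\<bar> < e \<Longrightarrow> X t0 = 0 \<Longrightarrow> X t = 0"
proof -
  define e where "e = min d (1 / (4 * (L + 1)))"
  have e: "e > 0" using d L by (simp add: e_def)
  have eL: "L * (2 * e) \<le> 1 / 2"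
  proof -
    have "L * (2 * e) \<le> (L + 1) * (2 * (1 / (4 * (L + 1))))" using L e by (intro mult_mono) (auto simp: e_def)
    moreover have "c * (2 * (1 / (4 * c))) = 1 / 2" if "c > 0" for c :: real using that by simp
    ultimately show ?thesis using L by (metis add_nonneg_pos zero_less_one)
  qed
  show thesis
  proof (rule that[OF e])
    fix t0 t assume t0: "t0 \<in> I" "\<bar>t0 - t1\<bar> < e" "X t0 = 0" and t: "t \<in> I" "\<bar>t - t1\<bar> < e"
    let ?a = "min t0 t" and ?b = "max t0 t"
    have sub: "s \<in> I \<and> \<bar>s - t1\<bar> < d" if "s \<in> {?a..?b}" for s
    proof -
      have "s \<in> I" using I t0 t that mem_is_interval_1_I[of I t0 t s] mem_is_interval_1_I[of I t t0 s]
        by (cases "t0 \<le> t") auto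
      moreover have "\<bar>s - t1\<bar> < e" using t0 t that by (auto simp: min_def max_def split: if_splits)
      ultimately show ?thesis by (simp add: e_def)
    qed
    have "norm (X t) \<le> 2 * (norm (X t0) + (?b - ?a) * 0)"
    proof (rule ode_small_interval_bound[where e=X and ?t0.0=t0 and t=t and e'=X' and L=L, OF _ _ _ _ L])
      show "(X has_vector_derivative X' s) (at s within {?a..?b})" if "s \<in> {?a..?b}" for s
        by (rule has_vector_derivative_within_subset[OF D]) (use sub that in auto)
      show "norm (X' s) \<le> L * norm (X s) + 0" if "s \<in> {?a..?b}" for s
        using B[of s] sub[OF that] by simp
      have "L * (?b - ?a) \<le> L * (2 * e)" using t0 t L by (intro mult_left_mono) (auto simp: min_def max_def)
      then show "L * (?b - ?a) \<le> 1 / 2" using eL by simp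
    qed auto
    then show "X t = 0" using t0 by simp
  qed
qed

lemma smooth_onD: "smooth_on S f \<Longrightarrow> Ck_on k S f" by (simp add: smooth_on_def)

lemma continuous_map_open_iff:
  fixes D :: "'a::topological_space set"
  assumes "open D"
  shows "continuous_map (top_of_set D) M f \<longleftrightarrow> f ` D \<subseteq> topspace M \<and> (\<forall>U. openin M U \<longrightarrow> open (D \<inter> f -` U))"
proof -
  have eq: "{x \<in> D. f x \<in> U} = D \<inter> f -` U" for U by auto
  show ?thesis
    unfolding continuous_map_def topspace_euclidean_subtopology eq openin_open_eq[OF assms]
    by auto
qed

section \<open>Charts and tangent vectors\<close>

locale smooth_mfd =
  fixes M :: "'m topology" and A :: "('m, 'e::euclidean_space) chart set"
  assumes manifold: "smooth_manifold M A"
begin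

lemma Hausdorff: "Hausdorff_space M"
  using manifold by (simp add: smooth_manifold_def)

lemma chart_openin: "\<kappa> \<in> A \<Longrightarrow> openin M (fst \<kappa>)"
  and chart_image_open: "\<kappa> \<in> A \<Longrightarrow> open (snd \<kappa> ` fst \<kappa>)"
  and chart_homeo: "\<kappa> \<in> A \<Longrightarrow> homeomorphic_map (subtopology M (fst \<kappa>)) (top_of_set (snd \<kappa> ` fst \<kappa>)) (snd \<kappa>)"
  using manifold by (simp_all add: smooth_manifold_def)

lemma chart_exists: "p \<in> topspace M \<Longrightarrow> \<exists>\<kappa>\<in>A. p \<in> fst \<kappa>"
proof -
  have "topspace M = (\<Union>\<kappa>\<in>A. fst \<kappa>)" using manifold unfolding smooth_manifold_def by (elim conjE)
  then show "p \<in> topspace M \<Longrightarrow> \<exists>\<kappa>\<in>A. p \<in> fst \<kappa>" by blast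
qed

lemma chart_topspace: "\<kappa> \<in> A \<Longrightarrow> fst \<kappa> \<subseteq> topspace M"
  using chart_openin openin_subset by blast

lemma chart_inj: "\<kappa> \<in> A \<Longrightarrow> inj_on (snd \<kappa>) (fst \<kappa>)"
proof -
  assume k: "\<kappa> \<in> A"
  have "topspace (subtopology M (fst \<kappa>)) = fst \<kappa>" using chart_topspace[OF k] by auto
  then show ?thesis using homeomorphic_imp_injective_map[OF chart_homeo[OF k]] by simp
qed

lemma chart_inv_left: "\<kappa> \<in> A \<Longrightarrow> p \<in> fst \<kappa> \<Longrightarrow> chart_inv \<kappa> (snd \<kappa> p) = p"
  by (rule inv_into_f_f[OF chart_inj])

lemma chart_inv_in: "x \<in> snd \<kappa> ` fst \<kappa> \<Longrightarrow> chart_inv \<kappa> x \<in> fst \<kappa>"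
  by (rule inv_into_into)

lemma chart_inv_right: "x \<in> snd \<kappa> ` fst \<kappa> \<Longrightarrow> snd \<kappa> (chart_inv \<kappa> x) = x"
  by (rule f_inv_into_f)

lemma chart_open_image:
  assumes "\<kappa> \<in> A" "openin M V"
  shows "open (snd \<kappa> ` (fst \<kappa> \<inter> V))"
proof -
  have "openin (subtopology M (fst \<kappa>)) (fst \<kappa> \<inter> V)"
    by (rule openin_subtopology_Int2[OF assms(2)])
  then have "openin (top_of_set (snd \<kappa> ` fst \<kappa>)) (snd \<kappa> ` (fst \<kappa> \<inter> V))"
    using homeomorphic_imp_open_map[OF chart_homeo[OF assms(1)]] unfolding open_map_def by blast
  then show ?thesis unfolding openin_open_eq[OF chart_image_open[OF assms(1)]] ..
qed

lemma overlap_open: "\<kappa> \<in> A \<Longrightarrow> \<mu> \<in> A \<Longrightarrow> open (snd \<kappa> ` (fst \<kappa> \<inter> fst \<mu>))"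
  by (rule chart_open_image[OF _ chart_openin])

definition transition :: "('m, 'e) chart \<Rightarrow> ('m, 'e) chart \<Rightarrow> 'e \<Rightarrow> 'e" where
  "transition \<kappa> \<mu> = snd \<mu> \<circ> chart_inv \<kappa>"

definition transition_deriv :: "('m, 'e) chart \<Rightarrow> ('m, 'e) chart \<Rightarrow> 'm \<Rightarrow> 'e \<Rightarrow> 'e" where
  "transition_deriv \<kappa> \<mu> p = frechet_derivative (transition \<kappa> \<mu>) (at (snd \<kappa> p))"

lemma transition_Ck:
  assumes "\<kappa> \<in> A" "\<mu> \<in> A"
  shows "Ck_on k (snd \<kappa> ` (fst \<kappa> \<inter> fst \<mu>)) (transition \<kappa> \<mu>)"
proof -
  have "\<forall>\<kappa>\<in>A. \<forall>\<mu>\<in>A. smooth_on (snd \<kappa> ` (fst \<kappa> \<inter> fst \<mu>)) (snd \<mu> \<circ> chart_inv \<kappa>)"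
    using manifold unfolding smooth_manifold_def by (elim conjE)
  then show ?thesis using assms unfolding smooth_on_def transition_def by blast
qed

lemma transition_apply: "\<kappa> \<in> A \<Longrightarrow> p \<in> fst \<kappa> \<Longrightarrow> transition \<kappa> \<mu> (snd \<kappa> p) = snd \<mu> p"
  by (simp add: transition_def chart_inv_left)

lemma transition_deriv_has_derivative:
  assumes "\<kappa> \<in> A" "\<mu> \<in> A" "p \<in> fst \<kappa>" "p \<in> fst \<mu>"
  shows "(transition \<kappa> \<mu> has_derivative transition_deriv \<kappa> \<mu> p) (at (snd \<kappa> p))"
  unfolding transition_deriv_def
  by (rule Ck_on_Suc_open_D[OF overlap_open[OF assms(1,2)] transition_Ck[OF assms(1,2)]]) (use assms in auto)

lemma transition_deriv_linear:
  assumes "\<kappa> \<in> A" "\<mu> \<in> A" "p \<in> fst \<kappa>" "p \<in> fst \<mu>"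
  shows "linear (transition_deriv \<kappa> \<mu> p)"
  using transition_deriv_has_derivative[OF assms] has_derivative_linear by blast

text \<open>This is the cocycle identity, by the chain rule and uniqueness of derivatives. It is
  what makes \<open>coord_vec\<close> a tangent vector.\<close>

lemma transition_deriv_comp:
  assumes "\<kappa> \<in> A" "\<mu> \<in> A" "\<nu> \<in> A" "p \<in> fst \<kappa>" "p \<in> fst \<mu>" "p \<in> fst \<nu>"
  shows "transition_deriv \<mu> \<nu> p (transition_deriv \<kappa> \<mu> p v) = transition_deriv \<kappa> \<nu> p v"
proof -
  have "(transition \<mu> \<nu> has_derivative transition_deriv \<mu> \<nu> p) (at (transition \<kappa> \<mu> (snd \<kappa> p)))"
    using transition_deriv_has_derivative[of \<mu> \<nu> p] assms by (simp add: transition_apply)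
  from has_derivative_compose[OF transition_deriv_has_derivative[of \<kappa> \<mu> p] this]
  have 1: "((\<lambda>x. transition \<mu> \<nu> (transition \<kappa> \<mu> x)) has_derivative (\<lambda>v. transition_deriv \<mu> \<nu> p (transition_deriv \<kappa> \<mu> p v))) (at (snd \<kappa> p))"
    using assms by blast
  have "((\<lambda>x. transition \<mu> \<nu> (transition \<kappa> \<mu> x)) has_derivative transition_deriv \<kappa> \<nu> p) (at (snd \<kappa> p))"
  proof (rule has_derivative_transform_within_open[OF transition_deriv_has_derivative[of \<kappa> \<nu> p] overlap_open[OF assms(1,2)]])
    fix x assume "x \<in> snd \<kappa> ` (fst \<kappa> \<inter> fst \<mu>)"
    then obtain q where "q \<in> fst \<kappa>" "q \<in> fst \<mu>" "x = snd \<kappa> q" by blast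
    then show "transition \<kappa> \<nu> x = transition \<mu> \<nu> (transition \<kappa> \<mu> x)" using assms by (simp add: transition_apply)
  qed (use assms in auto)
  from has_derivative_unique[OF 1 this] show ?thesis by metis
qed

lemma transition_deriv_refl:
  assumes "\<kappa> \<in> A" "p \<in> fst \<kappa>"
  shows "transition_deriv \<kappa> \<kappa> p v = v"
proof -
  have "(transition \<kappa> \<kappa> has_derivative (\<lambda>v. v)) (at (snd \<kappa> p))"
    by (rule has_derivative_transform_within_open[OF has_derivative_ident chart_image_open[OF assms(1)]])
      (use assms in \<open>auto simp: transition_apply\<close>)
  from has_derivative_unique[OF this transition_deriv_has_derivative[of \<kappa> \<kappa> p]] assms show ?thesis by metis
qed

section \<open>Tangent vectors and their coordinates in one chart\<close>

abbreviation "T \<equiv> tangent_space A"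

lemma tangentD:
  assumes "v \<in> T p" "\<kappa> \<in> A" "\<mu> \<in> A" "p \<in> fst \<kappa>" "p \<in> fst \<mu>"
  shows "v \<mu> = transition_deriv \<kappa> \<mu> p (v \<kappa>)"
  using assms(1)[unfolded tangent_space_def mem_Collect_eq, THEN conjunct2, THEN bspec, OF assms(2),
      THEN bspec, OF assms(3), THEN mp, OF conjI, OF assms(4,5)]
  unfolding transition_deriv_def transition_def .

lemma tangent_zero:
  assumes "v \<in> T p" "\<not> (\<kappa> \<in> A \<and> p \<in> fst \<kappa>)"
  shows "v \<kappa> = 0"
  using assms(1)[unfolded tangent_space_def mem_Collect_eq, THEN conjunct1, THEN spec, THEN mp, OF assms(2)] .

lemma tangentI:
  assumes "\<And>\<kappa>. \<not> (\<kappa> \<in> A \<and> p \<in> fst \<kappa>) \<Longrightarrow> v \<kappa> = 0"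
    and "\<And>\<kappa> \<mu>. \<kappa> \<in> A \<Longrightarrow> \<mu> \<in> A \<Longrightarrow> p \<in> fst \<kappa> \<Longrightarrow> p \<in> fst \<mu> \<Longrightarrow> v \<mu> = transition_deriv \<kappa> \<mu> p (v \<kappa>)"
  shows "v \<in> T p"
  unfolding tangent_space_def mem_Collect_eq
proof (intro conjI allI ballI impI)
  fix \<kappa> \<mu> assume "\<kappa> \<in> A" "\<mu> \<in> A" "p \<in> fst \<kappa> \<and> p \<in> fst \<mu>"
  then show "v \<mu> = frechet_derivative (snd \<mu> \<circ> chart_inv \<kappa>) (at (snd \<kappa> p)) (v \<kappa>)"
    using assms(2)[of \<kappa> \<mu>] unfolding transition_deriv_def transition_def by blast
qed (rule assms(1))

text \<open>The coordinates in all other charts follow by the transition derivatives or are 0.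
  Equations between tangent vectors are therefore checked in a single chart throughout.\<close>

lemma tangent_eqI:
  assumes "v \<in> T p" "w \<in> T p" "\<kappa> \<in> A" "p \<in> fst \<kappa>" "v \<kappa> = w \<kappa>"
  shows "v = w"
proof
  fix \<mu>
  show "v \<mu> = w \<mu>"
  proof (cases "\<mu> \<in> A \<and> p \<in> fst \<mu>")
    case True
    then show ?thesis using tangentD[OF assms(1,3) _ assms(4)] tangentD[OF assms(2,3) _ assms(4)] assms(5) by simp
  next
    case False
    then show ?thesis using tangent_zero assms(1,2) by metis
  qed
qed

lemma coord_vec_alt: "coord_vec A \<kappa> p w = (\<lambda>\<mu>. if \<mu> \<in> A \<and> p \<in> fst \<mu> then transition_deriv \<kappa> \<mu> p w else 0)"
  unfolding coord_vec_def transition_deriv_def transition_def by (rule refl)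

lemma coord_vec_tangent:
  assumes "\<kappa> \<in> A" "p \<in> fst \<kappa>"
  shows "coord_vec A \<kappa> p w \<in> T p"
proof (rule tangentI)
  fix \<mu> \<nu> assume "\<mu> \<in> A" "\<nu> \<in> A" "p \<in> fst \<mu>" "p \<in> fst \<nu>"
  then show "coord_vec A \<kappa> p w \<nu> = transition_deriv \<mu> \<nu> p (coord_vec A \<kappa> p w \<mu>)"
    using transition_deriv_comp[of \<kappa> \<mu> \<nu> p w] assms by (simp add: coord_vec_alt)
qed (simp only: coord_vec_alt if_False)

lemma coord_vec_self: "\<kappa> \<in> A \<Longrightarrow> p \<in> fst \<kappa> \<Longrightarrow> coord_vec A \<kappa> p w \<kappa> = w"
  by (simp add: coord_vec_alt transition_deriv_refl)

lemma tangent_0: "0 \<in> T p"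
proof (rule tangentI)
  fix \<kappa> \<mu> assume "\<kappa> \<in> A" "\<mu> \<in> A" "p \<in> fst \<kappa>" "p \<in> fst \<mu>"
  from linear_0[OF transition_deriv_linear[OF this]] show "(0 :: ('m, 'e) tvec) \<mu> = transition_deriv \<kappa> \<mu> p ((0 :: ('m, 'e) tvec) \<kappa>)" by simp
qed simp

lemma tangent_add: "v \<in> T p \<Longrightarrow> w \<in> T p \<Longrightarrow> v + w \<in> T p"
proof (rule tangentI)
  fix \<kappa> \<mu> assume v: "v \<in> T p" "w \<in> T p" and k: "\<kappa> \<in> A" "\<mu> \<in> A" "p \<in> fst \<kappa>" "p \<in> fst \<mu>"
  show "(v + w) \<mu> = transition_deriv \<kappa> \<mu> p ((v + w) \<kappa>)"
    unfolding plus_fun_apply linear_add[OF transition_deriv_linear[OF k]] tangentD[OF v(1) k] tangentD[OF v(2) k] by (rule refl)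
qed (simp add: tangent_zero)

lemma tangent_scaleR: "v \<in> T p \<Longrightarrow> r *\<^sub>R v \<in> T p"
proof (rule tangentI)
  fix \<kappa> \<mu> assume v: "v \<in> T p" and k: "\<kappa> \<in> A" "\<mu> \<in> A" "p \<in> fst \<kappa>" "p \<in> fst \<mu>"
  show "(r *\<^sub>R v) \<mu> = transition_deriv \<kappa> \<mu> p ((r *\<^sub>R v) \<kappa>)"
    unfolding scaleR_fun_def linear_cmul[OF transition_deriv_linear[OF k]] tangentD[OF v k] by (rule refl)
qed (simp add: scaleR_fun_def tangent_zero)

lemma tangent_sum: "(\<And>i. i \<in> I \<Longrightarrow> v i \<in> T p) \<Longrightarrow> sum v I \<in> T p"
  by (induction I rule: infinite_finite_induct) (auto simp: tangent_0 tangent_add)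

lemma tangent_eq_0_iff:
  assumes "v \<in> T p" "\<kappa> \<in> A" "p \<in> fst \<kappa>"
  shows "v = 0 \<longleftrightarrow> v \<kappa> = 0"
  using tangent_eqI[OF assms(1) tangent_0 assms(2,3)] by auto

section \<open>Induced charts of the slit tangent bundle\<close>

lemma slit_domain: "fst (slit_chart A \<kappa>) = {(p, v). p \<in> fst \<kappa> \<and> v \<in> T p \<and> v \<noteq> 0}"
  and slit_coord: "snd (slit_chart A \<kappa>) (p, v) = (snd \<kappa> p, v \<kappa>)"
  by (simp_all add: slit_chart_def)

text \<open>This is the coordinate range of the induced chart. A tangent vector is nonzero exactly
  when its coordinates in one chart around the point are nonzero, so removing the zero section
  amounts to y \<noteq> 0.\<close>

definition slit_image :: "('m, 'e) chart \<Rightarrow> ('e \<times> 'e) set" where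
  "slit_image \<kappa> = (snd \<kappa> ` fst \<kappa>) \<times> (- {0})"

lemma slit_image_open: "\<kappa> \<in> A \<Longrightarrow> open (slit_image \<kappa>)"
  unfolding slit_image_def by (intro open_Times chart_image_open) auto

lemma slit_coord_in:
  assumes "\<kappa> \<in> A" "P \<in> fst (slit_chart A \<kappa>)"
  shows "snd (slit_chart A \<kappa>) P \<in> slit_image \<kappa>"
  using assms by (auto simp: slit_domain slit_coord slit_image_def tangent_eq_0_iff)

lemma slit_inj:
  assumes "\<kappa> \<in> A"
  shows "inj_on (snd (slit_chart A \<kappa>)) (fst (slit_chart A \<kappa>))"
proof (rule inj_onI)
  fix P Q assume P: "P \<in> fst (slit_chart A \<kappa>)" and Q: "Q \<in> fst (slit_chart A \<kappa>)"
    and eq: "snd (slit_chart A \<kappa>) P = snd (slit_chart A \<kappa>) Q"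
  obtain p v q w where pq: "P = (p, v)" "Q = (q, w)" by fastforce
  have in_dom: "p \<in> fst \<kappa>" "q \<in> fst \<kappa>" "v \<in> T p" "w \<in> T q" using P Q by (simp_all add: pq slit_domain)
  have co: "snd \<kappa> p = snd \<kappa> q" "v \<kappa> = w \<kappa>" using eq by (simp_all add: pq slit_coord)
  have "p = q" by (rule inj_onD[OF chart_inj[OF assms] co(1) in_dom(1,2)])
  moreover from this have "v = w" using tangent_eqI[of v p w \<kappa>] in_dom co assms by simp
  ultimately show "P = Q" by (simp add: pq)
qed

lemma slit_inv:
  assumes "\<kappa> \<in> A" "(x, y) \<in> slit_image \<kappa>"
  shows "chart_inv (slit_chart A \<kappa>) (x, y) = (chart_inv \<kappa> x, coord_vec A \<kappa> (chart_inv \<kappa> x) y)"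
    and "(chart_inv \<kappa> x, coord_vec A \<kappa> (chart_inv \<kappa> x) y) \<in> fst (slit_chart A \<kappa>)"
    and "snd (slit_chart A \<kappa>) (chart_inv \<kappa> x, coord_vec A \<kappa> (chart_inv \<kappa> x) y) = (x, y)"
proof -
  let ?p = "chart_inv \<kappa> x"
  have p: "?p \<in> fst \<kappa>" "snd \<kappa> ?p = x" using assms by (auto simp: slit_image_def chart_inv_in chart_inv_right)
  have t: "coord_vec A \<kappa> ?p y \<in> T ?p" "coord_vec A \<kappa> ?p y \<kappa> = y"
    by (rule coord_vec_tangent[OF assms(1) p(1)], rule coord_vec_self[OF assms(1) p(1)])
  moreover have "coord_vec A \<kappa> ?p y \<noteq> 0" using t assms by (auto simp: slit_image_def)
  ultimately show 1: "(?p, coord_vec A \<kappa> ?p y) \<in> fst (slit_chart A \<kappa>)"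
    and 2: "snd (slit_chart A \<kappa>) (?p, coord_vec A \<kappa> ?p y) = (x, y)"
    using p by (auto simp: slit_domain slit_coord)
  show "chart_inv (slit_chart A \<kappa>) (x, y) = (?p, coord_vec A \<kappa> ?p y)"
    using inv_into_f_f[OF slit_inj[OF assms(1)] 1] 2 by simp
qed

lemma slit_inv_left:
  assumes "\<kappa> \<in> A" "P \<in> fst (slit_chart A \<kappa>)"
  shows "chart_inv (slit_chart A \<kappa>) (snd (slit_chart A \<kappa>) P) = P"
  using inv_into_f_f[OF slit_inj[OF assms(1)] assms(2)] .

lemma slit_chart_image:
  assumes "\<kappa> \<in> A"
  shows "snd (slit_chart A \<kappa>) ` fst (slit_chart A \<kappa>) = slit_image \<kappa>"
proof (intro equalityI subsetI)
  show "z \<in> slit_image \<kappa>" if "z \<in> snd (slit_chart A \<kappa>) ` fst (slit_chart A \<kappa>)" for z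
    using that slit_coord_in[OF assms] by blast
  show "z \<in> snd (slit_chart A \<kappa>) ` fst (slit_chart A \<kappa>)" if "z \<in> slit_image \<kappa>" for z
    using slit_inv(2,3)[OF assms, of "fst z" "snd z"] that by (metis image_eqI prod.collapse)
qed

definition slit_transition :: "('m, 'e) chart \<Rightarrow> ('m, 'e) chart \<Rightarrow> 'e \<times> 'e \<Rightarrow> 'e \<times> 'e" where
  "slit_transition \<kappa> \<mu> = snd (slit_chart A \<mu>) \<circ> chart_inv (slit_chart A \<kappa>)"

text \<open>With \<tau> the change of charts of \<open>M\<close>, the change of induced charts is
  (x, y) \<mapsto> (\<tau> x, D\<tau>(x) y) on an open set. It is differentiable because \<tau> is
  C^2.\<close>

lemma slit_transition_differentiable:
  assumes "\<kappa> \<in> A" "\<mu> \<in> A" "P \<in> fst (slit_chart A \<kappa>)" "P \<in> fst (slit_chart A \<mu>)"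
  shows "(slit_transition \<kappa> \<mu> has_derivative frechet_derivative (slit_transition \<kappa> \<mu>) (at (snd (slit_chart A \<kappa>) P))) (at (snd (slit_chart A \<kappa>) P))"
proof -
  let ?O = "snd \<kappa> ` (fst \<kappa> \<inter> fst \<mu>)"
  have O: "open ?O" by (rule overlap_open[OF assms(1,2)])
  let ?\<Phi> = "\<lambda>z. (transition \<kappa> \<mu> (fst z), frechet_derivative (transition \<kappa> \<mu>) (at (fst z)) (snd z))"
  let ?D = "?O \<times> (- {0 :: 'e})"
  have D: "open ?D" by (intro open_Times O) auto
  note tD = thick_open[OF D]
  have f: "Ck_on k ?D fst" "Ck_on k ?D snd" for k
    by (intro Ck_on_linear tD bounded_linear_fst bounded_linear_snd)+
  have Phi: "Ck_on (Suc 0) ?D ?\<Phi>"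
  proof (rule Ck_on_Pair[OF tD])
    show "Ck_on (Suc 0) ?D (\<lambda>z. transition \<kappa> \<mu> (fst z))"
      by (rule Ck_on_compose[OF tD thick_open[OF O] _ transition_Ck[OF assms(1,2)] f(1)]) auto
    show "Ck_on (Suc 0) ?D (\<lambda>z. frechet_derivative (transition \<kappa> \<mu>) (at (fst z)) (snd z))"
      by (rule Ck_on_frechet_comp[OF O tD _ transition_Ck[OF assms(1,2)] f]) auto
  qed
  have P: "snd (slit_chart A \<kappa>) P \<in> ?D"
  proof -
    obtain q v where P: "P = (q, v)" by fastforce
    have "q \<in> fst \<kappa>" "q \<in> fst \<mu>" "v \<kappa> \<noteq> 0"
      using slit_coord_in[OF assms(1,3)] assms(3,4) by (auto simp: P slit_domain slit_coord slit_image_def)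
    then show ?thesis by (auto simp: P slit_coord)
  qed
  have "(?\<Phi> has_derivative frechet_derivative ?\<Phi> (at (snd (slit_chart A \<kappa>) P))) (at (snd (slit_chart A \<kappa>) P))"
    by (rule Ck_on_Suc_open_D[OF D Phi P])
  then have *: "(slit_transition \<kappa> \<mu> has_derivative frechet_derivative ?\<Phi> (at (snd (slit_chart A \<kappa>) P))) (at (snd (slit_chart A \<kappa>) P))"
  proof (rule has_derivative_transform_within_open[OF _ D P])
    fix z :: "'e \<times> 'e" assume z: "z \<in> ?D"
    obtain x y where xy: "z = (x, y)" by fastforce
    have xs: "(x, y) \<in> slit_image \<kappa>" using z by (auto simp: xy slit_image_def)
    obtain q where q: "q \<in> fst \<kappa>" "q \<in> fst \<mu>" "x = snd \<kappa> q" using z by (auto simp: xy)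
    then have "chart_inv \<kappa> x = q" using chart_inv_left assms by simp
    then show "?\<Phi> z = slit_transition \<kappa> \<mu> z"
      using q(1,2) assms(1,2) by (simp add: q(3) xy slit_transition_def slit_inv(1)[OF assms(1) xs, unfolded q(3)] slit_coord transition_apply coord_vec_alt transition_deriv_def chart_inv_left)
  qed
  show ?thesis using * unfolding frechet_derivative_at[OF *] .
qed

text \<open>The set \<open>I\<close> and the family of chart derivatives are left general because
  three kinds of curves are covered: geodesics on open intervals, geodesics on compact intervals
  with one-sided velocities, and curves in a parameter direction of a variation. Near
  \<open>t\<close> the curve stays in the chart, so the chain rule with the transition map gives the
  transformation law.\<close>

lemma velocity_tangent:
  assumes "at t within I \<noteq> bot" "t \<in> I"
    and "\<And>\<kappa>. \<kappa> \<in> A \<Longrightarrow> c t \<in> fst \<kappa> \<Longrightarrow> ((\<lambda>\<tau>. snd \<kappa> (c \<tau>)) has_vector_derivative D \<kappa>) (at t within I)"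
    and "\<And>\<kappa>. \<kappa> \<in> A \<Longrightarrow> c t \<in> fst \<kappa> \<Longrightarrow> eventually (\<lambda>\<tau>. c \<tau> \<in> fst \<kappa>) (at t within I)"
  shows "velocity A I c t \<in> T (c t)" "\<And>\<kappa>. \<kappa> \<in> A \<Longrightarrow> c t \<in> fst \<kappa> \<Longrightarrow> velocity A I c t \<kappa> = D \<kappa>"
proof -
  show v: "velocity A I c t \<kappa> = D \<kappa>" if "\<kappa> \<in> A" "c t \<in> fst \<kappa>" for \<kappa>
    using vector_derivative_within[OF assms(1,3)] that by (simp add: velocity_def o_def)
  show "velocity A I c t \<in> T (c t)"
  proof (rule tangentI)
    fix \<kappa> \<mu> assume k: "\<kappa> \<in> A" "\<mu> \<in> A" "c t \<in> fst \<kappa>" "c t \<in> fst \<mu>"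
    have "((transition \<kappa> \<mu> \<circ> (\<lambda>\<tau>. snd \<kappa> (c \<tau>))) has_vector_derivative transition_deriv \<kappa> \<mu> (c t) (D \<kappa>)) (at t within I)"
      by (rule vector_derivative_diff_chain_within[OF assms(3)])
        (use k transition_deriv_has_derivative has_derivative_at_withinI in blast)+
    moreover have "eventually (\<lambda>\<tau>. (transition \<kappa> \<mu> \<circ> (\<lambda>\<tau>. snd \<kappa> (c \<tau>))) \<tau> = snd \<mu> (c \<tau>)) (at t within I)"
      using assms(4)[OF k(1,3)] by eventually_elim (simp add: transition_apply k)
    ultimately have "((\<lambda>\<tau>. snd \<mu> (c \<tau>)) has_vector_derivative transition_deriv \<kappa> \<mu> (c t) (D \<kappa>)) (at t within I)"
      unfolding has_vector_derivative_def
      by (rule has_derivative_transform_eventually) (use assms(2) k in \<open>auto simp: transition_apply\<close>)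
    from vector_derivative_within[OF assms(1) this] vector_derivative_within[OF assms(1) assms(3)[OF k(2,4)]]
    show "velocity A I c t \<mu> = transition_deriv \<kappa> \<mu> (c t) (velocity A I c t \<kappa>)" using v k by simp
  qed (auto simp: velocity_def)
qed

lemma smooth_map_open:
  assumes "open D" "smooth_map_into M A D f" "openin M U"
  shows "open (D \<inter> f -` U)"
  using assms by (simp add: smooth_map_into_def continuous_map_open_iff)

lemma smooth_map_Ck:
  assumes "smooth_map_into M A D f" "\<kappa> \<in> A"
  shows "Ck_on k (D \<inter> f -` fst \<kappa>) (\<lambda>x. snd \<kappa> (f x))"
  using assms by (simp add: smooth_map_into_def smooth_on_def o_def)

lemma smooth_map_chart:
  assumes "smooth_map_into M A D f" "x \<in> D"
  obtains \<kappa> where "\<kappa> \<in> A" "f x \<in> fst \<kappa>"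
proof -
  have "f x \<in> topspace M" using assms by (auto simp: smooth_map_into_def continuous_map_def)
  then show thesis using chart_exists that by blast
qed

text \<open>These are the coordinates of \<open>tlift A I c t\<close> in the induced chart, that is,
  the state (x, x') of the first-order geodesic system.\<close>

definition lift_coords :: "('m, 'e) chart \<Rightarrow> real set \<Rightarrow> (real \<Rightarrow> 'm) \<Rightarrow> real \<Rightarrow> 'e \<times> 'e" where
  "lift_coords \<kappa> I c t = (snd \<kappa> (c t), velocity A I c t \<kappa>)"

lemma smooth_curve_velocity:
  assumes I: "open I" and c: "smooth_map_into M A I c" and t: "t \<in> I"
  shows "velocity A I c t \<in> T (c t)"
    and "\<And>\<kappa>. \<kappa> \<in> A \<Longrightarrow> c t \<in> fst \<kappa> \<Longrightarrow> ((\<lambda>\<tau>. snd \<kappa> (c \<tau>)) has_vector_derivative velocity A I c t \<kappa>) (at t)"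
proof -
  have nb: "at t within I \<noteq> bot" using t I by (simp add: at_within_open[of t I])
  let ?D = "\<lambda>\<kappa>. vector_derivative (\<lambda>\<tau>. snd \<kappa> (c \<tau>)) (at t)"
  have op: "open (I \<inter> c -` fst \<kappa>)" if "\<kappa> \<in> A" for \<kappa>
    by (rule smooth_map_open[OF I c chart_openin[OF that]])
  have D: "((\<lambda>\<tau>. snd \<kappa> (c \<tau>)) has_vector_derivative ?D \<kappa>) (at t)" if k: "\<kappa> \<in> A" "c t \<in> fst \<kappa>" for \<kappa>
  proof -
    have "t \<in> I \<inter> c -` fst \<kappa>" using k t by simp
    from Ck_on_Suc_vectorD(1)[OF thick_open[OF op[OF k(1)]] smooth_map_Ck[OF c k(1)] this] op[OF k(1)] this
    show ?thesis by (simp add: at_within_open[of t "I \<inter> c -` fst \<kappa>"])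
  qed
  have D': "((\<lambda>\<tau>. snd \<kappa> (c \<tau>)) has_vector_derivative ?D \<kappa>) (at t within I)" if k: "\<kappa> \<in> A" "c t \<in> fst \<kappa>" for \<kappa>
    using D[OF that] has_vector_derivative_at_within by blast
  have ev: "eventually (\<lambda>\<tau>. c \<tau> \<in> fst \<kappa>) (at t within I)" if k: "\<kappa> \<in> A" "c t \<in> fst \<kappa>" for \<kappa>
    unfolding eventually_at_topological using op[OF k(1)] k t by (intro exI[of _ "I \<inter> c -` fst \<kappa>"]) auto
  show "velocity A I c t \<in> T (c t)" by (rule velocity_tangent(1)[OF nb t D' ev])
  show "((\<lambda>\<tau>. snd \<kappa> (c \<tau>)) has_vector_derivative velocity A I c t \<kappa>) (at t)" if k: "\<kappa> \<in> A" "c t \<in> fst \<kappa>" for \<kappa>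
    using velocity_tangent(2)[OF nb t D' ev k] D[OF k] by simp
qed

lemma lift_coords_Ck:
  assumes I: "open I" and c: "smooth_map_into M A I c" and k: "\<kappa> \<in> A"
  shows "Ck_on k (I \<inter> c -` fst \<kappa>) (lift_coords \<kappa> I c)"
proof -
  let ?D = "I \<inter> c -` fst \<kappa>"
  have D: "open ?D" by (rule smooth_map_open[OF I c chart_openin[OF k]])
  have "Ck_on k ?D (\<lambda>t. vector_derivative (\<lambda>\<tau>. snd \<kappa> (c \<tau>)) (at t within ?D))"
    by (rule Ck_on_Suc_vectorD(2)[OF thick_open[OF D] smooth_map_Ck[OF c k]])
  moreover have "vector_derivative (\<lambda>\<tau>. snd \<kappa> (c \<tau>)) (at t within ?D) = velocity A I c t \<kappa>" if "t \<in> ?D" for t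
    using vector_derivative_at[OF smooth_curve_velocity(2)[OF I c _ k]] that by (simp add: at_within_open[OF that D])
  ultimately have "Ck_on k ?D (\<lambda>t. velocity A I c t \<kappa>)"
    by (rule Ck_on_cong[THEN iffD1, rotated])
  then show ?thesis unfolding lift_coords_def[abs_def] by (intro Ck_on_Pair thick_open[OF D] smooth_map_Ck[OF c k])
qed

end

section \<open>Geodesics in coordinates\<close>

locale spray_mfd = smooth_mfd M A
  for M :: "'m topology" and A :: "('m, real^'n) chart set" +
  fixes S :: "('m, real^'n) tfield"
  assumes spray: "spray A S"
begin

text \<open>The coordinate expression \<open>(x, y) \<mapsto> (y, -2G(x, y))\<close> of the spray.\<close>

definition F :: "('m, real^'n) chart \<Rightarrow> (real^'n) \<times> (real^'n) \<Rightarrow> (real^'n) \<times> (real^'n)" where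
  "F \<kappa> = local_rep S (slit_chart A \<kappa>)"

abbreviation DF :: "('m, real^'n) chart \<Rightarrow> (real^'n) \<times> (real^'n) \<Rightarrow> (real^'n) \<times> (real^'n) \<Rightarrow> (real^'n) \<times> (real^'n)" where
  "DF \<kappa> z \<equiv> frechet_derivative (F \<kappa>) (at z)"

section \<open>The coordinate expression of the spray\<close>

lemma slit_atlas_mem: "\<kappa> \<in> A \<Longrightarrow> slit_chart A \<kappa> \<in> slit_atlas A"
  by (simp add: slit_atlas_def)

lemma S_tangent:
  assumes "\<kappa> \<in> A" "P \<in> fst (slit_chart A \<kappa>)"
  shows "S P \<in> tangent_space (slit_atlas A) P"
proof -
  have "\<forall>p\<in>(\<Union>\<kappa>\<in>slit_atlas A. fst \<kappa>). S p \<in> tangent_space (slit_atlas A) p"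
    using spray unfolding spray_def semispray_def smooth_vector_field_def by (elim conjE)
  then show ?thesis using slit_atlas_mem assms by blast
qed

lemma S_transform:
  assumes "\<kappa> \<in> A" "\<mu> \<in> A" "P \<in> fst (slit_chart A \<kappa>)" "P \<in> fst (slit_chart A \<mu>)"
  shows "S P (slit_chart A \<mu>) = frechet_derivative (slit_transition \<kappa> \<mu>) (at (snd (slit_chart A \<kappa>) P)) (S P (slit_chart A \<kappa>))"
  using S_tangent[OF assms(1,3), unfolded tangent_space_def mem_Collect_eq, THEN conjunct2, THEN bspec,
      OF slit_atlas_mem[OF assms(1)], THEN bspec, OF slit_atlas_mem[OF assms(2)], THEN mp, OF conjI, OF assms(3,4)]
  unfolding slit_transition_def .

lemma S_zero:
  assumes "\<kappa> \<in> A" "P \<in> fst (slit_chart A \<kappa>)" "\<not> (\<mu> \<in> slit_atlas A \<and> P \<in> fst \<mu>)"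
  shows "S P \<mu> = 0"
  using S_tangent[OF assms(1,2), unfolded tangent_space_def mem_Collect_eq, THEN conjunct1, THEN spec, THEN mp, OF assms(3)] .

lemma S_F:
  assumes "\<kappa> \<in> A" "P \<in> fst (slit_chart A \<kappa>)"
  shows "S P (slit_chart A \<kappa>) = F \<kappa> (snd (slit_chart A \<kappa>) P)"
  by (simp add: F_def local_rep_def slit_inv_left[OF assms])

lemma F_Ck:
  assumes "\<kappa> \<in> A"
  shows "Ck_on k (slit_image \<kappa>) (F \<kappa>)"
proof -
  have "\<forall>\<kappa>\<in>slit_atlas A. smooth_on (snd \<kappa> ` fst \<kappa>) (local_rep S \<kappa>)"
    using spray unfolding spray_def semispray_def smooth_vector_field_def by (elim conjE)
  from bspec[OF this slit_atlas_mem[OF assms]] show ?thesis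
    unfolding slit_chart_image[OF assms] F_def by (rule smooth_onD)
qed

lemma F_derivative: "\<kappa> \<in> A \<Longrightarrow> z \<in> slit_image \<kappa> \<Longrightarrow> (F \<kappa> has_derivative DF \<kappa> z) (at z)"
  by (rule Ck_on_Suc_open_D[OF slit_image_open F_Ck])

text \<open>The semispray condition is available in the chart that \<open>pushforward\<close>
  selects. There the base projection has coordinate expression \<open>fst\<close>, which gives the
  claim. The passage to \<kappa> works because the first component of a slit transition depends on x
  alone, with derivative \<open>transition_deriv\<close>, so the first component of S transforms
  like the tangent vector itself.\<close>

lemma fst_F:
  assumes k: "\<kappa> \<in> A" and z: "z \<in> slit_image \<kappa>"
  shows "fst (F \<kappa> z) = snd z"
proof -
  define P where "P = chart_inv (slit_chart A \<kappa>) z"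
  have P: "P \<in> fst (slit_chart A \<kappa>)" "snd (slit_chart A \<kappa>) P = z"
    using slit_inv[OF k, of "fst z" "snd z"] z by (simp_all add: P_def)
  obtain p v where pv: "P = (p, v)" by fastforce
  have p: "p \<in> fst \<kappa>" "v \<in> T p" "v \<noteq> 0" using P by (simp_all add: pv slit_domain)
  let ?Q = "\<lambda>\<kappa>'. \<kappa>' \<in> slit_atlas A \<and> P \<in> fst \<kappa>'"
  \<comment> \<open>This is literally the choice made inside \<open>pushforward\<close>, so that its
    unfolding meets the same term.\<close>
  define \<sigma> where "\<sigma> = (SOME \<kappa>'. ?Q \<kappa>')"
  have "?Q (slit_chart A \<kappa>)" using P slit_atlas_mem[OF k] by blast
  then have "?Q \<sigma>" unfolding \<sigma>_def by (rule someI)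
  then obtain \<mu> where m: "\<mu> \<in> A" "\<sigma> = slit_chart A \<mu>" "P \<in> fst (slit_chart A \<mu>)" by (auto simp: slit_atlas_def)
  have pm: "p \<in> fst \<mu>" using m by (simp add: pv slit_domain)
  have "\<forall>P\<in>(\<Union>\<kappa>\<in>slit_atlas A. fst \<kappa>). pushforward (slit_atlas A) A fst P (S P) = snd P"
    using spray unfolding spray_def semispray_def by (elim conjE)
  moreover have "P \<in> (\<Union>\<kappa>\<in>slit_atlas A. fst \<kappa>)" using P slit_atlas_mem[OF k] by blast
  ultimately have "pushforward (slit_atlas A) A fst P (S P) = snd P" by (rule bspec)
  moreover have "snd P = v" by (simp add: pv)
  ultimately have push: "pushforward (slit_atlas A) A fst P (S P) = v" by (rule trans)
  let ?zm = "snd (slit_chart A \<mu>) P"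
  have zm: "?zm \<in> slit_image \<mu>" by (rule slit_coord_in[OF m(1,3)])
  have "v \<mu> = frechet_derivative (snd \<mu> \<circ> fst \<circ> chart_inv \<sigma>) (at (snd \<sigma> P)) (S P \<sigma>)"
    using m(1) pm unfolding push[symmetric] pushforward_def Let_def \<sigma>_def[symmetric] by (simp add: pv)
  moreover have "((snd \<mu> \<circ> fst \<circ> chart_inv \<sigma>) has_derivative fst) (at ?zm)"
  proof (rule has_derivative_transform_within_open[OF bounded_linear_imp_has_derivative[OF bounded_linear_fst] slit_image_open[OF m(1)] zm])
    fix z :: "(real^'n) \<times> (real^'n)" assume z: "z \<in> slit_image \<mu>"
    then have "fst z \<in> snd \<mu> ` fst \<mu>" by (auto simp: slit_image_def)
    then show "fst z = (snd \<mu> \<circ> fst \<circ> chart_inv \<sigma>) z"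
      using slit_inv(1)[OF m(1), of "fst z" "snd z"] z by (simp add: m(2) chart_inv_right)
  qed
  then have "frechet_derivative (snd \<mu> \<circ> fst \<circ> chart_inv \<sigma>) (at ?zm) = fst"
    by (rule frechet_derivative_at[symmetric])
  ultimately have vm: "v \<mu> = fst (S P \<sigma>)" by (simp add: m(2))
  have "S P (slit_chart A \<kappa>) = frechet_derivative (slit_transition \<mu> \<kappa>) (at ?zm) (S P \<sigma>)"
    using S_transform[OF m(1) k m(3) P(1)] by (simp add: m(2))
  moreover have "(((\<lambda>z. fst (slit_transition \<mu> \<kappa> z))) has_derivative (\<lambda>w. fst (frechet_derivative (slit_transition \<mu> \<kappa>) (at ?zm) w))) (at ?zm)"
    by (rule has_derivative_fst[OF slit_transition_differentiable[OF m(1) k m(3) P(1)]])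
  moreover have "((\<lambda>z. fst (slit_transition \<mu> \<kappa> z)) has_derivative (\<lambda>w. transition_deriv \<mu> \<kappa> p (fst w))) (at ?zm)"
  proof (rule has_derivative_transform_within_open)
    have "(transition \<mu> \<kappa> has_derivative transition_deriv \<mu> \<kappa> p) (at (fst ?zm))"
      using transition_deriv_has_derivative[OF m(1) k pm p(1)] by (simp add: pv slit_coord)
    from has_derivative_compose[OF bounded_linear_imp_has_derivative[OF bounded_linear_fst] this]
    show "((\<lambda>z. transition \<mu> \<kappa> (fst z)) has_derivative (\<lambda>w. transition_deriv \<mu> \<kappa> p (fst w))) (at ?zm)" .
    show "open (snd \<mu> ` (fst \<mu> \<inter> fst \<kappa>) \<times> (- {0 :: real^'n}))"
      by (intro open_Times overlap_open[OF m(1) k]) auto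
    show "?zm \<in> snd \<mu> ` (fst \<mu> \<inter> fst \<kappa>) \<times> (- {0})" using zm pm p by (auto simp: pv slit_coord slit_image_def)
    fix z :: "(real^'n) \<times> (real^'n)" assume z: "z \<in> snd \<mu> ` (fst \<mu> \<inter> fst \<kappa>) \<times> (- {0})"
    then have "fst z \<in> snd \<mu> ` (fst \<mu> \<inter> fst \<kappa>)" "snd z \<noteq> 0" by auto
    then obtain q where q: "q \<in> fst \<mu>" "q \<in> fst \<kappa>" "fst z = snd \<mu> q" "snd z \<noteq> 0" by blast
    then have "(fst z, snd z) \<in> slit_image \<mu>" by (auto simp: slit_image_def)
    from slit_inv(1)[OF m(1) this] show "transition \<mu> \<kappa> (fst z) = fst (slit_transition \<mu> \<kappa> z)"
      by (simp add: slit_transition_def slit_coord transition_def)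
  qed
  ultimately have "fst (S P (slit_chart A \<kappa>)) = transition_deriv \<mu> \<kappa> p (fst (S P \<sigma>))"
    using has_derivative_unique by (metis (no_types, lifting))
  also have "\<dots> = v \<kappa>" using tangentD[OF p(2) m(1) k pm p(1)] vm by simp
  finally show ?thesis using S_F[OF k P(1)] P(2) by (auto simp: pv slit_coord)
qed

text \<open>The Liouville field has coordinates (0, y) and derivative w \<mapsto> (0, snd w), so
  [C, S] = S reads DF(0, y) - (0, snd F) = F. Its second component is Euler's relation for functions
  homogeneous of degree 2.\<close>

lemma F_Euler:
  assumes k: "\<kappa> \<in> A" and z: "(x, y) \<in> slit_image \<kappa>"
  shows "snd (DF \<kappa> (x, y) (0, y)) = 2 *\<^sub>R snd (F \<kappa> (x, y))"
proof -
  define P where "P = chart_inv (slit_chart A \<kappa>) (x, y)"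
  have P: "P \<in> fst (slit_chart A \<kappa>)" "snd (slit_chart A \<kappa>) P = (x, y)"
    using slit_inv[OF k z] by (simp_all add: P_def)
  have "\<forall>P\<in>(\<Union>\<kappa>\<in>slit_atlas A. fst \<kappa>). lie_bracket (slit_atlas A) (liouville A) S P = S P"
    using spray unfolding spray_def by (elim conjE)
  moreover have "P \<in> (\<Union>\<kappa>\<in>slit_atlas A. fst \<kappa>)" using P slit_atlas_mem[OF k] by blast
  ultimately have "lie_bracket (slit_atlas A) (liouville A) S P = S P" by (rule bspec)
  then have "lie_bracket (slit_atlas A) (liouville A) S P (slit_chart A \<kappa>) = S P (slit_chart A \<kappa>)" by (rule fun_cong)
  then have E: "DF \<kappa> (x, y) (0, y) - frechet_derivative (local_rep (liouville A) (slit_chart A \<kappa>)) (at (x, y)) (F \<kappa> (x, y)) = F \<kappa> (x, y)"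
    using P slit_atlas_mem[OF k] S_F[OF k P(1)] by (simp add: lie_bracket_def liouville_def F_def)
  have "(local_rep (liouville A) (slit_chart A \<kappa>) has_derivative (\<lambda>w. (0, snd w))) (at (x, y))"
  proof (rule has_derivative_transform_within_open[OF _ slit_image_open[OF k] z])
    show "((\<lambda>w. (0, snd w)) has_derivative (\<lambda>w. (0, snd w))) (at (x, y))"
      by (intro bounded_linear_imp_has_derivative bounded_linear_Pair bounded_linear_zero bounded_linear_snd)
    fix z :: "(real^'n) \<times> (real^'n)" assume "z \<in> slit_image \<kappa>"
    then show "(0, snd z) = local_rep (liouville A) (slit_chart A \<kappa>) z"
      using slit_inv[OF k, of "fst z" "snd z"] slit_atlas_mem[OF k] by (simp add: local_rep_def liouville_def)
  qed
  from frechet_derivative_at[OF this] have "frechet_derivative (local_rep (liouville A) (slit_chart A \<kappa>)) (at (x, y)) (F \<kappa> (x, y)) = (0, snd (F \<kappa> (x, y)))"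
    by metis
  with E have "DF \<kappa> (x, y) (0, y) = F \<kappa> (x, y) + (0, snd (F \<kappa> (x, y)))" by (simp add: algebra_simps)
  then show ?thesis by (simp add: scaleR_2)
qed

text \<open>A property of the germ of \<open>c\<close> at \<open>t\<close>, in one chart and without
  reference to an interval or to velocities. It passes to restrictions and to glued curves at once,
  and \<open>geodesicI\<close> returns to the definition of geodesics.\<close>

definition geod_local :: "(real \<Rightarrow> 'm) \<Rightarrow> real \<Rightarrow> bool" where
  "geod_local c t \<longleftrightarrow> (\<exists>\<kappa>\<in>A. \<exists>Z J. open J \<and> t \<in> J \<and> (\<forall>\<tau>\<in>J. c \<tau> \<in> fst \<kappa> \<and> snd \<kappa> (c \<tau>) = fst (Z \<tau>) \<and> Z \<tau> \<in> slit_image \<kappa> \<and>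
     (Z has_vector_derivative F \<kappa> (Z \<tau>)) (at \<tau>)))"

lemma geodesic_ode:
  assumes g: "geodesic M A S I c" and t: "t \<in> I" and k: "\<kappa> \<in> A" "c t \<in> fst \<kappa>"
  shows "tlift A I c t \<in> fst (slit_chart A \<kappa>)" "lift_coords \<kappa> I c t \<in> slit_image \<kappa>"
    "(lift_coords \<kappa> I c has_vector_derivative F \<kappa> (lift_coords \<kappa> I c t)) (at t)"
proof -
  have I: "open I" and c: "smooth_map_into M A I c" and v0: "velocity A I c t \<noteq> 0"
    and eq: "velocity (slit_atlas A) I (tlift A I c) t = S (tlift A I c t)"
    using g t unfolding geodesic_def by blast+
  show P: "tlift A I c t \<in> fst (slit_chart A \<kappa>)"
    using smooth_curve_velocity(1)[OF I c t] v0 k by (simp add: tlift_def slit_domain)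
  have sc: "snd (slit_chart A \<kappa>) (tlift A I c \<tau>) = lift_coords \<kappa> I c \<tau>" for \<tau>
    by (simp add: tlift_def slit_coord lift_coords_def)
  show z: "lift_coords \<kappa> I c t \<in> slit_image \<kappa>" using slit_coord_in[OF k(1) P] by (simp add: sc)
  let ?D = "I \<inter> c -` fst \<kappa>"
  have D: "open ?D" by (rule smooth_map_open[OF I c chart_openin[OF k(1)]])
  have tD: "t \<in> ?D" using t k by simp
  have "(lift_coords \<kappa> I c has_vector_derivative vector_derivative (lift_coords \<kappa> I c) (at t)) (at t)"
    using Ck_on_Suc_vectorD(1)[OF thick_open[OF D] lift_coords_Ck[OF I c k(1)] tD] by (simp add: at_within_open[OF tD D])
  moreover have "vector_derivative (lift_coords \<kappa> I c) (at t) = F \<kappa> (lift_coords \<kappa> I c t)"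
  proof -
    have "velocity (slit_atlas A) I (tlift A I c) t (slit_chart A \<kappa>) = vector_derivative (snd (slit_chart A \<kappa>) \<circ> tlift A I c) (at t)"
      using slit_atlas_mem[OF k(1)] P by (simp add: velocity_def at_within_open[OF t I])
    moreover have "snd (slit_chart A \<kappa>) \<circ> tlift A I c = lift_coords \<kappa> I c" by (simp add: fun_eq_iff sc)
    ultimately show ?thesis using S_F[OF k(1) P] by (simp add: eq sc)
  qed
  ultimately show "(lift_coords \<kappa> I c has_vector_derivative F \<kappa> (lift_coords \<kappa> I c t)) (at t)" by simp
qed

lemma geodesic_imp_geod_local:
  assumes g: "geodesic M A S I c" and t: "t \<in> I"
  shows "geod_local c t"
proof -
  have I: "open I" and c: "smooth_map_into M A I c" using g unfolding geodesic_def by blast+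
  obtain \<kappa> where k: "\<kappa> \<in> A" "c t \<in> fst \<kappa>" using smooth_map_chart[OF c t] by blast
  have D: "open (I \<inter> c -` fst \<kappa>)" by (rule smooth_map_open[OF I c chart_openin[OF k(1)]])
  show ?thesis unfolding geod_local_def
    by (intro bexI[OF _ k(1)] exI[of _ "lift_coords \<kappa> I c"] exI[of _ "I \<inter> c -` fst \<kappa>"] conjI D ballI)
      (use t k geodesic_ode[OF g _ k(1)] in \<open>auto simp: lift_coords_def\<close>)
qed

lemma geod_local_cong:
  assumes "geod_local c t" "open J" "t \<in> J" "\<And>\<tau>. \<tau> \<in> J \<Longrightarrow> c' \<tau> = c \<tau>"
  shows "geod_local c' t"
proof -
  obtain \<kappa> Z K where K: "\<kappa> \<in> A" "open K" "t \<in> K" "\<And>\<tau>. \<tau> \<in> K \<Longrightarrow> c \<tau> \<in> fst \<kappa> \<and> snd \<kappa> (c \<tau>) = fst (Z \<tau>) \<and> Z \<tau> \<in> slit_image \<kappa> \<and>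
     (Z has_vector_derivative F \<kappa> (Z \<tau>)) (at \<tau>)"
    using assms(1) unfolding geod_local_def by blast
  show ?thesis unfolding geod_local_def
    by (rule bexI[OF _ K(1)], rule exI[of _ Z], rule exI[of _ "J \<inter> K"])
      (use K assms in auto)
qed

text \<open>The definition asks for the equation in every induced chart. The local solution settles
  it in one of them; the others follow since both sides transform by the derivative of the slit
  transition, and away from the charts at the point both sides are 0.\<close>

lemma geodesicI:
  assumes I: "open I" "is_interval I" and c: "smooth_map_into M A I c" and loc: "\<And>t. t \<in> I \<Longrightarrow> geod_local c t"
  shows "geodesic M A S I c"
  unfolding geodesic_def
proof (intro conjI ballI I c)
  fix t assume t: "t \<in> I"
  obtain \<kappa> Z J where k: "\<kappa> \<in> A" and J0: "open J" "t \<in> J" and JJ: "\<And>\<tau>. \<tau> \<in> J \<Longrightarrow> c \<tau> \<in> fst \<kappa> \<and> snd \<kappa> (c \<tau>) = fst (Z \<tau>) \<and> Z \<tau> \<in> slit_image \<kappa> \<and>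
     (Z has_vector_derivative F \<kappa> (Z \<tau>)) (at \<tau>)"
    using loc[OF t] unfolding geod_local_def by blast
  define K where "K = J \<inter> I"
  have K: "open K" "t \<in> K" using J0 I t by (auto simp: K_def)
  have KI: "\<tau> \<in> I" "c \<tau> \<in> fst \<kappa>" "snd \<kappa> (c \<tau>) = fst (Z \<tau>)" "Z \<tau> \<in> slit_image \<kappa>"
     "(Z has_vector_derivative F \<kappa> (Z \<tau>)) (at \<tau>)" if "\<tau> \<in> K" for \<tau>
    using that JJ[of \<tau>] by (auto simp: K_def)
  \<comment> \<open>By \<open>fst_F\<close> the first component of Z' = F Z says that the second
    component of Z is the derivative of the first.\<close>
  have vel: "velocity A I c \<tau> \<kappa> = snd (Z \<tau>)" if \<tau>: "\<tau> \<in> K" for \<tau>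
  proof -
    have "((\<lambda>\<tau>. fst (Z \<tau>)) has_vector_derivative fst (F \<kappa> (Z \<tau>))) (at \<tau>)"
      by (rule bounded_linear.has_vector_derivative[OF bounded_linear_fst KI(5)[OF \<tau>]])
    then have "((\<lambda>\<tau>. snd \<kappa> (c \<tau>)) has_vector_derivative snd (Z \<tau>)) (at \<tau>)"
      unfolding fst_F[OF k KI(4)[OF \<tau>]]
      by (rule has_vector_derivative_transform_within_open[OF _ K(1) \<tau>]) (simp add: KI)
    from vector_derivative_at[OF this] vector_derivative_at[OF smooth_curve_velocity(2)[OF I(1) c KI(1)[OF \<tau>] k KI(2)[OF \<tau>]]]
    show ?thesis by simp
  qed
  have P: "tlift A I c \<tau> \<in> fst (slit_chart A \<kappa>)" "velocity A I c \<tau> \<noteq> 0" "snd (slit_chart A \<kappa>) (tlift A I c \<tau>) = Z \<tau>"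
    if \<tau>: "\<tau> \<in> K" for \<tau>
  proof -
    have "velocity A I c \<tau> \<kappa> \<noteq> 0" using vel[OF \<tau>] KI(4)[OF \<tau>] by (auto simp: slit_image_def)
    then show "velocity A I c \<tau> \<noteq> 0" by auto
    then show "tlift A I c \<tau> \<in> fst (slit_chart A \<kappa>)"
      using smooth_curve_velocity(1)[OF I(1) c KI(1)[OF \<tau>]] KI(2)[OF \<tau>] by (simp add: tlift_def slit_domain)
    show "snd (slit_chart A \<kappa>) (tlift A I c \<tau>) = Z \<tau>"
      using vel[OF \<tau>] KI(3)[OF \<tau>] by (simp add: tlift_def slit_coord)
  qed
  show "velocity A I c t \<noteq> 0" by (rule P(2)[OF K(2)])
  show "velocity (slit_atlas A) I (tlift A I c) t = S (tlift A I c t)"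
  proof
    fix \<sigma>
    show "velocity (slit_atlas A) I (tlift A I c) t \<sigma> = S (tlift A I c t) \<sigma>"
    proof (cases "\<sigma> \<in> slit_atlas A \<and> tlift A I c t \<in> fst \<sigma>")
      case False
      then show ?thesis using S_zero[OF k P(1)[OF K(2)] False] by (auto simp: velocity_def)
    next
      case True
      then obtain \<mu> where m: "\<mu> \<in> A" "\<sigma> = slit_chart A \<mu>" by (auto simp: slit_atlas_def)
      have Pm: "tlift A I c t \<in> fst (slit_chart A \<mu>)" using True m by simp
      have "(slit_transition \<kappa> \<mu> has_derivative frechet_derivative (slit_transition \<kappa> \<mu>) (at (Z t))) (at (Z t) within Z ` UNIV)"
        using slit_transition_differentiable[OF k m(1) P(1)[OF K(2)] Pm] unfolding P(3)[OF K(2)] by (rule has_derivative_at_withinI)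
      from vector_derivative_diff_chain_within[OF KI(5)[OF K(2)] this]
      have "((slit_transition \<kappa> \<mu> \<circ> Z) has_vector_derivative frechet_derivative (slit_transition \<kappa> \<mu>) (at (Z t)) (F \<kappa> (Z t))) (at t)" .
      then have "((snd \<sigma> \<circ> tlift A I c) has_vector_derivative frechet_derivative (slit_transition \<kappa> \<mu>) (at (Z t)) (F \<kappa> (Z t))) (at t)"
      proof (rule has_vector_derivative_transform_within_open[OF _ K])
        fix \<tau> assume \<tau>: "\<tau> \<in> K"
        have "chart_inv (slit_chart A \<kappa>) (Z \<tau>) = tlift A I c \<tau>"
          using slit_inv_left[OF k P(1)[OF \<tau>]] P(3)[OF \<tau>] by simp
        then show "(slit_transition \<kappa> \<mu> \<circ> Z) \<tau> = (snd \<sigma> \<circ> tlift A I c) \<tau>" by (simp add: slit_transition_def m(2))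
      qed
      from vector_derivative_at[OF this]
      have "velocity (slit_atlas A) I (tlift A I c) t \<sigma> = frechet_derivative (slit_transition \<kappa> \<mu>) (at (Z t)) (F \<kappa> (Z t))"
        using True by (simp add: velocity_def at_within_open[OF t I(1)])
      also have "\<dots> = S (tlift A I c t) \<sigma>"
        using S_transform[OF k m(1) P(1)[OF K(2)] Pm] S_F[OF k P(1)[OF K(2)]] P(3)[OF K(2)] by (simp add: m(2))
      finally show ?thesis .
    qed
  qed
qed

end

section \<open>Geodesic variations\<close>

lemma open_cube: "open (cube \<epsilon> :: (real^'k) set)"
proof -
  have "cube \<epsilon> = (\<Inter>a. {s :: real^'k. - \<epsilon> < s $ a} \<inter> {s. s $ a < \<epsilon>})" by (auto simp: cube_def)
  moreover have "open ({s :: real^'k. - \<epsilon> < s $ a} \<inter> {s. s $ a < \<epsilon>})" for a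
    by (intro open_Int open_Collect_less continuous_intros)
  ultimately show ?thesis by auto
qed

lemma zero_in_cube: "\<epsilon> > 0 \<Longrightarrow> 0 \<in> cube \<epsilon>" by (simp add: cube_def)

lemma cube_mono:
  assumes "\<epsilon>' \<le> \<epsilon>"
  shows "cube \<epsilon>' \<subseteq> (cube \<epsilon> :: (real^'k) set)"
proof
  fix s :: "real^'k" assume "s \<in> cube \<epsilon>'"
  then have "- \<epsilon>' < s $ a \<and> s $ a < \<epsilon>'" for a by (simp add: cube_def)
  then have "- \<epsilon> < s $ a \<and> s $ a < \<epsilon>" for a using assms by (smt (verit))
  then show "s \<in> cube \<epsilon>" by (simp add: cube_def)
qed

lemma cube_subset_open:
  fixes U :: "(real^'k) set"
  assumes "open U" "0 \<in> U"
  obtains \<epsilon> where "\<epsilon> > 0" "cube \<epsilon> \<subseteq> U"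
proof -
  obtain \<rho> where \<rho>: "\<rho> > 0" "ball 0 \<rho> \<subseteq> U" using assms open_contains_ball by blast
  show thesis
  proof
    \<comment> \<open>The norm is at most the sum of the absolute values of the
      \<open>CARD('k)\<close> coordinates, hence this bound for each coordinate.\<close>
    show "\<rho> / CARD('k) > 0" using \<rho> by simp
    show "cube (\<rho> / CARD('k)) \<subseteq> U"
    proof
      fix s :: "real^'k" assume s: "s \<in> cube (\<rho> / CARD('k))"
      have "norm s \<le> (\<Sum>a\<in>UNIV. \<bar>s $ a\<bar>)" by (rule norm_le_l1_cart)
      also have "\<dots> < (\<Sum>a\<in>(UNIV :: 'k set). \<rho> / CARD('k))"
      proof (rule sum_strict_mono)
        fix a :: 'k
        have "- (\<rho> / CARD('k)) < s $ a \<and> s $ a < \<rho> / CARD('k)" using s by (simp add: cube_def)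
        then show "\<bar>s $ a\<bar> < \<rho> / CARD('k)" by (simp add: abs_less_iff)
      qed auto
      also have "\<dots> = \<rho>" by simp
      finally show "s \<in> U" using \<rho> by auto
    qed
  qed
qed

context smooth_mfd
begin

lemma smooth_map_intoI:
  assumes "open D" "f ` D \<subseteq> topspace M" "\<And>U. openin M U \<Longrightarrow> open (D \<inter> f -` U)"
    and "\<And>\<kappa> k. \<kappa> \<in> A \<Longrightarrow> Ck_on k (D \<inter> f -` fst \<kappa>) (\<lambda>x. snd \<kappa> (f x))"
  shows "smooth_map_into M A D f"
  unfolding smooth_map_into_def smooth_on_def o_def continuous_map_open_iff[OF assms(1)] using assms(2-4) by blast

lemma smooth_map_topspace: "open D \<Longrightarrow> smooth_map_into M A D f \<Longrightarrow> f ` D \<subseteq> topspace M"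
  by (simp add: smooth_map_into_def continuous_map_open_iff)

lemma smooth_map_compose:
  assumes D: "open D" and D': "open D'" and f: "smooth_map_into M A D f"
    and g: "\<And>k. Ck_on k D' g" "g ` D' \<subseteq> D"
  shows "smooth_map_into M A D' (\<lambda>x. f (g x))"
proof (rule smooth_map_intoI[OF D'])
  show "(\<lambda>x. f (g x)) ` D' \<subseteq> topspace M" using smooth_map_topspace[OF D f] g(2) by blast
  have eq: "D' \<inter> (\<lambda>x. f (g x)) -` U = D' \<inter> g -` (D \<inter> f -` U)" for U using g(2) by auto
  show op: "open (D' \<inter> (\<lambda>x. f (g x)) -` U)" if "openin M U" for U
    unfolding eq using continuous_open_preimage[OF Ck_on_imp_continuous_on[OF g(1)] D' smooth_map_open[OF D f that]] .
  fix \<kappa> k assume k: "\<kappa> \<in> A"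
  let ?E = "D' \<inter> (\<lambda>x. f (g x)) -` fst \<kappa>"
  have E: "open ?E" by (rule op[OF chart_openin[OF k]])
  show "Ck_on k ?E (\<lambda>x. snd \<kappa> (f (g x)))"
    by (rule Ck_on_compose[OF thick_open[OF E] thick_open[OF smooth_map_open[OF D f chart_openin[OF k]]] _ smooth_map_Ck[OF f k]
         Ck_on_subset[OF thick_open[OF E] _ g(1)]]) (use g(2) in auto)
qed

lemma smooth_map_subset:
  assumes "open D" "open D'" "D' \<subseteq> D" "smooth_map_into M A D f"
  shows "smooth_map_into M A D' f"
  by (rule smooth_map_compose[OF assms(1,2,4) Ck_on_ident[OF thick_open[OF assms(2)]]]) (use assms(3) in auto)

lemma smooth_map_Un:
  assumes D1: "open D1" and D2: "open D2" and f1: "smooth_map_into M A D1 f1" and f2: "smooth_map_into M A D2 f2"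
    and eq: "\<And>x. x \<in> D1 \<Longrightarrow> f x = f1 x" "\<And>x. x \<in> D2 \<Longrightarrow> f x = f2 x"
  shows "smooth_map_into M A (D1 \<union> D2) f"
proof (rule smooth_map_intoI[OF open_Un[OF D1 D2]])
  show "f ` (D1 \<union> D2) \<subseteq> topspace M" using smooth_map_topspace[OF D1 f1] smooth_map_topspace[OF D2 f2] eq by force
  have e: "(D1 \<union> D2) \<inter> f -` U = (D1 \<inter> f1 -` U) \<union> (D2 \<inter> f2 -` U)" for U using eq by auto
  show op: "open ((D1 \<union> D2) \<inter> f -` U)" if "openin M U" for U
    unfolding e by (rule open_Un[OF smooth_map_open[OF D1 f1 that] smooth_map_open[OF D2 f2 that]])
  fix \<kappa> k assume k: "\<kappa> \<in> A"
  let ?E = "(D1 \<union> D2) \<inter> f -` fst \<kappa>"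
  have E: "open ?E" by (rule op[OF chart_openin[OF k]])
  have C: "Ck_on k (?E \<inter> Di) (\<lambda>x. snd \<kappa> (f x))"
    if "open Di" "smooth_map_into M A Di fi" "\<And>x. x \<in> Di \<Longrightarrow> f x = fi x" "Di \<subseteq> D1 \<union> D2" for Di fi
  proof -
    have "?E \<inter> Di = Di \<inter> fi -` fst \<kappa>" using that by auto
    then have "Ck_on k (?E \<inter> Di) (\<lambda>x. snd \<kappa> (fi x))" using smooth_map_Ck[OF that(2) k] by simp
    then show ?thesis by (rule Ck_on_cong[THEN iffD1, rotated]) (simp add: that(3))
  qed
  show "Ck_on k ?E (\<lambda>x. snd \<kappa> (f x))"
  proof (rule Ck_on_local[OF thick_open[OF E]])
    fix x assume "x \<in> ?E"
    then consider "x \<in> D1" | "x \<in> D2" by blast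
    then show "\<exists>U. open U \<and> x \<in> U \<and> Ck_on k (?E \<inter> U) (\<lambda>x. snd \<kappa> (f x))"
    proof cases
      case 1
      then show ?thesis using D1 C[OF D1 f1 eq(1)] by blast
    next
      case 2
      then show ?thesis using D2 C[OF D2 f2 eq(2)] by blast
    qed
  qed
qed

text \<open>Needed whenever a geodesic is restricted or glued: \<open>velocity\<close> carries its
  interval as an argument, although at interior points derivatives do not see it.\<close>

lemma velocity_open:
  assumes "open I" "open J" "t \<in> I" "t \<in> J" "\<And>\<tau>. \<tau> \<in> J \<Longrightarrow> c' \<tau> = c \<tau>"
  shows "velocity A J c' t = velocity A I c t"
proof -
  have e: "vector_derivative (snd \<kappa> \<circ> c') (at t) = vector_derivative (snd \<kappa> \<circ> c) (at t)" for \<kappa>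
  proof -
    have "((snd \<kappa> \<circ> c') has_vector_derivative D) (at t) \<longleftrightarrow> ((snd \<kappa> \<circ> c) has_vector_derivative D) (at t)" for D
      using has_vector_derivative_transform_within_open[OF _ assms(2,4), of "snd \<kappa> \<circ> c'" D "snd \<kappa> \<circ> c"]
        has_vector_derivative_transform_within_open[OF _ assms(2,4), of "snd \<kappa> \<circ> c" D "snd \<kappa> \<circ> c'"] assms(5) by auto
    then show ?thesis by (simp add: vector_derivative_def)
  qed
  show ?thesis unfolding velocity_def at_within_open[OF assms(3,1)] at_within_open[OF assms(4,2)] e assms(5)[OF assms(4)] by (rule refl)
qed

lemma tlift_eqI:
  assumes k: "\<kappa> \<in> A" and "tlift A I c t \<in> fst (slit_chart A \<kappa>)" "tlift A J c' t \<in> fst (slit_chart A \<kappa>)"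
    and "lift_coords \<kappa> I c t = lift_coords \<kappa> J c' t"
  shows "tlift A I c t = tlift A J c' t"
  by (rule inj_onD[OF slit_inj[OF k] _ assms(2,3)]) (use assms(4) in \<open>simp add: tlift_def slit_coord lift_coords_def\<close>)

lemma tlift_eqD: "tlift A I c t = tlift A J c' t \<Longrightarrow> lift_coords \<kappa> I c t = lift_coords \<kappa> J c' t"
  by (simp add: tlift_def lift_coords_def)

end

context spray_mfd
begin

section \<open>Restriction and uniqueness of geodesics\<close>

lemma geodesicD:
  assumes "geodesic M A S I c"
  shows "open I" "is_interval I" "smooth_map_into M A I c"
  using assms unfolding geodesic_def by blast+

lemma geodesic_subset:
  assumes g: "geodesic M A S I c" and J: "open J" "is_interval J" "J \<subseteq> I"
  shows "geodesic M A S J c"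
  by (rule geodesicI[OF J(1,2) smooth_map_subset[OF geodesicD(1)[OF g] J(1,3) geodesicD(3)[OF g]]])
    (use geodesic_imp_geod_local[OF g] J in auto)

text \<open>Agreement of the lifts spreads over a neighbourhood of each time \<open>a\<close>. If
  the base points at \<open>a\<close> differ, the Hausdorff property keeps the lifts different
  nearby; if only the velocities differ, continuity of the coordinates does; in both cases there is
  nothing to spread. If the lifts agree at \<open>a\<close>, both coordinate curves stay in a ball
  on which F is Lipschitz, and solutions over a short interval are unique.\<close>

lemma geodesic_unique:
  assumes g1: "geodesic M A S I c1" and g2: "geodesic M A S I c2"
    and t0: "t0 \<in> I" "tlift A I c1 t0 = tlift A I c2 t0" and t: "t \<in> I"
  shows "tlift A I c1 t = tlift A I c2 t"
proof (rule connected_induction_simple[of I t0 t "\<lambda>t. tlift A I c1 t = tlift A I c2 t", OF _ t0(1) t t0(2)])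
  note I = geodesicD(1)[OF g1] and c1 = geodesicD(3)[OF g1] and c2 = geodesicD(3)[OF g2]
  show "connected I" using geodesicD(2)[OF g1] is_interval_connected by blast
  fix a assume a: "a \<in> I"
  have "\<exists>Q. open Q \<and> Q \<subseteq> I \<and> a \<in> Q \<and> (\<forall>x\<in>Q. \<forall>y\<in>Q. tlift A I c1 x = tlift A I c2 x \<longrightarrow> tlift A I c1 y = tlift A I c2 y)"
  proof (cases "c1 a = c2 a")
    case False
    have "c1 a \<in> topspace M" "c2 a \<in> topspace M" using smooth_map_topspace[OF I] c1 c2 a by blast+
    then obtain U V where UV: "openin M U" "openin M V" "c1 a \<in> U" "c2 a \<in> V" "disjnt U V"
      using Hausdorff False unfolding Hausdorff_space_def by metis
    have "tlift A I c1 x \<noteq> tlift A I c2 x" if "x \<in> (I \<inter> c1 -` U) \<inter> (I \<inter> c2 -` V)" for x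
      using UV that by (auto simp: tlift_def disjnt_def)
    then show ?thesis
      using smooth_map_open[OF I c1 UV(1)] smooth_map_open[OF I c2 UV(2)] UV a
      by (intro exI[of _ "(I \<inter> c1 -` U) \<inter> (I \<inter> c2 -` V)"]) auto
  next
    case True
    obtain \<kappa> where k: "\<kappa> \<in> A" "c1 a \<in> fst \<kappa>" using smooth_map_chart[OF c1 a] by blast
    let ?D = "(I \<inter> c1 -` fst \<kappa>) \<inter> (I \<inter> c2 -` fst \<kappa>)"
    let ?Z1 = "lift_coords \<kappa> I c1" and ?Z2 = "lift_coords \<kappa> I c2"
    have D1: "open (I \<inter> c1 -` fst \<kappa>)" and D2: "open (I \<inter> c2 -` fst \<kappa>)"
      using smooth_map_open[OF I c1 chart_openin[OF k(1)]] smooth_map_open[OF I c2 chart_openin[OF k(1)]] by auto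
    have D: "open ?D" "a \<in> ?D" using D1 D2 a k True by auto
    have Zc: "continuous_on ?D ?Z1" "continuous_on ?D ?Z2"
      using Ck_on_imp_continuous_on[OF lift_coords_Ck[OF I c1 k(1)]] Ck_on_imp_continuous_on[OF lift_coords_Ck[OF I c2 k(1)]]
      by (auto intro: continuous_on_subset)
    have iff: "tlift A I c1 x = tlift A I c2 x \<longleftrightarrow> ?Z1 x = ?Z2 x" if "x \<in> ?D" for x
      using tlift_eqD[of I c1 x I c2 \<kappa>] tlift_eqI[OF k(1) geodesic_ode(1)[OF g1 _ k(1)] geodesic_ode(1)[OF g2 _ k(1)]] that by blast
    show ?thesis
    proof (cases "?Z1 a = ?Z2 a")
      case False
      have "open (?D \<inter> (\<lambda>x. ?Z1 x - ?Z2 x) -` (- {0}))"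
        by (rule continuous_open_preimage[OF continuous_on_diff[OF Zc] D(1)]) auto
      moreover have "tlift A I c1 x \<noteq> tlift A I c2 x" if "x \<in> ?D \<inter> (\<lambda>x. ?Z1 x - ?Z2 x) -` (- {0})" for x
      proof -
        have "x \<in> ?D" "?Z1 x \<noteq> ?Z2 x" using that by auto
        then show ?thesis using iff by blast
      qed
      moreover have "a \<in> ?D \<inter> (\<lambda>x. ?Z1 x - ?Z2 x) -` (- {0})" using D(2) False by simp
      ultimately show ?thesis
        by (intro exI[of _ "?D \<inter> (\<lambda>x. ?Z1 x - ?Z2 x) -` (- {0})"]) blast
    next
      case True
      have za: "?Z1 a \<in> slit_image \<kappa>" by (rule geodesic_ode(2)[OF g1 a k])
      obtain R L where R: "R > 0" "L \<ge> 0"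
        and lip: "\<And>x y. x \<in> cball (?Z1 a) R \<Longrightarrow> y \<in> cball (?Z1 a) R \<Longrightarrow> norm (F \<kappa> x - F \<kappa> y) \<le> L * norm (x - y)"
        using C1_locally_lipschitz[OF slit_image_open[OF k(1)] F_Ck[OF k(1)] za] by metis
      have "open (?D \<inter> ?Z1 -` ball (?Z1 a) R)" "open (?D \<inter> ?Z2 -` ball (?Z1 a) R)"
        using continuous_open_preimage[OF Zc(1) D(1)] continuous_open_preimage[OF Zc(2) D(1)] by auto
      then have "open ((?D \<inter> ?Z1 -` ball (?Z1 a) R) \<inter> (?D \<inter> ?Z2 -` ball (?Z1 a) R))" by (rule open_Int)
      moreover have "a \<in> (?D \<inter> ?Z1 -` ball (?Z1 a) R) \<inter> (?D \<inter> ?Z2 -` ball (?Z1 a) R)" using D(2) R True by auto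
      ultimately obtain r where r: "r > 0" "ball a r \<subseteq> (?D \<inter> ?Z1 -` ball (?Z1 a) R) \<inter> (?D \<inter> ?Z2 -` ball (?Z1 a) R)"
        using open_contains_ball by blast
      define e where "e = min r (1 / (4 * (L + 1)))"
      have e: "e > 0" "e \<le> r" using r R by (auto simp: e_def)
      have Le: "L * (2 * e) \<le> 1/2"
      proof -
        have "L * (2 * e) \<le> (L + 1) * (2 * (1 / (4 * (L + 1))))" using R e by (intro mult_mono) (auto simp: e_def)
        moreover have "c * (2 * (1 / (4 * c))) = 1 / 2" if "c > 0" for c :: real using that by simp
        ultimately show ?thesis using R by (metis add_nonneg_pos zero_less_one)
      qed
      have sub: "x \<in> ?D" "?Z1 x \<in> cball (?Z1 a) R" "?Z2 x \<in> cball (?Z1 a) R" if "x \<in> ball a e" for x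
      proof -
        have "x \<in> ball a r" using that e by auto
        then have "x \<in> (?D \<inter> ?Z1 -` ball (?Z1 a) R) \<inter> (?D \<inter> ?Z2 -` ball (?Z1 a) R)" using r by blast
        then show "x \<in> ?D" "?Z1 x \<in> cball (?Z1 a) R" "?Z2 x \<in> cball (?Z1 a) R" by auto
      qed
      have st: "?Z1 y = ?Z2 y" if x: "x \<in> ball a e" and y: "y \<in> ball a e" and eq: "?Z1 x = ?Z2 x" for x y
      proof -
        let ?l = "min x y" and ?u = "max x y"
        have seg: "s \<in> ball a e" if "s \<in> {?l..?u}" for s
          using x y that by (auto simp: dist_real_def min_def max_def abs_less_iff split: if_splits)
        have "L * (?u - ?l) \<le> L * (2 * e)"
          using x y R by (intro mult_left_mono) (auto simp: dist_real_def min_def max_def abs_less_iff)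
        then have Lu: "L * (?u - ?l) \<le> 1/2" using Le by simp
        have xin: "x \<in> {?l..?u}" and yin: "y \<in> {?l..?u}" by auto
        show ?thesis
        proof (rule ode_unique_lipschitz[where ?x1.0="?Z1" and ?x2.0="?Z2", OF lip R(2) Lu xin eq _ _ _ _ yin])
          fix s assume "s \<in> {?l..?u}"
          note s = sub[OF seg[OF this]]
          show "?Z1 s \<in> cball (?Z1 a) R" "?Z2 s \<in> cball (?Z1 a) R" using s by auto
          show "(?Z1 has_vector_derivative F \<kappa> (?Z1 s)) (at s within {?l..?u})"
            "(?Z2 has_vector_derivative F \<kappa> (?Z2 s)) (at s within {?l..?u})"
            using geodesic_ode(3)[OF g1 _ k(1), of s] geodesic_ode(3)[OF g2 _ k(1), of s] s(1)
            by (auto intro: has_vector_derivative_at_within)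
        qed
      qed
      have "tlift A I c1 y = tlift A I c2 y" if x: "x \<in> ball a e" and y: "y \<in> ball a e" and "tlift A I c1 x = tlift A I c2 x" for x y
        using st[OF x y] that(3) unfolding iff[OF sub(1)[OF x]] iff[OF sub(1)[OF y]] by blast
      moreover have "ball a e \<subseteq> I" using sub(1) by blast
      moreover have "a \<in> ball a e" using e by simp
      ultimately show ?thesis by (intro exI[of _ "ball a e"] conjI ballI impI open_ball)
    qed
  qed
  then show "\<exists>Q. openin (top_of_set I) Q \<and> a \<in> Q \<and> (\<forall>x\<in>Q. \<forall>y\<in>Q. tlift A I c1 x = tlift A I c2 x \<longrightarrow> tlift A I c1 y = tlift A I c2 y)"
    unfolding openin_open_eq[OF I] by blast
qed

text \<open>By \<open>fst_F\<close> the second component of a local solution is the velocity of its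
  first component, so \<open>Z\<close> has no choice but to be the state of
  \<open>c\<close>.\<close>

lemma lift_coords_eqI:
  assumes I: "open I" and c: "smooth_map_into M A I c" and t: "t \<in> I" and k: "\<kappa> \<in> A" and J: "open J" "t \<in> J"
    and JJ: "\<And>\<tau>. \<tau> \<in> J \<Longrightarrow> c \<tau> \<in> fst \<kappa> \<and> snd \<kappa> (c \<tau>) = fst (Z \<tau>) \<and> Z \<tau> \<in> slit_image \<kappa> \<and>
     (Z has_vector_derivative F \<kappa> (Z \<tau>)) (at \<tau>)"
  shows "lift_coords \<kappa> I c t = Z t"
proof -
  have "((\<lambda>\<tau>. fst (Z \<tau>)) has_vector_derivative fst (F \<kappa> (Z t))) (at t)"
    using JJ[OF J(2)] bounded_linear.has_vector_derivative[OF bounded_linear_fst] by blast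
  then have "((\<lambda>\<tau>. snd \<kappa> (c \<tau>)) has_vector_derivative snd (Z t)) (at t)"
    using fst_F[OF k] JJ[OF J(2)] by (simp add: has_vector_derivative_transform_within_open[OF _ J] JJ)
  from vector_derivative_at[OF this] vector_derivative_at[OF smooth_curve_velocity(2)[OF I c t k]]
  show ?thesis using JJ[OF J(2)] by (simp add: lift_coords_def prod_eq_iff)
qed

section \<open>Construction, gluing and extension of geodesic variations\<close>

lemma geodesic_variationD:
  assumes "geodesic_variation M A S K \<epsilon> V"
  shows "\<epsilon> > 0" "open K" "is_interval K" "smooth_map_into M A (K \<times> cube \<epsilon>) V"
    "\<And>s. s \<in> cube \<epsilon> \<Longrightarrow> geodesic M A S K (\<lambda>t. V (t, s))"
  using assms unfolding geodesic_variation_def by blast+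

lemma geodesic_variation_subset:
  assumes V: "geodesic_variation M A S K \<epsilon> V" and "\<epsilon>' > 0" "\<epsilon>' \<le> \<epsilon>" "open K'" "is_interval K'" "K' \<subseteq> K"
  shows "geodesic_variation M A S K' \<epsilon>' V"
  unfolding geodesic_variation_def
proof (intro conjI ballI)
  note V = geodesic_variationD[OF V]
  show "smooth_map_into M A (K' \<times> cube \<epsilon>') V"
    by (rule smooth_map_subset[OF open_Times[OF V(2) open_cube] open_Times[OF assms(4) open_cube] _ V(4)])
      (use assms cube_mono in blast)
  show "geodesic M A S K' (\<lambda>t. V (t, s))" if "s \<in> cube \<epsilon>'" for s
    using geodesic_subset[OF V(5) assms(4-6)] that cube_mono[OF assms(3)] by blast
qed (use assms in auto)

text \<open>The numbers \<delta> and r depend only on \<kappa> and z, while the starting time y and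
  the initial data z0 are free: the equation is autonomous, so one flow box serves all times. This
  uniformity lets \<open>extend_variation\<close> start a new piece at any time near a given
  one.\<close>

lemma local_variation:
  assumes k: "\<kappa> \<in> A" and z: "z \<in> slit_image \<kappa>"
  obtains \<delta> r where "\<delta> > 0" "r > 0" "ball z r \<subseteq> slit_image \<kappa>"
    "\<And>y (z0 :: real^'k \<Rightarrow> _) \<epsilon>. \<epsilon> > 0 \<Longrightarrow> (\<And>k. Ck_on k (cube \<epsilon>) z0) \<Longrightarrow> z0 ` cube \<epsilon> \<subseteq> ball z r \<Longrightarrow>
      \<exists>V. geodesic_variation M A S {y-\<delta><..<y+\<delta>} \<epsilon> V \<and>
        (\<forall>s\<in>cube \<epsilon>. V (y, s) \<in> fst \<kappa> \<and> lift_coords \<kappa> {y-\<delta><..<y+\<delta>} (\<lambda>t. V (t, s)) y = z0 s)"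
proof -
  obtain \<delta> r Z where \<delta>: "\<delta> > 0" and r: "r > 0" "ball z r \<subseteq> slit_image \<kappa>"
    and Z: "\<And>k. Ck_on k ({-\<delta><..<\<delta>} \<times> ball z r) Z" "\<And>w. w \<in> {-\<delta><..<\<delta>} \<times> ball z r \<Longrightarrow> Z w \<in> slit_image \<kappa>"
      "\<And>p. p \<in> ball z r \<Longrightarrow> Z (0, p) = p"
      "\<And>t p. t \<in> {-\<delta><..<\<delta>} \<Longrightarrow> p \<in> ball z r \<Longrightarrow> ((\<lambda>t. Z (t, p)) has_vector_derivative F \<kappa> (Z (t, p))) (at t)"
    using flow_box[OF slit_image_open[OF k] F_Ck[OF k] z] by metis
  show thesis
  proof (rule that[OF \<delta> r])
    fix y :: real and z0 :: "real^'k \<Rightarrow> _" and \<epsilon> :: real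
    assume \<epsilon>: "\<epsilon> > 0" and z0: "\<And>k. Ck_on k (cube \<epsilon>) z0" "z0 ` cube \<epsilon> \<subseteq> ball z r"
    let ?I = "{y-\<delta><..<y+\<delta>}"
    let ?W = "?I \<times> (cube \<epsilon> :: (real^'k) set)"
    have W: "open ?W" by (intro open_Times open_cube) auto
    note tW = thick_open[OF W]
    \<comment> \<open>Flow time is counted from the starting time y.\<close>
    define \<Phi> where "\<Phi> w = Z (fst w - y, z0 (snd w))" for w :: "real \<times> (real^'k)"
    have inb: "(fst w - y, z0 (snd w)) \<in> {-\<delta><..<\<delta>} \<times> ball z r" if "w \<in> ?W" for w
    proof -
      have "z0 (snd w) \<in> ball z r" using that z0(2) by auto
      then show ?thesis using that by auto
    qed
    have \<Phi>slit_image: "\<Phi> w \<in> slit_image \<kappa>" if "w \<in> ?W" for w unfolding \<Phi>_def by (rule Z(2)[OF inb[OF that]])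
    have B: "open ({-\<delta><..<\<delta>} \<times> ball z r)" by (intro open_Times) auto
    have \<Phi>C: "Ck_on k ?W \<Phi>" for k
    proof -
      have c: "Ck_on k ?W (\<lambda>w. (fst w - y, z0 (snd w)))"
      proof (rule Ck_on_Pair[OF tW Ck_on_diff[OF tW Ck_on_linear[OF tW bounded_linear_fst] Ck_on_const[OF tW]]])
        show "Ck_on k ?W (\<lambda>w. z0 (snd w))"
          by (rule Ck_on_compose[OF tW thick_open[OF open_cube] _ z0(1) Ck_on_linear[OF tW bounded_linear_snd]]) auto
      qed
      show ?thesis unfolding \<Phi>_def[abs_def]
        by (rule Ck_on_compose[OF tW thick_open[OF B] _ Z(1) c]) (use inb in blast)
    qed
    define V where "V w = chart_inv \<kappa> (fst (\<Phi> w))" for w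
    have fim: "fst (\<Phi> w) \<in> snd \<kappa> ` fst \<kappa>" if "w \<in> ?W" for w using \<Phi>slit_image[OF that] by (auto simp: slit_image_def)
    have Vk: "V w \<in> fst \<kappa>" "snd \<kappa> (V w) = fst (\<Phi> w)" if "w \<in> ?W" for w
      using fim[OF that] by (simp_all add: V_def chart_inv_in chart_inv_right)
    have op: "open (?W \<inter> V -` U)" if "openin M U" for U
    proof -
      have "?W \<inter> V -` U = ?W \<inter> (\<lambda>w. fst (\<Phi> w)) -` (snd \<kappa> ` (fst \<kappa> \<inter> U))"
      proof (intro equalityI subsetI)
        fix w assume w: "w \<in> ?W \<inter> V -` U"
        then have "fst (\<Phi> w) = snd \<kappa> (V w)" "V w \<in> fst \<kappa>" "V w \<in> U" using Vk[of w] by auto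
        then show "w \<in> ?W \<inter> (\<lambda>w. fst (\<Phi> w)) -` (snd \<kappa> ` (fst \<kappa> \<inter> U))" using w by blast
      next
        fix w assume w: "w \<in> ?W \<inter> (\<lambda>w. fst (\<Phi> w)) -` (snd \<kappa> ` (fst \<kappa> \<inter> U))"
        then obtain q where "q \<in> fst \<kappa>" "q \<in> U" "fst (\<Phi> w) = snd \<kappa> q" by blast
        then have "V w \<in> U" using k by (simp add: V_def chart_inv_left)
        then show "w \<in> ?W \<inter> V -` U" using w by blast
      qed
      moreover have "open (?W \<inter> (\<lambda>w. fst (\<Phi> w)) -` (snd \<kappa> ` (fst \<kappa> \<inter> U)))"
        by (rule continuous_open_preimage[OF continuous_on_fst[OF Ck_on_imp_continuous_on[OF \<Phi>C]] W chart_open_image[OF k that]])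
      ultimately show ?thesis by simp
    qed
    have Vs: "smooth_map_into M A ?W V"
    proof (rule smooth_map_intoI[OF W _ op])
      show "V ` ?W \<subseteq> topspace M" using Vk(1) chart_topspace[OF k] by blast
      fix \<mu> n assume m: "\<mu> \<in> A"
      let ?E = "?W \<inter> V -` fst \<mu>"
      have E: "open ?E" by (rule op[OF chart_openin[OF m]])
      have "Ck_on n ?E (\<lambda>w. transition \<kappa> \<mu> (fst (\<Phi> w)))"
      proof (rule Ck_on_compose[OF thick_open[OF E] thick_open[OF overlap_open[OF k m]] _ transition_Ck[OF k m]])
        show "Ck_on n ?E (\<lambda>w. fst (\<Phi> w))"
          by (rule Ck_on_subset[OF thick_open[OF E] _ Ck_on_fst[OF tW \<Phi>C]]) auto
        show "(\<lambda>w. fst (\<Phi> w)) ` ?E \<subseteq> snd \<kappa> ` (fst \<kappa> \<inter> fst \<mu>)"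
        proof (rule image_subsetI)
          fix w assume "w \<in> ?E"
          then have "fst (\<Phi> w) = snd \<kappa> (V w)" "V w \<in> fst \<kappa> \<inter> fst \<mu>" using Vk[of w] by auto
          then show "fst (\<Phi> w) \<in> snd \<kappa> ` (fst \<kappa> \<inter> fst \<mu>)" by (rule image_eqI)
        qed
      qed
      then show "Ck_on n ?E (\<lambda>w. snd \<mu> (V w))"
        by (rule Ck_on_cong[THEN iffD1, rotated]) (simp add: transition_def V_def)
    qed
    have Vc: "smooth_map_into M A ?I (\<lambda>t. V (t, s))" if s: "s \<in> cube \<epsilon>" for s
      by (rule smooth_map_compose[OF W open_greaterThanLessThan Vs])
        (use s in \<open>auto intro!: Ck_on_Pair Ck_on_ident Ck_on_const thick_open\<close>)
    have J: "V (\<tau>, s) \<in> fst \<kappa> \<and> snd \<kappa> (V (\<tau>, s)) = fst (\<Phi> (\<tau>, s)) \<and> \<Phi> (\<tau>, s) \<in> slit_image \<kappa> \<and>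
     ((\<lambda>\<tau>. \<Phi> (\<tau>, s)) has_vector_derivative F \<kappa> (\<Phi> (\<tau>, s))) (at \<tau>)" if s: "s \<in> cube \<epsilon>" and \<tau>: "\<tau> \<in> ?I" for s \<tau>
    proof -
      have w: "(\<tau>, s) \<in> ?W" using s \<tau> by blast
      have 1: "((\<lambda>t. t - y) has_vector_derivative 1) (at \<tau>)" by (auto intro!: derivative_eq_intros)
      have "\<tau> - y \<in> {-\<delta><..<\<delta>}" "z0 s \<in> ball z r" using inb[OF w] by auto
      from vector_diff_chain_at[OF 1 Z(4)[OF this]]
      have "((\<lambda>\<tau>. \<Phi> (\<tau>, s)) has_vector_derivative F \<kappa> (\<Phi> (\<tau>, s))) (at \<tau>)"
        by (simp add: \<Phi>_def o_def)
      then show ?thesis using Vk[OF w] \<Phi>slit_image[OF w] by blast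
    qed
    have geo: "geodesic M A S ?I (\<lambda>t. V (t, s))" if s: "s \<in> cube \<epsilon>" for s
    proof (rule geodesicI[OF _ _ Vc[OF s]])
      show "geod_local (\<lambda>t. V (t, s)) t" if "t \<in> ?I" for t
        unfolding geod_local_def by (intro bexI[OF _ k] exI[of _ "\<lambda>\<tau>. \<Phi> (\<tau>, s)"] exI[of _ ?I] conjI ballI J s that) auto
    qed auto
    have yI: "y \<in> ?I" using \<delta> by simp
    have "lift_coords \<kappa> ?I (\<lambda>t. V (t, s)) y = z0 s" if s: "s \<in> cube \<epsilon>" for s
    proof -
      have "lift_coords \<kappa> ?I (\<lambda>t. V (t, s)) y = \<Phi> (y, s)"
        by (rule lift_coords_eqI[OF open_greaterThanLessThan Vc[OF s] yI k open_greaterThanLessThan yI J[OF s]])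
      also have "\<dots> = z0 s" using Z(3)[of "z0 s"] z0(2) s by (auto simp: \<Phi>_def)
      finally show ?thesis .
    qed
    moreover have "V (y, s) \<in> fst \<kappa>" if "s \<in> cube \<epsilon>" for s using Vk(1)[of "(y, s)"] yI that by blast
    moreover have "geodesic_variation M A S ?I \<epsilon> V"
      unfolding geodesic_variation_def using \<epsilon> Vs geo by (auto simp: is_interval_oo)
    ultimately show "\<exists>V. geodesic_variation M A S ?I \<epsilon> V \<and>
        (\<forall>s\<in>cube \<epsilon>. V (y, s) \<in> fst \<kappa> \<and> lift_coords \<kappa> ?I (\<lambda>t. V (t, s)) y = z0 s)" by blast
  qed
qed

text \<open>For each s the two geodesics have the same lift at \<open>y\<close>, so by uniqueness
  they agree on the intersection of the intervals, which is an interval. The glued map is then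
  locally one of the two.\<close>

lemma geodesic_variation_Un:
  assumes V1: "geodesic_variation M A S K1 \<epsilon> V1" and V2: "geodesic_variation M A S K2 \<epsilon> V2"
    and y: "y \<in> K1" "y \<in> K2" and eq: "\<And>s. s \<in> cube \<epsilon> \<Longrightarrow> tlift A K1 (\<lambda>t. V1 (t, s)) y = tlift A K2 (\<lambda>t. V2 (t, s)) y"
  shows "\<exists>V. geodesic_variation M A S (K1 \<union> K2) \<epsilon> V \<and> (\<forall>t\<in>K1. \<forall>s\<in>cube \<epsilon>. V (t, s) = V1 (t, s))
     \<and> (\<forall>t\<in>K2. \<forall>s\<in>cube \<epsilon>. V (t, s) = V2 (t, s))"
proof -
  note d1 = geodesic_variationD[OF V1] and d2 = geodesic_variationD[OF V2]
  let ?K = "K1 \<inter> K2"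
  have K: "open ?K" "is_interval ?K" "y \<in> ?K" using d1(2,3) d2(2,3) y by (auto intro: is_interval_Int)
  have agree: "V1 (t, s) = V2 (t, s)" if t: "t \<in> ?K" and s: "s \<in> cube \<epsilon>" for t s
  proof -
    have g1: "geodesic M A S ?K (\<lambda>t. V1 (t, s))" by (rule geodesic_subset[OF d1(5)[OF s] K(1,2)]) simp
    have g2: "geodesic M A S ?K (\<lambda>t. V2 (t, s))" by (rule geodesic_subset[OF d2(5)[OF s] K(1,2)]) simp
    have "tlift A ?K (\<lambda>t. V1 (t, s)) y = tlift A ?K (\<lambda>t. V2 (t, s)) y"
      using eq[OF s] velocity_open[OF d1(2) K(1) y(1) K(3), of "\<lambda>t. V1 (t, s)" "\<lambda>t. V1 (t, s)"]
        velocity_open[OF d2(2) K(1) y(2) K(3), of "\<lambda>t. V2 (t, s)" "\<lambda>t. V2 (t, s)"] by (simp add: tlift_def)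
    from geodesic_unique[OF g1 g2 K(3) this t] show ?thesis by (simp add: tlift_def)
  qed
  define V where "V w = (if fst w \<in> K1 then V1 w else V2 w)" for w
  have e1: "V (t, s) = V1 (t, s)" if "t \<in> K1" for t s using that by (simp add: V_def)
  have e2: "V (t, s) = V2 (t, s)" if "t \<in> K2" "s \<in> cube \<epsilon>" for t s using agree[of t s] that by (simp add: V_def)
  have KU: "open (K1 \<union> K2)" using d1(2) d2(2) by (rule open_Un)
  have iv: "is_interval (K1 \<union> K2)"
    using d1(3) d2(3) y connected_Un[of K1 K2] unfolding is_interval_connected_1 by blast
  have sm: "smooth_map_into M A ((K1 \<union> K2) \<times> cube \<epsilon>) V"
    unfolding Sigma_Un_distrib1
    by (rule smooth_map_Un[OF open_Times[OF d1(2) open_cube] open_Times[OF d2(2) open_cube] d1(4) d2(4)])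
      (auto simp: e1 e2)
  have "geodesic M A S (K1 \<union> K2) (\<lambda>t. V (t, s))" if s: "s \<in> cube \<epsilon>" for s
  proof (rule geodesicI[OF KU iv])
    show "smooth_map_into M A (K1 \<union> K2) (\<lambda>t. V (t, s))"
      by (rule smooth_map_compose[OF open_Times[OF KU open_cube] KU sm])
        (use s in \<open>auto intro!: Ck_on_Pair Ck_on_ident Ck_on_const thick_open KU\<close>)
    fix t assume "t \<in> K1 \<union> K2"
    then consider "t \<in> K1" | "t \<in> K2" by blast
    then show "geod_local (\<lambda>t. V (t, s)) t"
    proof cases
      case 1
      show ?thesis by (rule geod_local_cong[OF geodesic_imp_geod_local[OF d1(5)[OF s] 1] d1(2) 1]) (rule e1)
    next
      case 2
      show ?thesis by (rule geod_local_cong[OF geodesic_imp_geod_local[OF d2(5)[OF s] 2] d2(2) 2]) (rule e2[OF _ s])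
    qed
  qed
  then have "geodesic_variation M A S (K1 \<union> K2) \<epsilon> V"
    unfolding geodesic_variation_def using d1(1) KU iv sm by blast
  then show ?thesis using e1 e2 by blast
qed

text \<open>The states (x, x') of all geodesics of the variation, as one function of (t, s), so that
  it can be differentiated in s.\<close>

definition variation_coords :: "('m, real^'n) chart \<Rightarrow> real set \<Rightarrow> (real \<times> (real^'k) \<Rightarrow> 'm) \<Rightarrow> real \<times> (real^'k) \<Rightarrow> (real^'n) \<times> (real^'n)" where
  "variation_coords \<kappa> K V w = lift_coords \<kappa> K (\<lambda>t. V (t, snd w)) (fst w)"

lemma variation_domain_open:
  assumes "geodesic_variation M A S K \<epsilon> V" "\<kappa> \<in> A"
  shows "open (K \<times> cube \<epsilon> \<inter> V -` fst \<kappa>)"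
  using smooth_map_open[OF open_Times[OF geodesic_variationD(2)[OF assms(1)] open_cube]
      geodesic_variationD(4)[OF assms(1)] chart_openin[OF assms(2)]] .

text \<open>The velocity component is the derivative of the coordinates of V in the direction (1,
  0), so it inherits joint smoothness in (t, s) from V.\<close>

lemma variation_coords_Ck:
  assumes V: "geodesic_variation M A S K \<epsilon> V" and k: "\<kappa> \<in> A"
  shows "Ck_on n (K \<times> cube \<epsilon> \<inter> V -` fst \<kappa>) (variation_coords \<kappa> K V)"
proof -
  note d = geodesic_variationD[OF V]
  let ?D = "K \<times> cube \<epsilon> \<inter> V -` fst \<kappa>"
  let ?v = "\<lambda>w. snd \<kappa> (V w)"
  have D: "open ?D" by (rule variation_domain_open[OF V k])
  note tD = thick_open[OF D]
  have v: "Ck_on n ?D ?v" for n by (rule smooth_map_Ck[OF d(4) k])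
  have "variation_coords \<kappa> K V w = (?v w, frechet_derivative ?v (at w) (1, 0))" if w: "w \<in> ?D" for w
  proof -
    obtain t s where ts: "w = (t, s)" by fastforce
    have t: "t \<in> K" "s \<in> cube \<epsilon>" "V (t, s) \<in> fst \<kappa>" using w by (auto simp: ts)
    have "(?v has_derivative frechet_derivative ?v (at w)) (at w)" by (rule Ck_on_Suc_open_D[OF D v w])
    then have "(?v has_derivative frechet_derivative ?v (at w)) (at (t, s) within (\<lambda>t. (t, s)) ` UNIV)"
      unfolding ts by (rule has_derivative_at_withinI)
    moreover have "((\<lambda>t. (t, s)) has_vector_derivative (1, 0)) (at t)"
      by (auto intro!: derivative_eq_intros has_vector_derivative_Pair)
    ultimately have "((?v \<circ> (\<lambda>t. (t, s))) has_vector_derivative frechet_derivative ?v (at w) (1, 0)) (at t)"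
      using vector_derivative_diff_chain_within by blast
    from vector_derivative_at[OF this]
      vector_derivative_at[OF smooth_curve_velocity(2)[OF d(2) geodesicD(3)[OF d(5)[OF t(2)]] t(1) k t(3)]]
    show ?thesis by (simp add: variation_coords_def lift_coords_def ts o_def)
  qed
  moreover have "Ck_on n ?D (\<lambda>w. (?v w, frechet_derivative ?v (at w) (1, 0)))"
    by (rule Ck_on_Pair[OF tD v Ck_on_frechet_comp[OF D tD _ v Ck_on_ident[OF tD] Ck_on_const[OF tD]]]) auto
  ultimately show ?thesis by (rule Ck_on_cong[THEN iffD2])
qed

lemma variation_coords_ode:
  assumes V: "geodesic_variation M A S K \<epsilon> V" and k: "\<kappa> \<in> A"
    and t: "t \<in> K" "s \<in> cube \<epsilon>" "V (t, s) \<in> fst \<kappa>"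
  shows "variation_coords \<kappa> K V (t, s) \<in> slit_image \<kappa>"
    "((\<lambda>t. variation_coords \<kappa> K V (t, s)) has_vector_derivative F \<kappa> (variation_coords \<kappa> K V (t, s))) (at t)"
  using geodesic_ode(2,3)[OF geodesic_variationD(5)[OF V t(2)] t(1) k t(3)]
  by (simp_all add: variation_coords_def)

text \<open>At a frozen time the states become smooth initial data on a smaller cube, close enough
  to the central state to be fed into \<open>local_variation\<close>.\<close>

lemma variation_slice:
  fixes V :: "real \<times> (real^'k) \<Rightarrow> 'm"
  assumes V: "geodesic_variation M A S K \<epsilon> V" and k: "\<kappa> \<in> A" and y: "y \<in> K" "V (y, 0) \<in> fst \<kappa>" and r: "r > 0"
  obtains \<epsilon>' where "\<epsilon>' > 0" "\<epsilon>' \<le> \<epsilon>" "\<And>s. s \<in> cube \<epsilon>' \<Longrightarrow> V (y, s) \<in> fst \<kappa>"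
    "\<And>n. Ck_on n (cube \<epsilon>') (\<lambda>s. variation_coords \<kappa> K V (y, s))" "(\<lambda>s. variation_coords \<kappa> K V (y, s)) ` cube \<epsilon>' \<subseteq> ball (variation_coords \<kappa> K V (y, 0)) r"
proof -
  note d = geodesic_variationD[OF V]
  let ?D = "K \<times> cube \<epsilon> \<inter> V -` fst \<kappa>"
  have D: "open ?D" by (rule variation_domain_open[OF V k])
  have pair: "continuous_on UNIV (\<lambda>s :: real^'k. (y, s))" by (intro continuous_intros)
  let ?E = "?D \<inter> variation_coords \<kappa> K V -` ball (variation_coords \<kappa> K V (y, 0)) r"
  have E: "open ?E"
    by (rule continuous_open_preimage[OF Ck_on_imp_continuous_on[OF variation_coords_Ck[OF V k]] D open_ball])
  have "open ((\<lambda>s. (y, s)) -` ?E)" by (rule open_vimage[OF E pair])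
  moreover have "0 \<in> (\<lambda>s. (y, s)) -` ?E" using y r zero_in_cube[OF d(1)] by simp
  ultimately obtain \<epsilon>1 where e1: "\<epsilon>1 > 0" "cube \<epsilon>1 \<subseteq> (\<lambda>s. (y, s)) -` ?E" using cube_subset_open by blast
  define \<epsilon>' where "\<epsilon>' = min \<epsilon> \<epsilon>1"
  have sub: "(y, s) \<in> ?E" if "s \<in> cube \<epsilon>'" for s
  proof -
    have "\<epsilon>' \<le> \<epsilon>1" by (simp add: \<epsilon>'_def)
    then have "s \<in> cube \<epsilon>1" using that cube_mono by blast
    then have "s \<in> (\<lambda>s. (y, s)) -` ?E" using e1(2) by blast
    then show ?thesis by (rule vimageD)
  qed
  note tc = thick_open[OF open_cube]
  show thesis
  proof (rule that[of \<epsilon>'])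
    show "Ck_on n (cube \<epsilon>') (\<lambda>s. variation_coords \<kappa> K V (y, s))" for n
      by (rule Ck_on_compose[OF tc thick_open[OF D] _ variation_coords_Ck[OF V k] Ck_on_Pair[OF tc Ck_on_const[OF tc] Ck_on_ident[OF tc]]])
        (use sub in blast)
    show "(\<lambda>s. variation_coords \<kappa> K V (y, s)) ` cube \<epsilon>' \<subseteq> ball (variation_coords \<kappa> K V (y, 0)) r"
      by (rule image_subsetI) (use sub in blast)
    show "V (y, s) \<in> fst \<kappa>" if "s \<in> cube \<epsilon>'" for s using sub[OF that] by blast
  qed (use e1 d(1) in \<open>auto simp: \<epsilon>'_def\<close>)
qed

text \<open>The property \<open>P b\<close>, that some continuation on a possibly smaller cube
  reaches \<open>b\<close>, spreads near each time: the slice of a continuation at x is continued by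
  a local variation, and the two are glued. The size of the cube may depend on \<open>b\<close>, so
  the target is a single time and not all of \<open>I\<close>.\<close>

lemma extend_variation:
  fixes V0 :: "real \<times> (real^'k) \<Rightarrow> 'm"
  assumes c: "geodesic M A S I c" and b: "b \<in> I"
    and V0: "geodesic_variation M A S K0 \<epsilon>0 V0" "K0 \<subseteq> I" "K0 \<noteq> {}" "\<And>t. t \<in> K0 \<Longrightarrow> V0 (t, 0) = c t"
  obtains K \<epsilon> V where "geodesic_variation M A S K \<epsilon> V" "K \<subseteq> I" "K0 \<subseteq> K" "b \<in> K" "\<epsilon> \<le> \<epsilon>0"
    "\<And>t. t \<in> K \<Longrightarrow> V (t, 0) = c t" "\<And>t s. t \<in> K0 \<Longrightarrow> s \<in> cube \<epsilon> \<Longrightarrow> V (t, s) = V0 (t, s)"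
proof -
  define G where "G K \<epsilon> V \<longleftrightarrow> geodesic_variation M A S K \<epsilon> V \<and> K \<subseteq> I \<and> K0 \<subseteq> K \<and> \<epsilon> \<le> \<epsilon>0 \<and>
    (\<forall>t\<in>K. V (t, 0) = c t) \<and> (\<forall>t\<in>K0. \<forall>s\<in>cube \<epsilon>. V (t, s) = V0 (t, s))" for K \<epsilon> and V :: "real \<times> (real^'k) \<Rightarrow> 'm"
  define P where "P b \<longleftrightarrow> (\<exists>K \<epsilon> V. G K \<epsilon> V \<and> b \<in> K)" for b
  note I = geodesicD[OF c]
  obtain a0 where a0: "a0 \<in> K0" using V0(3) by blast
  have P0: "P a0" unfolding P_def G_def using V0 a0 by blast
  have "P b"
  proof (rule connected_induction_simple[of I a0 b P, OF _ _ b P0])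
    show "connected I" using I(2) is_interval_connected by blast
    show "a0 \<in> I" using a0 V0(2) by blast
    fix a assume a: "a \<in> I"
    obtain \<kappa> where k: "\<kappa> \<in> A" "c a \<in> fst \<kappa>" using smooth_map_chart[OF I(3) a] by blast
    define z where "z = lift_coords \<kappa> I c a"
    have z: "z \<in> slit_image \<kappa>" unfolding z_def by (rule geodesic_ode(2)[OF c a k])
    obtain \<delta> r where \<delta>: "\<delta> > 0" and r: "r > 0" and
      LV: "\<And>y (z0 :: real^'k \<Rightarrow> _) \<epsilon>. \<epsilon> > 0 \<Longrightarrow> (\<And>k. Ck_on k (cube \<epsilon>) z0) \<Longrightarrow> z0 ` cube \<epsilon> \<subseteq> ball z r \<Longrightarrow>
      \<exists>V. geodesic_variation M A S {y-\<delta><..<y+\<delta>} \<epsilon> V \<and>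
        (\<forall>s\<in>cube \<epsilon>. V (y, s) \<in> fst \<kappa> \<and> lift_coords \<kappa> {y-\<delta><..<y+\<delta>} (\<lambda>t. V (t, s)) y = z0 s)"
      using local_variation[OF k(1) z, where 'k='k] by metis
    let ?D = "I \<inter> c -` fst \<kappa>"
    have D: "open ?D" by (rule smooth_map_open[OF I(1,3) chart_openin[OF k(1)]])
    \<comment> \<open>In \<open>?Q\<close> the state of \<open>c\<close> is within r/2 of
      \<open>z\<close>, which leaves r/2 for the spread of the slice. Two times in it are less than
      \<delta> apart, so a local piece started at one of them reaches the other.\<close>
    let ?Q = "(?D \<inter> lift_coords \<kappa> I c -` ball z (r/2)) \<inter> ball a (\<delta>/2)"
    have "open (?D \<inter> lift_coords \<kappa> I c -` ball z (r/2))"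
      by (rule continuous_open_preimage[OF Ck_on_imp_continuous_on[OF lift_coords_Ck[OF I(1,3) k(1)]] D open_ball])
    then have Q: "open ?Q" "?Q \<subseteq> I" "a \<in> ?Q" using a k \<delta> r by (auto simp: z_def)
    have step: "P y" if x: "x \<in> ?Q" and y: "y \<in> ?Q" and Px: "P x" for x y
    proof -
      obtain K \<epsilon> V where G: "G K \<epsilon> V" and xK: "x \<in> K" using Px unfolding P_def by blast
      then have V: "geodesic_variation M A S K \<epsilon> V" "K \<subseteq> I" "K0 \<subseteq> K" "\<epsilon> \<le> \<epsilon>0" "\<And>t. t \<in> K \<Longrightarrow> V (t, 0) = c t"
        "\<And>t s. t \<in> K0 \<Longrightarrow> s \<in> cube \<epsilon> \<Longrightarrow> V (t, s) = V0 (t, s)" unfolding G_def by auto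
      note d = geodesic_variationD[OF V(1)]
      have xV: "V (x, 0) \<in> fst \<kappa>" using x V(5)[OF xK] by simp
      obtain \<epsilon>' where e: "\<epsilon>' > 0" "\<epsilon>' \<le> \<epsilon>" "\<And>s. s \<in> cube \<epsilon>' \<Longrightarrow> V (x, s) \<in> fst \<kappa>"
        "\<And>n. Ck_on n (cube \<epsilon>') (\<lambda>s. variation_coords \<kappa> K V (x, s))" "(\<lambda>s. variation_coords \<kappa> K V (x, s)) ` cube \<epsilon>' \<subseteq> ball (variation_coords \<kappa> K V (x, 0)) (r/2)"
        using variation_slice[OF V(1) k(1) xK xV, of "r/2"] r by auto
      have xI: "x \<in> I" using x by blast
      have cx: "variation_coords \<kappa> K V (x, 0) = lift_coords \<kappa> I c x"
        using velocity_open[OF I(1) d(2) xI xK, of "\<lambda>t. V (t, 0)" c] V(5) xK by (simp add: variation_coords_def lift_coords_def)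
      have sub: "(\<lambda>s. variation_coords \<kappa> K V (x, s)) ` cube \<epsilon>' \<subseteq> ball z r"
      proof (rule image_subsetI)
        fix s :: "real^'k" assume "s \<in> cube \<epsilon>'"
        then have "dist (lift_coords \<kappa> I c x) (variation_coords \<kappa> K V (x, s)) < r/2" using e(5) cx by auto
        moreover have "dist z (lift_coords \<kappa> I c x) < r/2" using x by simp
        ultimately show "variation_coords \<kappa> K V (x, s) \<in> ball z r"
          using dist_triangle[of z "variation_coords \<kappa> K V (x, s)" "lift_coords \<kappa> I c x"] by simp
      qed
      let ?J = "{x-\<delta><..<x+\<delta>}"
      obtain V2 where V2: "geodesic_variation M A S ?J \<epsilon>' V2"
        "\<And>s. s \<in> cube \<epsilon>' \<Longrightarrow> V2 (x, s) \<in> fst \<kappa> \<and> lift_coords \<kappa> ?J (\<lambda>t. V2 (t, s)) x = variation_coords \<kappa> K V (x, s)"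
        using LV[OF e(1) e(4) sub] by blast
      note d2 = geodesic_variationD[OF V2(1)]
      have xJ: "x \<in> ?J" using \<delta> by simp
      have lift_eq: "tlift A K (\<lambda>t. V (t, s)) x = tlift A ?J (\<lambda>t. V2 (t, s)) x" if s: "s \<in> cube \<epsilon>'" for s
      proof (rule tlift_eqI[OF k(1)])
        have "s \<in> cube \<epsilon>" using s cube_mono[OF e(2)] by blast
        from geodesic_ode(1)[OF d(5)[OF this] xK k(1) e(3)[OF s]]
        show "tlift A K (\<lambda>t. V (t, s)) x \<in> fst (slit_chart A \<kappa>)" .
        show "tlift A ?J (\<lambda>t. V2 (t, s)) x \<in> fst (slit_chart A \<kappa>)"
          using geodesic_ode(1)[OF d2(5)[OF s] xJ k(1)] V2(2)[OF s] by blast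
        show "lift_coords \<kappa> K (\<lambda>t. V (t, s)) x = lift_coords \<kappa> ?J (\<lambda>t. V2 (t, s)) x" using V2(2)[OF s] by (simp add: variation_coords_def)
      qed
      \<comment> \<open>The local piece may leave \<open>I\<close>, where there is no central
        geodesic to compare with, so it is cut back.\<close>
      let ?J' = "?J \<inter> I"
      have J': "open ?J'" "is_interval ?J'" "?J' \<subseteq> ?J" "x \<in> ?J'" "y \<in> ?J'"
      proof -
        show "open ?J'" using I(1) by auto
        show "is_interval ?J'" by (rule is_interval_Int[OF is_interval_oo I(2)])
        show "x \<in> ?J'" using xI xJ by blast
        have "dist a x < \<delta>/2" "dist a y < \<delta>/2" "y \<in> I" using x y by auto
        then have "\<bar>a - x\<bar> < \<delta>/2" "\<bar>a - y\<bar> < \<delta>/2" by (simp_all add: dist_real_def)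
        then have "x - \<delta> < y" "y < x + \<delta>" by (auto simp: abs_real_def split: if_splits)
        then show "y \<in> ?J'" using \<open>y \<in> I\<close> by simp
      qed auto
      have V2': "geodesic_variation M A S ?J' \<epsilon>' V2" by (rule geodesic_variation_subset[OF V2(1) e(1) order_refl J'(1-3)])
      have V': "geodesic_variation M A S K \<epsilon>' V" by (rule geodesic_variation_subset[OF V(1) e(1,2) d(2,3) order_refl])
      have z0: "0 \<in> cube \<epsilon>'" by (rule zero_in_cube[OF e(1)])
      \<comment> \<open>The central curve of the new piece has the same lift at x as
        \<open>c\<close>, hence is \<open>c\<close> by uniqueness.\<close>
      have V2c: "V2 (t, 0) = c t" if t: "t \<in> ?J'" for t
      proof -
        have g1: "geodesic M A S ?J' (\<lambda>t. V2 (t, 0))" by (rule geodesic_subset[OF d2(5)[OF z0] J'(1-3)])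
        have g2: "geodesic M A S ?J' c" by (rule geodesic_subset[OF c J'(1,2)]) simp
        have v1: "velocity A ?J' (\<lambda>t. V2 (t, 0)) x = velocity A ?J (\<lambda>t. V2 (t, 0)) x"
          by (rule velocity_open[OF _ J'(1) xJ J'(4)]) auto
        have v2: "velocity A ?J' c x = velocity A I c x" by (rule velocity_open[OF I(1) J'(1) xI J'(4)]) auto
        have v3: "velocity A K (\<lambda>t. V (t, 0)) x = velocity A I c x"
          by (rule velocity_open[OF I(1) d(2) xI xK]) (rule V(5))
        have "tlift A ?J' (\<lambda>t. V2 (t, 0)) x = tlift A ?J' c x"
          using lift_eq[OF z0] V(5)[OF xK] by (simp add: tlift_def v1 v2 v3)
        from geodesic_unique[OF g1 g2 J'(4) this t] show ?thesis by (simp add: tlift_def)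
      qed
      have "tlift A K (\<lambda>t. V (t, s)) x = tlift A ?J' (\<lambda>t. V2 (t, s)) x" if s: "s \<in> cube \<epsilon>'" for s
        using lift_eq[OF s] velocity_open[OF _ J'(1) xJ J'(4), of "\<lambda>t. V2 (t, s)" "\<lambda>t. V2 (t, s)"] by (simp add: tlift_def)
      from geodesic_variation_Un[OF V' V2' xK J'(4) this]
      obtain U where U: "geodesic_variation M A S (K \<union> ?J') \<epsilon>' U" "\<And>t s. t \<in> K \<Longrightarrow> s \<in> cube \<epsilon>' \<Longrightarrow> U (t, s) = V (t, s)"
        "\<And>t s. t \<in> ?J' \<Longrightarrow> s \<in> cube \<epsilon>' \<Longrightarrow> U (t, s) = V2 (t, s)" by blast
      have "G (K \<union> ?J') \<epsilon>' U"
        unfolding G_def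
      proof (intro conjI ballI)
        show "U (t, 0) = c t" if "t \<in> K \<union> ?J'" for t
          using that U(2,3)[OF _ z0] V(5) V2c by fastforce
        show "U (t, s) = V0 (t, s)" if "t \<in> K0" "s \<in> cube \<epsilon>'" for t s
          using U(2)[of t s] V(6)[of t s] V(3) that cube_mono[OF e(2)] by (auto simp: subset_eq)
      qed (use U(1) V e in auto)
      then show "P y" unfolding P_def using J'(5) by blast
    qed
    show "\<exists>Q. openin (top_of_set I) Q \<and> a \<in> Q \<and> (\<forall>x\<in>Q. \<forall>y\<in>Q. P x \<longrightarrow> P y)"
      unfolding openin_open_eq[OF I(1)] using Q step by (intro exI[of _ ?Q]) blast
  qed
  then show thesis unfolding P_def G_def using that by blast
qed

end

section \<open>Parallel fields and Jacobi fields\<close>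

lemma bounded_bilinear_matrix_vector: "bounded_bilinear ((*v) :: real^'n^'m \<Rightarrow> real^'n \<Rightarrow> real^'m)"
  unfolding bilinear_conv_bounded_bilinear[symmetric] bilinear_def
  by (auto intro!: linearI simp: algebra_simps matrix_vector_mult_scaleR scaleR_matrix_vector_assoc)

lemma bounded_bilinear_matrix_matrix: "bounded_bilinear ((**) :: real^'n^'m \<Rightarrow> real^'l^'n \<Rightarrow> real^'l^'m)"
  unfolding bilinear_conv_bounded_bilinear[symmetric] bilinear_def
  by (auto intro!: linearI simp: vec_eq_iff matrix_matrix_mult_def sum.distrib sum_distrib_left algebra_simps)

lemma Ck_on_vecI:
  fixes f :: "'a::euclidean_space \<Rightarrow> 'b::euclidean_space^'n"
  assumes "thick S" "\<And>i. Ck_on k S (\<lambda>x. f x $ i)"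
  shows "Ck_on k S f"
proof (rule Ck_on_componentwise[OF assms(1)])
  fix b :: "'b^'n" assume "b \<in> Basis"
  then obtain i u where "b = axis i u" by (auto simp: Basis_vec_def)
  then show "Ck_on k S (\<lambda>x. f x \<bullet> b)" using Ck_on_inner_left[OF assms, of i u] by (simp add: inner_axis)
qed

lemma Ck_on_vec_nth: "thick S \<Longrightarrow> Ck_on k S f \<Longrightarrow> Ck_on k S (\<lambda>x. f x $ i)"
  by (rule Ck_on_bounded_linear[OF _ bounded_linear_vec_nth])

lemma has_vector_derivative_unique_thick:
  assumes "thick S" "t \<in> S" "(f has_vector_derivative a) (at t within S)" "(f has_vector_derivative b) (at t within S)"
  shows "a = b"
  using vector_derivative_eqI[OF assms(1,2,3)] vector_derivative_eqI[OF assms(1,2,4)] by simp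

context spray_mfd
begin

text \<open>Covers geodesics on open intervals together with their restrictions to compact ones.\<close>

definition geodesic_on :: "real set \<Rightarrow> (real \<Rightarrow> 'm) \<Rightarrow> bool" where
  "geodesic_on I c \<longleftrightarrow> is_interval I \<and> thick I \<and> c ` I \<subseteq> topspace M \<and>
     (\<forall>\<kappa>\<in>A. \<exists>U. open U \<and> I \<inter> c -` fst \<kappa> = I \<inter> U) \<and> (\<forall>t\<in>I. velocity A I c t \<in> T (c t)) \<and>
     (\<forall>\<kappa>\<in>A. \<forall>t\<in>I. c t \<in> fst \<kappa> \<longrightarrow> lift_coords \<kappa> I c t \<in> slit_image \<kappa> \<and>
        (lift_coords \<kappa> I c has_vector_derivative F \<kappa> (lift_coords \<kappa> I c t)) (at t within I))"

lemma geodesic_onD: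
  assumes "geodesic_on I c"
  shows "is_interval I" "thick I" "\<And>t. t \<in> I \<Longrightarrow> \<exists>\<kappa>\<in>A. c t \<in> fst \<kappa>"
    "\<And>\<kappa>. \<kappa> \<in> A \<Longrightarrow> \<exists>U. open U \<and> I \<inter> c -` fst \<kappa> = I \<inter> U" "\<And>t. t \<in> I \<Longrightarrow> velocity A I c t \<in> T (c t)"
    "\<And>\<kappa> t. \<kappa> \<in> A \<Longrightarrow> t \<in> I \<Longrightarrow> c t \<in> fst \<kappa> \<Longrightarrow> lift_coords \<kappa> I c t \<in> slit_image \<kappa>"
    "\<And>\<kappa> t. \<kappa> \<in> A \<Longrightarrow> t \<in> I \<Longrightarrow> c t \<in> fst \<kappa> \<Longrightarrow> (lift_coords \<kappa> I c has_vector_derivative F \<kappa> (lift_coords \<kappa> I c t)) (at t within I)"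
  using assms chart_exists unfolding geodesic_on_def by blast+

text \<open>The times spent in a chart are cut out of \<open>I\<close> by an open set, which
  preserves thickness and does not affect derivatives. Smoothness along \<open>c\<close>, stated
  chart by chart, thus yields derivatives within \<open>I\<close>.\<close>

lemma geodesic_on_domain:
  assumes g: "geodesic_on I c" and k: "\<kappa> \<in> A"
  shows "thick (I \<inter> c -` fst \<kappa>)" "\<And>t. t \<in> I \<Longrightarrow> c t \<in> fst \<kappa> \<Longrightarrow> at t within (I \<inter> c -` fst \<kappa>) = at t within I"
proof -
  obtain U where U: "open U" "I \<inter> c -` fst \<kappa> = I \<inter> U" using geodesic_onD(4)[OF g k] by blast
  show "thick (I \<inter> c -` fst \<kappa>)" unfolding U(2) by (rule thick_Int_open[OF geodesic_onD(2)[OF g] U(1)])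
  fix t assume "t \<in> I" "c t \<in> fst \<kappa>"
  then have "t \<in> U" using U(2) by blast
  then show "at t within (I \<inter> c -` fst \<kappa>) = at t within I" unfolding U(2) by (rule at_within_Int_open'[OF _ U(1)])
qed

lemma geodesic_on_geodesic:
  assumes g: "geodesic M A S I c"
  shows "geodesic_on I c"
  unfolding geodesic_on_def
proof (intro conjI ballI impI)
  note d = geodesicD[OF g]
  show "is_interval I" by (rule d(2))
  show "thick I" by (rule thick_open[OF d(1)])
  show "c ` I \<subseteq> topspace M" by (rule smooth_map_topspace[OF d(1,3)])
  show "\<exists>U. open U \<and> I \<inter> c -` fst \<kappa> = I \<inter> U" if "\<kappa> \<in> A" for \<kappa>
    by (rule exI[of _ "I \<inter> c -` fst \<kappa>"]) (use smooth_map_open[OF d(1,3) chart_openin[OF that]] in auto)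
  show "velocity A I c t \<in> T (c t)" if "t \<in> I" for t by (rule smooth_curve_velocity(1)[OF d(1,3) that])
  fix \<kappa> t assume "\<kappa> \<in> A" "t \<in> I" "c t \<in> fst \<kappa>"
  then show "lift_coords \<kappa> I c t \<in> slit_image \<kappa>" "(lift_coords \<kappa> I c has_vector_derivative F \<kappa> (lift_coords \<kappa> I c t)) (at t within I)"
    using geodesic_ode(2,3)[OF g] has_vector_derivative_at_within by blast+
qed

text \<open>By \<open>t0 < t1\<close> the interval is thick, so the one-sided derivatives in
  \<open>velocity\<close> are unique and equal to those of the extending geodesic; the equation then
  restricts.\<close>

lemma geodesic_on_closed:
  assumes g: "geodesic M A S I' c'" and sub: "{t0..t1} \<subseteq> I'" and lt: "t0 < t1" and eq: "\<And>t. t \<in> {t0..t1} \<Longrightarrow> c' t = c t"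
  shows "geodesic_on {t0..t1} c" "\<And>t. t \<in> {t0..t1} \<Longrightarrow> velocity A {t0..t1} c t = velocity A I' c' t"
proof -
  let ?I = "{t0..t1}"
  note d = geodesicD[OF g]
  have tI: "thick ?I" by (rule thick_cbox_real[OF lt])
  let ?U = "\<lambda>\<kappa>. I' \<inter> c' -` fst \<kappa>"
  have U: "open (?U \<kappa>)" if "\<kappa> \<in> A" for \<kappa> by (rule smooth_map_open[OF d(1,3) chart_openin[OF that]])
  have UI: "?I \<inter> c -` fst \<kappa> = ?I \<inter> ?U \<kappa>" for \<kappa> using sub eq by auto
  have vel: "velocity A ?I c t \<in> T (c t)" "\<And>\<kappa>. \<kappa> \<in> A \<Longrightarrow> c t \<in> fst \<kappa> \<Longrightarrow> velocity A ?I c t \<kappa> = velocity A I' c' t \<kappa>"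
    if t: "t \<in> ?I" for t
  proof -
    have nb: "at t within ?I \<noteq> bot" by (rule thick_real_not_bot[OF tI t])
    have D: "((\<lambda>\<tau>. snd \<kappa> (c \<tau>)) has_vector_derivative velocity A I' c' t \<kappa>) (at t within ?I)" if "\<kappa> \<in> A" "c t \<in> fst \<kappa>" for \<kappa>
    proof -
      have "c' t \<in> fst \<kappa>" "t \<in> I'" using that eq t sub by auto
      from smooth_curve_velocity(2)[OF d(1,3) this(2) that(1) this(1)]
      have "((\<lambda>\<tau>. snd \<kappa> (c' \<tau>)) has_vector_derivative velocity A I' c' t \<kappa>) (at t within ?I)"
        by (rule has_vector_derivative_at_within)
      then show ?thesis by (rule has_vector_derivative_transform[OF t, rotated]) (simp add: eq)
    qed
    have ev: "eventually (\<lambda>\<tau>. c \<tau> \<in> fst \<kappa>) (at t within ?I)" if "\<kappa> \<in> A" "c t \<in> fst \<kappa>" for \<kappa>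
      unfolding eventually_at_topological
      by (rule exI[of _ "?U \<kappa>"]) (use U[OF that(1)] that eq t sub in auto)
    show "velocity A ?I c t \<in> T (c t)" by (rule velocity_tangent(1)[OF nb t D ev])
    show "velocity A ?I c t \<kappa> = velocity A I' c' t \<kappa>" if "\<kappa> \<in> A" "c t \<in> fst \<kappa>" for \<kappa>
      by (rule velocity_tangent(2)[OF nb t D ev that])
  qed
  have lift_coords: "lift_coords \<kappa> ?I c t = lift_coords \<kappa> I' c' t" if "t \<in> ?I" "\<kappa> \<in> A" "c t \<in> fst \<kappa>" for \<kappa> t
    using vel(2)[OF that] eq[OF that(1)] by (simp add: lift_coords_def)
  show "velocity A ?I c t = velocity A I' c' t" if t: "t \<in> ?I" for t
  proof -
    have t': "t \<in> I'" using t sub by blast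
    obtain \<kappa> where k: "\<kappa> \<in> A" "c' t \<in> fst \<kappa>" using smooth_map_chart[OF d(3) t'] by blast
    have "velocity A I' c' t \<in> T (c t)" using smooth_curve_velocity(1)[OF d(1,3) t'] eq[OF t] by simp
    then show ?thesis using vel[OF t] k eq[OF t] by (intro tangent_eqI[of _ "c t" _ \<kappa>]) auto
  qed
  show "geodesic_on ?I c"
    unfolding geodesic_on_def
  proof (intro conjI ballI impI)
    show "is_interval ?I" by (rule is_interval_cc)
    show "thick ?I" by (rule tI)
    show "c ` ?I \<subseteq> topspace M" using smooth_map_topspace[OF d(1,3)] sub eq by force
    show "\<exists>U. open U \<and> ?I \<inter> c -` fst \<kappa> = ?I \<inter> U" if "\<kappa> \<in> A" for \<kappa> using U[OF that] UI by blast
    show "velocity A ?I c t \<in> T (c t)" if "t \<in> ?I" for t by (rule vel(1)[OF that])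
    fix \<kappa> t assume k: "\<kappa> \<in> A" and t: "t \<in> ?I" and ck: "c t \<in> fst \<kappa>"
    have tU: "t \<in> ?U \<kappa>" using t ck sub eq by auto
    then have g': "lift_coords \<kappa> I' c' t \<in> slit_image \<kappa>" "(lift_coords \<kappa> I' c' has_vector_derivative F \<kappa> (lift_coords \<kappa> I' c' t)) (at t within ?I \<inter> ?U \<kappa>)"
      using geodesic_ode(2,3)[OF g _ k, of t] has_vector_derivative_at_within by blast+
    show "lift_coords \<kappa> ?I c t \<in> slit_image \<kappa>" using g'(1) lift_coords[OF t k ck] by simp
    have tIU: "t \<in> ?I \<inter> ?U \<kappa>" using t tU by blast
    have "(lift_coords \<kappa> ?I c has_vector_derivative F \<kappa> (lift_coords \<kappa> I' c' t)) (at t within ?I \<inter> ?U \<kappa>)"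
    proof (rule has_vector_derivative_transform[OF tIU _ g'(2)])
      fix s assume s: "s \<in> ?I \<inter> ?U \<kappa>"
      then have "c s \<in> fst \<kappa>" using eq[of s] by simp
      then show "lift_coords \<kappa> ?I c s = lift_coords \<kappa> I' c' s" using lift_coords[of s \<kappa>] k s by blast
    qed
    then show "(lift_coords \<kappa> ?I c has_vector_derivative F \<kappa> (lift_coords \<kappa> ?I c t)) (at t within ?I)"
      unfolding at_within_Int_open'[OF tU U[OF k]] lift_coords[OF t k ck] .
  qed
qed

text \<open>Near each time the curve stays in one chart and the linearized equation along it has
  bounded coefficients. The uniqueness arguments for parallel fields and for Jacobi fields both rest
  on this.\<close>

lemma geodesic_on_bound:
  assumes g: "geodesic_on I c" and a: "a \<in> I" and k: "\<kappa> \<in> A" "c a \<in> fst \<kappa>"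
  obtains d L where "d > 0" "L \<ge> 0" "\<And>t. t \<in> I \<Longrightarrow> \<bar>t - a\<bar> < d \<Longrightarrow> c t \<in> fst \<kappa>"
    "\<And>t w. t \<in> I \<Longrightarrow> \<bar>t - a\<bar> < d \<Longrightarrow> norm (DF \<kappa> (lift_coords \<kappa> I c t) w) \<le> L * norm w"
proof -
  obtain U where U: "open U" "I \<inter> c -` fst \<kappa> = I \<inter> U" using geodesic_onD(4)[OF g k(1)] by blast
  have aU: "a \<in> U" using U(2) a k(2) by blast
  obtain R L where R: "R > 0" "L \<ge> 0"
    "\<And>x w. x \<in> cball (lift_coords \<kappa> I c a) R \<Longrightarrow> norm (DF \<kappa> x w) \<le> L * norm w"
    using C1_locally_lipschitz[OF slit_image_open[OF k(1)] F_Ck[OF k(1)] geodesic_onD(6)[OF g k(1) a k(2)]] by metis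
  have "continuous (at a within I) (lift_coords \<kappa> I c)"
    using geodesic_onD(7)[OF g k(1) a k(2)] has_vector_derivative_continuous by blast
  then obtain d1 where d1: "d1 > 0" "\<And>t. t \<in> I \<Longrightarrow> dist t a < d1 \<Longrightarrow> dist (lift_coords \<kappa> I c t) (lift_coords \<kappa> I c a) < R"
    unfolding continuous_within_eps_delta using R(1) by blast
  obtain d2 where d2: "d2 > 0" "ball a d2 \<subseteq> U" using U(1) aU open_contains_ball by blast
  show thesis
  proof (rule that[of "min d1 d2" L])
    fix t assume t: "t \<in> I" "\<bar>t - a\<bar> < min d1 d2"
    then have "t \<in> ball a d2" by (simp add: dist_real_def abs_minus_commute)
    then have "t \<in> I \<inter> U" using t d2 by blast
    then show "c t \<in> fst \<kappa>" using U(2) by blast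
    have "dist (lift_coords \<kappa> I c t) (lift_coords \<kappa> I c a) < R" using d1(2)[OF t(1)] t(2) by (simp add: dist_real_def)
    then show "norm (DF \<kappa> (lift_coords \<kappa> I c t) w) \<le> L * norm w" for w
      by (intro R(3)) (simp add: dist_commute)
  qed (use d1 d2 R in auto)
qed

lemma geodesic_on_induct:
  assumes g: "geodesic_on I c" and t: "t0 \<in> I" "t \<in> I" "P t0"
    and step: "\<And>a. a \<in> I \<Longrightarrow> \<exists>e>0. \<forall>x\<in>I. \<forall>y\<in>I. \<bar>x - a\<bar> < e \<longrightarrow> \<bar>y - a\<bar> < e \<longrightarrow> P x \<longrightarrow> P y"
  shows "P t"
proof (rule connected_induction_simple[of I t0 t P, OF _ t])
  show "connected I" using geodesic_onD(1)[OF g] is_interval_connected by blast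
  fix a assume a: "a \<in> I"
  obtain e where e: "e > 0" "\<And>x y. x \<in> I \<Longrightarrow> y \<in> I \<Longrightarrow> \<bar>x - a\<bar> < e \<Longrightarrow> \<bar>y - a\<bar> < e \<Longrightarrow> P x \<Longrightarrow> P y"
    using step[OF a] by blast
  show "\<exists>Q. openin (top_of_set I) Q \<and> a \<in> Q \<and> (\<forall>x\<in>Q. \<forall>y\<in>Q. P x \<longrightarrow> P y)"
  proof (intro exI[of _ "I \<inter> ball a e"] conjI ballI impI)
    show "openin (top_of_set I) (I \<inter> ball a e)" by (simp add: openin_open_Int)
    show "a \<in> I \<inter> ball a e" using a e by simp
    fix x y assume "x \<in> I \<inter> ball a e" "y \<in> I \<inter> ball a e" "P x"
    then show "P y" using e(2)[of x y] by (auto simp: dist_real_def abs_minus_commute)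
  qed
qed

text \<open>This is X' = - N X written through F: since F = (y, - 2 G), half the second component of
  \<open>DF \<kappa> z (0, w)\<close> is - N w. Smoothness is not part of it and is carried
  separately where needed.\<close>

definition parallel_along :: "real set \<Rightarrow> (real \<Rightarrow> 'm) \<Rightarrow> (real \<Rightarrow> ('m, real^'n) tvec) \<Rightarrow> bool" where
  "parallel_along I c X \<longleftrightarrow> (\<forall>t\<in>I. X t \<in> T (c t)) \<and> (\<forall>\<kappa>\<in>A. \<forall>t\<in>I. c t \<in> fst \<kappa> \<longrightarrow>
     ((\<lambda>\<tau>. X \<tau> \<kappa>) has_vector_derivative (1/2) *\<^sub>R snd (DF \<kappa> (lift_coords \<kappa> I c t) (0, X t \<kappa>))) (at t within I))"

lemma parallel_alongD:
  assumes "parallel_along I c X" "t \<in> I"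
  shows "X t \<in> T (c t)"
    "\<And>\<kappa>. \<kappa> \<in> A \<Longrightarrow> c t \<in> fst \<kappa> \<Longrightarrow> ((\<lambda>\<tau>. X \<tau> \<kappa>) has_vector_derivative (1/2) *\<^sub>R snd (DF \<kappa> (lift_coords \<kappa> I c t) (0, X t \<kappa>))) (at t within I)"
  using assms unfolding parallel_along_def by blast+

lemma DF_linear: "\<kappa> \<in> A \<Longrightarrow> z \<in> slit_image \<kappa> \<Longrightarrow> linear (DF \<kappa> z)"
  using F_derivative has_derivative_linear by blast

text \<open>In a chart a parallel field solves a linear equation with bounded coefficients. Applied
  to combinations of frame fields with constant coefficients, this carries linear independence from
  one time to all others.\<close>

lemma parallel_along_unique:
  assumes g: "geodesic_on I c" and X: "parallel_along I c X" and t: "t0 \<in> I" "X t0 = 0" "t \<in> I"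
  shows "X t = 0"
proof (rule geodesic_on_induct[OF g t(1,3), of "\<lambda>t. X t = 0", OF t(2)])
  fix a assume a: "a \<in> I"
  obtain \<kappa> where k: "\<kappa> \<in> A" "c a \<in> fst \<kappa>" using geodesic_onD(3)[OF g a] by blast
  obtain d L where d: "d > 0" "L \<ge> 0" "\<And>t. t \<in> I \<Longrightarrow> \<bar>t - a\<bar> < d \<Longrightarrow> c t \<in> fst \<kappa>"
    "\<And>t w. t \<in> I \<Longrightarrow> \<bar>t - a\<bar> < d \<Longrightarrow> norm (DF \<kappa> (lift_coords \<kappa> I c t) w) \<le> L * norm w"
    using geodesic_on_bound[OF g a k] by metis
  have B: "norm ((1/2) *\<^sub>R snd (DF \<kappa> (lift_coords \<kappa> I c t) (0, X t \<kappa>))) \<le> L * norm (X t \<kappa>)" if "t \<in> I" "\<bar>t - a\<bar> < d" for t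
  proof -
    have "norm (snd (DF \<kappa> (lift_coords \<kappa> I c t) (0, X t \<kappa>))) \<le> norm (DF \<kappa> (lift_coords \<kappa> I c t) (0, X t \<kappa>))" by (metis norm_snd_le prod.collapse)
    also have "\<dots> \<le> L * norm (X t \<kappa>)" using d(4)[OF that, of "(0, X t \<kappa>)"] by simp
    finally have *: "norm (snd (DF \<kappa> (lift_coords \<kappa> I c t) (0, X t \<kappa>))) \<le> L * norm (X t \<kappa>)" .
    have "L * norm (X t \<kappa>) \<ge> 0" using d(2) by simp
    then show ?thesis using * unfolding norm_scaleR by simp
  qed
  have D: "((\<lambda>\<tau>. X \<tau> \<kappa>) has_vector_derivative (1/2) *\<^sub>R snd (DF \<kappa> (lift_coords \<kappa> I c t) (0, X t \<kappa>))) (at t within I)"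
    if "t \<in> I" "\<bar>t - a\<bar> < d" for t by (rule parallel_alongD(2)[OF X that(1) k(1) d(3)[OF that]])
  obtain e where e: "e > 0" "\<And>t0 t. t0 \<in> I \<Longrightarrow> t \<in> I \<Longrightarrow> \<bar>t0 - a\<bar> < e \<Longrightarrow> \<bar>t - a\<bar> < e \<Longrightarrow> X t0 \<kappa> = 0 \<Longrightarrow> X t \<kappa> = 0"
    using linear_ode_unique_local[where X="\<lambda>\<tau>. X \<tau> \<kappa>" and ?t1.0=a, OF geodesic_onD(1)[OF g] d(1,2) D B] by blast
  show "\<exists>e>0. \<forall>x\<in>I. \<forall>y\<in>I. \<bar>x - a\<bar> < e \<longrightarrow> \<bar>y - a\<bar> < e \<longrightarrow> X x = 0 \<longrightarrow> X y = 0"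
  proof (intro exI[of _ "min d e"] conjI ballI impI)
    fix x y assume xy: "x \<in> I" "y \<in> I" "\<bar>x - a\<bar> < min d e" "\<bar>y - a\<bar> < min d e" "X x = 0"
    then have "X y \<kappa> = 0" using e(2)[of x y] by simp
    moreover have "c y \<in> fst \<kappa>" using d(3)[OF xy(2)] xy(4) by simp
    ultimately show "X y = 0" using tangent_eq_0_iff[OF parallel_alongD(1)[OF X xy(2)] k(1)] by blast
  qed (use d e in auto)
qed

lemma tvec_sum_apply: "(\<Sum>j\<in>J. w j *\<^sub>R (X j :: ('m, real^'n) tvec)) \<kappa> = (\<Sum>j\<in>J. w j *\<^sub>R X j \<kappa>)"
  by (induction J rule: infinite_finite_induct) (auto simp: scaleR_fun_def)

lemma parallel_along_sum:
  assumes g: "geodesic_on I c" and X: "\<And>j. j \<in> J \<Longrightarrow> parallel_along I c (X j)"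
  shows "parallel_along I c (\<lambda>t. \<Sum>j\<in>J. w j *\<^sub>R X j t)"
  unfolding parallel_along_def
proof (intro conjI ballI impI)
  show "(\<Sum>j\<in>J. w j *\<^sub>R X j t) \<in> T (c t)" if "t \<in> I" for t
    by (intro tangent_sum tangent_scaleR parallel_alongD(1)[OF X that])
  fix \<kappa> t assume k: "\<kappa> \<in> A" and t: "t \<in> I" and ck: "c t \<in> fst \<kappa>"
  let ?L = "\<lambda>y. (1/2) *\<^sub>R snd (DF \<kappa> (lift_coords \<kappa> I c t) (0, y))"
  have L: "linear ?L"
    using DF_linear[OF k geodesic_onD(6)[OF g k t ck]]
    by (intro linearI) (auto simp: linear_add[of "DF \<kappa> _" "(0, _)" "(0, _)", simplified] linear_cmul[of "DF \<kappa> _" _ "(0, _)", simplified] scaleR_add_right)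
  have "((\<lambda>\<tau>. \<Sum>j\<in>J. w j *\<^sub>R X j \<tau> \<kappa>) has_vector_derivative (\<Sum>j\<in>J. w j *\<^sub>R ?L (X j t \<kappa>))) (at t within I)"
    by (intro has_vector_derivative_sum bounded_linear.has_vector_derivative[OF bounded_linear_scaleR_right] parallel_alongD(2)[OF X t k ck])
  moreover have "(\<Sum>j\<in>J. w j *\<^sub>R ?L (X j t \<kappa>)) = ?L (\<Sum>j\<in>J. w j *\<^sub>R X j t \<kappa>)"
    by (simp only: linear_sum[OF L] linear_cmul[OF L])
  ultimately show "((\<lambda>\<tau>. (\<Sum>j\<in>J. w j *\<^sub>R X j \<tau>) \<kappa>) has_vector_derivative ?L ((\<Sum>j\<in>J. w j *\<^sub>R X j t) \<kappa>)) (at t within I)"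
    unfolding tvec_sum_apply by simp
qed

lemma parallel_along_velocity:
  assumes g: "geodesic_on I c"
  shows "parallel_along I c (velocity A I c)"
  unfolding parallel_along_def
proof (intro conjI ballI impI)
  show "velocity A I c t \<in> T (c t)" if "t \<in> I" for t by (rule geodesic_onD(5)[OF g that])
  fix \<kappa> t assume k: "\<kappa> \<in> A" "t \<in> I" "c t \<in> fst \<kappa>"
  have "((\<lambda>\<tau>. snd (lift_coords \<kappa> I c \<tau>)) has_vector_derivative snd (F \<kappa> (lift_coords \<kappa> I c t))) (at t within I)"
    by (rule bounded_linear.has_vector_derivative[OF bounded_linear_snd geodesic_onD(7)[OF g k]])
  moreover have "snd (F \<kappa> (lift_coords \<kappa> I c t)) = (1/2) *\<^sub>R snd (DF \<kappa> (lift_coords \<kappa> I c t) (0, velocity A I c t \<kappa>))"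
    using F_Euler[OF k(1) geodesic_onD(6)[OF g k, unfolded lift_coords_def]] by (simp add: lift_coords_def)
  ultimately show "((\<lambda>\<tau>. velocity A I c \<tau> \<kappa>) has_vector_derivative (1/2) *\<^sub>R snd (DF \<kappa> (lift_coords \<kappa> I c t) (0, velocity A I c t \<kappa>))) (at t within I)"
    by (simp add: lift_coords_def)
qed

section \<open>The matrices N and \<Phi> expressed by derivatives of F\<close>

lemma spray_N_mult:
  assumes k: "\<kappa> \<in> A" and z: "z \<in> slit_image \<kappa>"
  shows "spray_N A S \<kappa> z *v w = - ((1/2) *\<^sub>R snd (DF \<kappa> z (0, w)))"
    and "frechet_derivative (\<lambda>u. spray_G A S \<kappa> u $ i) (at z) = (\<lambda>d. - (1/2) * snd (DF \<kappa> z d) $ i)"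
proof -
  have G: "frechet_derivative (\<lambda>u. spray_G A S \<kappa> u $ i) (at z) = (\<lambda>d. - (1/2) * snd (DF \<kappa> z d) $ i)" for i
  proof (rule frechet_derivative_at[symmetric])
    have "((\<lambda>u. - (1/2) * snd (F \<kappa> u) $ i) has_derivative (\<lambda>d. - (1/2) * snd (DF \<kappa> z d) $ i)) (at z)"
      by (intro has_derivative_mult_right bounded_linear.has_derivative[OF bounded_linear_vec_nth] has_derivative_snd F_derivative k z)
    then show "((\<lambda>u. spray_G A S \<kappa> u $ i) has_derivative (\<lambda>d. - (1/2) * snd (DF \<kappa> z d) $ i)) (at z)"
      by (simp add: spray_G_def F_def)
  qed
  show "frechet_derivative (\<lambda>u. spray_G A S \<kappa> u $ i) (at z) = (\<lambda>d. - (1/2) * snd (DF \<kappa> z d) $ i)" by (rule G)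
  let ?L = "\<lambda>w. - ((1/2) *\<^sub>R snd (DF \<kappa> z (0, w)))"
  have L: "linear ?L"
    using DF_linear[OF k z]
    by (intro linearI) (auto simp: linear_add[of "DF \<kappa> _" "(0, _)" "(0, _)", simplified] linear_cmul[of "DF \<kappa> _" _ "(0, _)", simplified] scaleR_add_right)
  have "spray_N A S \<kappa> z = matrix ?L" unfolding spray_N_def G matrix_def by (simp add: vec_eq_iff)
  then show "spray_N A S \<kappa> z *v w = ?L w" using matrix_vector_mul(2)[OF L] by metis
qed

lemma spray_N_Ck:
  assumes k: "\<kappa> \<in> A"
  shows "Ck_on n (slit_image \<kappa>) (spray_N A S \<kappa>)"
proof -
  note t = thick_open[OF slit_image_open[OF k]]
  have "Ck_on n (slit_image \<kappa>) (\<lambda>z. spray_N A S \<kappa> z $ i $ j)" for i j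
  proof -
    have "Ck_on n (slit_image \<kappa>) (\<lambda>z. - (1/2) *\<^sub>R (snd (DF \<kappa> z (0, axis j 1)) $ i))"
      by (rule Ck_on_scaleR[OF t Ck_on_const[OF t] Ck_on_vec_nth[OF t Ck_on_snd[OF t
            Ck_on_frechet_comp[OF slit_image_open[OF k] t _ F_Ck[OF k] Ck_on_ident[OF t] Ck_on_const[OF t]]]]]) auto
    then show ?thesis
      by (rule Ck_on_cong[THEN iffD1, rotated]) (simp add: spray_N_def spray_N_mult(2)[OF k])
  qed
  then show ?thesis by (intro Ck_on_vecI t)
qed

abbreviation DN :: "('m, real^'n) chart \<Rightarrow> (real^'n) \<times> (real^'n) \<Rightarrow> (real^'n) \<times> (real^'n) \<Rightarrow> real^'n^'n" where
  "DN \<kappa> z \<equiv> frechet_derivative (spray_N A S \<kappa>) (at z)"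

lemma N_derivative: "\<kappa> \<in> A \<Longrightarrow> z \<in> slit_image \<kappa> \<Longrightarrow> (spray_N A S \<kappa> has_derivative DN \<kappa> z) (at z)"
  by (rule Ck_on_Suc_open_D[OF slit_image_open spray_N_Ck])

text \<open>With F = (y, - 2 G), the term 2 \<partial>G/\<partial>x of the index formula is minus
  the x-derivative of the second component of F, S(N) is the derivative of N in the direction F, and
  the sum over r is N N. In this form \<Phi> combines with derivatives along a geodesic, whose state
  moves in the direction F.\<close>

lemma spray_Phi_mult:
  assumes k: "\<kappa> \<in> A" and z: "z \<in> slit_image \<kappa>"
  shows "spray_Phi A S \<kappa> z *v w = - snd (DF \<kappa> z (w, 0)) - DN \<kappa> z (F \<kappa> z) *v w - spray_N A S \<kappa> z *v (spray_N A S \<kappa> z *v w)"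
proof -
  have dN: "frechet_derivative (\<lambda>u. spray_N A S \<kappa> u $ i $ j) (at z) = (\<lambda>d. DN \<kappa> z d $ i $ j)" for i j
    by (rule frechet_derivative_at[symmetric])
      (intro bounded_linear.has_derivative[OF bounded_linear_vec_nth] N_derivative k z)
  let ?L = "\<lambda>w. - snd (DF \<kappa> z (w, 0))"
  have L: "linear ?L"
    using DF_linear[OF k z]
    by (intro linearI) (auto simp: linear_add[of "DF \<kappa> _" "(_, 0)" "(_, 0)", simplified] linear_cmul[of "DF \<kappa> _" _ "(_, 0)", simplified])
  have "spray_Phi A S \<kappa> z = matrix ?L - DN \<kappa> z (F \<kappa> z) - spray_N A S \<kappa> z ** spray_N A S \<kappa> z"
    unfolding spray_Phi_def dN spray_N_mult(2)[OF k z] matrix_def F_def[symmetric]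
    by (simp add: vec_eq_iff matrix_matrix_mult_def)
  moreover have "matrix ?L *v w = ?L w" using matrix_vector_mul(2)[OF L] by metis
  ultimately show ?thesis by (simp add: matrix_vector_mult_diff_rdistrib matrix_vector_mul_assoc)
qed

lemma N_along_eq: "N_along A S I c \<kappa> t = spray_N A S \<kappa> (lift_coords \<kappa> I c t)"
  and Phi_along_eq: "Phi_along A S I c \<kappa> t = spray_Phi A S \<kappa> (lift_coords \<kappa> I c t)"
  by (simp_all add: N_along_def Phi_along_def tlift_def slit_coord lift_coords_def)

lemma N_along_derivative:
  assumes g: "geodesic_on I c" and k: "\<kappa> \<in> A" "t \<in> I" "c t \<in> fst \<kappa>"
  shows "(N_along A S I c \<kappa> has_vector_derivative DN \<kappa> (lift_coords \<kappa> I c t) (F \<kappa> (lift_coords \<kappa> I c t))) (at t within I)"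
proof -
  have "(spray_N A S \<kappa> has_derivative DN \<kappa> (lift_coords \<kappa> I c t)) (at (lift_coords \<kappa> I c t) within lift_coords \<kappa> I c ` I)"
    by (rule has_derivative_at_withinI[OF N_derivative[OF k(1) geodesic_onD(6)[OF g k]]])
  from vector_derivative_diff_chain_within[OF geodesic_onD(7)[OF g k] this]
  show ?thesis by (simp add: o_def N_along_eq[abs_def])
qed

lemma parallel_vec_parallel_along:
  assumes g: "geodesic_on I c" and X: "parallel_vec A S I c X"
  shows "parallel_along I c X"
  unfolding parallel_along_def
proof (intro conjI ballI impI)
  have XT: "\<forall>t\<in>I. X t \<in> T (c t)"
    using X unfolding parallel_vec_def vector_field_along_def by (elim conjE)
  have XC: "\<forall>\<kappa>\<in>A. smooth_on (I \<inter> c -` fst \<kappa>) (\<lambda>t. X t \<kappa>)"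
    using X unfolding parallel_vec_def vector_field_along_def by (elim conjE)
  have N: "\<forall>t\<in>I. nabla_vec A S I c X t = 0"
    using X unfolding parallel_vec_def vector_field_along_def by (elim conjE)
  show "X t \<in> T (c t)" if "t \<in> I" for t using XT that by blast
  fix \<kappa> t assume k: "\<kappa> \<in> A" "t \<in> I" "c t \<in> fst \<kappa>"
  have "t \<in> I \<inter> c -` fst \<kappa>" using k by simp
  from Ck_on_Suc_vectorD(1)[OF geodesic_on_domain(1)[OF g k(1)] smooth_onD[OF bspec[OF XC k(1)]] this]
  have D: "((\<lambda>t. X t \<kappa>) has_vector_derivative vector_derivative (\<lambda>t. X t \<kappa>) (at t within I)) (at t within I)"
    unfolding geodesic_on_domain(2)[OF g k] .
  have "nabla_vec A S I c X t \<kappa> = 0" using bspec[OF N k(2)] by simp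
  then have "vector_derivative (\<lambda>t. X t \<kappa>) (at t within I) = - (N_along A S I c \<kappa> t *v X t \<kappa>)"
    using k by (simp add: nabla_vec_def eq_neg_iff_add_eq_0)
  also have "\<dots> = (1/2) *\<^sub>R snd (DF \<kappa> (lift_coords \<kappa> I c t) (0, X t \<kappa>))"
    using spray_N_mult(1)[OF k(1) geodesic_onD(6)[OF g k]] by (simp add: N_along_eq)
  finally show "((\<lambda>\<tau>. X \<tau> \<kappa>) has_vector_derivative (1/2) *\<^sub>R snd (DF \<kappa> (lift_coords \<kappa> I c t) (0, X t \<kappa>))) (at t within I)"
    using D by simp
qed

text \<open>The equation x' = y is its own linearization: in a solution (\<xi>, \<eta>) of the
  linearized equation \<eta> is the derivative of \<xi>.\<close>

lemma fst_DF:
  assumes k: "\<kappa> \<in> A" and z: "z \<in> slit_image \<kappa>"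
  shows "fst (DF \<kappa> z w) = snd w"
proof -
  have 1: "((\<lambda>z. fst (F \<kappa> z)) has_derivative (\<lambda>w. fst (DF \<kappa> z w))) (at z)"
    by (intro has_derivative_fst F_derivative k z)
  have "((\<lambda>z. fst (F \<kappa> z)) has_derivative snd) (at z)"
    by (rule has_derivative_transform_within_open[OF bounded_linear_imp_has_derivative[OF bounded_linear_snd] slit_image_open[OF k] z])
      (simp add: fst_F[OF k])
  from fun_cong[OF has_derivative_unique[OF 1 this], of w] show ?thesis .
qed

text \<open>Vector fields along a curve which in coordinates solve the linearized geodesic equation.\<close>

definition jacobi_vec :: "real set \<Rightarrow> (real \<Rightarrow> 'm) \<Rightarrow> (real \<Rightarrow> ('m, real^'n) tvec) \<Rightarrow> bool" where
  "jacobi_vec I c X \<longleftrightarrow> (\<forall>t\<in>I. X t \<in> T (c t)) \<and> (\<forall>\<kappa>\<in>A. \<exists>\<eta>. \<forall>t\<in>I. c t \<in> fst \<kappa> \<longrightarrow>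
     ((\<lambda>\<tau>. (X \<tau> \<kappa>, \<eta> \<tau>)) has_vector_derivative DF \<kappa> (lift_coords \<kappa> I c t) (X t \<kappa>, \<eta> t)) (at t within I))"

lemma jacobi_vecE:
  assumes "jacobi_vec I c X" "\<kappa> \<in> A"
  obtains \<eta> where "\<And>t. t \<in> I \<Longrightarrow> c t \<in> fst \<kappa> \<Longrightarrow>
     ((\<lambda>\<tau>. (X \<tau> \<kappa>, \<eta> \<tau>)) has_vector_derivative DF \<kappa> (lift_coords \<kappa> I c t) (X t \<kappa>, \<eta> t)) (at t within I)"
  using assms unfolding jacobi_vec_def by blast

lemma jacobi_vec_tangent: "jacobi_vec I c X \<Longrightarrow> t \<in> I \<Longrightarrow> X t \<in> T (c t)"
  unfolding jacobi_vec_def by blast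

lemma jacobi_vec_eta:
  assumes g: "geodesic_on I c" and k: "\<kappa> \<in> A" "t \<in> I" "c t \<in> fst \<kappa>"
    and D: "((\<lambda>\<tau>. (X \<tau> \<kappa>, \<eta> \<tau>)) has_vector_derivative DF \<kappa> (lift_coords \<kappa> I c t) (X t \<kappa>, \<eta> t)) (at t within I)"
  shows "((\<lambda>\<tau>. X \<tau> \<kappa>) has_vector_derivative \<eta> t) (at t within I)"
    "(\<eta> has_vector_derivative snd (DF \<kappa> (lift_coords \<kappa> I c t) (X t \<kappa>, \<eta> t))) (at t within I)"
  using bounded_linear.has_vector_derivative[OF bounded_linear_fst D] bounded_linear.has_vector_derivative[OF bounded_linear_snd D]
  by (simp_all add: fst_DF[OF k(1) geodesic_onD(6)[OF g k]])

lemma tangent_diff: "v \<in> T p \<Longrightarrow> w \<in> T p \<Longrightarrow> v - w \<in> T p"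
  using tangent_add[OF _ tangent_scaleR[of w p "-1"], of v] by (simp add: scaleR_fun_def fun_eq_iff plus_fun_def fun_diff_def)

lemma jacobi_vec_diff:
  assumes g: "geodesic_on I c" and X: "jacobi_vec I c X" and Y: "jacobi_vec I c Y"
  shows "jacobi_vec I c (\<lambda>t. X t - Y t)"
  unfolding jacobi_vec_def
proof (intro conjI ballI)
  show "X t - Y t \<in> T (c t)" if "t \<in> I" for t by (intro tangent_diff jacobi_vec_tangent[OF X that] jacobi_vec_tangent[OF Y that])
  fix \<kappa> assume k: "\<kappa> \<in> A"
  obtain \<eta>1 where 1: "\<And>t. t \<in> I \<Longrightarrow> c t \<in> fst \<kappa> \<Longrightarrow>
     ((\<lambda>\<tau>. (X \<tau> \<kappa>, \<eta>1 \<tau>)) has_vector_derivative DF \<kappa> (lift_coords \<kappa> I c t) (X t \<kappa>, \<eta>1 t)) (at t within I)" using jacobi_vecE[OF X k] by blast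
  obtain \<eta>2 where 2: "\<And>t. t \<in> I \<Longrightarrow> c t \<in> fst \<kappa> \<Longrightarrow>
     ((\<lambda>\<tau>. (Y \<tau> \<kappa>, \<eta>2 \<tau>)) has_vector_derivative DF \<kappa> (lift_coords \<kappa> I c t) (Y t \<kappa>, \<eta>2 t)) (at t within I)" using jacobi_vecE[OF Y k] by blast
  show "\<exists>\<eta>. \<forall>t\<in>I. c t \<in> fst \<kappa> \<longrightarrow>
     ((\<lambda>\<tau>. ((X \<tau> - Y \<tau>) \<kappa>, \<eta> \<tau>)) has_vector_derivative DF \<kappa> (lift_coords \<kappa> I c t) ((X t - Y t) \<kappa>, \<eta> t)) (at t within I)"
  proof (rule exI[of _ "\<lambda>t. \<eta>1 t - \<eta>2 t"], intro ballI impI)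
    fix t assume t: "t \<in> I" "c t \<in> fst \<kappa>"
    have "DF \<kappa> (lift_coords \<kappa> I c t) (X t \<kappa>, \<eta>1 t) - DF \<kappa> (lift_coords \<kappa> I c t) (Y t \<kappa>, \<eta>2 t) = DF \<kappa> (lift_coords \<kappa> I c t) ((X t - Y t) \<kappa>, \<eta>1 t - \<eta>2 t)"
      using linear_diff[OF DF_linear[OF k geodesic_onD(6)[OF g k t]], of "(X t \<kappa>, \<eta>1 t)" "(Y t \<kappa>, \<eta>2 t)"] by simp
    with has_vector_derivative_diff[OF 1[OF t] 2[OF t]]
    show "((\<lambda>\<tau>. ((X \<tau> - Y \<tau>) \<kappa>, \<eta>1 \<tau> - \<eta>2 \<tau>)) has_vector_derivative DF \<kappa> (lift_coords \<kappa> I c t) ((X t - Y t) \<kappa>, \<eta>1 t - \<eta>2 t)) (at t within I)"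
      by simp
  qed
qed

text \<open>If the field and its derivative vanish in the chart, then so does the full state (\<xi>,
  \<eta>), as \<eta> is the derivative of \<xi>; the linearized equation keeps both at 0.\<close>

lemma jacobi_vec_unique_local:
  assumes g: "geodesic_on I c" and X: "jacobi_vec I c X" and a: "a \<in> I" and k: "\<kappa> \<in> A" "c a \<in> fst \<kappa>"
  obtains e where "e > 0" "\<And>x y. x \<in> I \<Longrightarrow> y \<in> I \<Longrightarrow> \<bar>x - a\<bar> < e \<Longrightarrow> \<bar>y - a\<bar> < e \<Longrightarrow> X x \<kappa> = 0 \<Longrightarrow>
     ((\<lambda>\<tau>. X \<tau> \<kappa>) has_vector_derivative 0) (at x within I) \<Longrightarrow> X y = 0"
proof -
  obtain \<eta> where \<eta>: "\<And>t. t \<in> I \<Longrightarrow> c t \<in> fst \<kappa> \<Longrightarrow>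
     ((\<lambda>\<tau>. (X \<tau> \<kappa>, \<eta> \<tau>)) has_vector_derivative DF \<kappa> (lift_coords \<kappa> I c t) (X t \<kappa>, \<eta> t)) (at t within I)" using jacobi_vecE[OF X k(1)] by blast
  obtain d L where d: "d > 0" "L \<ge> 0" "\<And>t. t \<in> I \<Longrightarrow> \<bar>t - a\<bar> < d \<Longrightarrow> c t \<in> fst \<kappa>"
    "\<And>t w. t \<in> I \<Longrightarrow> \<bar>t - a\<bar> < d \<Longrightarrow> norm (DF \<kappa> (lift_coords \<kappa> I c t) w) \<le> L * norm w"
    using geodesic_on_bound[OF g a k] by metis
  have D: "((\<lambda>\<tau>. (X \<tau> \<kappa>, \<eta> \<tau>)) has_vector_derivative DF \<kappa> (lift_coords \<kappa> I c t) (X t \<kappa>, \<eta> t)) (at t within I)"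
    if "t \<in> I" "\<bar>t - a\<bar> < d" for t by (rule \<eta>[OF that(1) d(3)[OF that]])
  obtain e where e: "e > 0" "\<And>t0 t. t0 \<in> I \<Longrightarrow> t \<in> I \<Longrightarrow> \<bar>t0 - a\<bar> < e \<Longrightarrow> \<bar>t - a\<bar> < e \<Longrightarrow> (X t0 \<kappa>, \<eta> t0) = 0 \<Longrightarrow> (X t \<kappa>, \<eta> t) = 0"
    using linear_ode_unique_local[where X="\<lambda>\<tau>. (X \<tau> \<kappa>, \<eta> \<tau>)" and ?t1.0=a, OF geodesic_onD(1)[OF g] d(1,2) D d(4)] by blast
  show thesis
  proof (rule that[of "min d e"])
    fix x y assume xy: "x \<in> I" "y \<in> I" "\<bar>x - a\<bar> < min d e" "\<bar>y - a\<bar> < min d e"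
      and X0: "X x \<kappa> = 0" "((\<lambda>\<tau>. X \<tau> \<kappa>) has_vector_derivative 0) (at x within I)"
    have cx: "c x \<in> fst \<kappa>" "c y \<in> fst \<kappa>" using d(3) xy by auto
    have "\<eta> x = 0"
      by (rule has_vector_derivative_unique_thick[OF geodesic_onD(2)[OF g] xy(1) jacobi_vec_eta(1)[where X=X and \<eta>=\<eta>, OF g k(1) xy(1) cx(1) \<eta>[OF xy(1) cx(1)]] X0(2)])
    then have "(X x \<kappa>, \<eta> x) = 0" using X0(1) by (simp add: zero_prod_def)
    then have "(X y \<kappa>, \<eta> y) = 0" using e(2)[OF xy(1,2)] xy(3,4) by simp
    then have "X y \<kappa> = 0" by (simp add: zero_prod_def)
    then show "X y = 0" using tangent_eq_0_iff[OF jacobi_vec_tangent[OF X xy(2)] k(1) cx(2)] by blast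
  qed (use d e in auto)
qed

text \<open>The derivative of X is taken in a chart, so initial data would have to be transformed at
  every change of charts. Vanishing near a time, the property \<open>P\<close>, involves no chart
  and implies that X and its derivative vanish in any of them; this is what spreads along
  \<open>I\<close>.\<close>

lemma jacobi_vec_unique:
  assumes g: "geodesic_on I c" and X: "jacobi_vec I c X" and t0: "t0 \<in> I" and k: "\<kappa> \<in> A" "c t0 \<in> fst \<kappa>"
    and X0: "X t0 \<kappa> = 0" "((\<lambda>\<tau>. X \<tau> \<kappa>) has_vector_derivative 0) (at t0 within I)" and t: "t \<in> I"
  shows "X t = 0"
proof -
  define P where "P t \<longleftrightarrow> (\<exists>e>0. \<forall>\<tau>\<in>I. \<bar>\<tau> - t\<bar> < e \<longrightarrow> X \<tau> = 0)" for t
  have PI: "P y" if "e > 0" "\<bar>y - a\<bar> < e" "\<And>x. x \<in> I \<Longrightarrow> \<bar>x - a\<bar> < e \<Longrightarrow> X x = 0" for y a e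
    unfolding P_def by (rule exI[of _ "e - \<bar>y - a\<bar>"]) (use that in auto)
  have P0: "P t0"
  proof -
    obtain e where e: "e > 0" "\<And>x y. x \<in> I \<Longrightarrow> y \<in> I \<Longrightarrow> \<bar>x - t0\<bar> < e \<Longrightarrow> \<bar>y - t0\<bar> < e \<Longrightarrow> X x \<kappa> = 0 \<Longrightarrow>
     ((\<lambda>\<tau>. X \<tau> \<kappa>) has_vector_derivative 0) (at x within I) \<Longrightarrow> X y = 0" by (rule jacobi_vec_unique_local[OF g X t0 k]) (rule that)
    have ee: "\<bar>t0 - t0\<bar> < e" using e(1) by simp
    show ?thesis by (rule PI[OF e(1) ee]) (rule e(2)[OF t0 _ ee _ X0])
  qed
  have "P t"
  proof (rule geodesic_on_induct[OF g t0 t, of P, OF P0])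
    fix a assume a: "a \<in> I"
    obtain \<mu> where m: "\<mu> \<in> A" "c a \<in> fst \<mu>" using geodesic_onD(3)[OF g a] by blast
    obtain e where e: "e > 0" "\<And>x y. x \<in> I \<Longrightarrow> y \<in> I \<Longrightarrow> \<bar>x - a\<bar> < e \<Longrightarrow> \<bar>y - a\<bar> < e \<Longrightarrow> X x \<mu> = 0 \<Longrightarrow>
     ((\<lambda>\<tau>. X \<tau> \<mu>) has_vector_derivative 0) (at x within I) \<Longrightarrow> X y = 0" by (rule jacobi_vec_unique_local[OF g X a m]) (rule that)
    show "\<exists>e>0. \<forall>x\<in>I. \<forall>y\<in>I. \<bar>x - a\<bar> < e \<longrightarrow> \<bar>y - a\<bar> < e \<longrightarrow> P x \<longrightarrow> P y"
    proof (intro exI[of _ e] conjI ballI impI)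
      fix x y assume xy: "x \<in> I" "y \<in> I" "\<bar>x - a\<bar> < e" "\<bar>y - a\<bar> < e" "P x"
      then obtain r where r: "r > 0" "\<And>\<tau>. \<tau> \<in> I \<Longrightarrow> \<bar>\<tau> - x\<bar> < r \<Longrightarrow> X \<tau> = 0" unfolding P_def by blast
      have z: "X x \<mu> = 0" using r(2)[OF xy(1)] r(1) by simp
      have "((\<lambda>\<tau>. 0) has_vector_derivative 0) (at x within I)" by simp
      then have "((\<lambda>\<tau>. X \<tau> \<mu>) has_vector_derivative 0) (at x within I)"
        by (rule has_vector_derivative_transform_within[OF _ r(1) xy(1)]) (use r(2) in \<open>auto simp: dist_real_def\<close>)
      then have n: "X w = 0" if "w \<in> I" "\<bar>w - a\<bar> < e" for w by (rule e(2)[OF xy(1) that(1) xy(3) that(2) z])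
      show "P y" by (rule PI[OF e(1) xy(4) n])
    qed (rule e(1))
  qed
  then show ?thesis using t unfolding P_def by auto
qed

section \<open>The derivative of a variation with respect to a parameter\<close>

definition vfield :: "('m, real^'n) chart \<Rightarrow> real set \<Rightarrow> (real \<times> (real^'k) \<Rightarrow> 'm) \<Rightarrow> 'k \<Rightarrow> real \<Rightarrow> (real^'n) \<times> (real^'n)" where
  "vfield \<kappa> K V a t = frechet_derivative (variation_coords \<kappa> K V) (at (t, 0)) (0, axis a 1)"

lemma axis_scaleR: "axis a r = r *\<^sub>R (axis a 1 :: real^'k)"
  by (simp add: vec_eq_iff axis_def)

lemma vfield_derivative:
  fixes V :: "real \<times> (real^'k) \<Rightarrow> 'm"
  assumes V: "geodesic_variation M A S K \<epsilon> V" and k: "\<kappa> \<in> A" and t: "t \<in> K" "V (t, 0) \<in> fst \<kappa>"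
  shows "((\<lambda>h. variation_coords \<kappa> K V (t, h *\<^sub>R axis a 1)) has_vector_derivative vfield \<kappa> K V a t) (at 0)"
proof -
  let ?D = "K \<times> cube \<epsilon> \<inter> V -` fst \<kappa>"
  have D: "open ?D" by (rule variation_domain_open[OF V k])
  have "(t, 0) \<in> ?D" using t zero_in_cube[OF geodesic_variationD(1)[OF V]] by simp
  from Ck_on_Suc_open_D[OF D variation_coords_Ck[OF V k] this]
  have "(variation_coords \<kappa> K V has_derivative frechet_derivative (variation_coords \<kappa> K V) (at (t, 0))) (at (t, 0 *\<^sub>R axis a 1) within (\<lambda>h. (t, h *\<^sub>R axis a 1)) ` UNIV)"
    by (simp add: has_derivative_at_withinI)
  moreover have "((\<lambda>h. (t, h *\<^sub>R (axis a 1 :: real^'k))) has_vector_derivative (0, 1 *\<^sub>R axis a 1)) (at 0)"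
    by (intro has_vector_derivative_Pair has_vector_derivative_const has_vector_derivative_scaleR[where g="\<lambda>_. axis a 1" and g'=0, simplified])
      (auto intro!: derivative_eq_intros)
  ultimately show ?thesis
    using vector_derivative_diff_chain_within[of "\<lambda>h. (t, h *\<^sub>R axis a 1)" "(0, 1 *\<^sub>R axis a 1)" 0 UNIV "variation_coords \<kappa> K V"]
    by (simp add: o_def vfield_def)
qed

text \<open>The curve in the parameter direction \<open>a\<close> through V(t, 0) stays in a chart
  for small parameters, so \<open>velocity_tangent\<close> applies to it, with the position
  component of \<open>vfield\<close> as the chart derivative.\<close>

lemma variation_partial_tangent:
  fixes V :: "real \<times> (real^'k) \<Rightarrow> 'm"
  assumes V: "geodesic_variation M A S K \<epsilon> V" and t: "t \<in> K"
  shows "variation_partial A V a t 0 \<in> T (V (t, 0))"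
    "\<And>\<kappa>. \<kappa> \<in> A \<Longrightarrow> V (t, 0) \<in> fst \<kappa> \<Longrightarrow> variation_partial A V a t 0 \<kappa> = fst (vfield \<kappa> K V a t)"
proof -
  let ?c = "\<lambda>r. V (t, 0 + axis a r)"
  have ax0: "axis a 0 = (0 :: real^'k)" by (simp add: axis_eq_0_iff)
  have c0: "?c 0 = V (t, 0)" by (simp only: ax0 add_0)
  have D: "((\<lambda>r. snd \<kappa> (?c r)) has_vector_derivative fst (vfield \<kappa> K V a t)) (at 0 within UNIV)"
    if "\<kappa> \<in> A" "?c 0 \<in> fst \<kappa>" for \<kappa>
  proof -
    have "V (t, 0) \<in> fst \<kappa>" using that c0 by simp
    from bounded_linear.has_vector_derivative[OF bounded_linear_fst vfield_derivative[OF V that(1) t this, of a]]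
    show ?thesis by (simp add: variation_coords_def lift_coords_def axis_scaleR[symmetric])
  qed
  have ev: "eventually (\<lambda>r. ?c r \<in> fst \<kappa>) (at 0 within UNIV)" if k: "\<kappa> \<in> A" "?c 0 \<in> fst \<kappa>" for \<kappa>
  proof -
    let ?D = "K \<times> cube \<epsilon> \<inter> V -` fst \<kappa>"
    have D: "open ?D" by (rule variation_domain_open[OF V k(1)])
    have "continuous_on UNIV (\<lambda>r. (t, r *\<^sub>R (axis a 1 :: real^'k)))" by (intro continuous_intros)
    from open_vimage[OF D this] have "open ((\<lambda>r. (t, r *\<^sub>R axis a 1)) -` ?D)" .
    moreover have "0 \<in> (\<lambda>r. (t, r *\<^sub>R axis a 1)) -` ?D"
      using t k c0 zero_in_cube[OF geodesic_variationD(1)[OF V]] by simp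
    ultimately show ?thesis unfolding eventually_at_topological
      by (intro exI[of _ "(\<lambda>r. (t, r *\<^sub>R axis a 1)) -` ?D"]) (auto simp: axis_scaleR[symmetric])
  qed
  have nb: "at (0::real) within UNIV \<noteq> bot" by simp
  show "variation_partial A V a t 0 \<in> T (V (t, 0))"
    using velocity_tangent(1)[OF nb UNIV_I D ev] unfolding variation_partial_def c0 by simp
  show "variation_partial A V a t 0 \<kappa> = fst (vfield \<kappa> K V a t)" if "\<kappa> \<in> A" "V (t, 0) \<in> fst \<kappa>" for \<kappa>
    using velocity_tangent(2)[OF nb UNIV_I D ev] that c0 unfolding variation_partial_def by simp
qed

text \<open>\<open>vfield\<close> is the pair (\<xi>, \<eta>) of derivatives of position and
  velocity in the parameter. Near (t1, 0) the given variation is a family of solutions of z' = F z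
  depending on s, and \<open>ode_param_derivative\<close> says that its parameter derivative solves
  the linearized equation.\<close>

lemma vfield_ode:
  fixes V :: "real \<times> (real^'k) \<Rightarrow> 'm"
  assumes V: "geodesic_variation M A S K \<epsilon> V" and k: "\<kappa> \<in> A" and t1: "t1 \<in> K" "V (t1, 0) \<in> fst \<kappa>"
  shows "(vfield \<kappa> K V a has_vector_derivative DF \<kappa> (variation_coords \<kappa> K V (t1, 0)) (vfield \<kappa> K V a t1)) (at t1)"
proof -
  let ?D = "K \<times> cube \<epsilon> \<inter> V -` fst \<kappa>"
  let ?variation_coords = "variation_coords \<kappa> K V"
  have D: "open ?D" by (rule variation_domain_open[OF V k])
  have tD: "(t1, 0) \<in> ?D" using t1 zero_in_cube[OF geodesic_variationD(1)[OF V]] by simp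
  define z1 where "z1 = ?variation_coords (t1, 0)"
  have z1: "z1 \<in> slit_image \<kappa>" unfolding z1_def using variation_coords_ode(1)[OF V k t1(1) _ t1(2)] tD by blast
  obtain R L where R: "R > 0" "L \<ge> 0" "cball z1 R \<subseteq> slit_image \<kappa>"
    "\<And>x w. x \<in> cball z1 R \<Longrightarrow> norm (DF \<kappa> x w) \<le> L * norm w"
    using C1_locally_lipschitz[OF slit_image_open[OF k] F_Ck[OF k] z1] by metis
  let ?E = "?D \<inter> ?variation_coords -` ball z1 R"
  have "open ?E" by (rule continuous_open_preimage[OF Ck_on_imp_continuous_on[OF variation_coords_Ck[OF V k]] D open_ball])
  moreover have "(t1, 0) \<in> ?E" using tD R by (simp add: z1_def)
  ultimately obtain B C where BC: "open B" "open C" "t1 \<in> B" "0 \<in> C" "B \<times> C \<subseteq> ?E"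
    by (metis open_prod_elim mem_Sigma_iff)
  obtain d where d: "d > 0" "ball t1 d \<subseteq> B" using BC open_contains_ball by blast
  \<comment> \<open>Besides keeping the states in the ball around \<open>z1\<close>, the time span
    has to satisfy \<open>L * (4 * \<delta>) \<le> 1/2\<close>.\<close>
  define \<delta> where "\<delta> = min d (1 / (8 * (L + 1)))"
  have \<delta>: "\<delta> > 0" "\<delta> \<le> d" using d R by (auto simp: \<delta>_def)
  have L\<delta>: "L * (4 * \<delta>) \<le> 1/2"
  proof -
    have "L * (4 * \<delta>) \<le> (L + 1) * (4 * (1 / (8 * (L + 1))))" using R \<delta> by (intro mult_mono) (auto simp: \<delta>_def)
    moreover have "c * (4 * (1 / (8 * c))) = 1 / 2" if "c > 0" for c :: real using that by simp
    ultimately show ?thesis using R by (metis add_nonneg_pos zero_less_one)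
  qed
  have inE: "(t1 + t, p) \<in> ?E" if "t \<in> {-\<delta><..<\<delta>}" "p \<in> C" for t p
  proof -
    have "t1 + t \<in> ball t1 d" using that(1) \<delta>(2) by (auto simp: dist_real_def abs_less_iff)
    then show ?thesis using d(2) BC(5) that(2) by blast
  qed
  let ?X = "ball z1 R"
  have XU: "?X \<subseteq> slit_image \<kappa>" using R(3) by (meson ball_subset_cball order_trans)
  \<comment> \<open>Time is shifted by t1, as the differentiation theorem takes its initial values
    at time 0.\<close>
  define y where "y w = ?variation_coords (t1 + fst w, snd w)" for w
  define f where "f w = F \<kappa> (snd (snd w))" for w :: "real \<times> (real^'k) \<times> (real^'n) \<times> (real^'n)"
  define f' where "f' w d = DF \<kappa> (snd (snd w)) (snd (snd d))" for w d :: "real \<times> (real^'k) \<times> (real^'n) \<times> (real^'n)"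
  have lin: "bounded_linear (\<lambda>w :: real \<times> (real^'k) \<times> (real^'n) \<times> (real^'n). snd (snd w))"
    by (rule bounded_linear_compose[OF bounded_linear_snd bounded_linear_snd])
  have fD: "(f has_derivative f' w) (at w)" if w: "w \<in> {-\<delta><..<\<delta>} \<times> C \<times> ?X" for w
  proof -
    have "snd (snd w) \<in> slit_image \<kappa>" using w XU by auto
    from has_derivative_compose[OF bounded_linear_imp_has_derivative[OF lin] F_derivative[OF k this]]
    show ?thesis unfolding f_def[abs_def] f'_def[abs_def] .
  qed
  note ts = thick_open[OF slit_image_open[OF k]]
  have DFc: "continuous_on (slit_image \<kappa>) (\<lambda>x. DF \<kappa> x i)" for i
    using Ck_on_frechet_comp[OF slit_image_open[OF k] ts _ F_Ck[OF k] Ck_on_ident[OF ts] Ck_on_const[OF ts], of 0 i] by simp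
  have fC: "continuous_on ({-\<delta><..<\<delta>} \<times> C \<times> ?X) (\<lambda>w. f' w v)" for v
    unfolding f'_def by (rule continuous_on_compose2[OF DFc]) (use XU in \<open>auto intro!: continuous_intros\<close>)
  have fL: "norm (f' w (0, 0, x)) \<le> L * norm x" if w: "w \<in> {-\<delta><..<\<delta>} \<times> C \<times> ?X" for w x
    unfolding f'_def using w by (auto intro!: R(4))
  have yc: "continuous_on ({-\<delta><..<\<delta>} \<times> C) y" unfolding y_def
    by (rule continuous_on_compose2[OF Ck_on_imp_continuous_on[OF variation_coords_Ck[OF V k]]])
      (use inE in \<open>auto intro!: continuous_intros\<close>)
  have yX: "y w \<in> ?X" if "w \<in> {-\<delta><..<\<delta>} \<times> C" for w
    using inE[of "fst w" "snd w"] that by (auto simp: y_def)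
  have yt: "((\<lambda>t. y (t, p)) has_vector_derivative f (t, p, y (t, p))) (at t)" if t: "t \<in> {-\<delta><..<\<delta>}" and p: "p \<in> C" for t p
  proof -
    have e: "t1 + t \<in> K" "p \<in> cube \<epsilon>" "V (t1 + t, p) \<in> fst \<kappa>" using inE[OF t p] by auto
    have 1: "((\<lambda>t. t1 + t) has_vector_derivative 1) (at t)" by (auto intro!: derivative_eq_intros)
    from vector_diff_chain_at[OF 1 variation_coords_ode(2)[OF V k e]] show ?thesis by (simp add: y_def f_def o_def)
  qed
  define y0' where "y0' p q = frechet_derivative ?variation_coords (at (t1, p)) (0, q)" for p q
  have inD: "(t1, p) \<in> ?D" if "p \<in> C" for p using inE[of 0 p] that \<delta> by auto
  have y0D: "((\<lambda>p. y (0, p)) has_derivative y0' p) (at p)" if "p \<in> C" for p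
  proof -
    have "((\<lambda>p. (t1, p)) has_derivative (\<lambda>q. (0, q))) (at p)" by (auto intro!: derivative_eq_intros)
    from has_derivative_compose[OF this Ck_on_Suc_open_D[OF D variation_coords_Ck[OF V k] inD[OF that]]]
    show ?thesis by (simp add: y_def y0'_def[abs_def])
  qed
  have y0c: "continuous_on C (\<lambda>p. y0' p v)" for v
  proof -
    note tC = thick_open[OF BC(2)]
    have "Ck_on 0 C (\<lambda>p. frechet_derivative ?variation_coords (at (t1, p)) (0, v))"
      by (rule Ck_on_frechet_comp[OF D tC _ variation_coords_Ck[OF V k] Ck_on_Pair[OF tC Ck_on_const[OF tC] Ck_on_ident[OF tC]] Ck_on_const[OF tC]])
        (use inD in blast)
    then show ?thesis by (simp add: y0'_def)
  qed
  obtain z where zz: "continuous_on ({-\<delta><..<\<delta>} \<times> C) z"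
      "\<And>t p. t \<in> {-\<delta><..<\<delta>} \<Longrightarrow> p \<in> C \<Longrightarrow> ((\<lambda>h. y (t, p + h *\<^sub>R axis a 1)) has_vector_derivative z (t, p)) (at 0)"
      "\<And>t p. t \<in> {-\<delta><..<\<delta>} \<Longrightarrow> p \<in> C \<Longrightarrow>
         ((\<lambda>t. z (t, p)) has_vector_derivative f' (t, p, y (t, p)) (0, axis a 1, z (t, p))) (at t)"
      "\<And>p. 0 < \<delta> \<Longrightarrow> p \<in> C \<Longrightarrow> z (0, p) = y0' p (axis a 1)"
    using ode_param_derivative[where f=f and f'=f' and y=y and ?y0'.0=y0' and v="axis a 1", OF BC(2) open_ball fD fC fL R(2) L\<delta> yc yX yt y0D y0c] by blast
  note z = zz(2,3)
  have eq: "z (t, 0) = vfield \<kappa> K V a (t1 + t)" if t: "t \<in> {-\<delta><..<\<delta>}" for t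
  proof -
    have "t1 + t \<in> K" "V (t1 + t, 0) \<in> fst \<kappa>" using inE[OF t BC(4)] by auto
    from vector_derivative_at[OF vfield_derivative[OF V k this, of a]] vector_derivative_at[OF z(1)[OF t BC(4)]]
    show ?thesis by (simp add: y_def)
  qed
  have 0: "0 \<in> {-\<delta><..<\<delta>}" using \<delta> by simp
  have "((\<lambda>t. vfield \<kappa> K V a (t1 + t)) has_vector_derivative DF \<kappa> z1 (vfield \<kappa> K V a t1)) (at 0)"
    by (rule has_vector_derivative_transform_within_open[OF z(2)[OF 0 BC(4), unfolded f'_def y_def eq[OF 0] snd_conv fst_conv add_0_right z1_def[symmetric]] open_greaterThanLessThan 0])
      (rule eq)
  then show ?thesis using has_vector_derivative_line[of "vfield \<kappa> K V a" 0 t1 1] by (simp add: z1_def)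
qed

lemma variation_partial_jacobi_vec:
  fixes V :: "real \<times> (real^'k) \<Rightarrow> 'm"
  assumes V: "geodesic_variation M A S K \<epsilon> V"
  shows "jacobi_vec K (\<lambda>t. V (t, 0)) (\<lambda>t. variation_partial A V a t 0)"
  unfolding jacobi_vec_def
proof (intro conjI ballI)
  show "variation_partial A V a t 0 \<in> T (V (t, 0))" if "t \<in> K" for t by (rule variation_partial_tangent(1)[OF V that])
  fix \<kappa> assume k: "\<kappa> \<in> A"
  show "\<exists>\<eta>. \<forall>t\<in>K. V (t, 0) \<in> fst \<kappa> \<longrightarrow> ((\<lambda>\<tau>. (variation_partial A V a \<tau> 0 \<kappa>, \<eta> \<tau>)) has_vector_derivative
     DF \<kappa> (lift_coords \<kappa> K (\<lambda>t. V (t, 0)) t) (variation_partial A V a t 0 \<kappa>, \<eta> t)) (at t within K)"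
  proof (rule exI[of _ "\<lambda>t. snd (vfield \<kappa> K V a t)"], intro ballI impI)
    fix t assume t: "t \<in> K" "V (t, 0) \<in> fst \<kappa>"
    let ?O = "K \<inter> (\<lambda>t. V (t, 0)) -` fst \<kappa>"
    have g: "geodesic M A S K (\<lambda>t. V (t, 0))"
      by (rule geodesic_variationD(5)[OF V zero_in_cube[OF geodesic_variationD(1)[OF V]]])
    have O: "open ?O" by (rule smooth_map_open[OF geodesicD(1,3)[OF g] chart_openin[OF k]])
    have tO: "t \<in> ?O" using t by simp
    have eq: "vfield \<kappa> K V a \<tau> = (variation_partial A V a \<tau> 0 \<kappa>, snd (vfield \<kappa> K V a \<tau>))" if "\<tau> \<in> ?O" for \<tau>
      using variation_partial_tangent(2)[OF V _ k] that by simp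
    have "((\<lambda>\<tau>. (variation_partial A V a \<tau> 0 \<kappa>, snd (vfield \<kappa> K V a \<tau>))) has_vector_derivative
        DF \<kappa> (variation_coords \<kappa> K V (t, 0)) (vfield \<kappa> K V a t)) (at t)"
      by (rule has_vector_derivative_transform_within_open[OF vfield_ode[OF V k t] O tO eq])
    then have "((\<lambda>\<tau>. (variation_partial A V a \<tau> 0 \<kappa>, snd (vfield \<kappa> K V a \<tau>))) has_vector_derivative
        DF \<kappa> (variation_coords \<kappa> K V (t, 0)) (variation_partial A V a t 0 \<kappa>, snd (vfield \<kappa> K V a t))) (at t within K)"
      unfolding eq[OF tO, symmetric] by (rule has_vector_derivative_at_within)
    then show "((\<lambda>\<tau>. (variation_partial A V a \<tau> 0 \<kappa>, snd (vfield \<kappa> K V a \<tau>))) has_vector_derivative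
       DF \<kappa> (lift_coords \<kappa> K (\<lambda>t. V (t, 0)) t) (variation_partial A V a t 0 \<kappa>, snd (vfield \<kappa> K V a t))) (at t within K)"
      by (simp add: variation_coords_def)
  qed
qed

lemma variation_partial_Ck:
  fixes V :: "real \<times> (real^'k) \<Rightarrow> 'm"
  assumes V: "geodesic_variation M A S K \<epsilon> V" and k: "\<kappa> \<in> A"
  shows "Ck_on n (K \<inter> (\<lambda>t. V (t, 0)) -` fst \<kappa>) (\<lambda>t. variation_partial A V a t 0 \<kappa>)"
proof -
  let ?O = "K \<inter> (\<lambda>t. V (t, 0)) -` fst \<kappa>"
  let ?D = "K \<times> cube \<epsilon> \<inter> V -` fst \<kappa>"
  note z = zero_in_cube[OF geodesic_variationD(1)[OF V]]
  have g: "geodesic M A S K (\<lambda>t. V (t, 0))" by (rule geodesic_variationD(5)[OF V z])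
  have O: "open ?O" by (rule smooth_map_open[OF geodesicD(1,3)[OF g] chart_openin[OF k]])
  note tO = thick_open[OF O]
  have "Ck_on n ?O (\<lambda>t. frechet_derivative (variation_coords \<kappa> K V) (at (t, 0)) (0, axis a 1))"
    by (rule Ck_on_frechet_comp[OF variation_domain_open[OF V k] tO _ variation_coords_Ck[OF V k] Ck_on_Pair[OF tO Ck_on_ident[OF tO] Ck_on_const[OF tO]] Ck_on_const[OF tO]])
      (use z in auto)
  from Ck_on_fst[OF tO this] show ?thesis
    by (rule Ck_on_cong[THEN iffD1, rotated]) (simp add: variation_partial_tangent(2)[OF V _ k] vfield_def)
qed

end

section \<open>Jacobi tensors\<close>

lemmas Ck_on_mult = Ck_on_bilinear[OF _ bounded_bilinear_mult]

lemma Ck_on_prod: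
  fixes f :: "'i \<Rightarrow> 'a::euclidean_space \<Rightarrow> real"
  assumes "thick S" "\<And>i. i \<in> I \<Longrightarrow> Ck_on k S (f i)"
  shows "Ck_on k S (\<lambda>x. \<Prod>i\<in>I. f i x)"
  using assms(2) by (induction I rule: infinite_finite_induct) (auto intro: Ck_on_const Ck_on_mult assms(1))

text \<open>The derivative of 1/f involves 1/f undifferentiated, so C^k of 1/f gives
  C^{k+1}.\<close>

lemma Ck_on_inverse:
  fixes f :: "'a::euclidean_space \<Rightarrow> real"
  assumes "thick S" "Ck_on k S f" "\<And>x. x \<in> S \<Longrightarrow> f x \<noteq> 0"
  shows "Ck_on k S (\<lambda>x. inverse (f x))"
  using assms(2)
proof (induction k)
  case 0
  then show ?case using assms(3) by (auto intro!: continuous_intros)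
next
  case (Suc k)
  then obtain f' where f': "\<And>x. x \<in> S \<Longrightarrow> (f has_derivative f' x) (at x within S)"
    "\<And>v. Ck_on k S (\<lambda>x. f' x v)" by (metis Ck_on_SucE)
  have i: "Ck_on k S (\<lambda>x. inverse (f x))" by (rule Suc.IH[OF Ck_on_Suc_imp[OF Suc.prems]])
  show ?case
  proof (rule Ck_on_SucI[OF assms(1), where f'="\<lambda>x v. - (inverse (f x) * f' x v * inverse (f x))"])
    show "((\<lambda>x. inverse (f x)) has_derivative (\<lambda>v. - (inverse (f x) * f' x v * inverse (f x)))) (at x within S)"
      if "x \<in> S" for x
      by (rule Deriv.has_derivative_inverse[OF assms(3)[OF that] f'(1)[OF that]])
    show "Ck_on k S (\<lambda>x. - (inverse (f x) * f' x v * inverse (f x)))" for v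
      by (rule Ck_on_minus[OF assms(1) Ck_on_mult[OF assms(1) Ck_on_mult[OF assms(1) i f'(2)] i]])
  qed
qed

lemma matrix_inv_mult:
  fixes E :: "real^'n^'n"
  assumes "invertible E"
  shows "E ** matrix_inv E = mat 1" "matrix_inv E ** E = mat 1"
  using assms someI_ex[of "\<lambda>B. E ** B = mat 1 \<and> B ** E = mat 1"] unfolding invertible_def matrix_inv_def by auto

text \<open>Cramer's rule, applied to the columns of the inverse. Entries become quotients of
  determinants, so smoothness of the inverse reduces to sums, products and 1/det.\<close>

lemma matrix_inv_entry:
  fixes E :: "real^'n^'n"
  assumes "invertible E"
  shows "matrix_inv E $ k $ j = det (\<chi> i l. if l = k then axis j 1 $ i else E $ i $ l) / det E"
proof -
  have "E *v (matrix_inv E *v axis j 1) = axis j 1"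
    by (simp add: matrix_vector_mul_assoc matrix_inv_mult[OF assms])
  then have "matrix_inv E *v axis j 1 = (\<chi> k. det (\<chi> i l. if l = k then axis j 1 $ i else E $ i $ l) / det E)"
    using cramer[of E "matrix_inv E *v axis j 1" "axis j 1"] assms by (simp add: invertible_det_nz)
  then have "(matrix_inv E *v axis j 1) $ k = det (\<chi> i l. if l = k then axis j 1 $ i else E $ i $ l) / det E" by simp
  then show ?thesis by (simp add: matrix_vector_mult_basis column_def)
qed

lemma Ck_on_det:
  fixes E :: "'a::euclidean_space \<Rightarrow> real^'n^'n"
  assumes "thick S" "\<And>i j. Ck_on k S (\<lambda>x. E x $ i $ j)"
  shows "Ck_on k S (\<lambda>x. det (E x))"
  unfolding det_def
  by (rule Ck_on_sum[OF assms(1)], rule Ck_on_mult[OF assms(1) Ck_on_const[OF assms(1)] Ck_on_prod[OF assms(1) assms(2)]])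

lemma Ck_on_matrix_inv:
  fixes E :: "'a::euclidean_space \<Rightarrow> real^'n^'n"
  assumes S: "thick S" and E: "\<And>i j. Ck_on k S (\<lambda>x. E x $ i $ j)" and inv: "\<And>x. x \<in> S \<Longrightarrow> invertible (E x)"
  shows "Ck_on k S (\<lambda>x. matrix_inv (E x))"
proof (intro Ck_on_vecI S)
  fix a j :: 'n
  have "Ck_on k S (\<lambda>x. det (\<chi> i l. if l = a then axis j 1 $ i else E x $ i $ l))"
  proof (rule Ck_on_det[OF S])
    show "Ck_on k S (\<lambda>x. (\<chi> i l. if l = a then axis j 1 $ i else E x $ i $ l) $ i $ l)" for i l
      by (cases "l = a") (auto intro: Ck_on_const[OF S] E)
  qed
  then have "Ck_on k S (\<lambda>x. det (\<chi> i l. if l = a then axis j 1 $ i else E x $ i $ l) * inverse (det (E x)))"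
    by (rule Ck_on_mult[OF S _ Ck_on_inverse[OF S Ck_on_det[OF S E]]]) (use inv in \<open>auto simp: invertible_det_nz\<close>)
  then show "Ck_on k S (\<lambda>x. matrix_inv (E x) $ a $ j)"
    by (rule Ck_on_cong[THEN iffD1, rotated]) (simp add: matrix_inv_entry[OF inv] divide_inverse)
qed

context spray_mfd
begin

section \<open>Tensors along a curve and their matrices\<close>

lemma endo_sum:
  assumes J: "endo_field_along A I c J" and t: "t \<in> I" and v: "\<And>j. j \<in> B \<Longrightarrow> v j \<in> T (c t)" and B: "finite B"
  shows "J t (\<Sum>j\<in>B. w j *\<^sub>R v j) = (\<Sum>j\<in>B. w j *\<^sub>R J t (v j))"
proof -
  have add: "\<And>u v. u \<in> T (c t) \<Longrightarrow> v \<in> T (c t) \<Longrightarrow> J t (u + v) = J t u + J t v"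
    and sc: "\<And>r u. u \<in> T (c t) \<Longrightarrow> J t (r *\<^sub>R u) = r *\<^sub>R J t u"
    using J t unfolding endo_field_along_def by blast+
  have z: "J t 0 = 0" using sc[OF tangent_0, of 0] unfolding scaleR_zero_left .
  show ?thesis using B v
  proof (induction B rule: finite_induct)
    case empty
    show ?case by (simp only: sum.empty z)
  next
    case (insert j B)
    have IH: "J t (\<Sum>j\<in>B. w j *\<^sub>R v j) = (\<Sum>j\<in>B. w j *\<^sub>R J t (v j))" by (rule insert.IH) (rule insert.prems, simp)
    have 1: "J t (w j *\<^sub>R v j + (\<Sum>j\<in>B. w j *\<^sub>R v j)) = J t (w j *\<^sub>R v j) + J t (\<Sum>j\<in>B. w j *\<^sub>R v j)"
      by (intro add tangent_scaleR tangent_sum) (use insert in auto)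
    have 2: "J t (w j *\<^sub>R v j) = w j *\<^sub>R J t (v j)" by (rule sc) (use insert in auto)
    show ?case unfolding sum.insert[OF insert.hyps(1,2)] 1 2 IH by (rule refl)
  qed
qed

lemma coord_expansion:
  assumes "v \<in> T p" "\<kappa> \<in> A" "p \<in> fst \<kappa>"
  shows "v = (\<Sum>j\<in>UNIV. (v \<kappa> $ j) *\<^sub>R coord_vec A \<kappa> p (axis j 1))"
proof (rule tangent_eqI[OF assms(1) _ assms(2,3)])
  show "(\<Sum>j\<in>UNIV. (v \<kappa> $ j) *\<^sub>R coord_vec A \<kappa> p (axis j 1)) \<in> T p"
    by (intro tangent_sum tangent_scaleR coord_vec_tangent assms)
  show "v \<kappa> = (\<Sum>j\<in>UNIV. (v \<kappa> $ j) *\<^sub>R coord_vec A \<kappa> p (axis j 1)) \<kappa>"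
    unfolding tvec_sum_apply coord_vec_self[OF assms(2,3)] using basis_expansion[of "v \<kappa>"] by (simp add: scalar_mult_eq_scaleR)
qed

lemma tensor_matrix_mult:
  assumes J: "endo_field_along A I c J" and t: "t \<in> I" and k: "\<kappa> \<in> A" "c t \<in> fst \<kappa>" and v: "v \<in> T (c t)"
  shows "J t v \<kappa> = tensor_matrix A c J \<kappa> t *v v \<kappa>"
proof -
  have "J t v = (\<Sum>j\<in>UNIV. (v \<kappa> $ j) *\<^sub>R J t (coord_vec A \<kappa> (c t) (axis j 1)))"
    using endo_sum[where B=UNIV and w="\<lambda>j. v \<kappa> $ j" and v="\<lambda>j. coord_vec A \<kappa> (c t) (axis j 1)", OF J t coord_vec_tangent[OF k] finite]
    unfolding coord_expansion[OF v k, symmetric] .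
  then have "J t v \<kappa> = (\<Sum>j\<in>UNIV. (v \<kappa> $ j) *\<^sub>R J t (coord_vec A \<kappa> (c t) (axis j 1)) \<kappa>)"
    by (simp add: tvec_sum_apply)
  also have "\<dots> = tensor_matrix A c J \<kappa> t *v v \<kappa>"
    by (simp add: matrix_mult_sum scalar_mult_eq_scaleR column_def tensor_matrix_def)
  finally show ?thesis .
qed

lemma nabla_tensor_matrix:
  assumes k: "\<kappa> \<in> A" "c t \<in> fst \<kappa>"
  shows "tensor_matrix A c (nabla_tensor A S I c J) \<kappa> t = vector_derivative (tensor_matrix A c J \<kappa>) (at t within I)
     + N_along A S I c \<kappa> t ** tensor_matrix A c J \<kappa> t - tensor_matrix A c J \<kappa> t ** N_along A S I c \<kappa> t"
  using k by (simp add: tensor_matrix_def[of A c "nabla_tensor A S I c J"] nabla_tensor_def matrix_endo_def coord_vec_self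
      matrix_vector_mult_basis column_def vec_eq_iff)

lemma nabla_tensor_apply:
  assumes k: "\<kappa> \<in> A" "c t \<in> fst \<kappa>"
  shows "nabla_tensor A S I c J t v \<kappa> = (vector_derivative (tensor_matrix A c J \<kappa>) (at t within I)
     + N_along A S I c \<kappa> t ** tensor_matrix A c J \<kappa> t - tensor_matrix A c J \<kappa> t ** N_along A S I c \<kappa> t) *v v \<kappa>"
  using k by (simp add: nabla_tensor_def matrix_endo_def)

text \<open>With P the matrix of J in a chart, \<nabla>J has the matrix R = P' + N P - P N, and the
  same formula applied to R gives \<nabla>\<nabla>J. Both directions between Jacobi tensors and
  Jacobi fields compute with these P and R.\<close>

lemma nabla_tensor_twice:
  assumes g: "geodesic_on I c" and k: "\<kappa> \<in> A" and J: "\<And>n. Ck_on n (I \<inter> c -` fst \<kappa>) (tensor_matrix A c J \<kappa>)"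
  obtains P P' R R' where "P = tensor_matrix A c J \<kappa>"
    "\<And>t. t \<in> I \<Longrightarrow> c t \<in> fst \<kappa> \<Longrightarrow> (P has_vector_derivative P' t) (at t within I)"
    "\<And>t. R t = P' t + N_along A S I c \<kappa> t ** P t - P t ** N_along A S I c \<kappa> t"
    "\<And>t. t \<in> I \<Longrightarrow> c t \<in> fst \<kappa> \<Longrightarrow> (R has_vector_derivative R' t) (at t within I)"
    "\<And>t v. t \<in> I \<Longrightarrow> c t \<in> fst \<kappa> \<Longrightarrow> nabla_tensor A S I c (nabla_tensor A S I c J) t v \<kappa>
        = (R' t + N_along A S I c \<kappa> t ** R t - R t ** N_along A S I c \<kappa> t) *v v \<kappa>"
proof -
  let ?D = "I \<inter> c -` fst \<kappa>"
  let ?N = "N_along A S I c \<kappa>"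
  note D = geodesic_on_domain[OF g k]
  define P where "P = tensor_matrix A c J \<kappa>"
  define P' where "P' t = vector_derivative P (at t within I)" for t
  define R where "R t = P' t + ?N t ** P t - P t ** ?N t" for t
  have P: "(P has_vector_derivative P' t) (at t within I)" if "t \<in> I" "c t \<in> fst \<kappa>" for t
    using Ck_on_Suc_vectorD(1)[OF D(1) J, of t] that D(2)[OF that] by (simp add: P_def P'_def)
  have "Ck_on (Suc 0) ?D P'"
    by (rule Ck_on_cong[THEN iffD1, OF _ Ck_on_Suc_vectorD(2)[OF D(1) J[of "Suc (Suc 0)"]]]) (simp add: P'_def P_def D(2))
  note P1 = Ck_on_Suc_vectorD(1)[OF D(1) this]
  have P'': "(P' has_vector_derivative vector_derivative P' (at t within I)) (at t within I)" if "t \<in> I" "c t \<in> fst \<kappa>" for t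
  proof -
    have "t \<in> ?D" using that by simp
    from P1[OF this] show ?thesis unfolding D(2)[OF that] .
  qed
  have "\<exists>R'. (R has_vector_derivative R') (at t within I)" if "t \<in> I" "c t \<in> fst \<kappa>" for t
  proof -
    note bb = bounded_bilinear.has_vector_derivative[OF bounded_bilinear_matrix_matrix]
    show ?thesis unfolding R_def[abs_def]
      by (rule exI, rule has_vector_derivative_diff[OF has_vector_derivative_add[OF P''[OF that]
         bb[OF N_along_derivative[OF g k that] P[OF that]]] bb[OF P[OF that] N_along_derivative[OF g k that]]])
  qed
  then obtain R' where R: "\<And>t. t \<in> I \<Longrightarrow> c t \<in> fst \<kappa> \<Longrightarrow> (R has_vector_derivative R' t) (at t within I)" by metis
  have Q: "tensor_matrix A c (nabla_tensor A S I c J) \<kappa> t = R t" if "t \<in> I" "c t \<in> fst \<kappa>" for t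
    using nabla_tensor_matrix[where c=c and t=t, OF k that(2)] by (simp add: R_def P'_def P_def)
  have Q': "vector_derivative (tensor_matrix A c (nabla_tensor A S I c J) \<kappa>) (at t within I) = R' t" if t: "t \<in> I" "c t \<in> fst \<kappa>" for t
  proof -
    have tD: "t \<in> ?D" using t by simp
    have "(tensor_matrix A c (nabla_tensor A S I c J) \<kappa> has_vector_derivative R' t) (at t within ?D)"
      by (rule has_vector_derivative_transform[OF tD _ R[OF t, folded D(2)[OF t]]]) (simp add: Q)
    from vector_derivative_eqI[OF D(1) tD this] show ?thesis unfolding D(2)[OF t] .
  qed
  show thesis
    by (rule that[OF P_def P R_def R]) (simp_all add: nabla_tensor_apply[where c=c, OF k] Q Q')
qed

text \<open>By the Leibniz rule \<nabla>X = 0 gives \<nabla>(J X) = (\<nabla>J) X and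
  \<nabla>\<nabla>(J X) = (\<nabla>\<nabla>J) X = - \<Phi> J X. With \<xi> = J X and \<eta> = \<xi>'
  this is the linearized equation.\<close>

lemma jacobi_tensor_jacobi_vec:
  assumes g: "geodesic_on I c" and J: "jacobi_tensor A S I c J" and X: "parallel_along I c X"
  shows "jacobi_vec I c (\<lambda>t. J t (X t))"
  unfolding jacobi_vec_def
proof (intro conjI ballI)
  have t11: "tensor11_along A I c J" and JJ: "\<And>t v. t \<in> I \<Longrightarrow> v \<in> T (c t) \<Longrightarrow>
        nabla_tensor A S I c (nabla_tensor A S I c J) t v + jacobi_endo A S I c t (J t v) = 0"
    using J unfolding jacobi_tensor_def by blast+
  have e: "endo_field_along A I c J" and sm: "\<forall>\<kappa>\<in>A. smooth_on (I \<inter> c -` fst \<kappa>) (tensor_matrix A c J \<kappa>)"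
    using t11 unfolding tensor11_along_def by blast+
  show "J t (X t) \<in> T (c t)" if "t \<in> I" for t
    using e that parallel_alongD(1)[OF X that] unfolding endo_field_along_def by blast
  fix \<kappa> assume k: "\<kappa> \<in> A"
  let ?N = "N_along A S I c \<kappa>"
  obtain P P' R R' where P: "P = tensor_matrix A c J \<kappa>"
    "\<And>t. t \<in> I \<Longrightarrow> c t \<in> fst \<kappa> \<Longrightarrow> (P has_vector_derivative P' t) (at t within I)"
    and R: "\<And>t. R t = P' t + ?N t ** P t - P t ** ?N t"
    "\<And>t. t \<in> I \<Longrightarrow> c t \<in> fst \<kappa> \<Longrightarrow> (R has_vector_derivative R' t) (at t within I)"
    "\<And>t v. t \<in> I \<Longrightarrow> c t \<in> fst \<kappa> \<Longrightarrow> nabla_tensor A S I c (nabla_tensor A S I c J) t v \<kappa> = (R' t + ?N t ** R t - R t ** ?N t) *v v \<kappa>"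
    using nabla_tensor_twice[OF g k smooth_onD[OF bspec[OF sm k]]] by metis
  let ?D = "I \<inter> c -` fst \<kappa>"
  note D = geodesic_on_domain[OF g k]
  have JX: "J t (X t) \<kappa> = P t *v X t \<kappa>" if "t \<in> I" "c t \<in> fst \<kappa>" for t
    unfolding P(1) by (rule tensor_matrix_mult[OF e that(1) k that(2) parallel_alongD(1)[OF X that(1)]])
  \<comment> \<open>This solves \<nabla>\<xi> = \<eta> + N \<xi> for \<eta>, where \<nabla>\<xi> = R
    X.\<close>
  define \<eta> where "\<eta> t = R t *v X t \<kappa> - ?N t *v (P t *v X t \<kappa>)" for t
  show "\<exists>\<eta>. \<forall>t\<in>I. c t \<in> fst \<kappa> \<longrightarrow> ((\<lambda>\<tau>. (J \<tau> (X \<tau>) \<kappa>, \<eta> \<tau>)) has_vector_derivative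
      DF \<kappa> (lift_coords \<kappa> I c t) (J t (X t) \<kappa>, \<eta> t)) (at t within I)"
  proof (rule exI[of _ \<eta>], intro ballI impI)
    fix t assume t: "t \<in> I" "c t \<in> fst \<kappa>"
    let ?z = "lift_coords \<kappa> I c t"
    note z = geodesic_onD(6)[OF g k t]
    let ?x = "X t \<kappa>" and ?u = "P t *v X t \<kappa>" and ?N' = "DN \<kappa> ?z (F \<kappa> ?z)"
    have X': "((\<lambda>\<tau>. X \<tau> \<kappa>) has_vector_derivative - (?N t *v ?x)) (at t within I)"
      using parallel_alongD(2)[OF X t(1) k t(2)] spray_N_mult(1)[OF k z, of ?x] by (simp add: N_along_eq)
    note mv = bounded_bilinear.has_vector_derivative[OF bounded_bilinear_matrix_vector]
    have u': "((\<lambda>\<tau>. P \<tau> *v X \<tau> \<kappa>) has_vector_derivative P t *v (- (?N t *v ?x)) + P' t *v ?x) (at t within I)"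
      by (rule mv[OF P(2)[OF t] X'])
    moreover have "P t *v (- (?N t *v ?x)) + P' t *v ?x = \<eta> t"
      unfolding \<eta>_def R(1) by (simp add: matrix_vector_mult_diff_rdistrib matrix_vector_mult_add_rdistrib matrix_vector_mul_assoc
          linear_neg[OF matrix_vector_mul_linear])
    ultimately have u': "((\<lambda>\<tau>. P \<tau> *v X \<tau> \<kappa>) has_vector_derivative \<eta> t) (at t within I)" by simp
    have "(\<eta> has_vector_derivative (R t *v (- (?N t *v ?x)) + R' t *v ?x) - (?N t *v \<eta> t + ?N' *v ?u)) (at t within I)"
      unfolding \<eta>_def[abs_def]
      by (intro has_vector_derivative_diff mv R(2)[OF t] X' N_along_derivative[OF g k t] u'[unfolded \<eta>_def])
    moreover have "(R t *v (- (?N t *v ?x)) + R' t *v ?x) - (?N t *v \<eta> t + ?N' *v ?u) = snd (DF \<kappa> ?z (?u, \<eta> t))"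
    proof -
      have "(R' t + ?N t ** R t - R t ** ?N t) *v ?x + Phi_along A S I c \<kappa> t *v ?u = 0"
        using fun_cong[OF JJ[OF t(1) parallel_alongD(1)[OF X t(1)]], of \<kappa>] R(3)[OF t, of "X t"] JX[OF t] k t
        by (simp add: jacobi_endo_def matrix_endo_def)
      then have 1: "R' t *v ?x + ?N t *v (R t *v ?x) - R t *v (?N t *v ?x) + Phi_along A S I c \<kappa> t *v ?u = 0"
        by (simp add: matrix_vector_mult_diff_rdistrib matrix_vector_mult_add_rdistrib matrix_vector_mul_assoc)
      have 2: "Phi_along A S I c \<kappa> t *v ?u = - snd (DF \<kappa> ?z (?u, 0)) - ?N' *v ?u - ?N t *v (?N t *v ?u)"
        by (simp only: Phi_along_eq spray_Phi_mult[OF k z] N_along_eq)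
      have 3: "?N t *v \<eta> t = - ((1/2) *\<^sub>R snd (DF \<kappa> ?z (0, \<eta> t)))"
        by (simp only: N_along_eq spray_N_mult(1)[OF k z])
      have "DF \<kappa> ?z (?u, \<eta> t) = DF \<kappa> ?z (?u, 0) + DF \<kappa> ?z (0, \<eta> t)"
        using linear_add[OF DF_linear[OF k z], of "(?u, 0)" "(0, \<eta> t)"] by simp
      then have 4: "snd (DF \<kappa> ?z (?u, \<eta> t)) = snd (DF \<kappa> ?z (?u, 0)) - ?N t *v \<eta> t - ?N t *v \<eta> t"
        using 3 by (simp add: scaleR_half_double[symmetric] algebra_simps)
      have 5: "?N t *v \<eta> t = ?N t *v (R t *v ?x) - ?N t *v (?N t *v ?u)"
        by (simp add: \<eta>_def matrix_vector_mult_diff_distrib)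
      \<comment> \<open>The rest is linear arithmetic between vectors: the terms with N' cancel, N R
        X and N N \<xi> combine to N \<eta>, and - 2 N \<eta> is the \<eta>-part of the second
        component of DF(\<xi>, \<eta>).\<close>
      have alg: "(- r + a) - (n + n') = s - n - n"
        if A: "a + b - r + phi = 0" "phi = - s - n' - nn" "n = b - nn" for a b r phi s n n' nn :: "real^'n"
        unfolding vec_eq_iff
      proof
        fix i
        show "((- r + a) - (n + n')) $ i = (s - n - n) $ i"
          using arg_cong[OF A(1), of "\<lambda>v. v $ i"] arg_cong[OF A(2), of "\<lambda>v. v $ i"] arg_cong[OF A(3), of "\<lambda>v. v $ i"] by simp
      qed
      show ?thesis
        unfolding 4 linear_neg[OF matrix_vector_mul_linear] by (rule alg[OF 1 2 5])
    qed
    ultimately have \<eta>': "(\<eta> has_vector_derivative snd (DF \<kappa> ?z (?u, \<eta> t))) (at t within I)" by simp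
    have "((\<lambda>\<tau>. (P \<tau> *v X \<tau> \<kappa>, \<eta> \<tau>)) has_vector_derivative (\<eta> t, snd (DF \<kappa> ?z (?u, \<eta> t)))) (at t within ?D)"
      unfolding D(2)[OF t] by (rule has_vector_derivative_Pair[OF u' \<eta>'])
    moreover have "(\<eta> t, snd (DF \<kappa> ?z (?u, \<eta> t))) = DF \<kappa> ?z (J t (X t) \<kappa>, \<eta> t)"
      using fst_DF[OF k z, of "(?u, \<eta> t)"] JX[OF t] by (simp add: prod_eq_iff)
    ultimately have "((\<lambda>\<tau>. (P \<tau> *v X \<tau> \<kappa>, \<eta> \<tau>)) has_vector_derivative DF \<kappa> ?z (J t (X t) \<kappa>, \<eta> t)) (at t within ?D)" by simp
    then have "((\<lambda>\<tau>. (J \<tau> (X \<tau>) \<kappa>, \<eta> \<tau>)) has_vector_derivative DF \<kappa> ?z (J t (X t) \<kappa>, \<eta> t)) (at t within ?D)"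
      by (rule has_vector_derivative_transform[rotated 2]) (use t JX in auto)
    then show "((\<lambda>\<tau>. (J \<tau> (X \<tau>) \<kappa>, \<eta> \<tau>)) has_vector_derivative DF \<kappa> ?z (J t (X t) \<kappa>, \<eta> t)) (at t within I)"
      unfolding D(2)[OF t] .
  qed
qed

end

section \<open>Jacobi tensors prescribed on a parallel frame\<close>

lemma sum_axis: "(\<Sum>i\<in>UNIV. (axis j (1::real) $ i) *\<^sub>R f i) = (f j :: 'a::real_vector)" for j :: "'n::finite"
proof -
  have "(axis j (1::real) $ i) *\<^sub>R f i = (if i = j then f i else 0)" for i by (simp add: axis_def)
  then show ?thesis by simp
qed

context spray_mfd
begin

text \<open>J is defined through frame coefficients, which involve no chart; its matrix in each
  chart then yields smoothness. As \<nabla>\<nabla>J + \<Phi> J is linear in the vector, the Jacobi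
  equation is checked on the parallel frame alone, where the computation of
  \<open>jacobi_tensor_jacobi_vec\<close> is run backwards. The same linearity over the frame gives
  the uniqueness clause.\<close>

lemma frame_tensor:
  fixes col xi :: "'n \<Rightarrow> real \<Rightarrow> ('m, real^'n) tvec"
  assumes g: "geodesic_on I c" and col: "\<And>j. parallel_along I c (col j)"
    and colC: "\<And>j \<kappa> n. \<kappa> \<in> A \<Longrightarrow> Ck_on n (I \<inter> c -` fst \<kappa>) (\<lambda>t. col j t \<kappa>)"
    and t0: "t0 \<in> I" and indep: "\<And>w :: real^'n. (\<Sum>j\<in>UNIV. (w $ j) *\<^sub>R col j t0) = 0 \<Longrightarrow> w = 0"
    and xi: "\<And>j. jacobi_vec I c (xi j)"
    and xiC: "\<And>j \<kappa> n. \<kappa> \<in> A \<Longrightarrow> Ck_on n (I \<inter> c -` fst \<kappa>) (\<lambda>t. xi j t \<kappa>)"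
  shows "\<exists>J. jacobi_tensor A S I c J \<and> (\<forall>t\<in>I. \<forall>j. J t (col j t) = xi j t) \<and>
    (\<forall>J'. endo_field_along A I c J' \<and> (\<forall>t\<in>I. \<forall>j. J' t (col j t) = xi j t) \<longrightarrow>
      (\<forall>t\<in>I. \<forall>v\<in>T (c t). J' t v = J t v))"
proof -
  define E where "E \<kappa> t = (\<chi> i j. col j t \<kappa> $ i)" for \<kappa> t
  define X where "X \<kappa> t = (\<chi> i j. xi j t \<kappa> $ i)" for \<kappa> t
  have mul: "(\<Sum>j\<in>UNIV. (w $ j) *\<^sub>R f j) = (\<chi> i j. f j $ i) *v w" for w :: "real^'n" and f :: "'n \<Rightarrow> real^'n"
    by (simp add: matrix_mult_sum scalar_mult_eq_scaleR column_def)
  have Emul: "(\<Sum>j\<in>UNIV. (w $ j) *\<^sub>R col j t) \<kappa> = E \<kappa> t *v w" for w \<kappa> t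
    unfolding tvec_sum_apply E_def by (rule mul)
  have Xmul: "(\<Sum>j\<in>UNIV. (w $ j) *\<^sub>R xi j t) \<kappa> = X \<kappa> t *v w" for w \<kappa> t
    unfolding tvec_sum_apply X_def by (rule mul)
  have colT: "col j t \<in> T (c t)" if "t \<in> I" for j t by (rule parallel_alongD(1)[OF col that])
  \<comment> \<open>A combination of the frame with constant coefficients is parallel, so if it
    vanishes at \<open>t\<close> it vanishes at \<open>t0\<close>.\<close>
  have ker: "w = 0" if t: "t \<in> I" and k: "\<kappa> \<in> A" "c t \<in> fst \<kappa>" and w: "E \<kappa> t *v w = 0" for t \<kappa> w
  proof (rule indep)
    have p: "parallel_along I c (\<lambda>t. \<Sum>j\<in>UNIV. (w $ j) *\<^sub>R col j t)" by (rule parallel_along_sum[OF g col])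
    have "(\<Sum>j\<in>UNIV. (w $ j) *\<^sub>R col j t) = 0"
      using tangent_eq_0_iff[OF parallel_alongD(1)[OF p t] k] w unfolding Emul by blast
    from parallel_along_unique[OF g p t this t0] show "(\<Sum>j\<in>UNIV. (w $ j) *\<^sub>R col j t0) = 0" .
  qed
  have inv: "invertible (E \<kappa> t)" if "t \<in> I" "\<kappa> \<in> A" "c t \<in> fst \<kappa>" for t \<kappa>
    unfolding invertible_left_inverse matrix_left_invertible_ker using ker[OF that] by blast
  \<comment> \<open>The frame coefficients of \<open>v\<close>, chosen without a chart;
    \<open>\<alpha>k\<close> identifies them with the inverse of E applied to v in each
    chart.\<close>
  define \<alpha> where "\<alpha> t v = (SOME w :: real^'n. v = (\<Sum>j\<in>UNIV. (w $ j) *\<^sub>R col j t))" for t v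
  have \<alpha>: "v = (\<Sum>j\<in>UNIV. (\<alpha> t v $ j) *\<^sub>R col j t)" if t: "t \<in> I" and v: "v \<in> T (c t)" for t v
  proof -
    obtain \<kappa> where k: "\<kappa> \<in> A" "c t \<in> fst \<kappa>" using geodesic_onD(3)[OF g t] by blast
    define w where "w = matrix_inv (E \<kappa> t) *v v \<kappa>"
    have "v = (\<Sum>j\<in>UNIV. (w $ j) *\<^sub>R col j t)"
    proof (rule tangent_eqI[OF v _ k])
      show "(\<Sum>j\<in>UNIV. (w $ j) *\<^sub>R col j t) \<in> T (c t)" by (intro tangent_sum tangent_scaleR colT t)
      show "v \<kappa> = (\<Sum>j\<in>UNIV. (w $ j) *\<^sub>R col j t) \<kappa>"
        unfolding Emul w_def by (simp add: matrix_vector_mul_assoc matrix_inv_mult[OF inv[OF t k]])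
    qed
    then show ?thesis unfolding \<alpha>_def by (rule someI)
  qed
  have \<alpha>k: "\<alpha> t v = matrix_inv (E \<kappa> t) *v v \<kappa>" if t: "t \<in> I" and v: "v \<in> T (c t)" and k: "\<kappa> \<in> A" "c t \<in> fst \<kappa>" for t v \<kappa>
  proof -
    have "v \<kappa> = E \<kappa> t *v \<alpha> t v" using fun_cong[OF \<alpha>[OF t v], of \<kappa>] unfolding Emul .
    then show ?thesis by (simp add: matrix_vector_mul_assoc matrix_inv_mult[OF inv[OF t k]])
  qed
  define J where "J t v = (\<Sum>j\<in>UNIV. (\<alpha> t v $ j) *\<^sub>R xi j t)" for t v
  have Jk: "J t v \<kappa> = (X \<kappa> t ** matrix_inv (E \<kappa> t)) *v v \<kappa>" if t: "t \<in> I" and v: "v \<in> T (c t)" and k: "\<kappa> \<in> A" "c t \<in> fst \<kappa>" for t v \<kappa>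
    unfolding J_def Xmul \<alpha>k[OF that] by (simp add: matrix_vector_mul_assoc)
  have JT: "J t v \<in> T (c t)" if "t \<in> I" for t v
    unfolding J_def by (intro tangent_sum tangent_scaleR jacobi_vec_tangent[OF xi that])
  have endo: "endo_field_along A I c J"
    unfolding endo_field_along_def
  proof (intro ballI conjI allI)
    fix t u assume t: "t \<in> I" and u: "u \<in> T (c t)"
    obtain \<kappa> where k: "\<kappa> \<in> A" "c t \<in> fst \<kappa>" using geodesic_onD(3)[OF g t] by blast
    show "J t u \<in> T (c t)" by (rule JT[OF t])
    show "J t (r *\<^sub>R u) = r *\<^sub>R J t u" for r
    proof (rule tangent_eqI[OF JT[OF t] tangent_scaleR[OF JT[OF t]] k])
      show "J t (r *\<^sub>R u) \<kappa> = (r *\<^sub>R J t u) \<kappa>"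
        using Jk[OF t tangent_scaleR[OF u] k, of r] Jk[OF t u k] by (simp add: scaleR_fun_def matrix_vector_mult_scaleR)
    qed
    fix v assume v: "v \<in> T (c t)"
    show "J t (u + v) = J t u + J t v"
    proof (rule tangent_eqI[OF JT[OF t] tangent_add[OF JT[OF t] JT[OF t]] k])
      show "J t (u + v) \<kappa> = (J t u + J t v) \<kappa>"
        using Jk[OF t tangent_add[OF u v] k] Jk[OF t u k] Jk[OF t v k] by (simp add: matrix_vector_right_distrib)
    qed
  qed
  have tm: "tensor_matrix A c J \<kappa> t = X \<kappa> t ** matrix_inv (E \<kappa> t)" if t: "t \<in> I" and k: "\<kappa> \<in> A" "c t \<in> fst \<kappa>" for t \<kappa>
    using Jk[OF t coord_vec_tangent[OF k] k] k
    by (simp add: tensor_matrix_def coord_vec_self matrix_vector_mult_basis column_def vec_eq_iff)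
  have tmC: "Ck_on n (I \<inter> c -` fst \<kappa>) (tensor_matrix A c J \<kappa>)" if k: "\<kappa> \<in> A" for \<kappa> n
  proof -
    note tD = geodesic_on_domain(1)[OF g k]
    have "Ck_on n (I \<inter> c -` fst \<kappa>) (\<lambda>t. X \<kappa> t ** matrix_inv (E \<kappa> t))"
    proof (rule Ck_on_bilinear[OF tD bounded_bilinear_matrix_matrix])
      show "Ck_on n (I \<inter> c -` fst \<kappa>) (X \<kappa>)"
        by (intro Ck_on_vecI tD) (simp add: X_def Ck_on_vec_nth[OF tD xiC[OF k]])
      show "Ck_on n (I \<inter> c -` fst \<kappa>) (\<lambda>t. matrix_inv (E \<kappa> t))"
        by (rule Ck_on_matrix_inv[OF tD]) (use inv k in \<open>auto simp: E_def Ck_on_vec_nth[OF tD colC[OF k]]\<close>)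
    qed
    then show ?thesis by (rule Ck_on_cong[THEN iffD1, rotated]) (simp add: tm k)
  qed
  have Jcol: "J t (col j t) = xi j t" if t: "t \<in> I" for t j
  proof -
    obtain \<kappa> where k: "\<kappa> \<in> A" "c t \<in> fst \<kappa>" using geodesic_onD(3)[OF g t] by blast
    have "E \<kappa> t *v axis j 1 = col j t \<kappa>" unfolding Emul[symmetric] tvec_sum_apply by (rule sum_axis)
    then have "\<alpha> t (col j t) = axis j 1"
      unfolding \<alpha>k[OF t colT[OF t] k] by (simp add: matrix_vector_mul_assoc matrix_inv_mult[OF inv[OF t k]] flip: \<open>E \<kappa> t *v axis j 1 = col j t \<kappa>\<close>)
    then show ?thesis unfolding J_def by (simp only: sum_axis)
  qed
  have jac: "nabla_tensor A S I c (nabla_tensor A S I c J) t v \<kappa> + jacobi_endo A S I c t (J t v) \<kappa> = 0"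
    if t: "t \<in> I" and v: "v \<in> T (c t)" and k: "\<kappa> \<in> A" "c t \<in> fst \<kappa>" for t v \<kappa>
  proof -
    let ?N = "N_along A S I c \<kappa>"
    note D = geodesic_on_domain[OF g k(1)]
    let ?D = "I \<inter> c -` fst \<kappa>"
    obtain P P' R R' where P: "P = tensor_matrix A c J \<kappa>"
      "\<And>t. t \<in> I \<Longrightarrow> c t \<in> fst \<kappa> \<Longrightarrow> (P has_vector_derivative P' t) (at t within I)"
      and R: "\<And>t. R t = P' t + ?N t ** P t - P t ** ?N t"
      "\<And>t. t \<in> I \<Longrightarrow> c t \<in> fst \<kappa> \<Longrightarrow> (R has_vector_derivative R' t) (at t within I)"
      "\<And>t v. t \<in> I \<Longrightarrow> c t \<in> fst \<kappa> \<Longrightarrow> nabla_tensor A S I c (nabla_tensor A S I c J) t v \<kappa> = (R' t + ?N t ** R t - R t ** ?N t) *v v \<kappa>"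
      using nabla_tensor_twice[OF g k(1) tmC[OF k(1)]] by metis
    let ?z = "lift_coords \<kappa> I c t"
    note z = geodesic_onD(6)[OF g k(1) t k(2)]
    let ?N' = "DN \<kappa> ?z (F \<kappa> ?z)"
    \<comment> \<open>The matrix of \<nabla>\<nabla>J + \<Phi> J at \<open>t\<close>.\<close>
    let ?Q = "R' t + ?N t ** R t - R t ** ?N t + Phi_along A S I c \<kappa> t ** P t"
    note mv = bounded_bilinear.has_vector_derivative[OF bounded_bilinear_matrix_vector]
    have Qcol: "?Q *v col j t \<kappa> = 0" for j
    proof -
      let ?x = "\<lambda>s. col j s \<kappa>" and ?u = "\<lambda>s. xi j s \<kappa>"
      obtain \<eta> where \<eta>: "\<And>t. t \<in> I \<Longrightarrow> c t \<in> fst \<kappa> \<Longrightarrow>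
        ((\<lambda>\<tau>. (xi j \<tau> \<kappa>, \<eta> \<tau>)) has_vector_derivative DF \<kappa> (lift_coords \<kappa> I c t) (xi j t \<kappa>, \<eta> t)) (at t within I)"
        using jacobi_vecE[OF xi k(1), of j] by blast
      have X': "(?x has_vector_derivative - (?N s *v ?x s)) (at s within I)" if s: "s \<in> I" "c s \<in> fst \<kappa>" for s
        using parallel_alongD(2)[OF col s(1) k(1) s(2)] spray_N_mult(1)[OF k(1) geodesic_onD(6)[OF g k(1) s], of "?x s"] by (simp add: N_along_eq)
      have Pu: "P s *v ?x s = ?u s" if s: "s \<in> I" "c s \<in> fst \<kappa>" for s
        using tensor_matrix_mult[OF endo s(1) k(1) s(2) colT[OF s(1)]] Jcol[OF s(1)] by (simp add: P(1))
      have u': "(?u has_vector_derivative \<eta> s) (at s within I)" "(\<eta> has_vector_derivative snd (DF \<kappa> (lift_coords \<kappa> I c s) (?u s, \<eta> s))) (at s within I)"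
        if s: "s \<in> I" "c s \<in> fst \<kappa>" for s
        using jacobi_vec_eta[where X="xi j" and \<eta>=\<eta>, OF g k(1) s \<eta>[OF s]] by auto
      \<comment> \<open>The derivative of \<xi> = P x is computed twice, from the linearized
        equation and from the product rule; uniqueness of derivatives on a thick set equates the
        results.\<close>
      have eta: "\<eta> s = P s *v (- (?N s *v ?x s)) + P' s *v ?x s" if s: "s \<in> I" "c s \<in> fst \<kappa>" for s
      proof -
        have sD: "s \<in> ?D" using s by simp
        have "(?u has_vector_derivative P s *v (- (?N s *v ?x s)) + P' s *v ?x s) (at s within ?D)"
          by (rule has_vector_derivative_transform[OF sD _ mv[OF P(2)[OF s] X'[OF s], folded D(2)[OF s]]]) (simp add: Pu)
        from has_vector_derivative_unique_thick[OF D(1) sD u'(1)[OF s, folded D(2)[OF s]] this] show ?thesis .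
      qed
      have Rx: "R s *v ?x s = \<eta> s + ?N s *v ?u s" if s: "s \<in> I" "c s \<in> fst \<kappa>" for s
        unfolding R(1) eta[OF s] Pu[OF s, symmetric]
        by (simp add: matrix_vector_mult_diff_rdistrib matrix_vector_mult_add_rdistrib matrix_vector_mul_assoc linear_neg[OF matrix_vector_mul_linear])
      have tD: "t \<in> ?D" using t k by simp
      note s = t k(2)
      have "((\<lambda>s. \<eta> s + ?N s *v ?u s) has_vector_derivative snd (DF \<kappa> ?z (?u t, \<eta> t)) + (?N t *v \<eta> t + ?N' *v ?u t)) (at t within ?D)"
        unfolding D(2)[OF s]
        by (rule has_vector_derivative_add[OF u'(2)[OF s] mv[OF N_along_derivative[OF g k(1) s] u'(1)[OF s]]])
      moreover have "((\<lambda>s. \<eta> s + ?N s *v ?u s) has_vector_derivative R t *v (- (?N t *v ?x t)) + R' t *v ?x t) (at t within ?D)"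
        by (rule has_vector_derivative_transform[OF tD _ mv[OF R(2)[OF s] X'[OF s], folded D(2)[OF s]]]) (simp add: Rx)
      ultimately have 1: "snd (DF \<kappa> ?z (?u t, \<eta> t)) + (?N t *v \<eta> t + ?N' *v ?u t) = R t *v (- (?N t *v ?x t)) + R' t *v ?x t"
        by (rule has_vector_derivative_unique_thick[OF D(1) tD])
      have 2: "Phi_along A S I c \<kappa> t *v ?u t = - snd (DF \<kappa> ?z (?u t, 0)) - ?N' *v ?u t - ?N t *v (?N t *v ?u t)"
        by (simp only: Phi_along_eq spray_Phi_mult[OF k(1) z] N_along_eq)
      have 3: "?N t *v \<eta> t = - ((1/2) *\<^sub>R snd (DF \<kappa> ?z (0, \<eta> t)))"
        by (simp only: N_along_eq spray_N_mult(1)[OF k(1) z])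
      have "DF \<kappa> ?z (?u t, \<eta> t) = DF \<kappa> ?z (?u t, 0) + DF \<kappa> ?z (0, \<eta> t)"
        using linear_add[OF DF_linear[OF k(1) z], of "(?u t, 0)" "(0, \<eta> t)"] by simp
      then have 4: "snd (DF \<kappa> ?z (?u t, \<eta> t)) = snd (DF \<kappa> ?z (?u t, 0)) - ?N t *v \<eta> t - ?N t *v \<eta> t"
        using 3 by (simp add: scaleR_half_double[symmetric] algebra_simps)
      have 5: "?N t *v (R t *v ?x t) = ?N t *v \<eta> t + ?N t *v (?N t *v ?u t)"
        by (simp add: Rx[OF s] matrix_vector_right_distrib)
      have 6: "R t *v (- (?N t *v ?x t)) = - (R t *v (?N t *v ?x t))" by (rule linear_neg[OF matrix_vector_mul_linear])
      have alg: "r' + nr - r + phi = 0"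
        if B: "s4 + (n + n') = - r + r'" "phi = - s - n' - nn" "s4 = s - n - n" "nr = n + nn"
        for r' nr r phi s4 n n' s nn :: "real^'n"
        unfolding vec_eq_iff
      proof
        fix i
        show "(r' + nr - r + phi) $ i = 0 $ i"
          using arg_cong[OF B(1), of "\<lambda>v. v $ i"] arg_cong[OF B(2), of "\<lambda>v. v $ i"] arg_cong[OF B(3), of "\<lambda>v. v $ i"]
            arg_cong[OF B(4), of "\<lambda>v. v $ i"] by simp
      qed
      have "R' t *v ?x t + ?N t *v (R t *v ?x t) - R t *v (?N t *v ?x t) + Phi_along A S I c \<kappa> t *v ?u t = 0"
        by (rule alg[OF 1[unfolded 6] 2 4 5])
      then show ?thesis
        by (simp add: matrix_vector_mult_diff_rdistrib matrix_vector_mult_add_rdistrib matrix_vector_mul_assoc[symmetric] Pu[OF s])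
    qed
    have "v \<kappa> = (\<Sum>j\<in>UNIV. (\<alpha> t v $ j) *\<^sub>R col j t \<kappa>)"
      using fun_cong[OF \<alpha>[OF t v], of \<kappa>] unfolding tvec_sum_apply .
    then have "?Q *v v \<kappa> = (\<Sum>j\<in>UNIV. (\<alpha> t v $ j) *\<^sub>R (?Q *v col j t \<kappa>))"
      by (simp only: linear_sum[OF matrix_vector_mul_linear] linear_cmul[OF matrix_vector_mul_linear])
    then have "?Q *v v \<kappa> = 0" by (simp add: Qcol)
    moreover have "J t v \<kappa> = P t *v v \<kappa>" unfolding P(1) by (rule tensor_matrix_mult[OF endo t k v])
    ultimately show ?thesis
      using k by (simp add: R(3)[OF t k(2)] jacobi_endo_def matrix_endo_def matrix_vector_mult_add_rdistrib matrix_vector_mul_assoc)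
  qed
  have jt: "jacobi_tensor A S I c J"
    unfolding jacobi_tensor_def tensor11_along_def smooth_on_def
  proof (intro conjI ballI allI endo tmC)
    fix t v assume t: "t \<in> I" and v: "v \<in> T (c t)"
    show "nabla_tensor A S I c (nabla_tensor A S I c J) t v + jacobi_endo A S I c t (J t v) = 0"
    proof
      fix \<kappa>
      show "(nabla_tensor A S I c (nabla_tensor A S I c J) t v + jacobi_endo A S I c t (J t v)) \<kappa> = 0 \<kappa>"
      proof (cases "\<kappa> \<in> A \<and> c t \<in> fst \<kappa>")
        case True
        then show ?thesis using jac[OF t v, of \<kappa>] by simp
      next
        case False
        then have "matrix_endo A (c t) B u \<kappa> = 0" for B u unfolding matrix_endo_def by (rule if_not_P)
        then show ?thesis by (simp add: nabla_tensor_def[of _ _ _ _ "nabla_tensor A S I c J"] jacobi_endo_def)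
      qed
    qed
  qed
  have "J' t v = J t v"
    if J': "endo_field_along A I c J'" "\<forall>t\<in>I. \<forall>j. J' t (col j t) = xi j t" and t: "t \<in> I" and v: "v \<in> T (c t)" for J' t v
  proof -
    have eq: "J' t (col j t) = xi j t" for j using J'(2) t by blast
    have "J' t (\<Sum>j\<in>UNIV. (\<alpha> t v $ j) *\<^sub>R col j t) = (\<Sum>j\<in>UNIV. (\<alpha> t v $ j) *\<^sub>R J' t (col j t))"
      by (rule endo_sum[OF J'(1) t colT[OF t] finite])
    then show "J' t v = J t v" unfolding \<alpha>[OF t v, symmetric] eq J_def .
  qed
  with jt Jcol show ?thesis by blast
qed

lemma jacobi_vec_zero:
  assumes g: "geodesic_on I c"
  shows "jacobi_vec I c (\<lambda>_. 0)"
  unfolding jacobi_vec_def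
proof (intro conjI ballI exI[of _ "\<lambda>_. 0"] impI)
  show "0 \<in> T (c t)" for t by (rule tangent_0)
  fix \<kappa> t assume "\<kappa> \<in> A" "t \<in> I" "c t \<in> fst \<kappa>"
  then have "DF \<kappa> (lift_coords \<kappa> I c t) ((0 :: ('m, real^'n) tvec) \<kappa>, 0) = 0"
    using linear_0[OF DF_linear[OF _ geodesic_onD(6)[OF g]]] by (simp add: zero_prod_def)
  then show "((\<lambda>\<tau>. ((0 :: ('m, real^'n) tvec) \<kappa>, 0)) has_vector_derivative DF \<kappa> (lift_coords \<kappa> I c t) ((0 :: ('m, real^'n) tvec) \<kappa>, 0)) (at t within I)"
    by simp
qed

text \<open>The frame is indexed by \<open>'n\<close>, the parameters by \<open>'k\<close>. The
  bijection \<sigma> with \<open>'k option\<close> bridges the types: \<open>None\<close> stands for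
  the velocity, \<open>Some a\<close> for the field \<open>e a\<close>. The velocity at 0 lies
  outside W, so its coefficient vanishes, and the rest is independence of the basis of W.\<close>

lemma frame_independent:
  fixes e :: "'k::finite \<Rightarrow> real \<Rightarrow> ('m, real^'n) tvec" and \<sigma> :: "'n \<Rightarrow> 'k option"
  assumes e: "parallel_transversal_frame A S I c W e" and \<sigma>: "bij \<sigma>"
    and w: "(\<Sum>j\<in>UNIV. ((w :: real^'n) $ j) *\<^sub>R (case \<sigma> j of None \<Rightarrow> velocity A I c 0 | Some a \<Rightarrow> e a 0)) = 0"
  shows "w = 0"
proof -
  have inj: "inj (\<lambda>a. e a 0)" and ind: "independent (range (\<lambda>a. e a 0))" and sp: "span (range (\<lambda>a. e a 0)) = W"
    and W: "subspace W" and vW: "velocity A I c 0 \<notin> W"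
    using e unfolding parallel_transversal_frame_def by blast+
  define b where "b x = w $ inv \<sigma> x" for x
  have wb: "w $ j = b (\<sigma> j)" for j using \<sigma> by (simp add: b_def bij_is_inj)
  let ?g = "\<lambda>x. b x *\<^sub>R (case x of None \<Rightarrow> velocity A I c 0 | Some a \<Rightarrow> e a 0)"
  have "(\<Sum>j\<in>UNIV. ?g (\<sigma> j)) = (\<Sum>x\<in>UNIV. ?g x)"
    by (rule sum.reindex_bij_betw) (use \<sigma> in \<open>simp add: bij_def\<close>)
  also have "\<dots> = ?g None + (\<Sum>a\<in>UNIV. ?g (Some a))"
    unfolding UNIV_option_conv by (subst sum.insert) (auto simp: sum.reindex)
  finally have s: "b None *\<^sub>R velocity A I c 0 + (\<Sum>a\<in>UNIV. b (Some a) *\<^sub>R e a 0) = 0"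
    using w unfolding wb by simp
  have inW: "(\<Sum>a\<in>UNIV. b (Some a) *\<^sub>R e a 0) \<in> W"
    unfolding sp[symmetric] by (intro span_sum span_scale span_base) auto
  have b0: "b None = 0"
  proof (rule ccontr)
    assume n: "b None \<noteq> 0"
    have "b None *\<^sub>R velocity A I c 0 = - (\<Sum>a\<in>UNIV. b (Some a) *\<^sub>R e a 0)"
      using s by (rule eq_neg_iff_add_eq_0[THEN iffD2])
    then have "b None *\<^sub>R velocity A I c 0 \<in> W" using subspace_neg[OF W inW] by simp
    from subspace_scale[OF W this, of "inverse (b None)"] have "velocity A I c 0 \<in> W" using n by simp
    then show False using vW by blast
  qed
  let ?f = "\<lambda>a. e a 0"
  \<comment> \<open>\<open>independent\<close> speaks of sets of vectors, so the coefficients are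
    moved from indices to vectors; injectivity of a \<mapsto> \<open>e a 0\<close> makes this
    faithful.\<close>
  define u where "u v = b (Some (inv ?f v))" for v
  have "(\<Sum>v\<in>range ?f. u v *\<^sub>R v) = (\<Sum>a\<in>UNIV. u (?f a) *\<^sub>R ?f a)"
    by (rule sum.reindex[OF inj, unfolded o_def])
  also have "\<dots> = 0" using s b0 by (simp add: u_def inv_f_f[OF inj])
  finally have z: "(\<Sum>v\<in>range ?f. u v *\<^sub>R v) = 0" .
  have "b (Some a) = 0" for a
    using independentD[OF ind _ order_refl z, of "?f a"] by (simp add: u_def inv_f_f[OF inj])
  then have "b x = 0" for x using b0 by (cases x) auto
  then show "w = 0" by (simp add: vec_eq_iff wb)
qed

section \<open>Passage between geodesic variations and Jacobi tensors\<close>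

lemma variation_partial_derivative:
  fixes V :: "real \<times> (real^'k) \<Rightarrow> 'm"
  assumes V: "geodesic_variation M A S K \<epsilon> V" and k: "\<kappa> \<in> A" and t: "t \<in> K" "V (t, 0) \<in> fst \<kappa>"
  shows "((\<lambda>\<tau>. variation_partial A V a \<tau> 0 \<kappa>) has_vector_derivative snd (vfield \<kappa> K V a t)) (at t)"
proof -
  have z: "0 \<in> cube \<epsilon>" by (rule zero_in_cube[OF geodesic_variationD(1)[OF V]])
  let ?O = "K \<inter> (\<lambda>t. V (t, 0)) -` fst \<kappa>"
  have O: "open ?O"
    by (rule smooth_map_open[OF geodesicD(1,3)[OF geodesic_variationD(5)[OF V z]] chart_openin[OF k]])
  have tO: "t \<in> ?O" using t by simp
  have "((\<lambda>\<tau>. fst (vfield \<kappa> K V a \<tau>)) has_vector_derivative fst (DF \<kappa> (variation_coords \<kappa> K V (t, 0)) (vfield \<kappa> K V a t))) (at t)"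
    by (rule bounded_linear.has_vector_derivative[OF bounded_linear_fst vfield_ode[OF V k t]])
  then have "((\<lambda>\<tau>. fst (vfield \<kappa> K V a \<tau>)) has_vector_derivative snd (vfield \<kappa> K V a t)) (at t)"
    unfolding fst_DF[OF k variation_coords_ode(1)[OF V k t(1) z t(2)]] .
  then show ?thesis
    by (rule has_vector_derivative_transform_within_open[OF _ O tO]) (simp add: variation_partial_tangent(2)[OF V _ k])
qed

text \<open>Brings the variation field from the open interval of the variation to the compact
  interval of \<open>c\<close>. The hypothesis on lifts bridges velocities taken within different
  sets.\<close>

lemma jacobi_vec_subset:
  assumes X: "jacobi_vec K \<gamma> X" and sub: "I \<subseteq> K" and eq: "\<And>t. t \<in> I \<Longrightarrow> tlift A I c t = tlift A K \<gamma> t"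
  shows "jacobi_vec I c X"
  unfolding jacobi_vec_def
proof (intro conjI ballI)
  have c: "c t = \<gamma> t" if "t \<in> I" for t using eq[OF that] by (simp add: tlift_def)
  show "X t \<in> T (c t)" if "t \<in> I" for t using jacobi_vec_tangent[OF X, of t] c sub that by auto
  fix \<kappa> assume k: "\<kappa> \<in> A"
  obtain \<eta> where \<eta>: "\<And>t. t \<in> K \<Longrightarrow> \<gamma> t \<in> fst \<kappa> \<Longrightarrow>
     ((\<lambda>\<tau>. (X \<tau> \<kappa>, \<eta> \<tau>)) has_vector_derivative DF \<kappa> (lift_coords \<kappa> K \<gamma> t) (X t \<kappa>, \<eta> t)) (at t within K)" using jacobi_vecE[OF X k] by blast
  show "\<exists>\<eta>. \<forall>t\<in>I. c t \<in> fst \<kappa> \<longrightarrow> ((\<lambda>\<tau>. (X \<tau> \<kappa>, \<eta> \<tau>)) has_vector_derivative DF \<kappa> (lift_coords \<kappa> I c t) (X t \<kappa>, \<eta> t)) (at t within I)"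
  proof (rule exI[of _ \<eta>], intro ballI impI)
    fix t assume t: "t \<in> I" "c t \<in> fst \<kappa>"
    then have "t \<in> K" "\<gamma> t \<in> fst \<kappa>" using sub c by auto
    from has_vector_derivative_within_subset[OF \<eta>[OF this] sub]
    show "((\<lambda>\<tau>. (X \<tau> \<kappa>, \<eta> \<tau>)) has_vector_derivative DF \<kappa> (lift_coords \<kappa> I c t) (X t \<kappa>, \<eta> t)) (at t within I)"
      unfolding tlift_eqD[OF eq[OF t(1)], of \<kappa>] .
  qed
qed

lemma tlift_subset_eq:
  assumes "open I" "open J" "J \<subseteq> I" "\<And>t. t \<in> J \<Longrightarrow> c' t = c t" "t \<in> J"
  shows "tlift A J c' t = tlift A I c t"
  using velocity_open[OF assms(1,2) _ assms(5,4)] assms by (auto simp: tlift_def)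

text \<open>The velocity and the fields \<open>e a\<close> form the parallel frame; the values
  prescribed on it, 0 and the parameter derivatives of V, are Jacobi fields.\<close>

lemma variation_tensor:
  fixes V :: "real \<times> (real^'k::finite) \<Rightarrow> 'm" and e :: "'k \<Rightarrow> real \<Rightarrow> ('m, real^'n) tvec"
  assumes card: "CARD('n) = Suc (CARD('k))" and I: "0 \<in> I"
    and V: "geodesic_variation M A S I \<epsilon> V" and e: "parallel_transversal_frame A S I (\<lambda>t. V (t, 0)) W e"
  shows "\<exists>J. jacobi_tensor A S I (\<lambda>t. V (t, 0)) J \<and>
    (\<forall>t\<in>I. J t (velocity A I (\<lambda>t. V (t, 0)) t) = 0 \<and> (\<forall>a. J t (e a t) = variation_partial A V a t 0)) \<and>
    (\<forall>J'. endo_field_along A I (\<lambda>t. V (t, 0)) J' \<and>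
       (\<forall>t\<in>I. J' t (velocity A I (\<lambda>t. V (t, 0)) t) = 0 \<and> (\<forall>a. J' t (e a t) = variation_partial A V a t 0)) \<longrightarrow>
       (\<forall>t\<in>I. \<forall>v\<in>T (V (t, 0)). J' t v = J t v))"
proof -
  let ?c = "\<lambda>t. V (t, 0)"
  have gc: "geodesic M A S I ?c"
    by (rule geodesic_variationD(5)[OF V zero_in_cube[OF geodesic_variationD(1)[OF V]]])
  note g = geodesic_on_geodesic[OF gc]
  have "CARD('n) = CARD('k option)" using card by simp
  then obtain \<sigma> :: "'n \<Rightarrow> 'k option" where \<sigma>: "bij \<sigma>"
    using finite_same_card_bij[of "UNIV :: 'n set" "UNIV :: 'k option set"] by auto
  define col where "col j = (case \<sigma> j of None \<Rightarrow> velocity A I ?c | Some a \<Rightarrow> e a)" for j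
  define xi where "xi j = (case \<sigma> j of None \<Rightarrow> (\<lambda>_. 0) | Some a \<Rightarrow> (\<lambda>t. variation_partial A V a t 0))" for j
  have parallel_along_e: "parallel_vec A S I ?c (e a)" for a
    using e unfolding parallel_transversal_frame_def by blast
  have col: "parallel_along I ?c (col j)" for j
    using parallel_along_velocity[OF g] parallel_vec_parallel_along[OF g parallel_along_e] by (cases "\<sigma> j") (auto simp: col_def)
  have D: "thick (I \<inter> ?c -` fst \<kappa>)" if "\<kappa> \<in> A" for \<kappa> by (rule geodesic_on_domain(1)[OF g that])
  have colC: "Ck_on n (I \<inter> ?c -` fst \<kappa>) (\<lambda>t. col j t \<kappa>)" if k: "\<kappa> \<in> A" for j \<kappa> n
  proof (cases "\<sigma> j")
    case None
    have "Ck_on n (I \<inter> ?c -` fst \<kappa>) (\<lambda>t. snd (lift_coords \<kappa> I ?c t))"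
      by (rule Ck_on_snd[OF D[OF k] lift_coords_Ck[OF geodesicD(1,3)[OF gc] k]])
    then show ?thesis using None by (simp add: col_def lift_coords_def)
  next
    case (Some a)
    have "smooth_on (I \<inter> ?c -` fst \<kappa>) (\<lambda>t. e a t \<kappa>)"
      using parallel_along_e[of a] k unfolding parallel_vec_def vector_field_along_def by blast
    then show ?thesis using Some by (simp add: col_def smooth_onD)
  qed
  have xi: "jacobi_vec I ?c (xi j)" for j
    using jacobi_vec_zero[OF g] variation_partial_jacobi_vec[OF V] by (cases "\<sigma> j") (auto simp: xi_def)
  have xiC: "Ck_on n (I \<inter> ?c -` fst \<kappa>) (\<lambda>t. xi j t \<kappa>)" if k: "\<kappa> \<in> A" for j \<kappa> n
    using Ck_on_const[OF D[OF k]] variation_partial_Ck[OF V k] by (cases "\<sigma> j") (auto simp: xi_def)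
  have indep: "w = 0" if "(\<Sum>j\<in>UNIV. (w $ j) *\<^sub>R col j 0) = 0" for w :: "real^'n"
  proof (rule frame_independent[OF e \<sigma>])
    have "col j 0 = (case \<sigma> j of None \<Rightarrow> velocity A I ?c 0 | Some a \<Rightarrow> e a 0)" for j
      by (cases "\<sigma> j") (auto simp: col_def)
    then show "(\<Sum>j\<in>UNIV. (w $ j) *\<^sub>R (case \<sigma> j of None \<Rightarrow> velocity A I ?c 0 | Some a \<Rightarrow> e a 0)) = 0"
      using that by simp
  qed
  obtain j0 where j0: "\<sigma> j0 = None" using \<sigma> by (metis bij_pointE)
  have ja: "\<exists>j. \<sigma> j = Some a" for a using \<sigma> by (metis bij_pointE)
  \<comment> \<open>Conditions indexed by \<open>'n\<close> through \<sigma> are translated into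
    separate conditions on the velocity and on the \<open>e a\<close>.\<close>
  have iff: "(\<forall>j. K t (col j t) = xi j t) \<longleftrightarrow>
      K t (velocity A I ?c t) = 0 \<and> (\<forall>a. K t (e a t) = variation_partial A V a t 0)" for K t
  proof safe
    assume *: "\<forall>j. K t (col j t) = xi j t"
    show "K t (velocity A I ?c t) = 0" using spec[OF *, of j0] by (simp add: col_def xi_def j0)
    fix a
    obtain j where "\<sigma> j = Some a" using ja by blast
    then show "K t (e a t) = variation_partial A V a t 0" using spec[OF *, of j] by (simp add: col_def xi_def)
  next
    fix j assume "K t (velocity A I ?c t) = 0" "\<forall>a. K t (e a t) = variation_partial A V a t 0"
    then show "K t (col j t) = xi j t" by (cases "\<sigma> j") (auto simp: col_def xi_def)
  qed
  show ?thesis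
    unfolding iff[symmetric]
    by (rule frame_tensor[where col=col and xi=xi, OF g col colC I indep xi xiC])
qed

text \<open>Both \<open>J t (e a t)\<close> and the parameter derivative of V are Jacobi fields
  along \<open>c\<close>, so it suffices that V has the right derivatives of states at time 0.
  Variations live on open intervals, so the central geodesic is the extension \<open>c'\<close>, not
  \<open>c\<close> itself.\<close>

lemma tensor_variation:
  fixes e :: "'k::finite \<Rightarrow> real \<Rightarrow> ('m, real^'n) tvec"
  assumes lt: "t0 < t1" and zero: "0 \<in> {t0..t1}" and gc: "geodesic_closed M A S {t0..t1} c"
    and e: "\<And>a. parallel_vec A S {t0..t1} c (e a)" and J: "jacobi_tensor A S {t0..t1} c J"
  obtains K \<epsilon> and V :: "real \<times> (real^'k) \<Rightarrow> 'm" where "geodesic_variation M A S K \<epsilon> V" "{t0..t1} \<subseteq> K"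
    "\<And>t. t \<in> {t0..t1} \<Longrightarrow> V (t, 0) = c t"
    "\<And>t a. t \<in> {t0..t1} \<Longrightarrow> J t (e a t) = variation_partial A V a t 0"
proof -
  let ?I = "{t0..t1}"
  obtain I' c' where c': "geodesic M A S I' c'" and sub: "?I \<subseteq> I'" and eq: "\<And>t. t \<in> ?I \<Longrightarrow> c' t = c t"
    using gc unfolding geodesic_closed_def by blast
  have g: "geodesic_on ?I c" by (rule geodesic_on_closed(1)[OF c' sub lt eq])
  have vel: "velocity A ?I c t = velocity A I' c' t" if "t \<in> ?I" for t
    by (rule geodesic_on_closed(2)[OF c' sub lt eq that])
  note d' = geodesicD[OF c']
  have I0: "0 \<in> I'" using zero sub by blast
  have jX: "jacobi_vec ?I c (\<lambda>t. J t (e a t))" for a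
    by (rule jacobi_tensor_jacobi_vec[OF g J parallel_vec_parallel_along[OF g e]])
  obtain \<kappa> where k: "\<kappa> \<in> A" "c 0 \<in> fst \<kappa>" using geodesic_onD(3)[OF g zero] by blast
  have k': "c' 0 \<in> fst \<kappa>" using k(2) eq[OF zero] by simp
  have "\<exists>\<eta>. ((\<lambda>t. J t (e a t) \<kappa>) has_vector_derivative \<eta>) (at 0 within ?I)" for a
  proof -
    obtain \<eta> where "\<And>t. t \<in> ?I \<Longrightarrow> c t \<in> fst \<kappa> \<Longrightarrow>
       ((\<lambda>\<tau>. (J \<tau> (e a \<tau>) \<kappa>, \<eta> \<tau>)) has_vector_derivative DF \<kappa> (lift_coords \<kappa> ?I c t) (J t (e a t) \<kappa>, \<eta> t)) (at t within ?I)"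
      using jacobi_vecE[OF jX[of a] k(1)] by blast
    from jacobi_vec_eta(1)[where X="\<lambda>t. J t (e a t)" and \<eta>=\<eta>, OF g k(1) zero k(2) this[OF zero k(2)]] show ?thesis by blast
  qed
  \<comment> \<open>Derivative at time 0 of the coordinates of \<open>J t (e a t)\<close>, one-sided
    if 0 is an end point; with the value at 0 it makes up the initial state of the Jacobi
    field.\<close>
  then obtain \<eta> where \<eta>: "\<And>a. ((\<lambda>t. J t (e a t) \<kappa>) has_vector_derivative \<eta> a) (at 0 within ?I)" by metis
  define z where "z = lift_coords \<kappa> I' c' 0"
  have z: "z \<in> slit_image \<kappa>" unfolding z_def by (rule geodesic_ode(2)[OF c' I0 k(1) k'])
  obtain \<delta> r where \<delta>: "\<delta> > 0" and r: "r > 0" and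
    LV: "\<And>y (z0 :: real^'k \<Rightarrow> _) \<epsilon>. \<epsilon> > 0 \<Longrightarrow> (\<And>k. Ck_on k (cube \<epsilon>) z0) \<Longrightarrow> z0 ` cube \<epsilon> \<subseteq> ball z r \<Longrightarrow>
    \<exists>V. geodesic_variation M A S {y-\<delta><..<y+\<delta>} \<epsilon> V \<and>
      (\<forall>s\<in>cube \<epsilon>. V (y, s) \<in> fst \<kappa> \<and> lift_coords \<kappa> {y-\<delta><..<y+\<delta>} (\<lambda>t. V (t, s)) y = z0 s)"
    using local_variation[OF k(1) z, where 'k='k] by metis
  \<comment> \<open>Affine in s, so the derivative in direction \<open>a\<close> is exactly the
    initial state of the corresponding Jacobi field.\<close>
  define z0 where "z0 s = z + (\<Sum>a\<in>UNIV. (s $ a) *\<^sub>R (J 0 (e a 0) \<kappa>, \<eta> a))" for s :: "real^'k"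
  have z0C: "Ck_on n S z0" if "open S" for n S
    unfolding z0_def[abs_def]
    by (intro Ck_on_add Ck_on_const Ck_on_sum Ck_on_scaleR Ck_on_vec_nth Ck_on_ident thick_open that)
  have z00: "z0 0 = z" by (simp add: z0_def flip: zero_prod_def)
  have "open (z0 -` ball z r)"
    by (rule open_vimage[OF open_ball Ck_on_imp_continuous_on[OF z0C[OF open_UNIV]]])
  then obtain \<epsilon>0 where e0: "\<epsilon>0 > 0" "cube \<epsilon>0 \<subseteq> z0 -` ball z r"
    using cube_subset_open[of "z0 -` ball z r"] z00 r by auto
  have z0b: "z0 ` cube \<epsilon>0 \<subseteq> ball z r" using e0(2) by blast
  let ?J = "{0-\<delta><..<0+\<delta>}"
  obtain V0 where V0: "geodesic_variation M A S ?J \<epsilon>0 V0"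
    "\<And>s. s \<in> cube \<epsilon>0 \<Longrightarrow> V0 (0, s) \<in> fst \<kappa> \<and> lift_coords \<kappa> ?J (\<lambda>t. V0 (t, s)) 0 = z0 s"
    using LV[OF e0(1) z0C[OF open_cube] z0b, of 0] by blast
  note d0 = geodesic_variationD[OF V0(1)]
  have oc: "0 \<in> cube \<epsilon>0" by (rule zero_in_cube[OF e0(1)])
  have J0: "0 \<in> ?J" using \<delta> by simp
  let ?K0 = "?J \<inter> I'"
  have K0: "open ?K0" "is_interval ?K0" "?K0 \<subseteq> ?J" "0 \<in> ?K0"
    using d'(1) is_interval_Int[OF is_interval_oo d'(2)] J0 I0 by auto
  have V0': "geodesic_variation M A S ?K0 \<epsilon>0 V0" by (rule geodesic_variation_subset[OF V0(1) e0(1) order_refl K0(1-3)])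
  have V0c: "V0 (t, 0) = c' t" if t: "t \<in> ?K0" for t
  proof -
    have g1: "geodesic M A S ?K0 (\<lambda>t. V0 (t, 0))" by (rule geodesic_subset[OF d0(5)[OF oc] K0(1-3)])
    have g2: "geodesic M A S ?K0 c'" by (rule geodesic_subset[OF c' K0(1,2)]) simp
    have "tlift A ?K0 (\<lambda>t. V0 (t, 0)) 0 = tlift A ?J (\<lambda>t. V0 (t, 0)) 0"
      by (rule tlift_subset_eq[OF _ K0(1,3) _ K0(4)]) auto
    also have "\<dots> = tlift A I' c' 0"
    proof (rule tlift_eqI[OF k(1)])
      show "tlift A ?J (\<lambda>t. V0 (t, 0)) 0 \<in> fst (slit_chart A \<kappa>)"
        using geodesic_ode(1)[OF d0(5)[OF oc] J0 k(1)] V0(2)[OF oc] by blast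
      show "tlift A I' c' 0 \<in> fst (slit_chart A \<kappa>)" by (rule geodesic_ode(1)[OF c' I0 k(1) k'])
      show "lift_coords \<kappa> ?J (\<lambda>t. V0 (t, 0)) 0 = lift_coords \<kappa> I' c' 0" using V0(2)[OF oc] z00 by (simp add: z_def)
    qed
    also have "\<dots> = tlift A ?K0 c' 0"
      by (rule tlift_subset_eq[OF d'(1) K0(1) _ _ K0(4), symmetric]) auto
    finally show ?thesis using geodesic_unique[OF g1 g2 K0(4) _ t] by (simp add: tlift_def)
  qed
  have t0I: "t0 \<in> I'" "t1 \<in> I'" using sub lt by auto
  have ne: "?K0 \<noteq> {}" using K0(4) by blast
  \<comment> \<open>Two extensions suffice, one to each end point: the final domain is an interval
    containing t0 and t1, hence everything between them.\<close>
  obtain K1 \<epsilon>1 V1 where V1: "geodesic_variation M A S K1 \<epsilon>1 V1" "K1 \<subseteq> I'" "?K0 \<subseteq> K1" "t0 \<in> K1" "\<epsilon>1 \<le> \<epsilon>0"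
    "\<And>t. t \<in> K1 \<Longrightarrow> V1 (t, 0) = c' t" "\<And>t s. t \<in> ?K0 \<Longrightarrow> s \<in> cube \<epsilon>1 \<Longrightarrow> V1 (t, s) = V0 (t, s)"
    using extend_variation[OF c' t0I(1) V0' _ ne V0c] by (metis inf_le2)
  have ne1: "K1 \<noteq> {}" using V1(4) by blast
  obtain K \<epsilon> V where V: "geodesic_variation M A S K \<epsilon> V" "K \<subseteq> I'" "K1 \<subseteq> K" "t1 \<in> K" "\<epsilon> \<le> \<epsilon>1"
    "\<And>t. t \<in> K \<Longrightarrow> V (t, 0) = c' t" "\<And>t s. t \<in> K1 \<Longrightarrow> s \<in> cube \<epsilon> \<Longrightarrow> V (t, s) = V1 (t, s)"
    using extend_variation[OF c' t0I(2) V1(1,2) ne1 V1(6)] by metis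
  note d = geodesic_variationD[OF V(1)]
  have IK: "?I \<subseteq> K"
    using V(4) V1(4) V(3) d(3) by (auto intro: mem_is_interval_1_I[of K t0 t1])
  have Vc: "V (t, 0) = c t" if "t \<in> ?I" for t using V(6)[of t] eq[OF that] IK that by auto
  have VV0: "V (t, s) = V0 (t, s)" if t: "t \<in> ?K0" and s: "s \<in> cube \<epsilon>" for t s
  proof -
    have "s \<in> cube \<epsilon>1" using s cube_mono[OF V(5)] by blast
    moreover have "t \<in> K1" using t V1(3) by blast
    ultimately show ?thesis using V(7)[of t s] V1(7)[of t s] s t by simp
  qed
  have K0K: "?K0 \<subseteq> K" using V1(3) V(3) by blast
  have zK: "0 \<in> K" using K0K K0(4) by blast
  have lift: "tlift A ?I c t = tlift A K (\<lambda>t. V (t, 0)) t" if t: "t \<in> ?I" for t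
  proof -
    have tK: "t \<in> K" using t IK by blast
    have "tlift A K (\<lambda>t. V (t, 0)) t = tlift A I' c' t"
      by (rule tlift_subset_eq[OF d'(1) d(2) V(2) V(6) tK])
    then show ?thesis using vel[OF t] eq[OF t] by (simp add: tlift_def)
  qed
  have V0k: "V (0, 0) \<in> fst \<kappa>" using V(6)[OF zK] k' by simp
  \<comment> \<open>The extensions have only shrunk the cube; near s = 0 the states of V at time 0
    are still \<open>z0 s\<close>, which is all that the derivative sees.\<close>
  have vf: "vfield \<kappa> K V a 0 = (J 0 (e a 0) \<kappa>, \<eta> a)" for a
  proof -
    have vz0: "variation_coords \<kappa> K V (0, s) = z0 s" if s: "s \<in> cube \<epsilon>" for s
    proof -
      have s0: "s \<in> cube \<epsilon>0" using s cube_mono[OF V(5)] cube_mono[OF V1(5)] by blast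
      have "tlift A ?K0 (\<lambda>t. V0 (t, s)) 0 = tlift A K (\<lambda>t. V (t, s)) 0"
        by (rule tlift_subset_eq[OF d(2) K0(1) K0K _ K0(4)]) (simp add: VV0 s)
      moreover have "tlift A ?K0 (\<lambda>t. V0 (t, s)) 0 = tlift A ?J (\<lambda>t. V0 (t, s)) 0"
        by (rule tlift_subset_eq[OF d0(2) K0(1,3) _ K0(4)]) simp
      ultimately have "tlift A K (\<lambda>t. V (t, s)) 0 = tlift A ?J (\<lambda>t. V0 (t, s)) 0" by simp
      from tlift_eqD[OF this, of \<kappa>] show ?thesis using V0(2)[OF s0] by (simp add: variation_coords_def)
    qed
    have line: "continuous_on UNIV (\<lambda>h. h *\<^sub>R (axis a 1 :: real^'k))" by (intro continuous_intros)
    let ?U = "(\<lambda>h. h *\<^sub>R axis a 1) -` (cube \<epsilon> :: (real^'k) set)"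
    have U: "open ?U" "0 \<in> ?U" using open_vimage[OF open_cube line] zero_in_cube[OF d(1)] by auto
    have D1: "((\<lambda>h. variation_coords \<kappa> K V (0, h *\<^sub>R axis a 1)) has_vector_derivative vfield \<kappa> K V a 0) (at 0)"
      by (rule vfield_derivative[OF V(1) k(1) zK V0k])
    have zl: "z0 (h *\<^sub>R axis a 1) = z + h *\<^sub>R (J 0 (e a 0) \<kappa>, \<eta> a)" for h
    proof -
      have "z0 (h *\<^sub>R axis a 1) = z + h *\<^sub>R (\<Sum>b\<in>UNIV. (axis a (1::real) $ b) *\<^sub>R (J 0 (e b 0) \<kappa>, \<eta> b))"
        unfolding z0_def by (simp add: scaleR_sum_right)
      then show ?thesis unfolding sum_axis .
    qed
    have "((\<lambda>h. z + h *\<^sub>R (J 0 (e a 0) \<kappa>, \<eta> a)) has_vector_derivative (0 + (0 *\<^sub>R 0 + 1 *\<^sub>R (J 0 (e a 0) \<kappa>, \<eta> a)))) (at 0)"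
      by (intro has_vector_derivative_add has_vector_derivative_const has_vector_derivative_scaleR) auto
    then have "((\<lambda>h. z0 (h *\<^sub>R axis a 1)) has_vector_derivative (J 0 (e a 0) \<kappa>, \<eta> a)) (at 0)"
      unfolding zl by simp
    then have "((\<lambda>h. variation_coords \<kappa> K V (0, h *\<^sub>R axis a 1)) has_vector_derivative (J 0 (e a 0) \<kappa>, \<eta> a)) (at 0)"
      by (rule has_vector_derivative_transform_within_open[OF _ U]) (simp add: vz0)
    from vector_derivative_at[OF this] vector_derivative_at[OF D1] show ?thesis by simp
  qed
  show thesis
  proof (rule that[OF V(1) IK Vc])
    fix t a assume t: "t \<in> ?I"
    let ?Y = "\<lambda>t. variation_partial A V a t 0"
    have jY: "jacobi_vec ?I c ?Y" by (rule jacobi_vec_subset[OF variation_partial_jacobi_vec[OF V(1)] IK lift])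
    have Y0: "?Y 0 \<kappa> = J 0 (e a 0) \<kappa>" using variation_partial_tangent(2)[OF V(1) zK k(1) V0k] vf by simp
    have "((\<lambda>\<tau>. ?Y \<tau> \<kappa>) has_vector_derivative \<eta> a) (at 0 within ?I)"
      using variation_partial_derivative[OF V(1) k(1) zK V0k, of a] vf by (simp add: has_vector_derivative_at_within)
    from has_vector_derivative_diff[OF \<eta>[of a] this]
    have D0: "((\<lambda>\<tau>. (J \<tau> (e a \<tau>) - ?Y \<tau>) \<kappa>) has_vector_derivative 0) (at 0 within ?I)" by simp
    have Z0: "(J 0 (e a 0) - ?Y 0) \<kappa> = 0" using Y0 by simp
    have "J t (e a t) - ?Y t = 0"
      by (rule jacobi_vec_unique[where X="\<lambda>t. J t (e a t) - ?Y t", OF g jacobi_vec_diff[OF g jX jY] zero k Z0 D0 t])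
    then show "J t (e a t) = variation_partial A V a t 0" by (rule eq_iff_diff_eq_0[THEN iffD2])
  qed
qed

end

theorem theorem4p3:
  fixes M :: "'m topology"
    and A :: "('m, real^'n) chart set"
    and S :: "('m, real^'n) tfield"
  assumes manifold: "smooth_manifold M A"
    and dim_ge_2: "CARD('n) \<ge> 2"
    and params: "CARD('k::finite) = CARD('n) - 1"
    and spray: "spray A S"
  shows
    "(\<forall>(I :: real set) (\<epsilon> :: real) (V :: real \<times> (real^'k) \<Rightarrow> 'm) c W
        (e :: 'k \<Rightarrow> real \<Rightarrow> ('m, real^'n) tvec).
        open I \<and> is_interval I \<and> 0 \<in> I \<and>
        geodesic_variation M A S I \<epsilon> V \<and> c = (\<lambda>t. V (t, 0)) \<and>
        parallel_transversal_frame A S I c W e \<longrightarrow>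
        (\<exists>J. jacobi_tensor A S I c J \<and>
             (\<forall>t\<in>I. J t (velocity A I c t) = 0 \<and>
                (\<forall>a. J t (e a t) = variation_partial A V a t 0)) \<and>
             (\<forall>J'. endo_field_along A I c J' \<and>
                (\<forall>t\<in>I. J' t (velocity A I c t) = 0 \<and>
                   (\<forall>a. J' t (e a t) = variation_partial A V a t 0)) \<longrightarrow>
                (\<forall>t\<in>I. \<forall>v\<in>tangent_space A (c t). J' t v = J t v))))
     \<and>
     (\<forall>(t0 :: real) (t1 :: real) I c W (e :: 'k \<Rightarrow> real \<Rightarrow> ('m, real^'n) tvec) J.
        t0 < t1 \<and> I = {t0..t1} \<and> 0 \<in> I \<and>
        geodesic_closed M A S I c \<and>
        parallel_transversal_frame A S I c W e \<and>
        jacobi_tensor A S I c J \<and>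
        transversal A I c J (\<lambda>t. span (range (\<lambda>a. e a t))) \<longrightarrow>
        (\<exists>I' \<epsilon> (V :: real \<times> (real^'k) \<Rightarrow> 'm).
           open I' \<and> is_interval I' \<and> I \<subseteq> I' \<and>
           geodesic_variation M A S I' \<epsilon> V \<and>
           (\<forall>t\<in>I. V (t, 0) = c t) \<and>
           (\<forall>t\<in>I. J t (velocity A I c t) = 0 \<and>
              (\<forall>a. J t (e a t) = variation_partial A V a t 0))))"
proof (rule conjI)
  interpret spray_mfd M A S by unfold_locales (rule manifold, rule spray)
  \<comment> \<open>Removes the truncated subtraction, so that \<open>'n\<close> and
    \<open>'k option\<close> have the same cardinality.\<close>
  have card: "CARD('n) = Suc CARD('k)" using dim_ge_2 params by simp
  show "\<forall>(I :: real set) (\<epsilon> :: real) (V :: real \<times> (real^'k) \<Rightarrow> 'm) c W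
        (e :: 'k \<Rightarrow> real \<Rightarrow> ('m, real^'n) tvec).
        open I \<and> is_interval I \<and> 0 \<in> I \<and>
        geodesic_variation M A S I \<epsilon> V \<and> c = (\<lambda>t. V (t, 0)) \<and>
        parallel_transversal_frame A S I c W e \<longrightarrow>
        (\<exists>J. jacobi_tensor A S I c J \<and>
             (\<forall>t\<in>I. J t (velocity A I c t) = 0 \<and>
                (\<forall>a. J t (e a t) = variation_partial A V a t 0)) \<and>
             (\<forall>J'. endo_field_along A I c J' \<and>
                (\<forall>t\<in>I. J' t (velocity A I c t) = 0 \<and>
                   (\<forall>a. J' t (e a t) = variation_partial A V a t 0)) \<longrightarrow>
                (\<forall>t\<in>I. \<forall>v\<in>tangent_space A (c t). J' t v = J t v)))"
  proof (intro allI impI, elim conjE)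
    fix I :: "real set" and \<epsilon> :: real and V :: "real \<times> (real^'k) \<Rightarrow> 'm" and c W
      and e :: "'k \<Rightarrow> real \<Rightarrow> ('m, real^'n) tvec"
    assume I: "0 \<in> I" and V: "geodesic_variation M A S I \<epsilon> V" and c: "c = (\<lambda>t. V (t, 0))"
      and e: "parallel_transversal_frame A S I c W e"
    show "\<exists>J. jacobi_tensor A S I c J \<and>
             (\<forall>t\<in>I. J t (velocity A I c t) = 0 \<and>
                (\<forall>a. J t (e a t) = variation_partial A V a t 0)) \<and>
             (\<forall>J'. endo_field_along A I c J' \<and>
                (\<forall>t\<in>I. J' t (velocity A I c t) = 0 \<and>
                   (\<forall>a. J' t (e a t) = variation_partial A V a t 0)) \<longrightarrow>
                (\<forall>t\<in>I. \<forall>v\<in>tangent_space A (c t). J' t v = J t v))"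
      using variation_tensor[OF card I V e[unfolded c]] unfolding c .
  qed
  show "\<forall>(t0 :: real) (t1 :: real) I c W (e :: 'k \<Rightarrow> real \<Rightarrow> ('m, real^'n) tvec) J.
        t0 < t1 \<and> I = {t0..t1} \<and> 0 \<in> I \<and>
        geodesic_closed M A S I c \<and>
        parallel_transversal_frame A S I c W e \<and>
        jacobi_tensor A S I c J \<and>
        transversal A I c J (\<lambda>t. span (range (\<lambda>a. e a t))) \<longrightarrow>
        (\<exists>I' \<epsilon> (V :: real \<times> (real^'k) \<Rightarrow> 'm).
           open I' \<and> is_interval I' \<and> I \<subseteq> I' \<and>
           geodesic_variation M A S I' \<epsilon> V \<and>
           (\<forall>t\<in>I. V (t, 0) = c t) \<and>
           (\<forall>t\<in>I. J t (velocity A I c t) = 0 \<and>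
              (\<forall>a. J t (e a t) = variation_partial A V a t 0)))"
  proof (intro allI impI, elim conjE)
    fix t0 t1 :: real and I c W and e :: "'k \<Rightarrow> real \<Rightarrow> ('m, real^'n) tvec" and J
    assume lt: "t0 < t1" and I: "I = {t0..t1}" and zero: "0 \<in> I" and gc: "geodesic_closed M A S I c"
      and e: "parallel_transversal_frame A S I c W e" and J: "jacobi_tensor A S I c J"
      and transition: "transversal A I c J (\<lambda>t. span (range (\<lambda>a. e a t)))"
    have pe: "parallel_vec A S I c (e a)" for a using e unfolding parallel_transversal_frame_def by blast
    have J0: "J t (velocity A I c t) = 0" if "t \<in> I" for t using transition that unfolding transversal_def by blast
    obtain K \<epsilon> and V :: "real \<times> (real^'k) \<Rightarrow> 'm" where V: "geodesic_variation M A S K \<epsilon> V" "I \<subseteq> K"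
      "\<And>t. t \<in> I \<Longrightarrow> V (t, 0) = c t" "\<And>t a. t \<in> I \<Longrightarrow> J t (e a t) = variation_partial A V a t 0"
      unfolding I by (rule tensor_variation[OF lt zero[unfolded I] gc[unfolded I] pe[unfolded I] J[unfolded I]]) (rule that[unfolded I])
    show "\<exists>I' \<epsilon> (V :: real \<times> (real^'k) \<Rightarrow> 'm).
           open I' \<and> is_interval I' \<and> I \<subseteq> I' \<and>
           geodesic_variation M A S I' \<epsilon> V \<and>
           (\<forall>t\<in>I. V (t, 0) = c t) \<and>
           (\<forall>t\<in>I. J t (velocity A I c t) = 0 \<and>
              (\<forall>a. J t (e a t) = variation_partial A V a t 0))"
      using V J0 geodesic_variationD(2,3)[OF V(1)] by (intro exI[of _ K] exI[of _ \<epsilon>] exI[of _ V]) simp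
  qed
qed

end
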